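(* Let $W$ be an irreducible Coxeter group with simple reflections indexed by $I$, and let $\mathbf d=(d_i)_{i\in I}$ be integers with $d_i\geqslant 2$ for all $i$. The nil-Hecke $\Bbbk$-algebra $n\mathcal H(W,\mathbf d,J_{<5})$ is a finitely generated $\Bbbk$-module if and only if exactly one of the following occurs: (1) $W$ is a finite Coxeter group and $\mathbf d=(2,\dots,2)$; (2) $W$ is of type $A_n$ for some $n\geqslant 1$, and $\mathbf d=(d,2,\dots,2)$ or $(2,\dots,2,d)$ for some $d>2$. In the first case, $\dim n\mathcal H(W,\mathbf d,J_{<5})$ equals: $|W|$ for $W$ of type $A_n,B_n,D_n,E_6,E_7,E_8,F_4$; $76$ for type $H_3$; $1460$ for type $H_4$; and for type $I_2(m)$ it equals $2m$ if $m<5$ and $2m-1$ if $m\geqslant 5$. In the second case, $\dim n\mathcal H(W,\mathbf d,J_{<5})=n!\,(1+n(d-1))$.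
   Context: $\Bbbk$ is a fixed nonzero unital commutative ring. A Coxeter group $W$ has a finite nonempty index set $I$ of simple reflections and a Coxeter matrix $(m_{ij})_{i,j\in I}$ with $m_{ii}=1$ and $m_{ij}=m_{ji}\in\{2,3,\dots,\infty\}$ for $i\ne j$. Let $J$ be the set of unordered pairs $\{a,b\}\subset I$, $a\neq b$, with $m_{ab}<\infty$. For $j=\{a,b\}\in J$ let $\mathbf v_j=\mathbf s_a\mathbf s_b\mathbf s_a\cdots$ and $\mathbf w_j=\mathbf s_b\mathbf s_a\mathbf s_b\cdots$ be the two alternating words with $m_{ab}$ letters each; these are the two sides of the braid relation for $j$, whose length is $\ell(\mathbf v_j)=\ell(\mathbf w_j)=m_{ab}$. For $J_0\subset J$ and $\mathbf d=(d_i)_{i\in I}$ with integers $d_i\geqslant 2$, the nil-Hecke algebra $n\mathcal H(W,\mathbf d,J_0)$ is the associative unital $\Bbbk$-algebra generated by $\{\mathbf s_i:i\in I\}$ with relations $$\mathbf s_i^{d_i}=0\ (i\in I),\qquad \mathbf v_j=\mathbf w_j\ (j\in J_0),\qquad \mathbf v_j=0=\mathbf w_j\ (j\in J\setminus J_0).$$ For $k\geqslant 1$ put $J_{<k}=\{j\in J:\ell(\mathbf v_j)<k\}$. $W$ is irreducible if the graph on $I$ with $i,j$ adjacent iff $m_{ij}\geqslant 3$ is connected. Types refer to the standard classification of irreducible finite Coxeter groups; in type $A_n$ the nodes are numbered consecutively along the path and $\mathbf d$ is listed in this order; $I_2(m)$ is the dihedral group of order $2m$. The statement $\dim M=r$ means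 that $M$ is a free $\Bbbk$-module of rank $r$. *)

theory Defs
  imports "HOL-Algebra.Module" "HOL-Algebra.QuotRing" "HOL-Library.Extended_Nat"
begin

section \<open>Coxeter matrices and Coxeter groups\<close>

definition coxeter_matrix :: "'i set \<Rightarrow> ('i \<Rightarrow> 'i \<Rightarrow> enat) \<Rightarrow> bool" where
  "coxeter_matrix I m \<longleftrightarrow>
     finite I \<and> I \<noteq> {} \<and> (\<forall>i\<in>I. m i i = 1) \<and>
     (\<forall>i\<in>I. \<forall>j\<in>I. i \<noteq> j \<longrightarrow> m i j = m j i \<and> 2 \<le> m i j)"

definition coxeter_irreducible :: "'i set \<Rightarrow> ('i \<Rightarrow> 'i \<Rightarrow> enat) \<Rightarrow> bool" where
  "coxeter_irreducible I m \<longleftrightarrow>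
     (\<forall>i\<in>I. \<forall>j\<in>I. (i, j) \<in> {(a, b). a \<in> I \<and> b \<in> I \<and> a \<noteq> b \<and> 3 \<le> m a b}\<^sup>*)"

text \<open>
  The congruence on words over \<open>I\<close> generated by \<open>(s\<^sub>i s\<^sub>j)\<^bsup>m i j\<^esup> = 1\<close> for finite \<open>m i j\<close>.
  The case \<open>i = j\<close> gives \<open>s\<^sub>i s\<^sub>i = 1\<close>, so every generator is invertible already in the monoid
  with this presentation, which is therefore the Coxeter group.
\<close>

inductive_set coxeter_cong :: "'i set \<Rightarrow> ('i \<Rightarrow> 'i \<Rightarrow> enat) \<Rightarrow> ('i list \<times> 'i list) set"
  for I :: "'i set" and m :: "'i \<Rightarrow> 'i \<Rightarrow> enat" where
  relation: "\<lbrakk>u \<in> lists I; v \<in> lists I; i \<in> I; j \<in> I; m i j \<noteq> \<infinity>\<rbrakk> \<Longrightarrow>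
     (u @ concat (replicate (the_enat (m i j)) [i, j]) @ v, u @ v) \<in> coxeter_cong I m"
| refl: "u \<in> lists I \<Longrightarrow> (u, u) \<in> coxeter_cong I m"
| sym: "(u, v) \<in> coxeter_cong I m \<Longrightarrow> (v, u) \<in> coxeter_cong I m"
| trans: "\<lbrakk>(u, v) \<in> coxeter_cong I m; (v, w) \<in> coxeter_cong I m\<rbrakk> \<Longrightarrow> (u, w) \<in> coxeter_cong I m"

definition coxeter_group :: "'i set \<Rightarrow> ('i \<Rightarrow> 'i \<Rightarrow> enat) \<Rightarrow> 'i list set monoid" where
  "coxeter_group I m =
     \<lparr>carrier = lists I // coxeter_cong I m,
      monoid.mult = (\<lambda>C D. \<Union>x\<in>C. \<Union>y\<in>D. coxeter_cong I m `` {x @ y}),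
      one = coxeter_cong I m `` {[]}\<rparr>"

section \<open>Finite irreducible types\<close>

datatype coxeter_type =
  Type_A nat | Type_B nat | Type_D nat | Type_E6 | Type_E7 | Type_E8 | Type_F4 |
  Type_H3 | Type_H4 | Type_I2 nat

fun type_rank :: "coxeter_type \<Rightarrow> nat" where
  "type_rank (Type_A n) = n"
| "type_rank (Type_B n) = n"
| "type_rank (Type_D n) = n"
| "type_rank Type_E6 = 6"
| "type_rank Type_E7 = 7"
| "type_rank Type_E8 = 8"
| "type_rank Type_F4 = 4"
| "type_rank Type_H3 = 3"
| "type_rank Type_H4 = 4"
| "type_rank (Type_I2 k) = 2"

fun type_admissible :: "coxeter_type \<Rightarrow> bool" where
  "type_admissible (Type_A n) = (1 \<le> n)"
| "type_admissible (Type_B n) = (2 \<le> n)"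
| "type_admissible (Type_D n) = (4 \<le> n)"
| "type_admissible (Type_I2 k) = (3 \<le> k)"
| "type_admissible _ = True"

text \<open>
  Entries \<open>m i j\<close> for nodes \<open>1 \<le> i < j \<le> n\<close>, numbered as in Bourbaki (Lie groups and Lie
  algebras, chapter VI), with the \<open>5\<close>-edge of \<open>H\<^sub>3\<close> and \<open>H\<^sub>4\<close> joining nodes \<open>1\<close> and \<open>2\<close>.
\<close>

definition type_E_entry :: "nat \<Rightarrow> nat \<Rightarrow> enat" where
  "type_E_entry i j =
     (if (i = 1 \<and> j = 3) \<or> (i = 2 \<and> j = 4) \<or> (3 \<le> i \<and> j = i + 1) then 3 else 2)"

fun type_entry :: "coxeter_type \<Rightarrow> nat \<Rightarrow> nat \<Rightarrow> enat" where
  "type_entry (Type_A n) i j = (if j = i + 1 then 3 else 2)"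
| "type_entry (Type_B n) i j = (if j = i + 1 then (if j = n then 4 else 3) else 2)"
| "type_entry (Type_D n) i j =
     (if (j = i + 1 \<and> j < n) \<or> (j = i + 2 \<and> j = n) then 3 else 2)"
| "type_entry Type_E6 i j = type_E_entry i j"
| "type_entry Type_E7 i j = type_E_entry i j"
| "type_entry Type_E8 i j = type_E_entry i j"
| "type_entry Type_F4 i j = (if j = i + 1 then (if i = 2 then 4 else 3) else 2)"
| "type_entry Type_H3 i j = (if j = i + 1 then (if i = 1 then 5 else 3) else 2)"
| "type_entry Type_H4 i j = (if j = i + 1 then (if i = 1 then 5 else 3) else 2)"
| "type_entry (Type_I2 k) i j = enat k"

definition type_matrix :: "coxeter_type \<Rightarrow> nat \<Rightarrow> nat \<Rightarrow> enat" where
  "type_matrix T i j = (if i = j then 1 else type_entry T (min i j) (max i j))"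

definition type_numbering ::
  "'i set \<Rightarrow> ('i \<Rightarrow> 'i \<Rightarrow> enat) \<Rightarrow> coxeter_type \<Rightarrow> (nat \<Rightarrow> 'i) \<Rightarrow> bool" where
  "type_numbering I m T f \<longleftrightarrow>
     type_admissible T \<and> bij_betw f {1..type_rank T} I \<and>
     (\<forall>i\<in>{1..type_rank T}. \<forall>j\<in>{1..type_rank T}. m (f i) (f j) = type_matrix T i j)"

definition has_type :: "'i set \<Rightarrow> ('i \<Rightarrow> 'i \<Rightarrow> enat) \<Rightarrow> coxeter_type \<Rightarrow> bool" where
  "has_type I m T \<longleftrightarrow> (\<exists>f. type_numbering I m T f)"

section \<open>Algebras given by generators and relations\<close>

text \<open>
  The free associative unital \<open>R\<close>-algebra on \<open>I\<close>: finitely supported \<open>R\<close>-valued functions on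
  the words over \<open>I\<close>, with convolution along concatenation as product.
\<close>

definition free_algebra ::
  "('k, 'm) ring_scheme \<Rightarrow> 'i set \<Rightarrow> ('k, 'i list \<Rightarrow> 'k) module" where
  "free_algebra R I =
     \<lparr>carrier = {f. range f \<subseteq> carrier R \<and> finite {w. f w \<noteq> \<zero>\<^bsub>R\<^esub>} \<and> {w. f w \<noteq> \<zero>\<^bsub>R\<^esub>} \<subseteq> lists I},
      monoid.mult = (\<lambda>f g w. \<Oplus>\<^bsub>R\<^esub>p\<in>{(u, v). u @ v = w}. f (fst p) \<otimes>\<^bsub>R\<^esub> g (snd p)),
      one = (\<lambda>w. if w = [] then \<one>\<^bsub>R\<^esub> else \<zero>\<^bsub>R\<^esub>),
      zero = (\<lambda>w. \<zero>\<^bsub>R\<^esub>),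
      add = (\<lambda>f g w. f w \<oplus>\<^bsub>R\<^esub> g w),
      smult = (\<lambda>c f w. c \<otimes>\<^bsub>R\<^esub> f w)\<rparr>"

definition word_monomial :: "('k, 'm) ring_scheme \<Rightarrow> 'i list \<Rightarrow> 'i list \<Rightarrow> 'k" where
  "word_monomial R v = (\<lambda>w. if w = v then \<one>\<^bsub>R\<^esub> else \<zero>\<^bsub>R\<^esub>)"

text \<open>
  \<open>A Quot N\<close> with its scalar action, which is the action on representatives
  (compare \<^const>\<open>rcoset_mult\<close>).
\<close>

definition quotient_algebra :: "('k, 'a, 'm) module_scheme \<Rightarrow> 'a set \<Rightarrow> ('k, 'a set) module" where
  "quotient_algebra A N =
     \<lparr>carrier = carrier (A Quot N),
      monoid.mult = monoid.mult (A Quot N),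
      one = one (A Quot N),
      zero = zero (A Quot N),
      add = add (A Quot N),
      smult = (\<lambda>c C. \<Union>x\<in>C. N +>\<^bsub>A\<^esub> (c \<odot>\<^bsub>A\<^esub> x))\<rparr>"

section \<open>Nil-Hecke algebras\<close>

primrec alternating_word :: "nat \<Rightarrow> 'i \<Rightarrow> 'i \<Rightarrow> 'i list" where
  "alternating_word 0 a b = []"
| "alternating_word (Suc n) a b = a # alternating_word n b a"

text \<open>
  One side of the braid relation for \<open>{a, b}\<close>, the one starting with \<open>a\<close>. The other side is
  \<open>braid_word m b a\<close>. Only meaningful if \<open>m a b\<close> is finite.
\<close>

definition braid_word :: "('i \<Rightarrow> 'i \<Rightarrow> enat) \<Rightarrow> 'i \<Rightarrow> 'i \<Rightarrow> 'i list" where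
  "braid_word m a b = alternating_word (the_enat (m a b)) a b"

definition braid_pairs :: "'i set \<Rightarrow> ('i \<Rightarrow> 'i \<Rightarrow> enat) \<Rightarrow> 'i set set" where
  "braid_pairs I m = {{a, b} | a b. a \<in> I \<and> b \<in> I \<and> a \<noteq> b \<and> m a b < \<infinity>}"

definition braid_pairs_less :: "'i set \<Rightarrow> ('i \<Rightarrow> 'i \<Rightarrow> enat) \<Rightarrow> nat \<Rightarrow> 'i set set" where
  "braid_pairs_less I m k =
     {{a, b} | a b. {a, b} \<in> braid_pairs I m \<and> a \<noteq> b \<and> length (braid_word m a b) < k}"

text \<open>
  The choice of a first letter for each unordered pair is avoided by imposing the braid relations for
  both orderings; this does not change the ideal they generate.
\<close>

definition nil_Hecke_relators ::
  "('k, 'm) ring_scheme \<Rightarrow> 'i set \<Rightarrow> ('i \<Rightarrow> 'i \<Rightarrow> enat) \<Rightarrow> ('i \<Rightarrow> nat) \<Rightarrow> 'i set set \<Rightarrow>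
     ('i list \<Rightarrow> 'k) set" where
  "nil_Hecke_relators R I m d J0 =
     {word_monomial R (replicate (d i) i) | i. i \<in> I} \<union>
     {word_monomial R (braid_word m a b) \<ominus>\<^bsub>free_algebra R I\<^esub> word_monomial R (braid_word m b a)
        | a b. a \<noteq> b \<and> {a, b} \<in> J0} \<union>
     {word_monomial R (braid_word m a b) | a b. a \<noteq> b \<and> {a, b} \<in> braid_pairs I m - J0}"

definition nil_Hecke ::
  "('k, 'm) ring_scheme \<Rightarrow> 'i set \<Rightarrow> ('i \<Rightarrow> 'i \<Rightarrow> enat) \<Rightarrow> ('i \<Rightarrow> nat) \<Rightarrow> 'i set set \<Rightarrow>
     ('k, ('i list \<Rightarrow> 'k) set) module" where
  "nil_Hecke R I m d J0 =
     quotient_algebra (free_algebra R I) (Idl\<^bsub>free_algebra R I\<^esub> (nil_Hecke_relators R I m d J0))"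

section \<open>Finitely generated and free modules\<close>

definition module_fin_gen :: "('k, 'm) ring_scheme \<Rightarrow> ('k, 'a, 'n) module_scheme \<Rightarrow> bool" where
  "module_fin_gen R M \<longleftrightarrow>
     (\<exists>S. finite S \<and> S \<subseteq> carrier M \<and>
       (\<forall>x\<in>carrier M. \<exists>c\<in>S \<rightarrow> carrier R. x = (\<Oplus>\<^bsub>M\<^esub>b\<in>S. c b \<odot>\<^bsub>M\<^esub> b)))"

definition free_of_rank :: "('k, 'm) ring_scheme \<Rightarrow> ('k, 'a, 'n) module_scheme \<Rightarrow> nat \<Rightarrow> bool" where
  "free_of_rank R M r \<longleftrightarrow>
     (\<exists>B. finite B \<and> card B = r \<and> B \<subseteq> carrier M \<and>
       (\<forall>x\<in>carrier M. \<exists>!c. c \<in> B \<rightarrow>\<^sub>E carrier R \<and> x = (\<Oplus>\<^bsub>M\<^esub>b\<in>B. c b \<odot>\<^bsub>M\<^esub> b)))"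

end

theory Submission
  imports Defs Complex_Main "HOL-Library.Sublist" "HOL-Combinatorics.Permutations"
begin

text \<open>
  Every relator of the nil-Hecke algebra is a word or a difference of two words of equal length. The
  algebra therefore has a basis of classes of words, for every coefficient ring. Call a word dead if the
  braid moves of length below \<open>5\<close> carry it to a word with a vanishing factor, that is, \<open>d i\<close> letters \<open>i\<close>
  in a row or a braid word of length at least \<open>5\<close>. The classes of the other words, the
  alive ones, under those moves form a basis (\<open>nil_Hecke_rank\<close>), so that the theorem becomes a question
  on words: when are there finitely many alive classes, and how many?

  Counting. If all exponents are \<open>2\<close>, then alive words are reduced, because braid moves carry a word
  that is not reduced to a word with a square (\<open>nonreduced_braid_square\<close>). Hence a finite group leaves
  only finitely many alive words (\<open>finite_group_finite_alive\<close>). If moreover all finite labels are below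
  \<open>5\<close>, then Matsumoto's theorem identifies the alive classes with the elements of the group
  (\<open>alive_classes_coxeter_group\<close>). The finite irreducible types with larger labels are the dihedral one,
  whose alive words can be listed (\<open>alive_classes_dihedral\<close>), and \<open>H\<^sub>3\<close> and \<open>H\<^sub>4\<close>, for which a finite
  confluent rewriting system yields normal words that can be counted (\<open>h3_type\<close>, \<open>h4_type\<close>). In type
  \<open>A\<^sub>n\<close> with one larger exponent at an end, the letters act on pairs of a permutation and a counter; a
  word is alive if and only if it acts on the initial pair, and its class is determined by the result
  (\<open>alive_classes_type_A\<close>).

  Infinite examples. A partial action of the letters that satisfies the relations, with the zero of the
  algebra acting as the nowhere defined map, shows that all words with a defined action are alive. Such
  actions come from walks through the Coxeter graph that never admit a braid move other than the exchange
  of commuting letters. The walk may run around a cycle (\<open>infinite_cycle\<close>), or to and fro between two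
  places where it can turn around (\<open>infinite_two_turnings\<close>): at a vertex with exponent larger than \<open>2\<close>
  it can repeat the letter, at an edge with label at least \<open>4\<close> it can bounce back, and at a branch
  vertex it can visit two commuting neighbours and return. A label at least \<open>6\<close> together with one more
  vertex also allows an endless walk (\<open>infinite_heavy_six\<close>). Two more examples are given by finite tables:
  an edge with label at least \<open>5\<close> with neighbours on both sides, and the path on five vertices with
  labels \<open>5, 3, 3, 3\<close> (\<open>infinite_heavy_middle\<close>, \<open>infinite_heavy_end\<close>).

  Classification. Let there be finitely many alive classes. Then the graph has no cycle, and a vertex
  with exponent larger than \<open>2\<close> excludes any other place to turn around; so the graph is a path of type
  \<open>A\<^sub>n\<close> with that vertex at an end (\<open>fat_vertex\<close>). Likewise, a finite label at least \<open>5\<close> excludes all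
  branch vertices and all further labels above \<open>3\<close>, and the last three examples leave only the dihedral
  type, \<open>H\<^sub>3\<close> and \<open>H\<^sub>4\<close>, whose groups are finite (\<open>finite_group_if_heavy\<close>). In the remaining case the
  alive classes correspond to the elements of the group.
\<close>

section \<open>The free algebra on words\<close>

lemma finite_splittings: "finite {(u, v). u @ v = w}"
proof (rule finite_subset)
  show "{(u, v). u @ v = w} \<subseteq> (\<lambda>k. (take k w, drop k w)) ` {..length w}"
  proof clarify
    fix u v :: "'b list"
    show "(u, v) \<in> (\<lambda>k. (take k (u @ v), drop k (u @ v))) ` {..length (u @ v)}"
      by (rule image_eqI[of _ _ "length u"]) auto
  qed
qed simp

locale free_word_algebra = cring R for R :: "('k, 'm) ring_scheme" (structure) +
  fixes I :: "'i set"
begin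

abbreviation F where "F \<equiv> free_algebra R I"

lemma free_carrier_iff:
  "f \<in> carrier F \<longleftrightarrow>
     (\<forall>w. f w \<in> carrier R) \<and> finite {w. f w \<noteq> \<zero>} \<and> (\<forall>w. f w \<noteq> \<zero> \<longrightarrow> w \<in> lists I)"
  by (auto simp: free_algebra_def)

lemma free_eval [simp]: "f \<in> carrier F \<Longrightarrow> f w \<in> carrier R"
  by (simp add: free_carrier_iff)

lemma free_simps:
  "(f \<otimes>\<^bsub>F\<^esub> g) w = (\<Oplus>p\<in>{(u, v). u @ v = w}. f (fst p) \<otimes> g (snd p))"
  "\<one>\<^bsub>F\<^esub> w = (if w = [] then \<one> else \<zero>)"
  "\<zero>\<^bsub>F\<^esub> w = \<zero>"
  "(f \<oplus>\<^bsub>F\<^esub> g) w = f w \<oplus> g w"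
  "(c \<odot>\<^bsub>F\<^esub> f) w = c \<otimes> f w"
  by (simp_all add: free_algebra_def)

lemma free_zero_closed: "\<zero>\<^bsub>F\<^esub> \<in> carrier F"
  by (simp add: free_carrier_iff free_simps)

lemma free_one_closed: "\<one>\<^bsub>F\<^esub> \<in> carrier F"
  by (auto simp: free_carrier_iff free_simps)

lemma free_add_closed: "\<lbrakk>f \<in> carrier F; g \<in> carrier F\<rbrakk> \<Longrightarrow> f \<oplus>\<^bsub>F\<^esub> g \<in> carrier F"
proof -
  assume f: "f \<in> carrier F" and g: "g \<in> carrier F"
  have "{w. f w \<oplus> g w \<noteq> \<zero>} \<subseteq> {w. f w \<noteq> \<zero>} \<union> {w. g w \<noteq> \<zero>}" by auto
  moreover have "w \<in> lists I" if "f w \<oplus> g w \<noteq> \<zero>" for w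
    using that f g by (cases "f w = \<zero>") (auto simp: free_carrier_iff)
  ultimately show ?thesis using f g
    by (auto simp: free_carrier_iff free_simps intro: finite_subset)
qed

lemma free_smult_closed: "\<lbrakk>c \<in> carrier R; f \<in> carrier F\<rbrakk> \<Longrightarrow> c \<odot>\<^bsub>F\<^esub> f \<in> carrier F"
proof -
  assume c: "c \<in> carrier R" and f: "f \<in> carrier F"
  have "{w. c \<otimes> f w \<noteq> \<zero>} \<subseteq> {w. f w \<noteq> \<zero>}" using c by auto
  with c f show ?thesis
    by (auto simp: free_carrier_iff free_simps intro: finite_subset)
qed

lemma free_mult_closed: "\<lbrakk>f \<in> carrier F; g \<in> carrier F\<rbrakk> \<Longrightarrow> f \<otimes>\<^bsub>F\<^esub> g \<in> carrier F"
proof -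
  assume f: "f \<in> carrier F" and g: "g \<in> carrier F"
  have sub: "{w. (f \<otimes>\<^bsub>F\<^esub> g) w \<noteq> \<zero>} \<subseteq> (\<lambda>(u, v). u @ v) ` ({w. f w \<noteq> \<zero>} \<times> {w. g w \<noteq> \<zero>})"
  proof (rule subsetI, rule ccontr)
    fix w assume w: "w \<in> {w. (f \<otimes>\<^bsub>F\<^esub> g) w \<noteq> \<zero>}"
      and nw: "w \<notin> (\<lambda>(u, v). u @ v) ` ({w. f w \<noteq> \<zero>} \<times> {w. g w \<noteq> \<zero>})"
    have "(f \<otimes>\<^bsub>F\<^esub> g) w = (\<Oplus>p\<in>{(u, v). u @ v = w}. \<zero>)"
      unfolding free_simps
    proof (rule finsum_cong')
      fix p assume "p \<in> {(u, v). u @ v = w}"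
      then have "f (fst p) = \<zero> \<or> g (snd p) = \<zero>" using nw by force
      then show "f (fst p) \<otimes> g (snd p) = \<zero>" using f g by auto
    qed auto
    then show False using w by simp
  qed
  have "(f \<otimes>\<^bsub>F\<^esub> g) w \<in> carrier R" for w
    unfolding free_simps using f g by (intro finsum_closed) auto
  moreover have "finite {w. (f \<otimes>\<^bsub>F\<^esub> g) w \<noteq> \<zero>}"
    using f g by (intro finite_subset[OF sub]) (auto simp: free_carrier_iff)
  moreover have "w \<in> lists I" if "(f \<otimes>\<^bsub>F\<^esub> g) w \<noteq> \<zero>" for w
  proof -
    from that have "w \<in> {w. (f \<otimes>\<^bsub>F\<^esub> g) w \<noteq> \<zero>}" by simp
    from subsetD[OF sub this] obtain u v where "w = u @ v" "f u \<noteq> \<zero>" "g v \<noteq> \<zero>" by auto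
    then show ?thesis using f g by (auto simp: free_carrier_iff)
  qed
  ultimately show ?thesis by (simp add: free_carrier_iff)
qed

lemma finsum_Sigma:
  assumes "finite A" "\<And>a. a \<in> A \<Longrightarrow> finite (B a)"
    "\<And>a b. a \<in> A \<Longrightarrow> b \<in> B a \<Longrightarrow> h (a, b) \<in> carrier R"
  shows "(\<Oplus>p\<in>Sigma A B. h p) = (\<Oplus>a\<in>A. \<Oplus>b\<in>B a. h (a, b))"
proof -
  have "(\<Oplus>p\<in>Sigma A B. h p) = (\<Oplus>p\<in>(\<Union>a\<in>A. Pair a ` B a). h p)"
    by (rule arg_cong[where f = "finsum R h"]) auto
  also have "\<dots> = (\<Oplus>a\<in>A. \<Oplus>p\<in>Pair a ` B a. h p)"
    using assms by (intro add.finprod_UN_disjoint) (auto simp: pairwise_def disjnt_def)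
  also have "\<dots> = (\<Oplus>a\<in>A. \<Oplus>b\<in>B a. h (a, b))"
  proof (rule finsum_cong'[OF HOL.refl])
    fix a assume a: "a \<in> A"
    show "(\<Oplus>p\<in>Pair a ` B a. h p) = (\<Oplus>b\<in>B a. h (a, b))"
      using assms a by (intro finsum_reindex) (auto simp: inj_on_def)
  next
    show "(\<lambda>a. \<Oplus>b\<in>B a. h (a, b)) \<in> A \<rightarrow> carrier R"
      using assms by (auto intro!: finsum_closed)
  qed
  finally show ?thesis .
qed

text \<open>
  Both sides are sums over the splittings of \<open>w\<close> into three words.
\<close>

lemma free_mult_assoc:
  assumes f: "f \<in> carrier F" and g: "g \<in> carrier F" and h: "h \<in> carrier F"
  shows "(f \<otimes>\<^bsub>F\<^esub> g) \<otimes>\<^bsub>F\<^esub> h = f \<otimes>\<^bsub>F\<^esub> (g \<otimes>\<^bsub>F\<^esub> h)"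
proof
  fix w
  let ?S = "\<lambda>w. {(u, v). u @ v = w}"
  have "((f \<otimes>\<^bsub>F\<^esub> g) \<otimes>\<^bsub>F\<^esub> h) w =
      (\<Oplus>p\<in>?S w. \<Oplus>q\<in>?S (fst p). f (fst q) \<otimes> g (snd q) \<otimes> h (snd p))"
    unfolding free_simps using f g h
    by (intro finsum_cong' HOL.refl) (auto simp: finsum_ldistr finite_splittings intro!: finsum_closed)
  also have "\<dots> = (\<Oplus>t\<in>Sigma (?S w) (\<lambda>p. ?S (fst p)).
      f (fst (snd t)) \<otimes> g (snd (snd t)) \<otimes> h (snd (fst t)))"
    using f g h by (subst finsum_Sigma) (auto simp: finite_splittings)
  also have "\<dots> = (\<Oplus>t\<in>(\<lambda>t. ((fst (fst t) @ fst (snd t), snd (snd t)), (fst (fst t), fst (snd t))))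
        ` Sigma (?S w) (\<lambda>p. ?S (snd p)).
      f (fst (snd t)) \<otimes> g (snd (snd t)) \<otimes> h (snd (fst t)))"
    by (rule arg_cong[where f = "finsum R _"]) (force simp: image_iff)
  also have "\<dots> = (\<Oplus>t\<in>Sigma (?S w) (\<lambda>p. ?S (snd p)).
      f (fst (fst t)) \<otimes> (g (fst (snd t)) \<otimes> h (snd (snd t))))"
    using f g h
    by (subst finsum_reindex) (auto simp: inj_on_def m_assoc intro!: finsum_cong')
  also have "\<dots> = (\<Oplus>p\<in>?S w. \<Oplus>q\<in>?S (snd p). f (fst p) \<otimes> (g (fst q) \<otimes> h (snd q)))"
    using f g h by (subst finsum_Sigma) (auto simp: finite_splittings)
  also have "\<dots> = (f \<otimes>\<^bsub>F\<^esub> (g \<otimes>\<^bsub>F\<^esub> h)) w"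
    unfolding free_simps using f g h
    by (intro finsum_cong' HOL.refl) (auto simp: finsum_rdistr finite_splittings intro!: finsum_closed)
  finally show "((f \<otimes>\<^bsub>F\<^esub> g) \<otimes>\<^bsub>F\<^esub> h) w = (f \<otimes>\<^bsub>F\<^esub> (g \<otimes>\<^bsub>F\<^esub> h)) w" .
qed

lemma mono_mult_left:
  assumes g: "g \<in> carrier F"
  shows "word_monomial R [] \<otimes>\<^bsub>F\<^esub> g = g" "g \<otimes>\<^bsub>F\<^esub> word_monomial R [] = g"
proof -
  have 1: "(\<Oplus>p\<in>{(u, v). u @ v = w}. word_monomial R [] (fst p) \<otimes> g (snd p)) = g w" for w
  proof -
    have "(\<Oplus>p\<in>{(u, v). u @ v = w}. word_monomial R [] (fst p) \<otimes> g (snd p))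
        = (\<Oplus>p\<in>{(u, v). u @ v = w}. if ([], w) = p then g (snd p) else \<zero>)"
      using g by (intro finsum_cong' HOL.refl) (auto simp: word_monomial_def)
    also have "\<dots> = g (snd ([], w))"
      using g by (subst finsum_singleton) (auto simp: finite_splittings)
    finally show ?thesis by simp
  qed
  have 2: "(\<Oplus>p\<in>{(u, v). u @ v = w}. g (fst p) \<otimes> word_monomial R [] (snd p)) = g w" for w
  proof -
    have "(\<Oplus>p\<in>{(u, v). u @ v = w}. g (fst p) \<otimes> word_monomial R [] (snd p))
        = (\<Oplus>p\<in>{(u, v). u @ v = w}. if (w, []) = p then g (fst p) else \<zero>)"
      using g by (intro finsum_cong' HOL.refl) (auto simp: word_monomial_def)
    also have "\<dots> = g (fst (w, []))"
      using g by (subst finsum_singleton) (auto simp: finite_splittings)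
    finally show ?thesis by simp
  qed
  from 1 2 show "word_monomial R [] \<otimes>\<^bsub>F\<^esub> g = g" "g \<otimes>\<^bsub>F\<^esub> word_monomial R [] = g"
    by (auto simp: free_simps)
qed

lemma free_one: "\<one>\<^bsub>F\<^esub> = word_monomial R []"
  by (simp add: free_algebra_def word_monomial_def)

lemma free_ring: "ring F"
proof (rule ringI)
  show "abelian_group F"
  proof (rule abelian_groupI)
    fix x assume x: "x \<in> carrier F"
    have "(\<lambda>w. \<ominus> x w) \<in> carrier F"
    proof -
      have "{w. \<ominus> x w \<noteq> \<zero>} \<subseteq> {w. x w \<noteq> \<zero>}" by auto
      then show ?thesis using x by (auto simp: free_carrier_iff intro: finite_subset)
    qed
    moreover have "(\<lambda>w. \<ominus> x w) \<oplus>\<^bsub>F\<^esub> x = \<zero>\<^bsub>F\<^esub>"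
      using x by (auto simp: free_algebra_def l_neg)
    ultimately show "\<exists>y\<in>carrier F. y \<oplus>\<^bsub>F\<^esub> x = \<zero>\<^bsub>F\<^esub>" by blast
  qed (auto simp: free_zero_closed free_add_closed intro!: ext simp: free_simps a_ac)
  show "monoid F"
    by (rule monoidI)
      (auto simp: free_mult_closed free_mult_assoc free_one_closed[unfolded free_one]
         free_one mono_mult_left)
  show "(x \<oplus>\<^bsub>F\<^esub> y) \<otimes>\<^bsub>F\<^esub> z = x \<otimes>\<^bsub>F\<^esub> z \<oplus>\<^bsub>F\<^esub> y \<otimes>\<^bsub>F\<^esub> z"
    if "x \<in> carrier F" "y \<in> carrier F" "z \<in> carrier F" for x y z
    using that
    by (auto simp: free_simps l_distr intro!: ext simp flip: finsum_addf intro!: finsum_cong')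
  show "z \<otimes>\<^bsub>F\<^esub> (x \<oplus>\<^bsub>F\<^esub> y) = z \<otimes>\<^bsub>F\<^esub> x \<oplus>\<^bsub>F\<^esub> z \<otimes>\<^bsub>F\<^esub> y"
    if "x \<in> carrier F" "y \<in> carrier F" "z \<in> carrier F" for x y z
    using that
    by (auto simp: free_simps r_distr intro!: ext simp flip: finsum_addf intro!: finsum_cong')
qed

sublocale F: ring F by (rule free_ring)

lemma free_minus: "\<lbrakk>f \<in> carrier F; g \<in> carrier F\<rbrakk> \<Longrightarrow> (f \<ominus>\<^bsub>F\<^esub> g) w = f w \<ominus> g w"
proof -
  assume f: "f \<in> carrier F" and g: "g \<in> carrier F"
  have "(\<ominus>\<^bsub>F\<^esub> g) w \<oplus> g w = \<zero>"
    using F.l_neg[OF g] free_simps(3,4) by metis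
  then have "(\<ominus>\<^bsub>F\<^esub> g) w = \<ominus> g w"
    using g F.a_inv_closed[OF g] by (metis free_eval minus_equality)
  then show ?thesis by (simp add: a_minus_def free_simps)
qed

lemma mono_closed [simp]: "u \<in> lists I \<Longrightarrow> word_monomial R u \<in> carrier F"
  by (auto simp: free_carrier_iff word_monomial_def split: if_splits)

lemma mono_mult:
  assumes "u \<in> lists I" "v \<in> lists I"
  shows "word_monomial R u \<otimes>\<^bsub>F\<^esub> word_monomial R v = word_monomial R (u @ v)"
proof
  fix w
  have "(word_monomial R u \<otimes>\<^bsub>F\<^esub> word_monomial R v) w =
     (\<Oplus>p\<in>{(u, v). u @ v = w}. if (u, v) = p then \<one> else \<zero>)"
    unfolding free_simps by (intro finsum_cong' HOL.refl) (auto simp: word_monomial_def)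
  also have "\<dots> = word_monomial R (u @ v) w"
  proof (cases "u @ v = w")
    case True
    then show ?thesis
      by (subst finsum_singleton) (auto simp: finite_splittings word_monomial_def)
  next
    case False
    then have "(\<Oplus>p\<in>{(u, v). u @ v = w}. if (u, v) = p then \<one> else \<zero>) = (\<Oplus>p\<in>{(u, v). u @ v = w}. \<zero>)"
      by (intro finsum_cong') auto
    then show ?thesis using False by (simp add: word_monomial_def)
  qed
  finally show "(word_monomial R u \<otimes>\<^bsub>F\<^esub> word_monomial R v) w = word_monomial R (u @ v) w" .
qed

lemma smult_eq_mult:
  assumes c: "c \<in> carrier R" and f: "f \<in> carrier F"
  shows "c \<odot>\<^bsub>F\<^esub> f = (c \<odot>\<^bsub>F\<^esub> \<one>\<^bsub>F\<^esub>) \<otimes>\<^bsub>F\<^esub> f"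
proof
  fix w
  have "((c \<odot>\<^bsub>F\<^esub> \<one>\<^bsub>F\<^esub>) \<otimes>\<^bsub>F\<^esub> f) w = (\<Oplus>p\<in>{(u, v). u @ v = w}. c \<otimes> (\<one>\<^bsub>F\<^esub> (fst p) \<otimes> f (snd p)))"
    using c f F.one_closed unfolding free_simps(1,5)
    by (intro finsum_cong' HOL.refl) (auto simp: m_assoc)
  also have "\<dots> = c \<otimes> (\<one>\<^bsub>F\<^esub> \<otimes>\<^bsub>F\<^esub> f) w"
    using c f F.one_closed unfolding free_simps(1)
    by (subst finsum_rdistr) (auto simp: finite_splittings)
  finally show "(c \<odot>\<^bsub>F\<^esub> f) w = ((c \<odot>\<^bsub>F\<^esub> \<one>\<^bsub>F\<^esub>) \<otimes>\<^bsub>F\<^esub> f) w"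
    using f by (simp add: free_simps(5))
qed

end

section \<open>Quotients of the free algebra by monomial relations\<close>

text \<open>
  An equivalence relation \<open>E\<close> and a set \<open>D\<close> of words, both compatible with concatenation: the words
  in \<open>D\<close> are to become zero, and equivalent words are to be identified. As \<open>E\<close> preserves the
  length and the alphabet is finite, all classes are finite, which allows summing coefficients over a
  class.
\<close>

locale monomial_relations = free_word_algebra R I
  for R :: "('k, 'm) ring_scheme" (structure) and I :: "'i set" +
  fixes E :: "('i list \<times> 'i list) set" and D :: "'i list set"
  assumes finite_letters: "finite I"
    and nontrivial: "\<one> \<noteq> \<zero>"
    and equiv_E: "equiv (lists I) E"
    and E_ctxt: "\<lbrakk>(u, v) \<in> E; p \<in> lists I; q \<in> lists I\<rbrakk> \<Longrightarrow> (p @ u @ q, p @ v @ q) \<in> E"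
    and E_length: "(u, v) \<in> E \<Longrightarrow> length u = length v"
    and D_words: "D \<subseteq> lists I"
    and D_ctxt: "\<lbrakk>u \<in> D; p \<in> lists I; q \<in> lists I\<rbrakk> \<Longrightarrow> p @ u @ q \<in> D"
    and D_E: "\<lbrakk>(u, v) \<in> E; u \<in> D\<rbrakk> \<Longrightarrow> v \<in> D"
begin

definition live_classes :: "'i list set set" where
  "live_classes = {E `` {u} | u. u \<in> lists I \<and> u \<notin> D}"

definition class_sum :: "'i list set \<Rightarrow> ('i list \<Rightarrow> 'k) \<Rightarrow> 'k" where
  "class_sum C f = (\<Oplus>w\<in>C. f w)"

definition sum_kernel :: "('i list \<Rightarrow> 'k) set" where
  "sum_kernel = {f \<in> carrier F. \<forall>C\<in>live_classes. class_sum C f = \<zero>}"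

lemma E_words: "(u, v) \<in> E \<Longrightarrow> u \<in> lists I \<and> v \<in> lists I"
  using equiv_E by (meson equiv_class_eq_iff)

lemma E_sym: "(u, v) \<in> E \<Longrightarrow> (v, u) \<in> E"
  using equiv_E by (meson equivE symE)

lemma E_refl: "u \<in> lists I \<Longrightarrow> (u, u) \<in> E"
  using equiv_E by (meson equivE refl_onD)

lemma live_classD:
  assumes "C \<in> live_classes"
  shows "finite C" "C \<subseteq> lists I - D" "w \<in> C \<Longrightarrow> C = E `` {w}" "C \<noteq> {}"
proof -
  from assms obtain u where u: "C = E `` {u}" "u \<in> lists I" "u \<notin> D"
    by (auto simp: live_classes_def)
  have "C \<subseteq> {w. set w \<subseteq> I \<and> length w = length u}"
    using u E_length E_words by (fastforce simp: in_lists_conv_set)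
  then show "finite C" using finite_lists_length_eq[OF finite_letters] finite_subset by blast
  show "C \<subseteq> lists I - D" using u E_words D_E E_sym by blast
  show "C = E `` {w}" if "w \<in> C"
    using u that equiv_class_eq[OF equiv_E, of u w] by simp
  show "C \<noteq> {}" using u E_refl by auto
qed

lemma live_classI: "w \<in> lists I - D \<Longrightarrow> E `` {w} \<in> live_classes"
  by (auto simp: live_classes_def)

lemma live_classes_disjoint:
  "\<lbrakk>C \<in> live_classes; C' \<in> live_classes; w \<in> C; w \<in> C'\<rbrakk> \<Longrightarrow> C = C'"
  using live_classD(3) by metis

lemma class_sum_closed [simp]: "f \<in> carrier F \<Longrightarrow> class_sum C f \<in> carrier R"
  unfolding class_sum_def by (intro finsum_closed) auto

lemma class_sum_add:
  "\<lbrakk>f \<in> carrier F; g \<in> carrier F\<rbrakk> \<Longrightarrow> class_sum C (f \<oplus>\<^bsub>F\<^esub> g) = class_sum C f \<oplus> class_sum C g"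
proof -
  assume f: "f \<in> carrier F" and g: "g \<in> carrier F"
  have "class_sum C (f \<oplus>\<^bsub>F\<^esub> g) = (\<Oplus>w\<in>C. f w \<oplus> g w)"
    unfolding class_sum_def using f g by (intro finsum_cong') (auto simp: free_simps)
  then show ?thesis using f g by (simp add: class_sum_def finsum_addf)
qed

lemma class_sum_zero: "class_sum C (\<zero>\<^bsub>F\<^esub>) = \<zero>"
  by (simp add: class_sum_def free_simps)

lemma class_sum_mono:
  assumes "finite C" shows "class_sum C (word_monomial R u) = (if u \<in> C then \<one> else \<zero>)"
proof (cases "u \<in> C")
  case True
  have "class_sum C (word_monomial R u) = (\<Oplus>w\<in>C. if u = w then \<one> else \<zero>)"
    unfolding class_sum_def by (rule finsum_cong') (auto simp: word_monomial_def)
  then show ?thesis using assms True by (simp add: finsum_singleton)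
next
  case False
  then have "class_sum C (word_monomial R u) = (\<Oplus>w\<in>C. \<zero>)"
    unfolding class_sum_def by (intro finsum_cong') (auto simp: word_monomial_def)
  then show ?thesis using False by simp
qed

text \<open>
  A set of words that is a union of live classes contributes nothing. This is what makes the
  kernel of the class sums stable under multiplication.
\<close>

lemma saturated_sum:
  assumes f: "f \<in> sum_kernel" and V: "finite V" "V \<subseteq> lists I - D"
    and sat: "\<And>v v'. v \<in> V \<Longrightarrow> (v, v') \<in> E \<Longrightarrow> v' \<in> V"
  shows "(\<Oplus>v\<in>V. f v) = \<zero>"
proof -
  let ?Q = "(\<lambda>v. E `` {v}) ` V"
  have Q: "?Q \<subseteq> live_classes" using V(2) live_classI by blast
  have "V = \<Union>?Q"
  proof
    show "V \<subseteq> \<Union>?Q"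
    proof
      fix v assume v: "v \<in> V"
      then have "(v, v) \<in> E" using V(2) by (intro E_refl) blast
      then show "v \<in> \<Union>?Q" using v by blast
    qed
    show "\<Union>?Q \<subseteq> V" using sat by auto
  qed
  then have "(\<Oplus>v\<in>V. f v) = (\<Oplus>v\<in>\<Union>?Q. f v)" by (rule arg_cong)
  also have "\<dots> = (\<Oplus>C\<in>?Q. \<Oplus>v\<in>C. f v)"
  proof -
    have "pairwise disjnt ?Q"
      unfolding pairwise_def disjnt_def using live_classes_disjoint Q by (meson disjoint_iff subsetD)
    then show ?thesis
      using live_classD(1) Q f V(1)
      by (intro add.finprod_Union_disjoint[unfolded comp_def]) (auto simp: sum_kernel_def)
  qed
  also have "\<dots> = (\<Oplus>C\<in>?Q. \<zero>)"
    using f Q by (intro finsum_cong') (auto simp: sum_kernel_def class_sum_def)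
  finally show ?thesis by simp
qed

lemma class_sum_mult:
  assumes f: "f \<in> carrier F" and g: "g \<in> carrier F" and C: "finite C"
  shows "class_sum C (f \<otimes>\<^bsub>F\<^esub> g) = (\<Oplus>p\<in>{(u, v). u @ v \<in> C}. f (fst p) \<otimes> g (snd p))"
proof -
  let ?S = "\<lambda>w. {(u, v). u @ v = w}"
  have "class_sum C (f \<otimes>\<^bsub>F\<^esub> g) = (\<Oplus>w\<in>C. \<Oplus>p\<in>?S w. f (fst p) \<otimes> g (snd p))"
    by (simp add: class_sum_def free_simps)
  also have "\<dots> = (\<Oplus>t\<in>Sigma C ?S. f (fst (snd t)) \<otimes> g (snd (snd t)))"
    using f g C by (subst finsum_Sigma) (auto simp: finite_splittings)
  also have "\<dots> = (\<Oplus>p\<in>snd ` Sigma C ?S. f (fst p) \<otimes> g (snd p))"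
    using f g by (subst finsum_reindex) (auto simp: inj_on_def)
  also have "snd ` Sigma C ?S = {(u, v). u @ v \<in> C}" by force
  finally show ?thesis .
qed

lemma finite_class_splittings: "finite C \<Longrightarrow> finite {(u, v). u @ v \<in> C}"
proof -
  assume "finite C"
  then have "finite (\<Union>w\<in>C. {(u, v). u @ v = w})" by (intro finite_UN_I finite_splittings)
  moreover have "{(u, v). u @ v \<in> C} = (\<Union>w\<in>C. {(u, v). u @ v = w})" by auto
  ultimately show ?thesis by simp
qed

lemma live_factor:
  assumes C: "C \<in> live_classes" and uv: "u @ v \<in> C"
  shows "u \<in> lists I - D" "v \<in> lists I - D"
    "(v, v') \<in> E \<Longrightarrow> u @ v' \<in> C" "(u, u') \<in> E \<Longrightarrow> u' @ v \<in> C"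
proof -
  have w: "u @ v \<in> lists I - D" using live_classD(2)[OF C] uv by blast
  then show "u \<in> lists I - D" using D_ctxt[of u "[]" v] by auto
  show "v \<in> lists I - D" using w D_ctxt[of v u "[]"] by auto
  have CE: "C = E `` {u @ v}" by (rule live_classD(3)[OF C uv])
  show "u @ v' \<in> C" if "(v, v') \<in> E" using E_ctxt[OF that, of u "[]"] w CE by auto
  show "u' @ v \<in> C" if "(u, u') \<in> E" using E_ctxt[OF that, of "[]" v] w CE by auto
qed

text \<open>
  A product contributes to the class sum over \<open>C\<close> through the pairs \<open>(u, v)\<close> with \<open>u @ v \<in> C\<close>. For a
  fixed \<open>u\<close> the possible \<open>v\<close> form a union of live classes, since \<open>C\<close> is closed under \<open>E\<close> and
  avoids \<open>D\<close>.
\<close>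

lemma sum_kernel_ideal: "ideal sum_kernel F"
proof (rule idealI)
  show "subgroup sum_kernel (add_monoid F)"
  proof (rule F.add.subgroupI)
    show "sum_kernel \<noteq> {}" using class_sum_zero F.zero_closed by (auto simp: sum_kernel_def)
    fix a assume a: "a \<in> sum_kernel"
    have "class_sum C (\<ominus>\<^bsub>F\<^esub> a) = \<zero>" if "C \<in> live_classes" for C
      using a that class_sum_add[of "\<ominus>\<^bsub>F\<^esub> a" a C] F.l_neg[of a] class_sum_zero
      by (simp add: sum_kernel_def)
    then show "\<ominus>\<^bsub>F\<^esub> a \<in> sum_kernel" using a by (auto simp: sum_kernel_def)
    fix b assume b: "b \<in> sum_kernel"
    show "a \<oplus>\<^bsub>F\<^esub> b \<in> sum_kernel"
      using a b by (auto simp: sum_kernel_def class_sum_add)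
  qed (auto simp: sum_kernel_def)
next
  fix f x assume f: "f \<in> sum_kernel" and x: "x \<in> carrier F"
  have fF: "f \<in> carrier F" using f by (simp add: sum_kernel_def)
  have "class_sum C (x \<otimes>\<^bsub>F\<^esub> f) = \<zero>" if C: "C \<in> live_classes" for C
  proof -
    let ?P = "{(u, v). u @ v \<in> C}" and ?V = "\<lambda>u. {v. u @ v \<in> C}"
    have fin: "finite ?P" using live_classD(1)[OF C] by (rule finite_class_splittings)
    have V: "finite (?V u)" for u
      using finite_imageI[OF fin, of snd] by (rule finite_subset[rotated]) (auto intro: rev_image_eqI)
    have "?P = Sigma (fst ` ?P) ?V" by (auto intro: rev_image_eqI)
    then have "class_sum C (x \<otimes>\<^bsub>F\<^esub> f) = (\<Oplus>p\<in>Sigma (fst ` ?P) ?V. x (fst p) \<otimes> f (snd p))"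
      using class_sum_mult[OF x fF live_classD(1)[OF C]] by simp
    also have "\<dots> = (\<Oplus>u\<in>fst ` ?P. \<Oplus>v\<in>?V u. x u \<otimes> f v)"
      using fin V x fF by (subst finsum_Sigma) auto
    also have "\<dots> = (\<Oplus>u\<in>fst ` ?P. x u \<otimes> (\<Oplus>v\<in>?V u. f v))"
      using V x fF by (intro finsum_cong' HOL.refl) (auto simp: finsum_rdistr intro!: finsum_closed)
    also have "\<dots> = (\<Oplus>u\<in>fst ` ?P. \<zero>)"
    proof (intro finsum_cong' HOL.refl)
      fix u
      have "(\<Oplus>v\<in>?V u. f v) = \<zero>"
      proof (rule saturated_sum[OF f V])
        show "?V u \<subseteq> lists I - D" using live_factor(2)[OF C] by blast
        show "v' \<in> ?V u" if "v \<in> ?V u" "(v, v') \<in> E" for v v'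
          using live_factor(3)[OF C, of u v v'] that by simp
      qed
      then show "x u \<otimes> (\<Oplus>v\<in>?V u. f v) = \<zero>" using x by simp
    qed auto
    finally show ?thesis by simp
  qed
  then show "x \<otimes>\<^bsub>F\<^esub> f \<in> sum_kernel" using x fF by (auto simp: sum_kernel_def)
  have "class_sum C (f \<otimes>\<^bsub>F\<^esub> x) = \<zero>" if C: "C \<in> live_classes" for C
  proof -
    let ?P = "{(u, v). u @ v \<in> C}" and ?U = "\<lambda>v. {u. u @ v \<in> C}"
    have fin: "finite ?P" using live_classD(1)[OF C] by (rule finite_class_splittings)
    have U: "finite (?U v)" for v
      using finite_imageI[OF fin, of fst] by (rule finite_subset[rotated]) (auto intro: rev_image_eqI)
    have "?P = (\<lambda>(v, u). (u, v)) ` Sigma (snd ` ?P) ?U"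
    proof (intro equalityI subsetI)
      fix p assume "p \<in> ?P"
      then show "p \<in> (\<lambda>(v, u). (u, v)) ` Sigma (snd ` ?P) ?U"
        by (intro image_eqI[where x = "(snd p, fst p)"]) (auto intro: rev_image_eqI)
    qed auto
    then have "class_sum C (f \<otimes>\<^bsub>F\<^esub> x)
        = (\<Oplus>p\<in>(\<lambda>(v, u). (u, v)) ` Sigma (snd ` ?P) ?U. f (fst p) \<otimes> x (snd p))"
      using class_sum_mult[OF fF x live_classD(1)[OF C]] by simp
    also have "\<dots> = (\<Oplus>p\<in>Sigma (snd ` ?P) ?U. f (snd p) \<otimes> x (fst p))"
      using x fF by (subst finsum_reindex) (auto simp: inj_on_def intro!: finsum_cong')
    also have "\<dots> = (\<Oplus>v\<in>snd ` ?P. \<Oplus>u\<in>?U v. f u \<otimes> x v)"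
      using fin U x fF by (subst finsum_Sigma) auto
    also have "\<dots> = (\<Oplus>v\<in>snd ` ?P. (\<Oplus>u\<in>?U v. f u) \<otimes> x v)"
      using U x fF by (intro finsum_cong' HOL.refl) (auto simp: finsum_ldistr intro!: finsum_closed)
    also have "\<dots> = (\<Oplus>v\<in>snd ` ?P. \<zero>)"
    proof (intro finsum_cong' HOL.refl)
      fix v
      have "(\<Oplus>u\<in>?U v. f u) = \<zero>"
      proof (rule saturated_sum[OF f U])
        show "?U v \<subseteq> lists I - D" using live_factor(1)[OF C] by blast
        show "u' \<in> ?U v" if "u \<in> ?U v" "(u, u') \<in> E" for u u'
          using live_factor(4)[OF C, of u v u'] that by simp
      qed
      then show "(\<Oplus>u\<in>?U v. f u) \<otimes> x v = \<zero>" using x by simp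
    qed auto
    finally show ?thesis by simp
  qed
  then show "f \<otimes>\<^bsub>F\<^esub> x \<in> sum_kernel" using x fF by (auto simp: sum_kernel_def)
qed (rule F.ring_axioms)

lemma sum_kernel_relators:
  "(u, v) \<in> E \<Longrightarrow> word_monomial R u \<ominus>\<^bsub>F\<^esub> word_monomial R v \<in> sum_kernel"
  "u \<in> D \<Longrightarrow> word_monomial R u \<in> sum_kernel"
proof -
  assume uv: "(u, v) \<in> E"
  have [simp]: "word_monomial R u \<in> carrier F" "word_monomial R v \<in> carrier F"
    using E_words[OF uv] by auto
  have "class_sum C (word_monomial R u \<ominus>\<^bsub>F\<^esub> word_monomial R v) = \<zero>" if C: "C \<in> live_classes" for C
  proof -
    have iff: "u \<in> C \<longleftrightarrow> v \<in> C"
      using live_classD(3)[OF C] uv E_sym[OF uv] by (metis Image_singleton_iff)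
    have "class_sum C (word_monomial R u) =
        class_sum C ((word_monomial R u \<ominus>\<^bsub>F\<^esub> word_monomial R v) \<oplus>\<^bsub>F\<^esub> word_monomial R v)"
      by (simp add: F.minus_eq F.a_assoc F.l_neg)
    also have "\<dots> = class_sum C (word_monomial R u \<ominus>\<^bsub>F\<^esub> word_monomial R v) \<oplus> class_sum C (word_monomial R v)"
      by (rule class_sum_add) auto
    finally show ?thesis
      using iff live_classD(1)[OF C] by (simp add: class_sum_mono split: if_splits)
  qed
  then show "word_monomial R u \<ominus>\<^bsub>F\<^esub> word_monomial R v \<in> sum_kernel" by (auto simp: sum_kernel_def)
next
  assume u: "u \<in> D"
  have "class_sum C (word_monomial R u) = \<zero>" if C: "C \<in> live_classes" for C
    using live_classD(1,2)[OF C] u by (auto simp: class_sum_mono)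
  moreover have "u \<in> lists I" using u D_words by blast
  ultimately show "word_monomial R u \<in> sum_kernel" by (simp add: sum_kernel_def)
qed

end

text \<open>
  An ideal generated by binomials \<open>u - v\<close> with \<open>(u, v) \<in> E\<close> and by monomials in \<open>D\<close>. The minimality
  condition refers to the ideals that contain all those elements, so that the generators may be
  chosen much smaller than \<open>E\<close> and \<open>D\<close>.
\<close>

locale monomial_ideal = monomial_relations R I E D
  for R :: "('k, 'm) ring_scheme" (structure) and I :: "'i set" and E D +
  fixes N :: "('i list \<Rightarrow> 'k) set"
  assumes N_ideal: "ideal N F"
    and N_E: "(u, v) \<in> E \<Longrightarrow> word_monomial R u \<ominus>\<^bsub>F\<^esub> word_monomial R v \<in> N"
    and N_D: "u \<in> D \<Longrightarrow> word_monomial R u \<in> N"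
    and N_minimal: "\<lbrakk>ideal K F; \<And>u v. (u, v) \<in> E \<Longrightarrow> word_monomial R u \<ominus>\<^bsub>F\<^esub> word_monomial R v \<in> K;
       \<And>u. u \<in> D \<Longrightarrow> word_monomial R u \<in> K\<rbrakk> \<Longrightarrow> N \<subseteq> K"
begin

sublocale N: ideal N F by (rule N_ideal)

abbreviation A where "A \<equiv> quotient_algebra F N"

lemma N_sum_kernel: "N \<subseteq> sum_kernel"
  by (rule N_minimal[OF sum_kernel_ideal]) (auto intro: sum_kernel_relators)

lemma N_smult: "\<lbrakk>c \<in> carrier R; f \<in> N\<rbrakk> \<Longrightarrow> c \<odot>\<^bsub>F\<^esub> f \<in> N"
  using smult_eq_mult[of c f] N.I_l_closed[of f "c \<odot>\<^bsub>F\<^esub> \<one>\<^bsub>F\<^esub>"] free_smult_closed[of c "\<one>\<^bsub>F\<^esub>"]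
    N.Icarr F.one_closed by simp

definition class_rep :: "'i list \<Rightarrow> 'i list" where
  "class_rep w = (SOME v. v \<in> E `` {w})"

definition reps :: "'i list set" where "reps = class_rep ` (lists I - D)"

lemma class_rep: "w \<in> lists I - D \<Longrightarrow> (w, class_rep w) \<in> E \<and> class_rep w \<in> reps"
  unfolding class_rep_def reps_def using E_refl[of w] someI[of "\<lambda>v. v \<in> E `` {w}" w] by simp

lemma reps_live: "r \<in> reps \<Longrightarrow> r \<in> lists I - D \<and> class_rep r = r"
proof -
  assume "r \<in> reps"
  then obtain w where w: "w \<in> lists I - D" "r = class_rep w" by (auto simp: reps_def)
  then have wr: "(w, r) \<in> E" using class_rep by simp
  then have "E `` {w} = E `` {r}" using equiv_class_eq[OF equiv_E] by simp
  then have "class_rep w = class_rep r" by (simp only: class_rep_def)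
  then have "class_rep r = r" using w(2) by simp
  moreover have "r \<in> lists I - D" using wr w E_words[OF wr] D_E[OF E_sym[OF wr]] by blast
  ultimately show ?thesis by simp
qed

lemma bij_reps_classes: "bij_betw (\<lambda>r. E `` {r}) reps live_classes"
proof (rule bij_betwI')
  fix r r' assume r: "r \<in> reps" "r' \<in> reps"
  show "E `` {r} = E `` {r'} \<longleftrightarrow> r = r'"
    using reps_live[OF r(1)] reps_live[OF r(2)] by (metis class_rep_def)
next
  fix r assume "r \<in> reps"
  then show "E `` {r} \<in> live_classes" using reps_live live_classI by blast
next
  fix C assume C: "C \<in> live_classes"
  then obtain w where w: "C = E `` {w}" "w \<in> lists I - D" by (auto simp: live_classes_def)
  then have "C = E `` {class_rep w}" using class_rep equiv_class_eq[OF equiv_E] by blast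
  then show "\<exists>r\<in>reps. C = E `` {r}" using class_rep w(2) by blast
qed

lemma class_sum_rep:
  assumes g: "g \<in> carrier F" "{w. g w \<noteq> \<zero>} \<subseteq> reps" and r: "r \<in> reps"
  shows "class_sum (E `` {r}) g = g r"
proof -
  let ?C = "E `` {r}"
  have C: "?C \<in> live_classes" using bij_reps_classes r by (auto simp: bij_betw_def)
  have "class_sum ?C g = (\<Oplus>w\<in>?C. if r = w then g w else \<zero>)"
    unfolding class_sum_def
  proof (rule finsum_cong'[OF HOL.refl])
    fix w assume w: "w \<in> ?C"
    show "g w = (if r = w then g w else \<zero>)"
    proof (cases "g w = \<zero>")
      case False
      then have "w \<in> reps" using g by auto
      moreover have "E `` {w} = E `` {r}" using w equiv_class_eq[OF equiv_E, of r w] by simp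
      ultimately have "w = r" using bij_reps_classes r by (auto simp: bij_betw_def dest: inj_onD)
      then show ?thesis by simp
    qed simp
  qed (use g in auto)
  also have "\<dots> = g r"
    using live_classD(1)[OF C] E_refl reps_live[OF r] g by (subst finsum_singleton) auto
  finally show ?thesis .
qed

text \<open>
  Spanning: term by term, each word is replaced by the representative of its class, or dropped if it
  lies in \<open>D\<close>.
\<close>

lemma reduce_to_reps:
  assumes "f \<in> carrier F"
  shows "\<exists>g\<in>carrier F. {w. g w \<noteq> \<zero>} \<subseteq> reps \<and> f \<ominus>\<^bsub>F\<^esub> g \<in> N"
proof -
  have "\<exists>g\<in>carrier F. {w. g w \<noteq> \<zero>} \<subseteq> reps \<and> f \<ominus>\<^bsub>F\<^esub> g \<in> N"
    if "finite X" "f \<in> carrier F" "{w. f w \<noteq> \<zero>} \<subseteq> X" for X f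
    using that
  proof (induction X arbitrary: f rule: finite_induct)
    case empty
    have "f \<ominus>\<^bsub>F\<^esub> f = \<zero>\<^bsub>F\<^esub>" using F.r_neg[OF empty.prems(1)] by (simp only: F.minus_eq)
    then have "f \<ominus>\<^bsub>F\<^esub> f \<in> N" using N.zero_closed by simp
    then show ?case using empty by blast
  next
    case (insert x X f)
    note f = insert.prems(1)
    let ?c = "f x"
    have cx: "?c \<in> carrier R" using f by simp
    \<comment> \<open>\<open>h\<close> is \<open>f\<close> without its term at \<open>x\<close>, and \<open>t\<close> is the reduced form of that term\<close>
    let ?h = "\<lambda>w. if w = x then \<zero> else f w"
    have h: "?h \<in> carrier F"
    proof -
      have "{w. ?h w \<noteq> \<zero>} \<subseteq> {w. f w \<noteq> \<zero>}" by auto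
      then show ?thesis using f by (auto simp: free_carrier_iff intro: finite_subset)
    qed
    have "{w. ?h w \<noteq> \<zero>} \<subseteq> X" using insert.prems(2) by auto
    from insert.IH[OF h this] obtain g where
      g: "g \<in> carrier F" "{w. g w \<noteq> \<zero>} \<subseteq> reps" "?h \<ominus>\<^bsub>F\<^esub> g \<in> N" by blast
    show ?case
    proof (cases "?c = \<zero>")
      case True
      then have "?h = f" by auto
      then show ?thesis using g by auto
    next
      case False
      then have x: "x \<in> lists I" using f by (simp add: free_carrier_iff)
      define t where "t = (if x \<in> D then \<zero>\<^bsub>F\<^esub> else word_monomial R (class_rep x))"
      have t: "t \<in> carrier F" "{w. t w \<noteq> \<zero>} \<subseteq> reps"
        using class_rep[of x] reps_live[of "class_rep x"] x
        by (auto simp: t_def free_simps word_monomial_def split: if_splits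
            intro!: mono_closed[unfolded word_monomial_def])
      have tN: "word_monomial R x \<ominus>\<^bsub>F\<^esub> t \<in> N"
        using N_D[of x] N_E class_rep[of x] x mono_closed[OF x]
        by (auto simp: t_def F.minus_eq)
      let ?g = "g \<oplus>\<^bsub>F\<^esub> ?c \<odot>\<^bsub>F\<^esub> t"
      have cc: "?c \<odot>\<^bsub>F\<^esub> t \<in> carrier F" using free_smult_closed cx t by blast
      have gF: "?g \<in> carrier F" using g cc by simp
      have "{w. ?g w \<noteq> \<zero>} \<subseteq> {w. g w \<noteq> \<zero>} \<union> {w. t w \<noteq> \<zero>}" using cx by (auto simp: free_simps)
      then have supp: "{w. ?g w \<noteq> \<zero>} \<subseteq> reps" using g t by blast
      have "f \<ominus>\<^bsub>F\<^esub> ?g = (?h \<ominus>\<^bsub>F\<^esub> g) \<oplus>\<^bsub>F\<^esub> ?c \<odot>\<^bsub>F\<^esub> (word_monomial R x \<ominus>\<^bsub>F\<^esub> t)"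
      proof
        fix w
        have cl: "f w \<in> carrier R" "g w \<in> carrier R" "t w \<in> carrier R" using f g t by auto
        show "(f \<ominus>\<^bsub>F\<^esub> ?g) w = ((?h \<ominus>\<^bsub>F\<^esub> g) \<oplus>\<^bsub>F\<^esub> ?c \<odot>\<^bsub>F\<^esub> (word_monomial R x \<ominus>\<^bsub>F\<^esub> t)) w"
          using cl cx h f g(1) t(1) gF mono_closed[OF x]
          by (simp add: free_minus free_simps word_monomial_def minus_eq minus_add r_distr r_minus
              a_ac)
      qed
      then have "f \<ominus>\<^bsub>F\<^esub> ?g \<in> N" using g(3) N_smult[OF cx tN] N.a_closed by simp
      then show ?thesis using gF supp by blast
    qed
  qed
  then show ?thesis using assms by (auto simp: free_carrier_iff)
qed

lemma A_simps:
  "carrier A = {N +>\<^bsub>F\<^esub> f | f. f \<in> carrier F}"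
  "\<zero>\<^bsub>A\<^esub> = N +>\<^bsub>F\<^esub> \<zero>\<^bsub>F\<^esub>"
  "\<lbrakk>f \<in> carrier F; g \<in> carrier F\<rbrakk> \<Longrightarrow> (N +>\<^bsub>F\<^esub> f) \<oplus>\<^bsub>A\<^esub> (N +>\<^bsub>F\<^esub> g) = N +>\<^bsub>F\<^esub> (f \<oplus>\<^bsub>F\<^esub> g)"
  by (auto simp: quotient_algebra_def FactRing_def A_RCOSETS_def' N.a_rcos_sum F.a_rcos_zero[OF N_ideal]
      N.zero_closed)

lemma A_carrierI: "f \<in> carrier F \<Longrightarrow> N +>\<^bsub>F\<^esub> f \<in> carrier A"
  unfolding A_simps(1) by blast

lemma A_smult:
  assumes c: "c \<in> carrier R" and f: "f \<in> carrier F"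
  shows "c \<odot>\<^bsub>A\<^esub> (N +>\<^bsub>F\<^esub> f) = N +>\<^bsub>F\<^esub> (c \<odot>\<^bsub>F\<^esub> f)"
proof -
  have "N +>\<^bsub>F\<^esub> (c \<odot>\<^bsub>F\<^esub> x) = N +>\<^bsub>F\<^esub> (c \<odot>\<^bsub>F\<^esub> f)" if "x \<in> N +>\<^bsub>F\<^esub> f" for x
  proof -
    from that obtain a where a: "a \<in> N" "x = a \<oplus>\<^bsub>F\<^esub> f" by (auto simp: a_r_coset_def')
    then have aF: "a \<in> carrier F" using N.Icarr by blast
    have cx: "c \<odot>\<^bsub>F\<^esub> x \<in> carrier F" "c \<odot>\<^bsub>F\<^esub> f \<in> carrier F"
      using free_smult_closed[OF c] f aF a(2) by auto
    have "c \<odot>\<^bsub>F\<^esub> x \<ominus>\<^bsub>F\<^esub> c \<odot>\<^bsub>F\<^esub> f = c \<odot>\<^bsub>F\<^esub> a"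
    proof
      fix w
      show "(c \<odot>\<^bsub>F\<^esub> x \<ominus>\<^bsub>F\<^esub> c \<odot>\<^bsub>F\<^esub> f) w = (c \<odot>\<^bsub>F\<^esub> a) w"
        unfolding free_minus[OF cx]
        using a c free_eval[OF f, of w] free_eval[OF aF, of w]
        by (simp add: free_simps r_distr minus_eq a_assoc r_neg)
    qed
    then have "c \<odot>\<^bsub>F\<^esub> x \<ominus>\<^bsub>F\<^esub> c \<odot>\<^bsub>F\<^esub> f \<in> N" using N_smult[OF c a(1)] by simp
    then show ?thesis
      using F.quotient_eq_iff_same_a_r_cos[OF N_ideal] free_smult_closed[OF c] f aF a by auto
  qed
  moreover have "f \<in> N +>\<^bsub>F\<^esub> f" using f by (rule N.a_rcos_self)
  then have "N +>\<^bsub>F\<^esub> f \<noteq> {}" by blast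
  ultimately have "(\<Union>x\<in>N +>\<^bsub>F\<^esub> f. N +>\<^bsub>F\<^esub> (c \<odot>\<^bsub>F\<^esub> x)) = N +>\<^bsub>F\<^esub> (c \<odot>\<^bsub>F\<^esub> f)"
    by (intro SUP_eq_const)
  then show ?thesis by (simp add: quotient_algebra_def)
qed

lemma A_abelian: "abelian_group A"
proof -
  interpret Q: ring "F Quot N" by (rule N.quotient_is_ring)
  have Q: "carrier A = carrier (F Quot N)" "add A = add (F Quot N)" "zero A = zero (F Quot N)"
    by (simp_all add: quotient_algebra_def)
  show ?thesis
  proof (rule abelian_groupI, unfold Q)
    fix x assume "x \<in> carrier (F Quot N)"
    then show "\<exists>y\<in>carrier (F Quot N). y \<oplus>\<^bsub>F Quot N\<^esub> x = \<zero>\<^bsub>F Quot N\<^esub>"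
      by (intro bexI[of _ "\<ominus>\<^bsub>F Quot N\<^esub> x"]) (auto simp: Q.l_neg)
  qed (auto simp: Q.a_ac)
qed

sublocale A: abelian_group A by (rule A_abelian)

lemma A_finsum:
  assumes "finite B" "\<And>b. b \<in> B \<Longrightarrow> c b \<in> carrier R" "\<And>b. b \<in> B \<Longrightarrow> g b \<in> carrier F"
  shows "\<exists>h\<in>carrier F. (\<Oplus>\<^bsub>A\<^esub>b\<in>B. c b \<odot>\<^bsub>A\<^esub> (N +>\<^bsub>F\<^esub> g b)) = N +>\<^bsub>F\<^esub> h \<and>
     (\<forall>w. h w = (\<Oplus>b\<in>B. c b \<otimes> g b w))"
  using assms
proof (induction B rule: finite_induct)
  case empty
  then show ?case using F.zero_closed by (auto simp: A_simps(2) free_simps intro!: bexI[of _ "\<zero>\<^bsub>F\<^esub>"])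
next
  case (insert b B)
  then obtain h where h: "h \<in> carrier F"
    "(\<Oplus>\<^bsub>A\<^esub>b\<in>B. c b \<odot>\<^bsub>A\<^esub> (N +>\<^bsub>F\<^esub> g b)) = N +>\<^bsub>F\<^esub> h" "\<forall>w. h w = (\<Oplus>b\<in>B. c b \<otimes> g b w)" by auto
  have cl: "c x \<odot>\<^bsub>F\<^esub> g x \<in> carrier F" if "x \<in> insert b B" for x
    using insert.prems[OF that] by (rule free_smult_closed)
  have "c x \<odot>\<^bsub>A\<^esub> (N +>\<^bsub>F\<^esub> g x) \<in> carrier A" if "x \<in> insert b B" for x
    unfolding A_smult[OF insert.prems[OF that]] by (rule A_carrierI[OF cl[OF that]])
  then have "(\<Oplus>\<^bsub>A\<^esub>b\<in>insert b B. c b \<odot>\<^bsub>A\<^esub> (N +>\<^bsub>F\<^esub> g b)) = N +>\<^bsub>F\<^esub> (c b \<odot>\<^bsub>F\<^esub> g b \<oplus>\<^bsub>F\<^esub> h)"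
    using insert.hyps insert.prems[of b] h cl[of b]
    by (subst A.finsum_insert) (simp_all add: A_smult A_simps(3) Pi_iff A_carrierI)
  moreover have "(c b \<odot>\<^bsub>F\<^esub> g b \<oplus>\<^bsub>F\<^esub> h) w = (\<Oplus>b\<in>insert b B. c b \<otimes> g b w)" for w
    using insert h by (subst finsum_insert) (auto simp: free_simps)
  ultimately show ?case using h(1) cl[of b] by blast
qed

lemma coset_eq_iff:
  "\<lbrakk>f \<in> carrier F; g \<in> carrier F\<rbrakk> \<Longrightarrow> N +>\<^bsub>F\<^esub> f = N +>\<^bsub>F\<^esub> g \<longleftrightarrow> f \<ominus>\<^bsub>F\<^esub> g \<in> N"
  using F.quotient_eq_iff_same_a_r_cos[OF N_ideal] by blast

lemma coset_class_sum:
  assumes "f \<in> carrier F" "g \<in> carrier F" "N +>\<^bsub>F\<^esub> f = N +>\<^bsub>F\<^esub> g" "C \<in> live_classes"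
  shows "class_sum C f = class_sum C g"
proof -
  have "f \<ominus>\<^bsub>F\<^esub> g \<in> sum_kernel" using assms N_sum_kernel coset_eq_iff by blast
  then have "class_sum C (f \<ominus>\<^bsub>F\<^esub> g) = \<zero>" using assms(4) by (simp add: sum_kernel_def)
  moreover have "f = (f \<ominus>\<^bsub>F\<^esub> g) \<oplus>\<^bsub>F\<^esub> g" using assms by (simp add: F.minus_eq F.a_assoc F.l_neg)
  then have "class_sum C f = class_sum C (f \<ominus>\<^bsub>F\<^esub> g) \<oplus> class_sum C g"
    using class_sum_add[of "f \<ominus>\<^bsub>F\<^esub> g" g C] assms by simp
  ultimately show ?thesis using assms by simp
qed

text \<open>
  Linear independence holds because the ideal is contained in the kernel of the class sums, and the
  class sum of a combination of representatives is a single coefficient.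
\<close>

theorem free_of_rank_classes:
  assumes fin: "finite live_classes"
  shows "free_of_rank R A (card live_classes)"
proof -
  define mb where "mb r = N +>\<^bsub>F\<^esub> word_monomial R r" for r
  have repsF: "word_monomial R r \<in> carrier F" if "r \<in> reps" for r
    using that reps_live by auto
  have finr: "finite reps" using fin bij_reps_classes bij_betw_finite by blast
  have cls: "E `` {r} \<in> live_classes" if "r \<in> reps" for r
    using bij_reps_classes that by (auto simp: bij_betw_def)
  have inj: "inj_on mb reps"
  proof (rule inj_onI, rule ccontr)
    fix r s assume rs: "r \<in> reps" "s \<in> reps" "mb r = mb s" "r \<noteq> s"
    let ?C = "E `` {r}"
    have "class_sum ?C (word_monomial R r) = class_sum ?C (word_monomial R s)"
      using rs repsF cls by (intro coset_class_sum) (auto simp: mb_def)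
    moreover have "s \<notin> ?C"
    proof
      assume "s \<in> ?C"
      then have "E `` {s} = E `` {r}" using equiv_class_eq[OF equiv_E, of r s] by simp
      then show False using rs bij_reps_classes by (auto simp: bij_betw_def dest: inj_onD)
    qed
    ultimately show False
      using live_classD(1)[OF cls[OF rs(1)]] E_refl reps_live[OF rs(1)] nontrivial
      by (auto simp: class_sum_mono split: if_splits)
  qed
  have comb: "\<exists>h\<in>carrier F. (\<Oplus>\<^bsub>A\<^esub>b\<in>mb ` reps. c b \<odot>\<^bsub>A\<^esub> b) = N +>\<^bsub>F\<^esub> h \<and>
      (\<forall>w. h w = (if w \<in> reps then c (mb w) else \<zero>))"
    if c: "c \<in> mb ` reps \<rightarrow> carrier R" for c
  proof -
    have "(\<Oplus>\<^bsub>A\<^esub>b\<in>mb ` reps. c b \<odot>\<^bsub>A\<^esub> b) = (\<Oplus>\<^bsub>A\<^esub>r\<in>reps. c (mb r) \<odot>\<^bsub>A\<^esub> mb r)"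
    proof (intro A.finsum_reindex inj)
      show "(\<lambda>b. c b \<odot>\<^bsub>A\<^esub> b) \<in> mb ` reps \<rightarrow> carrier A"
        using c repsF free_smult_closed by (auto simp: mb_def A_smult Pi_iff intro!: A_carrierI)
    qed
    then obtain h where h: "h \<in> carrier F" "(\<Oplus>\<^bsub>A\<^esub>b\<in>mb ` reps. c b \<odot>\<^bsub>A\<^esub> b) = N +>\<^bsub>F\<^esub> h"
      "\<forall>w. h w = (\<Oplus>r\<in>reps. c (mb r) \<otimes> word_monomial R r w)"
      using A_finsum[OF finr, of "\<lambda>r. c (mb r)" "word_monomial R"] c repsF
      by (auto simp: mb_def Pi_iff)
    have "h w = (if w \<in> reps then c (mb w) else \<zero>)" for w
    proof -
      have "h w = (\<Oplus>r\<in>reps. if w = r then c (mb r) else \<zero>)"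
        using h(3) c by (auto intro!: finsum_cong' simp: word_monomial_def Pi_iff)
      also have "\<dots> = (if w \<in> reps then c (mb w) else \<zero>)"
      proof (cases "w \<in> reps")
        case True
        then show ?thesis using finr c by (subst finsum_singleton) (auto simp: Pi_iff)
      next
        case False
        then have "(\<Oplus>r\<in>reps. if w = r then c (mb r) else \<zero>) = (\<Oplus>r\<in>reps. \<zero>)"
          by (intro finsum_cong') auto
        then show ?thesis using False by simp
      qed
      finally show ?thesis .
    qed
    then show ?thesis using h by blast
  qed
  have uniq: "\<exists>!c. c \<in> mb ` reps \<rightarrow>\<^sub>E carrier R \<and> x = (\<Oplus>\<^bsub>A\<^esub>b\<in>mb ` reps. c b \<odot>\<^bsub>A\<^esub> b)"
    if "x \<in> carrier A" for x
  proof -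
    from that obtain f where f: "f \<in> carrier F" "x = N +>\<^bsub>F\<^esub> f" by (auto simp: A_simps)
    from reduce_to_reps[OF f(1)] obtain g where
      g: "g \<in> carrier F" "{w. g w \<noteq> \<zero>} \<subseteq> reps" "f \<ominus>\<^bsub>F\<^esub> g \<in> N" by blast
    have xg: "x = N +>\<^bsub>F\<^esub> g" using f g coset_eq_iff by blast
    define c0 where "c0 = (\<lambda>b\<in>mb ` reps. g (the_inv_into reps mb b))"
    have c0: "c0 \<in> mb ` reps \<rightarrow>\<^sub>E carrier R" using g by (auto simp: c0_def)
    have c0mb: "c0 (mb r) = g r" if "r \<in> reps" for r
      using that inj by (simp add: c0_def the_inv_into_f_f)
    show ?thesis
    proof (rule ex1I[of _ c0])
      from comb[of c0] c0 obtain h where h: "h \<in> carrier F"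
        "(\<Oplus>\<^bsub>A\<^esub>b\<in>mb ` reps. c0 b \<odot>\<^bsub>A\<^esub> b) = N +>\<^bsub>F\<^esub> h"
        "\<forall>w. h w = (if w \<in> reps then c0 (mb w) else \<zero>)" by blast
      have "h w = g w" for w
      proof (cases "w \<in> reps")
        case False
        then have "g w = \<zero>" using g(2) by blast
        then show ?thesis using h(3) False by simp
      qed (use h(3) c0mb in simp)
      then have "h = g" ..
      then show "c0 \<in> mb ` reps \<rightarrow>\<^sub>E carrier R \<and> x = (\<Oplus>\<^bsub>A\<^esub>b\<in>mb ` reps. c0 b \<odot>\<^bsub>A\<^esub> b)"
        using c0 h xg by simp
    next
      fix c assume c: "c \<in> mb ` reps \<rightarrow>\<^sub>E carrier R \<and> x = (\<Oplus>\<^bsub>A\<^esub>b\<in>mb ` reps. c b \<odot>\<^bsub>A\<^esub> b)"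
      then have cR: "c \<in> mb ` reps \<rightarrow> carrier R" by (simp add: PiE_def)
      from comb[OF cR] c obtain h where h: "h \<in> carrier F" "x = N +>\<^bsub>F\<^esub> h"
        "\<forall>w. h w = (if w \<in> reps then c (mb w) else \<zero>)" by auto
      have "c b = c0 b" if b: "b \<in> mb ` reps" for b
      proof -
        from b obtain r where r: "r \<in> reps" "b = mb r" by blast
        have "c (mb r) = class_sum (E `` {r}) h"
        proof -
          have "{w. h w \<noteq> \<zero>} \<subseteq> reps" using h(3) by (auto split: if_splits)
          from class_sum_rep[OF h(1) this r(1)] show ?thesis
            using h(3)[rule_format, of r] r(1) by simp
        qed
        also have "\<dots> = class_sum (E `` {r}) g"
          using h xg g cls[OF r(1)] by (intro coset_class_sum) auto
        also have "\<dots> = g r" by (rule class_sum_rep[OF g(1,2) r(1)])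
        finally show ?thesis using r c0mb by simp
      qed
      then show "c = c0" using c c0 by (intro PiE_ext[of c "mb ` reps" "\<lambda>_. carrier R"]) auto
    qed
  qed
  have "mb ` reps \<subseteq> carrier A" using repsF by (auto simp: mb_def intro!: A_carrierI)
  moreover have "card (mb ` reps) = card live_classes"
    using card_image[OF inj] bij_betw_same_card[OF bij_reps_classes] by simp
  ultimately show ?thesis
    unfolding free_of_rank_def using finr
    by (intro exI[of _ "mb ` reps"] conjI ballI uniq) simp_all
qed

text \<open>
  Finitely many elements of the free algebra involve finitely many words. The class sum over a live
  class without any of these words vanishes on their linear combinations, but not on a word of that
  class.
\<close>

theorem not_fin_gen_classes:
  assumes inf: "infinite live_classes"
  shows "\<not> module_fin_gen R A"
proof
  assume "module_fin_gen R A"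
  then obtain S where S: "finite S" "S \<subseteq> carrier A"
    "\<forall>x\<in>carrier A. \<exists>c\<in>S \<rightarrow> carrier R. x = (\<Oplus>\<^bsub>A\<^esub>b\<in>S. c b \<odot>\<^bsub>A\<^esub> b)"
    by (auto simp: module_fin_gen_def)
  have "\<forall>b\<in>S. \<exists>f. f \<in> carrier F \<and> b = N +>\<^bsub>F\<^esub> f"
    using S(2) unfolding A_simps(1) by blast
  then obtain g where g: "\<forall>b\<in>S. g b \<in> carrier F \<and> b = N +>\<^bsub>F\<^esub> g b" by metis
  define W where "W = (\<Union>b\<in>S. {w. g b w \<noteq> \<zero>})"
  have "finite W" using S(1) g by (auto simp: W_def free_carrier_iff)
  then have "finite ((\<lambda>w. E `` {w}) ` W)" by simp
  with inf obtain C where C: "C \<in> live_classes" "C \<notin> (\<lambda>w. E `` {w}) ` W"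
    by (meson finite_subset subsetI)
  obtain w where w: "w \<in> C" using live_classD(4)[OF C(1)] by blast
  have wI: "w \<in> lists I" using live_classD(2)[OF C(1)] w by blast
  have CW: "C \<inter> W = {}" using C(2) live_classD(3)[OF C(1)] by blast
  have "N +>\<^bsub>F\<^esub> word_monomial R w \<in> carrier A" using wI by (intro A_carrierI) simp
  with S(3) obtain c where c: "c \<in> S \<rightarrow> carrier R"
    "N +>\<^bsub>F\<^esub> word_monomial R w = (\<Oplus>\<^bsub>A\<^esub>b\<in>S. c b \<odot>\<^bsub>A\<^esub> b)" by blast
  have "(\<Oplus>\<^bsub>A\<^esub>b\<in>S. c b \<odot>\<^bsub>A\<^esub> b) = (\<Oplus>\<^bsub>A\<^esub>b\<in>S. c b \<odot>\<^bsub>A\<^esub> (N +>\<^bsub>F\<^esub> g b))"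
  proof (intro A.finsum_cong' HOL.refl)
    show "(\<lambda>b. c b \<odot>\<^bsub>A\<^esub> (N +>\<^bsub>F\<^esub> g b)) \<in> S \<rightarrow> carrier A"
    proof
      fix b assume "b \<in> S"
      then have "c b \<in> carrier R" "g b \<in> carrier F" using g c(1) by auto
      then show "c b \<odot>\<^bsub>A\<^esub> (N +>\<^bsub>F\<^esub> g b) \<in> carrier A"
        using free_smult_closed by (simp add: A_smult A_carrierI)
    qed
  qed (use g in auto)
  with A_finsum[OF S(1), of c g] g c obtain h where h: "h \<in> carrier F"
    "N +>\<^bsub>F\<^esub> word_monomial R w = N +>\<^bsub>F\<^esub> h" "\<forall>v. h v = (\<Oplus>b\<in>S. c b \<otimes> g b v)"
    by (auto simp: Pi_iff)
  have "class_sum C (word_monomial R w) = class_sum C h"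
    using wI h C(1) by (intro coset_class_sum) auto
  moreover have "class_sum C h = \<zero>"
  proof -
    have "h v = \<zero>" if "v \<in> C" for v
    proof -
      have "g b v = \<zero>" if "b \<in> S" for b using that \<open>v \<in> C\<close> CW by (auto simp: W_def)
      then have "(\<Oplus>b\<in>S. c b \<otimes> g b v) = (\<Oplus>b\<in>S. \<zero>)"
        using c(1) by (intro finsum_cong') (auto simp: Pi_iff)
      then show ?thesis using h(3) by simp
    qed
    then have "class_sum C h = (\<Oplus>v\<in>C. \<zero>)"
      unfolding class_sum_def by (intro finsum_cong') auto
    then show ?thesis by simp
  qed
  ultimately show False using w live_classD(1)[OF C(1)] nontrivial by (simp add: class_sum_mono)
qed

end

lemma free_of_rank_fin_gen: "free_of_rank R M r \<Longrightarrow> module_fin_gen R M"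
  unfolding free_of_rank_def module_fin_gen_def
proof (elim exE conjE)
  fix B
  assume B: "finite B" "B \<subseteq> carrier M"
    "\<forall>x\<in>carrier M. \<exists>!c. c \<in> B \<rightarrow>\<^sub>E carrier R \<and> x = (\<Oplus>\<^bsub>M\<^esub>b\<in>B. c b \<odot>\<^bsub>M\<^esub> b)"
  have comb: "\<exists>c\<in>B \<rightarrow> carrier R. x = (\<Oplus>\<^bsub>M\<^esub>b\<in>B. c b \<odot>\<^bsub>M\<^esub> b)" if "x \<in> carrier M" for x
  proof -
    from B(3) that obtain c where "c \<in> B \<rightarrow>\<^sub>E carrier R" "x = (\<Oplus>\<^bsub>M\<^esub>b\<in>B. c b \<odot>\<^bsub>M\<^esub> b)"
      by (meson ex1_implies_ex)
    then show ?thesis by (intro bexI[of _ c]) (auto simp: PiE_def)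
  qed
  show "\<exists>S. finite S \<and> S \<subseteq> carrier M \<and>
      (\<forall>x\<in>carrier M. \<exists>c\<in>S \<rightarrow> carrier R. x = (\<Oplus>\<^bsub>M\<^esub>b\<in>S. c b \<odot>\<^bsub>M\<^esub> b))"
    by (intro exI[of _ B] conjI ballI B(1,2) comb)
qed

section \<open>Braid moves and the monomial basis of the nil-Hecke algebra\<close>

text \<open>
  The predicate \<open>P\<close> selects the lengths of the braid relations: all of them for the Coxeter group, and
  those below \<open>5\<close> for the nil-Hecke algebra.
\<close>

definition braid_moves :: "'i set \<Rightarrow> ('i \<Rightarrow> 'i \<Rightarrow> enat) \<Rightarrow> (nat \<Rightarrow> bool) \<Rightarrow> ('i list \<times> 'i list) set" where
  "braid_moves I m P = {(p @ braid_word m a b @ q, p @ braid_word m b a @ q) | p q a b.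
     p \<in> lists I \<and> q \<in> lists I \<and> a \<in> I \<and> b \<in> I \<and> a \<noteq> b \<and> m a b \<noteq> \<infinity> \<and> P (the_enat (m a b))}"

definition braid_equiv :: "'i set \<Rightarrow> ('i \<Rightarrow> 'i \<Rightarrow> enat) \<Rightarrow> (nat \<Rightarrow> bool) \<Rightarrow> ('i list \<times> 'i list) set" where
  "braid_equiv I m P = {(u, v). u \<in> lists I \<and> (u, v) \<in> (braid_moves I m P)\<^sup>*}"

abbreviation short_equiv :: "'i set \<Rightarrow> ('i \<Rightarrow> 'i \<Rightarrow> enat) \<Rightarrow> ('i list \<times> 'i list) set" where
  "short_equiv I m \<equiv> braid_equiv I m (\<lambda>k. k < 5)"

definition monomial_relators :: "'i set \<Rightarrow> ('i \<Rightarrow> 'i \<Rightarrow> enat) \<Rightarrow> ('i \<Rightarrow> nat) \<Rightarrow> 'i list set" where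
  "monomial_relators I m d = {replicate (d i) i | i. i \<in> I} \<union>
     {braid_word m a b | a b. a \<in> I \<and> b \<in> I \<and> a \<noteq> b \<and> m a b \<noteq> \<infinity> \<and> 5 \<le> the_enat (m a b)}"

definition null_words :: "'i set \<Rightarrow> ('i \<Rightarrow> 'i \<Rightarrow> enat) \<Rightarrow> ('i \<Rightarrow> nat) \<Rightarrow> 'i list set" where
  "null_words I m d = {p @ k @ q | p k q. p \<in> lists I \<and> q \<in> lists I \<and> k \<in> monomial_relators I m d}"

definition dead_words :: "'i set \<Rightarrow> ('i \<Rightarrow> 'i \<Rightarrow> enat) \<Rightarrow> ('i \<Rightarrow> nat) \<Rightarrow> 'i list set" where
  "dead_words I m d = {u. \<exists>v\<in>null_words I m d. (u, v) \<in> short_equiv I m}"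

definition alive_classes :: "'i set \<Rightarrow> ('i \<Rightarrow> 'i \<Rightarrow> enat) \<Rightarrow> ('i \<Rightarrow> nat) \<Rightarrow> 'i list set set" where
  "alive_classes I m d = {short_equiv I m `` {u} | u. u \<in> lists I \<and> u \<notin> dead_words I m d}"

lemma length_alternating_word [simp]: "length (alternating_word n a b) = n"
  by (induction n arbitrary: a b) auto

lemma alternating_word_in [simp]: "a \<in> I \<Longrightarrow> b \<in> I \<Longrightarrow> alternating_word n a b \<in> lists I"
  by (induction n arbitrary: a b) auto

lemma braid_word_in [simp]: "a \<in> I \<Longrightarrow> b \<in> I \<Longrightarrow> braid_word m a b \<in> lists I"
  unfolding braid_word_def by (rule alternating_word_in)

lemma set_alternating_word: "set (alternating_word n a b) \<subseteq> {a, b}"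
  by (induction n arbitrary: a b) auto

lemma set_braid_word: "set (braid_word m a b) \<subseteq> {a, b}"
  unfolding braid_word_def by (rule set_alternating_word)

lemma length_braid_word [simp]: "length (braid_word m a b) = the_enat (m a b)"
  by (simp add: braid_word_def)

lemma braid_movesI:
  "\<lbrakk>p \<in> lists I; q \<in> lists I; a \<in> I; b \<in> I; a \<noteq> b; m a b \<noteq> \<infinity>; P (the_enat (m a b))\<rbrakk> \<Longrightarrow>
     (p @ braid_word m a b @ q, p @ braid_word m b a @ q) \<in> braid_moves I m P"
  unfolding braid_moves_def by blast

lemma braid_moves_words: "(u, v) \<in> braid_moves I m P \<Longrightarrow> u \<in> lists I \<and> v \<in> lists I"
  unfolding braid_moves_def by (auto dest: subsetD[OF set_braid_word])

lemma braid_moves_ctxt: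
  "\<lbrakk>(u, v) \<in> braid_moves I m P; p \<in> lists I; q \<in> lists I\<rbrakk> \<Longrightarrow> (p @ u @ q, p @ v @ q) \<in> braid_moves I m P"
proof -
  assume uv: "(u, v) \<in> braid_moves I m P" and pq: "p \<in> lists I" "q \<in> lists I"
  then obtain x y a b where *: "u = x @ braid_word m a b @ y" "v = x @ braid_word m b a @ y"
    "x \<in> lists I" "y \<in> lists I" "a \<in> I" "b \<in> I" "a \<noteq> b" "m a b \<noteq> \<infinity>" "P (the_enat (m a b))"
    unfolding braid_moves_def by blast
  have "p @ u @ q = (p @ x) @ braid_word m a b @ (y @ q)"
    "p @ v @ q = (p @ x) @ braid_word m b a @ (y @ q)" "p @ x \<in> lists I" "y @ q \<in> lists I"
    using * pq by auto
  then show ?thesis unfolding braid_moves_def using *(5-9) by blast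
qed

lemma rtrancl_braid_words:
  "(u, v) \<in> (braid_moves I m P)\<^sup>* \<Longrightarrow> u \<in> lists I \<Longrightarrow> v \<in> lists I"
  by (induction rule: rtrancl_induct) (auto dest: braid_moves_words)

lemma braid_equiv_words: "(u, v) \<in> braid_equiv I m P \<Longrightarrow> u \<in> lists I \<and> v \<in> lists I"
  unfolding braid_equiv_def using rtrancl_braid_words by fastforce

lemma braid_equiv_refl: "u \<in> lists I \<Longrightarrow> (u, u) \<in> braid_equiv I m P"
  by (simp add: braid_equiv_def)

lemma braid_equiv_trans:
  "(u, v) \<in> braid_equiv I m P \<Longrightarrow> (v, w) \<in> braid_equiv I m P \<Longrightarrow> (u, w) \<in> braid_equiv I m P"
  unfolding braid_equiv_def by (auto intro: rtrancl_trans)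

lemma braid_equiv_move: "(u, v) \<in> braid_moves I m P \<Longrightarrow> (u, v) \<in> braid_equiv I m P"
  unfolding braid_equiv_def using braid_moves_words by fastforce

lemma braid_equiv_ctxt:
  assumes "(u, v) \<in> braid_equiv I m P" "p \<in> lists I" "q \<in> lists I"
  shows "(p @ u @ q, p @ v @ q) \<in> braid_equiv I m P"
proof -
  from assms(1) have "(u, v) \<in> (braid_moves I m P)\<^sup>*" "u \<in> lists I" by (auto simp: braid_equiv_def)
  then show ?thesis
  proof (induction rule: rtrancl_induct)
    case base
    then show ?case using assms(2,3) by (intro braid_equiv_refl) auto
  next
    case (step v w)
    then show ?case
      using braid_moves_ctxt[OF step(2) assms(2,3)] braid_equiv_move braid_equiv_trans by blast
  qed
qed

lemma braid_equiv_induct [consumes 1, case_names refl step]: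
  assumes "(u, v) \<in> braid_equiv I m P" and "u \<in> lists I \<Longrightarrow> Q u"
    and "\<And>v w. (u, v) \<in> braid_equiv I m P \<Longrightarrow> (v, w) \<in> braid_moves I m P \<Longrightarrow> Q v \<Longrightarrow> Q w"
  shows "Q v"
proof -
  from assms(1) have "(u, v) \<in> (braid_moves I m P)\<^sup>*" and u: "u \<in> lists I" by (auto simp: braid_equiv_def)
  then show ?thesis
    by (induction rule: rtrancl_induct) (use assms(2,3) u in \<open>auto simp: braid_equiv_def\<close>)
qed

locale coxeter_data =
  fixes I :: "'i set" and m :: "'i \<Rightarrow> 'i \<Rightarrow> enat"
  assumes coxeter: "coxeter_matrix I m"
begin

lemma finite_I: "finite I" and m_diag: "i \<in> I \<Longrightarrow> m i i = 1"
  and m_sym: "\<lbrakk>i \<in> I; j \<in> I\<rbrakk> \<Longrightarrow> m i j = m j i"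
  and m_ge_2: "\<lbrakk>i \<in> I; j \<in> I; i \<noteq> j\<rbrakk> \<Longrightarrow> 2 \<le> m i j"
proof -
  have *: "finite I" "\<forall>i\<in>I. m i i = 1" "\<forall>i\<in>I. \<forall>j\<in>I. i \<noteq> j \<longrightarrow> m i j = m j i \<and> 2 \<le> m i j"
    using coxeter unfolding coxeter_matrix_def by blast+
  show "finite I" by (rule *(1))
  show "i \<in> I \<Longrightarrow> m i i = 1" using *(2) by blast
  show "2 \<le> m i j" if "i \<in> I" "j \<in> I" "i \<noteq> j"
    by (rule *(3)[rule_format, OF that, THEN conjunct2])
  show "m i j = m j i" if "i \<in> I" "j \<in> I"
  proof (cases "i = j")
    case False
    show ?thesis by (rule *(3)[rule_format, OF that False, THEN conjunct1])
  qed simp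
qed

lemma braid_moves_sym: "(u, v) \<in> braid_moves I m P \<Longrightarrow> (v, u) \<in> braid_moves I m P"
proof -
  assume "(u, v) \<in> braid_moves I m P"
  then obtain x y a b where *: "u = x @ braid_word m a b @ y" "v = x @ braid_word m b a @ y"
    "x \<in> lists I" "y \<in> lists I" "a \<in> I" "b \<in> I" "a \<noteq> b" "m a b \<noteq> \<infinity>" "P (the_enat (m a b))"
    unfolding braid_moves_def by blast
  then show ?thesis 
  proof -
    have "m b a \<noteq> \<infinity>" "P (the_enat (m b a))" using * m_sym[of a b] by simp_all
    then show ?thesis unfolding braid_moves_def using *(1-7) by blast
  qed
qed

lemma braid_equiv_sym: "(u, v) \<in> braid_equiv I m P \<Longrightarrow> (v, u) \<in> braid_equiv I m P"
proof -
  assume uv: "(u, v) \<in> braid_equiv I m P"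
  have "Relation.sym (braid_moves I m P)" using braid_moves_sym by (auto simp: sym_def)
  then have "Relation.sym ((braid_moves I m P)\<^sup>*)" by (rule sym_rtrancl)
  then show ?thesis using uv braid_equiv_words[OF uv] by (auto simp: braid_equiv_def sym_def)
qed

lemma equiv_braid_equiv: "equiv (lists I) (braid_equiv I m P)"
proof (rule equivI)
  show "braid_equiv I m P \<subseteq> lists I \<times> lists I"
    by (auto simp del: in_lists_conv_set dest: braid_equiv_words)
  show "refl_on (lists I) (braid_equiv I m P)" by (rule refl_onI) (rule braid_equiv_refl)
  show "Relation.sym (braid_equiv I m P)" using braid_equiv_sym by (auto simp: sym_def)
  show "Relation.trans (braid_equiv I m P)" using braid_equiv_trans by (auto simp: trans_def)
qed

lemma braid_moves_length: "(u, v) \<in> braid_moves I m P \<Longrightarrow> length u = length v"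
  unfolding braid_moves_def using m_sym[THEN arg_cong, of _ _ the_enat] by auto

lemma braid_equiv_length: "(u, v) \<in> braid_equiv I m P \<Longrightarrow> length u = length v"
  by (induction rule: braid_equiv_induct) (auto dest: braid_moves_length)

lemma monomial_relators_words: "k \<in> monomial_relators I m d \<Longrightarrow> k \<in> lists I"
  by (auto simp: monomial_relators_def in_lists_conv_set dest: braid_word_in[unfolded in_lists_conv_set])

lemma null_words_words: "u \<in> null_words I m d \<Longrightarrow> u \<in> lists I"
  unfolding null_words_def using monomial_relators_words by fastforce

lemma null_words_ctxt:
  "\<lbrakk>u \<in> null_words I m d; p \<in> lists I; q \<in> lists I\<rbrakk> \<Longrightarrow> p @ u @ q \<in> null_words I m d"
proof -
  assume u: "u \<in> null_words I m d" and pq: "p \<in> lists I" "q \<in> lists I"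
  then obtain x k y where *: "u = x @ k @ y" "x \<in> lists I" "y \<in> lists I" "k \<in> monomial_relators I m d"
    unfolding null_words_def by blast
  have "p @ u @ q = (p @ x) @ k @ (y @ q)" "p @ x \<in> lists I" "y @ q \<in> lists I" using * pq by auto
  then show ?thesis unfolding null_words_def using *(4) by blast
qed

lemma dead_words_ctxt:
  "\<lbrakk>u \<in> dead_words I m d; p \<in> lists I; q \<in> lists I\<rbrakk> \<Longrightarrow> p @ u @ q \<in> dead_words I m d"
  unfolding dead_words_def using null_words_ctxt[of _ d p q] braid_equiv_ctxt[of u _ I m _ p q] by auto

lemma dead_words_equiv:
  "(u, v) \<in> short_equiv I m \<Longrightarrow> u \<in> dead_words I m d \<Longrightarrow> v \<in> dead_words I m d"
  unfolding dead_words_def using braid_equiv_trans[OF braid_equiv_sym[of u v]] by auto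

lemma null_words_dead: "u \<in> null_words I m d \<Longrightarrow> u \<in> dead_words I m d"
  unfolding dead_words_def using null_words_words[of u d] braid_equiv_refl[of u I m] by auto

lemma dead_words_words: "u \<in> dead_words I m d \<Longrightarrow> u \<in> lists I"
  unfolding dead_words_def using braid_equiv_words by blast

lemma braid_pair_less_iff:
  assumes "a \<noteq> b"
  shows "{a, b} \<in> braid_pairs_less I m 5 \<longleftrightarrow> a \<in> I \<and> b \<in> I \<and> m a b \<noteq> \<infinity> \<and> the_enat (m a b) < 5"
    (is "?L = ?R")
proof
  assume ?L
  then show ?R unfolding braid_pairs_less_def braid_pairs_def
    by (auto simp: doubleton_eq_iff m_sym)
next
  assume ?R
  then show ?L unfolding braid_pairs_less_def braid_pairs_def using assms by fastforce
qed

lemma braid_pair_long_iff: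
  assumes "a \<noteq> b"
  shows "{a, b} \<in> braid_pairs I m - braid_pairs_less I m 5 \<longleftrightarrow>
    a \<in> I \<and> b \<in> I \<and> m a b \<noteq> \<infinity> \<and> 5 \<le> the_enat (m a b)"
proof -
  have "{a, b} \<in> braid_pairs I m \<longleftrightarrow> a \<in> I \<and> b \<in> I \<and> m a b \<noteq> \<infinity>"
    unfolding braid_pairs_def using assms by (auto simp: doubleton_eq_iff m_sym)
  then show ?thesis using braid_pair_less_iff[OF assms] by auto
qed

text \<open>
  All relations of the nil-Hecke algebra are binomial or monomial. Hence the classes of words under
  braid moves that avoid every word equivalent to a vanishing one form a basis.
\<close>

lemma nil_Hecke_monomial_ideal:
  fixes R :: "('k, 'm) ring_scheme" and d :: "'i \<Rightarrow> nat"
  assumes R: "cring R" "\<one>\<^bsub>R\<^esub> \<noteq> \<zero>\<^bsub>R\<^esub>"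
  defines "N \<equiv> Idl\<^bsub>free_algebra R I\<^esub> (nil_Hecke_relators R I m d (braid_pairs_less I m 5))"
  shows "monomial_ideal R I (short_equiv I m) (dead_words I m d) N"
proof -
  interpret cring R by fact
  interpret free_word_algebra R I ..
  let ?M = "word_monomial R"
  have rel: "nil_Hecke_relators R I m d (braid_pairs_less I m 5) =
      {?M k | k. k \<in> monomial_relators I m d} \<union>
      {?M (braid_word m a b) \<ominus>\<^bsub>F\<^esub> ?M (braid_word m b a) | a b.
        a \<noteq> b \<and> a \<in> I \<and> b \<in> I \<and> m a b \<noteq> \<infinity> \<and> the_enat (m a b) < 5}"
  proof -
    have short: "a \<noteq> b \<and> {a, b} \<in> braid_pairs_less I m 5 \<longleftrightarrow>
        a \<noteq> b \<and> a \<in> I \<and> b \<in> I \<and> m a b \<noteq> \<infinity> \<and> the_enat (m a b) < 5" for a b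
      using braid_pair_less_iff[of a b] by blast
    have long: "a \<noteq> b \<and> {a, b} \<in> braid_pairs I m - braid_pairs_less I m 5 \<longleftrightarrow>
        a \<in> I \<and> b \<in> I \<and> a \<noteq> b \<and> m a b \<noteq> \<infinity> \<and> 5 \<le> the_enat (m a b)" for a b
      using braid_pair_long_iff[of a b] by blast
    show ?thesis unfolding nil_Hecke_relators_def monomial_relators_def short long by blast
  qed
  have relF: "nil_Hecke_relators R I m d (braid_pairs_less I m 5) \<subseteq> carrier F"
    unfolding rel using monomial_relators_words by auto
  interpret N: ideal N F unfolding N_def by (rule F.genideal_ideal[OF relF])
  have relN: "nil_Hecke_relators R I m d (braid_pairs_less I m 5) \<subseteq> N"
    unfolding N_def by (rule F.genideal_self[OF relF])
  have move: "?M u \<ominus>\<^bsub>F\<^esub> ?M v \<in> N" if "(u, v) \<in> braid_moves I m (\<lambda>k. k < 5)" for u v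
  proof -
    from that obtain p q a b where *: "u = p @ braid_word m a b @ q" "v = p @ braid_word m b a @ q"
      "p \<in> lists I" "q \<in> lists I" "a \<in> I" "b \<in> I" "a \<noteq> b" "m a b \<noteq> \<infinity>" "the_enat (m a b) < 5"
      unfolding braid_moves_def by blast
    let ?x = "?M (braid_word m a b)" and ?y = "?M (braid_word m b a)"
    have xy: "?x \<in> carrier F" "?y \<in> carrier F" "?M p \<in> carrier F" "?M q \<in> carrier F"
      using * by (auto intro!: mono_closed)
    have "?x \<ominus>\<^bsub>F\<^esub> ?y \<in> N" using relN rel * by blast
    then have "?M p \<otimes>\<^bsub>F\<^esub> ((?x \<ominus>\<^bsub>F\<^esub> ?y) \<otimes>\<^bsub>F\<^esub> ?M q) \<in> N"
      using xy by (intro N.I_l_closed N.I_r_closed)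
    moreover have "?M p \<otimes>\<^bsub>F\<^esub> ((?x \<ominus>\<^bsub>F\<^esub> ?y) \<otimes>\<^bsub>F\<^esub> ?M q)
        = ?M p \<otimes>\<^bsub>F\<^esub> (?x \<otimes>\<^bsub>F\<^esub> ?M q) \<ominus>\<^bsub>F\<^esub> ?M p \<otimes>\<^bsub>F\<^esub> (?y \<otimes>\<^bsub>F\<^esub> ?M q)"
      using xy by (simp add: F.minus_eq F.l_distr F.r_distr F.l_minus F.r_minus)
    moreover have "?M p \<otimes>\<^bsub>F\<^esub> (?M w \<otimes>\<^bsub>F\<^esub> ?M q) = ?M (p @ w @ q)" if "w \<in> lists I" for w
      using that *(3,4) mono_mult[of w q] mono_mult[of p "w @ q"] by simp
    ultimately show ?thesis using * by simp
  qed
  have equiv: "?M u \<ominus>\<^bsub>F\<^esub> ?M v \<in> N" if "(u, v) \<in> short_equiv I m" for u v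
    using that
  proof (induction rule: braid_equiv_induct)
    case refl
    then have "?M u \<ominus>\<^bsub>F\<^esub> ?M u = \<zero>\<^bsub>F\<^esub>" using F.r_neg[of "?M u"] by (simp add: F.minus_eq)
    then show ?case using N.zero_closed by simp
  next
    case (step v w)
    have cl: "?M u \<in> carrier F" "?M v \<in> carrier F" "?M w \<in> carrier F"
      using braid_equiv_words[OF step(1)] braid_moves_words[OF step(2)] by auto
    have "?M u \<ominus>\<^bsub>F\<^esub> ?M w = (?M u \<ominus>\<^bsub>F\<^esub> ?M v) \<oplus>\<^bsub>F\<^esub> (?M v \<ominus>\<^bsub>F\<^esub> ?M w)"
    proof -
      have "(?M u \<ominus>\<^bsub>F\<^esub> ?M v) \<oplus>\<^bsub>F\<^esub> (?M v \<ominus>\<^bsub>F\<^esub> ?M w)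
          = ?M u \<oplus>\<^bsub>F\<^esub> ((\<ominus>\<^bsub>F\<^esub> ?M v \<oplus>\<^bsub>F\<^esub> ?M v) \<oplus>\<^bsub>F\<^esub> \<ominus>\<^bsub>F\<^esub> ?M w)"
        using cl by (simp add: F.minus_eq F.a_assoc)
      then show ?thesis using cl by (simp add: F.l_neg F.minus_eq)
    qed
    then show ?case using step(3) move[OF step(2)] N.a_closed by simp
  qed
  have null: "?M v \<in> N" if v: "v \<in> null_words I m d" for v
  proof -
    from v obtain p k q where *: "v = p @ k @ q" "p \<in> lists I" "q \<in> lists I" "k \<in> monomial_relators I m d"
      unfolding null_words_def by blast
    have k: "k \<in> lists I" by (rule monomial_relators_words[OF *(4)])
    have "?M k \<in> N" using relN rel * by blast
    then have "?M p \<otimes>\<^bsub>F\<^esub> (?M k \<otimes>\<^bsub>F\<^esub> ?M q) \<in> N"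
      using * by (intro N.I_l_closed N.I_r_closed mono_closed)
    moreover have "?M p \<otimes>\<^bsub>F\<^esub> (?M k \<otimes>\<^bsub>F\<^esub> ?M q) = ?M v"
      using k * mono_mult[of k q] mono_mult[of p "k @ q"] by simp
    ultimately show ?thesis by simp
  qed
  show ?thesis
  proof unfold_locales
    show "finite I" by (rule finite_I)
    show "\<one>\<^bsub>R\<^esub> \<noteq> \<zero>\<^bsub>R\<^esub>" by (rule R(2))
    show "equiv (lists I) (short_equiv I m)" by (rule equiv_braid_equiv)
    show "(p @ u @ q, p @ v @ q) \<in> short_equiv I m"
      if "(u, v) \<in> short_equiv I m" "p \<in> lists I" "q \<in> lists I" for u v p q
      by (rule braid_equiv_ctxt[OF that])
    show "length u = length v" if "(u, v) \<in> short_equiv I m" for u v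
      by (rule braid_equiv_length[OF that])
    show "dead_words I m d \<subseteq> lists I" using dead_words_words by blast
    show "p @ u @ q \<in> dead_words I m d"
      if "u \<in> dead_words I m d" "p \<in> lists I" "q \<in> lists I" for u p q
      by (rule dead_words_ctxt[OF that])
    show "v \<in> dead_words I m d" if "(u, v) \<in> short_equiv I m" "u \<in> dead_words I m d" for u v
      by (rule dead_words_equiv[OF that])
    show "?M u \<ominus>\<^bsub>F\<^esub> ?M v \<in> N" if "(u, v) \<in> short_equiv I m" for u v by (rule equiv[OF that])
    show "?M u \<in> N" if u: "u \<in> dead_words I m d" for u
    proof -
      from u obtain v where v: "v \<in> null_words I m d" "(u, v) \<in> short_equiv I m"
        by (auto simp: dead_words_def)
      have cl: "?M u \<in> carrier F" "?M v \<in> carrier F" using braid_equiv_words[OF v(2)] by auto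
      have "?M u = (?M u \<ominus>\<^bsub>F\<^esub> ?M v) \<oplus>\<^bsub>F\<^esub> ?M v" using cl by (simp add: F.minus_eq F.a_assoc F.l_neg)
      then show ?thesis using equiv[OF v(2)] null[OF v(1)] N.a_closed by metis
    qed
    show "N \<subseteq> K" if K: "ideal K F" "\<And>u v. (u, v) \<in> short_equiv I m \<Longrightarrow> ?M u \<ominus>\<^bsub>F\<^esub> ?M v \<in> K"
      "\<And>u. u \<in> dead_words I m d \<Longrightarrow> ?M u \<in> K" for K
      unfolding N_def
    proof (rule F.genideal_minimal[OF K(1)])
      have "?M k \<in> K" if k: "k \<in> monomial_relators I m d" for k
      proof (intro K(3) null_words_dead)
        have "k = [] @ k @ []" by simp
        then show "k \<in> null_words I m d" unfolding null_words_def using k by blast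
      qed
      moreover have "?M (braid_word m a b) \<ominus>\<^bsub>F\<^esub> ?M (braid_word m b a) \<in> K"
        if ab: "a \<noteq> b" "a \<in> I" "b \<in> I" "m a b \<noteq> \<infinity>" "the_enat (m a b) < 5" for a b
      proof (intro K(2) braid_equiv_move)
        have "braid_word m a b = [] @ braid_word m a b @ []" "braid_word m b a = [] @ braid_word m b a @ []"
          by simp_all
        then show "(braid_word m a b, braid_word m b a) \<in> braid_moves I m (\<lambda>k. k < 5)"
          unfolding braid_moves_def using ab by blast
      qed
      ultimately show "nil_Hecke_relators R I m d (braid_pairs_less I m 5) \<subseteq> K" unfolding rel by blast
    qed
  qed
qed

theorem nil_Hecke_rank:
  fixes R :: "('k, 'm) ring_scheme" and d :: "'i \<Rightarrow> nat"
  assumes R: "cring R" "\<one>\<^bsub>R\<^esub> \<noteq> \<zero>\<^bsub>R\<^esub>"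
  defines "NH \<equiv> nil_Hecke R I m d (braid_pairs_less I m 5)"
  shows "finite (alive_classes I m d) \<Longrightarrow> free_of_rank R NH (card (alive_classes I m d))"
    and "module_fin_gen R NH \<longleftrightarrow> finite (alive_classes I m d)"
proof -
  interpret M: monomial_ideal R I "short_equiv I m" "dead_words I m d"
    "Idl\<^bsub>free_algebra R I\<^esub> (nil_Hecke_relators R I m d (braid_pairs_less I m 5))"
    by (rule nil_Hecke_monomial_ideal[OF R])
  have eq: "M.live_classes = alive_classes I m d"
    by (simp add: M.live_classes_def alive_classes_def)
  show 1: "free_of_rank R NH (card (alive_classes I m d))" if "finite (alive_classes I m d)"
    using M.free_of_rank_classes that unfolding NH_def nil_Hecke_def eq by blast
  show "module_fin_gen R NH \<longleftrightarrow> finite (alive_classes I m d)"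
    using M.not_fin_gen_classes 1 free_of_rank_fin_gen unfolding NH_def nil_Hecke_def eq by blast
qed

section \<open>Counting alive classes\<close>

text \<open>
  The alive classes are the fibres of any invariant that is constant along braid moves, undefined
  on vanishing words, and admits a normal form for each of its values.
\<close>

lemma alive_classes_invariant:
  fixes st :: "'i list \<Rightarrow> 'x option"
  assumes move: "\<And>u v. (u, v) \<in> braid_moves I m (\<lambda>k. k < 5) \<Longrightarrow> st u = st v"
    and null: "\<And>u. u \<in> null_words I m d \<Longrightarrow> st u = None"
    and nf: "\<And>u x. u \<in> lists I \<Longrightarrow> st u = Some x \<Longrightarrow> (u, c x) \<in> short_equiv I m"
    and dead: "\<And>u. u \<in> lists I \<Longrightarrow> st u = None \<Longrightarrow> u \<in> dead_words I m d"
  defines "X \<equiv> {x. \<exists>u\<in>lists I. st u = Some x}"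
  shows "card (alive_classes I m d) = card X" "finite (alive_classes I m d) \<longleftrightarrow> finite X"
proof -
  have st_equiv: "st u = st v" if "(u, v) \<in> short_equiv I m" for u v
    using that by (induction rule: braid_equiv_induct) (auto dest: move)
  have alive: "u \<notin> dead_words I m d \<longleftrightarrow> st u \<noteq> None" if "u \<in> lists I" for u
    using that dead st_equiv null unfolding dead_words_def by fastforce
  have class_eq: "short_equiv I m `` {u} = {v \<in> lists I. st v = Some x}"
    if u: "u \<in> lists I" "st u = Some x" for u x
  proof (intro equalityI subsetI)
    fix v assume "v \<in> short_equiv I m `` {u}"
    then show "v \<in> {v \<in> lists I. st v = Some x}" using st_equiv[of u v] braid_equiv_words[of u v] u by auto
  next
    fix v assume v: "v \<in> {v \<in> lists I. st v = Some x}"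
    then have "(v, c x) \<in> short_equiv I m" using nf by blast
    then show "v \<in> short_equiv I m `` {u}"
      using nf[OF u] braid_equiv_sym braid_equiv_trans by blast
  qed
  have bij: "bij_betw (\<lambda>x. {v \<in> lists I. st v = Some x}) X (alive_classes I m d)"
  proof (rule bij_betw_imageI)
    show "inj_on (\<lambda>x. {v \<in> lists I. st v = Some x}) X"
    proof (rule inj_onI)
      fix x y assume "x \<in> X" and eq: "{v \<in> lists I. st v = Some x} = {v \<in> lists I. st v = Some y}"
      then obtain u where u: "u \<in> {v \<in> lists I. st v = Some x}" by (auto simp: X_def)
      then have "u \<in> {v \<in> lists I. st v = Some y}" unfolding eq .
      with u show "x = y" by simp
    qed
    show "(\<lambda>x. {v \<in> lists I. st v = Some x}) ` X = alive_classes I m d"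
    proof (intro equalityI subsetI)
      fix C assume "C \<in> (\<lambda>x. {v \<in> lists I. st v = Some x}) ` X"
      then obtain u x where u: "u \<in> lists I" "st u = Some x" "C = {v \<in> lists I. st v = Some x}"
        by (auto simp: X_def)
      then show "C \<in> alive_classes I m d"
        unfolding alive_classes_def using alive[of u] class_eq[of u x] by auto
    next
      fix C assume "C \<in> alive_classes I m d"
      then obtain u where u: "u \<in> lists I" "u \<notin> dead_words I m d" "C = short_equiv I m `` {u}"
        by (auto simp: alive_classes_def)
      then obtain x where "st u = Some x" using alive by auto
      then show "C \<in> (\<lambda>x. {v \<in> lists I. st v = Some x}) ` X"
        using u class_eq[of u x] by (auto simp: X_def)
    qed
  qed
  show "card (alive_classes I m d) = card X" by (rule bij_betw_same_card[OF bij, symmetric])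
  show "finite (alive_classes I m d) \<longleftrightarrow> finite X" using bij_betw_finite[OF bij] by blast
qed

text \<open>
  Words in one class have the same length.
\<close>

lemma infinite_alive_classes:
  assumes "\<And>n. \<exists>u\<in>lists I. n \<le> length u \<and> u \<notin> dead_words I m d"
  shows "infinite (alive_classes I m d)"
proof
  assume fin: "finite (alive_classes I m d)"
  define L where "L C = (SOME k. \<exists>u\<in>C. length u = k)" for C :: "'i list set"
  obtain n where n: "\<forall>C\<in>alive_classes I m d. L C < n"
    using finite_nat_set_iff_bounded[of "L ` alive_classes I m d"] fin by auto
  obtain u where u: "u \<in> lists I" "n \<le> length u" "u \<notin> dead_words I m d" using assms by blast
  let ?C = "short_equiv I m `` {u}"
  have "\<exists>k. \<exists>v\<in>?C. length v = k" using braid_equiv_refl[OF u(1)] by blast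
  then have "\<exists>v\<in>?C. length v = L ?C" unfolding L_def by (rule someI_ex)
  then have "L ?C = length u" using braid_equiv_length[of u] by auto
  moreover have "?C \<in> alive_classes I m d" using u by (auto simp: alive_classes_def)
  ultimately show False using n u(2) by force
qed

end

text \<open>Words act from the left, so that their last letter acts first.\<close>

fun run :: "('i \<Rightarrow> 's \<Rightarrow> 's option) \<Rightarrow> 'i list \<Rightarrow> 's \<Rightarrow> 's option" where
  "run act [] x = Some x"
| "run act (i # u) x = Option.bind (run act u x) (act i)"

lemma run_append: "run act (u @ v) x = Option.bind (run act v x) (run act u)"
  by (induction u) (auto split: Option.bind_split)

text \<open>
  A representation of the nil-Hecke algebra in which every letter maps a basis vector to a basis vector or
  to zero. It detects alive words: a word that does not act as zero is alive.
\<close>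

locale nil_action = coxeter_data I m
  for I :: "'i set" and m :: "'i \<Rightarrow> 'i \<Rightarrow> enat" +
  fixes d :: "'i \<Rightarrow> nat" and S :: "'s set" and act :: "'i \<Rightarrow> 's \<Rightarrow> 's option"
  assumes act_closed: "\<lbrakk>i \<in> I; x \<in> S; act i x = Some y\<rbrakk> \<Longrightarrow> y \<in> S"
    and act_braid: "\<lbrakk>a \<in> I; b \<in> I; a \<noteq> b; m a b \<noteq> \<infinity>; the_enat (m a b) < 5; x \<in> S\<rbrakk> \<Longrightarrow>
       run act (braid_word m a b) x = run act (braid_word m b a) x"
    and act_long: "\<lbrakk>a \<in> I; b \<in> I; a \<noteq> b; m a b \<noteq> \<infinity>; 5 \<le> the_enat (m a b); x \<in> S\<rbrakk> \<Longrightarrow>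
       run act (braid_word m a b) x = None"
    and act_nil: "\<lbrakk>i \<in> I; x \<in> S\<rbrakk> \<Longrightarrow> run act (replicate (d i) i) x = None"
begin

lemma run_closed: "\<lbrakk>u \<in> lists I; x \<in> S; run act u x = Some y\<rbrakk> \<Longrightarrow> y \<in> S"
proof (induction u arbitrary: y)
  case (Cons i u)
  then show ?case using act_closed by (auto simp: bind_eq_Some_conv)
qed simp

lemma run_move:
  assumes "(u, v) \<in> braid_moves I m (\<lambda>k. k < 5)" "x \<in> S"
  shows "run act u x = run act v x"
proof -
  from assms(1) obtain p q a b where *: "u = p @ braid_word m a b @ q" "v = p @ braid_word m b a @ q"
    "q \<in> lists I" "a \<in> I" "b \<in> I" "a \<noteq> b" "m a b \<noteq> \<infinity>" "the_enat (m a b) < 5"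
    unfolding braid_moves_def by blast
  show ?thesis
  proof (cases "run act q x")
    case (Some y)
    then have "y \<in> S" using run_closed * assms(2) by blast
    then show ?thesis using Some * act_braid[of a b y] by (simp add: run_append)
  qed (simp add: * run_append)
qed

lemma run_null:
  assumes "u \<in> null_words I m d" "x \<in> S" shows "run act u x = None"
proof -
  from assms(1) obtain p k q where *: "u = p @ k @ q" "q \<in> lists I" "k \<in> monomial_relators I m d"
    unfolding null_words_def by blast
  show ?thesis
  proof (cases "run act q x")
    case (Some y)
    then have "y \<in> S" using run_closed * assms(2) by blast
    then have "run act k y = None"
      using *(3) act_long act_nil by (auto simp: monomial_relators_def)
    then show ?thesis using Some * by (simp add: run_append)
  qed (simp add: * run_append)
qed

lemma run_dead:
  assumes "u \<in> dead_words I m d" "x \<in> S" shows "run act u x = None"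
proof -
  from assms(1) obtain v where v: "v \<in> null_words I m d" "(u, v) \<in> short_equiv I m"
    by (auto simp: dead_words_def)
  from v(2) have "run act u x = run act v x"
    by (induction rule: braid_equiv_induct) (auto dest: run_move[OF _ assms(2)])
  then show ?thesis using run_null[OF v(1) assms(2)] by simp
qed

lemma cycle_infinite:
  assumes x: "x \<in> S" and p: "p \<in> lists I" "p \<noteq> []" "run act p x = Some x"
  shows "infinite (alive_classes I m d)"
proof (rule infinite_alive_classes)
  fix n
  have run: "run act (concat (replicate n p)) x = Some x"
    by (induction n) (auto simp: run_append p(3))
  show "\<exists>u\<in>lists I. n \<le> length u \<and> u \<notin> dead_words I m d"
  proof (intro bexI conjI)
    show "concat (replicate n p) \<in> lists I" using p(1) by (induction n) auto
    have "n * 1 \<le> n * length p" using p(2) by (intro mult_le_mono2) (cases p; simp)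
    then show "n \<le> length (concat (replicate n p))" by (simp add: length_concat sum_list_replicate)
    show "concat (replicate n p) \<notin> dead_words I m d" using run run_dead[OF _ x] by fastforce
  qed
qed

end

section \<open>Alternating words\<close>

abbreviation alt :: "nat \<Rightarrow> 'i \<Rightarrow> 'i \<Rightarrow> 'i list" where "alt \<equiv> alternating_word"

lemma rev_in_lists [simp]: "rev u \<in> lists I \<longleftrightarrow> u \<in> lists I"
  by (simp add: in_lists_conv_set)

lemma alt_add: "alt (n + k) a b = alt n a b @ (if even n then alt k a b else alt k b a)"
  by (induction n arbitrary: a b) auto

lemma alt_Suc_right: "alt (Suc n) a b = alt n a b @ [if even n then a else b]"
  using alt_add[of n 1 a b] by auto

lemma rev_alt: "rev (alt n a b) = (if even n then alt n b a else alt n a b)"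
proof (induction n arbitrary: a b)
  case (Suc n)
  then show ?case using alt_Suc_right[of n b a] alt_Suc_right[of n a b] by auto
qed simp

lemma alt_double: "alt (2 * n) a b = concat (replicate n [a, b])"
  by (induction n) auto

lemma alt_split: "j + k = 2 * n \<Longrightarrow> alt (2 * n) a b = alt j a b @ rev (alt k b a)"
  using alt_add[of j k a b] by (auto simp: rev_alt) presburger+

section \<open>The numbers game and the orders of products of two generators\<close>

text \<open>
  The successive numbers that are fired if two nodes with edge weight \<open>c\<close> fire alternately, starting
  from the numbers \<open>p\<close> and \<open>q\<close>. For \<open>c = 2 cos \<theta>\<close> this is a sine wave with frequency \<open>\<theta>\<close>.
\<close>

fun fired :: "real \<Rightarrow> real \<Rightarrow> real \<Rightarrow> nat \<Rightarrow> real" where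
  "fired c p q 0 = p"
| "fired c p q (Suc 0) = c * p + q"
| "fired c p q (Suc (Suc t)) = c * fired c p q (Suc t) - fired c p q t"

lemma fired_sin:
  "sin \<theta> * fired (2 * cos \<theta>) p q t = p * sin ((real t + 1) * \<theta>) + q * sin (real t * \<theta>)"
proof (induction "2 * cos \<theta>" p q t rule: fired.induct)
  case (2 p q)
  have "sin (\<theta> * 2) = 2 * sin \<theta> * cos \<theta>" using sin_double[of \<theta>] by (simp add: mult.commute)
  then show ?case by (simp add: algebra_simps)
next
  case (3 p q t)
  have tri: "sin ((x + 1) * \<theta>) = 2 * cos \<theta> * sin (x * \<theta>) - sin ((x - 1) * \<theta>)" for x
    by (simp add: ring_distribs sin_add sin_diff)
  have "sin \<theta> * fired (2 * cos \<theta>) p q (Suc (Suc t)) =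
      2 * cos \<theta> * (sin \<theta> * fired (2 * cos \<theta>) p q (Suc t)) - sin \<theta> * fired (2 * cos \<theta>) p q t"
    by (simp add: algebra_simps)
  also have "\<dots> = p * (2 * cos \<theta> * sin ((real t + 2) * \<theta>) - sin ((real t + 2 - 1) * \<theta>)) +
      q * (2 * cos \<theta> * sin ((real t + 1) * \<theta>) - sin ((real t + 1 - 1) * \<theta>))"
    unfolding 3 by (simp add: algebra_simps)
  also have "\<dots> = p * sin ((real t + 2 + 1) * \<theta>) + q * sin ((real t + 1 + 1) * \<theta>)"
    unfolding tri by simp
  finally show ?case by (simp add: add.commute)
qed simp

lemma fired_two: "fired 2 p q t = p * (real t + 1) + q * real t"
  by (induction "2 :: real" p q t rule: fired.induct) (auto simp: algebra_simps)

lemma fired_full_turn: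
  fixes p q :: real
  assumes n: "2 \<le> n"
  defines "\<theta> \<equiv> pi / real n"
  defines "f \<equiv> fired (2 * cos \<theta>) p q"
  shows "f (t + 2 * n) = f t" "f (2 * n - 1) = - q"
    "(\<Sum>s<n. f (2 * s)) = 0" "(\<Sum>s<n. f (2 * s + 1)) = 0"
proof -
  have th: "0 < \<theta>" "\<theta> < pi" using n by (auto simp: \<theta>_def field_simps)
  have s0: "sin \<theta> > 0" using sin_gt_zero th by blast
  have turn: "real (2 * n) * \<theta> = 2 * pi" using n by (simp add: \<theta>_def)
  show per: "f (t + 2 * n) = f t" for t
  proof -
    have "(real (t + 2 * n) + 1) * \<theta> = (real t + 1) * \<theta> + 2 * pi"
      "real (t + 2 * n) * \<theta> = real t * \<theta> + 2 * pi" using turn by (simp_all add: algebra_simps)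
    then have "sin \<theta> * f (t + 2 * n) = sin \<theta> * f t" unfolding f_def fired_sin by simp
    then show ?thesis using s0 by simp
  qed
  show "f (2 * n - 1) = - q"
  proof -
    have 1: "(real (2 * n - 1) + 1) * \<theta> = 2 * pi" "real (2 * n - 1) * \<theta> = 2 * pi - \<theta>"
      using turn n by (simp_all add: of_nat_diff algebra_simps)
    have "sin \<theta> * f (2 * n - 1) = sin \<theta> * (- q)" unfolding f_def fired_sin 1 by simp
    then show ?thesis using s0 by (metis less_irrefl mult_left_cancel)
  qed
  \<comment> \<open>The sums over even and odd positions determine each other by the recursion: \<open>2 A = c B\<close> and \<open>2 B = c A\<close>.\<close>
  let ?c = "2 * cos \<theta>" and ?A = "\<Sum>s<n. f (2 * s)" and ?B = "\<Sum>s<n. f (2 * s + 1)"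
  have rec: "f (t + 2) + f t = ?c * f (t + 1)" for t by (simp add: f_def)
  have shift: "(\<Sum>s<n. g (Suc s)) = (\<Sum>s<n. g s)" if "g n = g 0" for g :: "nat \<Rightarrow> real"
    using that sum.lessThan_Suc_shift[of g n] sum.lessThan_Suc[of g n] by simp
  have sA: "(\<Sum>s<n. f (2 * s + 2)) = ?A" using shift[of "\<lambda>s. f (2 * s)"] per[of 0] by simp
  have sB: "(\<Sum>s<n. f (2 * s + 3)) = ?B"
    using shift[of "\<lambda>s. f (2 * s + 1)"] per[of 1] by (simp add: numeral_3_eq_3)
  have A: "2 * ?A = ?c * ?B"
  proof -
    have "(\<Sum>s<n. f (2 * s + 2) + f (2 * s)) = (\<Sum>s<n. ?c * f (2 * s + 1))"
      using rec[of "2 * _"] by simp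
    then show ?thesis using sA by (simp add: sum.distrib sum_distrib_left)
  qed
  have B: "2 * ?B = ?c * ?A"
  proof -
    have "f (2 * s + 3) + f (2 * s + 1) = ?c * f (2 * s + 2)" for s
      using rec[of "2 * s + 1"] by (simp add: numeral_3_eq_3)
    then have "(\<Sum>s<n. f (2 * s + 3) + f (2 * s + 1)) = (\<Sum>s<n. ?c * f (2 * s + 2))" by simp
    then show ?thesis using sA sB by (simp add: sum.distrib flip: sum_distrib_left)
  qed
  have "4 * ?A = ?c * (2 * ?B)" using A by simp
  also have "\<dots> = 4 * (cos \<theta>)\<^sup>2 * ?A" unfolding B by (simp add: power2_eq_square)
  finally have "(1 - (cos \<theta>)\<^sup>2) * ?A = 0" by (simp add: algebra_simps)
  then have "(sin \<theta>)\<^sup>2 * ?A = 0" by (simp add: sin_squared_eq)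
  then show "?A = 0" using s0 by simp
  with B show "?B = 0" by simp
qed

context coxeter_data
begin

abbreviation ceq (infix \<open>\<sim>\<close> 50) where "u \<sim> v \<equiv> (u, v) \<in> coxeter_cong I m"

lemma ceq_words: "u \<sim> v \<Longrightarrow> u \<in> lists I \<and> v \<in> lists I"
proof (induction rule: coxeter_cong.induct)
  case (relation u v i j)
  have "concat (replicate n [i, j]) \<in> lists I" for n using relation by (induction n) auto
  then show ?case using relation by simp
qed auto

lemma ceq_refl [simp]: "u \<in> lists I \<Longrightarrow> u \<sim> u" by (rule coxeter_cong.refl)
lemma ceq_sym: "u \<sim> v \<Longrightarrow> v \<sim> u" by (rule coxeter_cong.sym)
lemma ceq_trans [trans]: "u \<sim> v \<Longrightarrow> v \<sim> w \<Longrightarrow> u \<sim> w" by (rule coxeter_cong.trans)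

lemma ceq_ctxt:
  assumes "u \<sim> v" "p \<in> lists I" "q \<in> lists I" shows "p @ u @ q \<sim> p @ v @ q"
  using assms
proof (induction rule: coxeter_cong.induct)
  case (relation u v i j)
  then show ?case
    using coxeter_cong.relation[of "p @ u" I "v @ q" i j m] by simp
next
  case (refl u)
  then show ?case by (intro coxeter_cong.refl) auto
qed (auto intro: ceq_sym ceq_trans)

lemma ceq_left: "u \<sim> v \<Longrightarrow> p \<in> lists I \<Longrightarrow> p @ u \<sim> p @ v"
  using ceq_ctxt[of u v p "[]"] by simp

lemma ceq_right: "u \<sim> v \<Longrightarrow> q \<in> lists I \<Longrightarrow> u @ q \<sim> v @ q"
  using ceq_ctxt[of u v "[]" q] by simp

lemma ceq_Cons: "u \<sim> v \<Longrightarrow> i \<in> I \<Longrightarrow> i # u \<sim> i # v"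
  using ceq_left[of u v "[i]"] by simp

lemma ceq_append: "u \<sim> u' \<Longrightarrow> v \<sim> v' \<Longrightarrow> u @ v \<sim> u' @ v'"
  using ceq_left[of v v' u] ceq_right[of u u' v'] ceq_words ceq_trans by blast

lemma ceq_square: "i \<in> I \<Longrightarrow> u \<in> lists I \<Longrightarrow> i # i # u \<sim> u"
  using coxeter_cong.relation[of "[]" I u i i m] m_diag[of i] by (simp add: one_enat_def)

lemma ceq_square_mid: "i \<in> I \<Longrightarrow> p \<in> lists I \<Longrightarrow> q \<in> lists I \<Longrightarrow> p @ i # i # q \<sim> p @ q"
  using ceq_left[OF ceq_square] by blast

lemma ceq_rev_left: "u \<in> lists I \<Longrightarrow> rev u @ u \<sim> []"
proof (induction u)
  case (Cons i u)
  then have "rev u @ i # i # u \<sim> rev u @ u" by (intro ceq_square_mid) auto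
  moreover have "rev u @ u \<sim> []" using Cons by auto
  ultimately show ?case using ceq_trans[of "rev u @ i # i # u"] by simp
qed simp

lemma ceq_rev_right: "u \<in> lists I \<Longrightarrow> u @ rev u \<sim> []"
  using ceq_rev_left[of "rev u"] by simp

lemma ceq_cancel_left: "p @ u \<sim> p @ v \<Longrightarrow> u \<sim> v"
proof -
  assume h: "p @ u \<sim> p @ v"
  then have l: "p \<in> lists I" "u \<in> lists I" "v \<in> lists I" using ceq_words by fastforce+
  have e: "(rev p @ p) @ w \<sim> w" if "w \<in> lists I" for w
    using ceq_right[OF ceq_rev_left[OF l(1)] that] by simp
  have "(rev p @ p) @ u \<sim> (rev p @ p) @ v" using ceq_left[OF h, of "rev p"] l by simp
  then show ?thesis using e[OF l(2)] e[OF l(3)] ceq_sym ceq_trans by blast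
qed

lemma ceq_cancel_right: "u @ q \<sim> v @ q \<Longrightarrow> u \<sim> v"
proof -
  assume h: "u @ q \<sim> v @ q"
  then have l: "q \<in> lists I" "u \<in> lists I" "v \<in> lists I" using ceq_words by fastforce+
  have e: "w @ q @ rev q \<sim> w" if "w \<in> lists I" for w
    using ceq_left[OF ceq_rev_right[OF l(1)] that] by simp
  have "u @ q @ rev q \<sim> v @ q @ rev q" using ceq_right[OF h, of "rev q"] l by simp
  then show ?thesis using e[OF l(2)] e[OF l(3)] ceq_sym ceq_trans by blast
qed

lemma ceq_Cons_cancel: "i # u \<sim> i # v \<Longrightarrow> u \<sim> v"
  using ceq_cancel_left[of "[i]" u v] by simp

lemma alt_order: "\<lbrakk>a \<in> I; b \<in> I; m a b \<noteq> \<infinity>\<rbrakk> \<Longrightarrow> alt (2 * the_enat (m a b)) a b \<sim> []"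
  using coxeter_cong.relation[of "[]" I "[]" a b m] by (simp add: alt_double)

lemma braid_word_ceq:
  assumes "a \<in> I" "b \<in> I" "m a b \<noteq> \<infinity>" shows "braid_word m a b \<sim> braid_word m b a"
proof -
  let ?n = "the_enat (m a b)"
  have "alt ?n a b @ rev (alt ?n b a) \<sim> []"
    using alt_order[OF assms] alt_split[of ?n ?n ?n a b] by simp
  moreover have "alt ?n b a @ rev (alt ?n b a) \<sim> []" using assms by (intro ceq_rev_right) simp
  ultimately have "alt ?n a b \<sim> alt ?n b a" using ceq_cancel_right ceq_sym ceq_trans by blast
  then show ?thesis using m_sym assms by (simp add: braid_word_def)
qed

lemma braid_equiv_ceq: "(u, v) \<in> braid_equiv I m P \<Longrightarrow> u \<sim> v"
proof (induction rule: braid_equiv_induct)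
  case refl
  then show ?case by simp
next
  case (step v w)
  from step(2) obtain p q a b where "v = p @ braid_word m a b @ q" "w = p @ braid_word m b a @ q"
    "p \<in> lists I" "q \<in> lists I" "a \<in> I" "b \<in> I" "a \<noteq> b" "m a b \<noteq> \<infinity>"
    unfolding braid_moves_def by blast
  then have "v \<sim> w" using ceq_ctxt[OF braid_word_ceq] by blast
  then show ?case using step(3) ceq_trans by blast
qed

text \<open>
  The contragredient of the geometric representation: firing \<open>i\<close> negates the number at \<open>i\<close> and adds
  multiples of it to the numbers at the other nodes. It separates the powers of \<open>s\<^sub>a s\<^sub>b\<close>.
\<close>

definition weight :: "'i \<Rightarrow> 'i \<Rightarrow> real" where
  "weight i j = (if m i j = \<infinity> then 2 else 2 * cos (pi / real (the_enat (m i j))))"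

definition fire :: "'i \<Rightarrow> ('i \<Rightarrow> real) \<Rightarrow> ('i \<Rightarrow> real)" where
  "fire i x = (\<lambda>k. if k = i then - x i else if k \<in> I then x k + weight i k * x i else x k)"

definition play :: "'i list \<Rightarrow> ('i \<Rightarrow> real) \<Rightarrow> ('i \<Rightarrow> real)" where
  "play u x = foldr fire u x"

lemma play_simps: "play [] x = x" "play (i # u) x = fire i (play u x)" "play (u @ v) x = play u (play v x)"
  by (simp_all add: play_def)

lemma play_alternating:
  fixes x :: "'i \<Rightarrow> real"
  assumes ij: "i \<in> I" "j \<in> I" "i \<noteq> j"
  defines "f \<equiv> fired (weight i j) (x j) (x i)"
  shows "play (concat (replicate t [i, j])) x =
    (\<lambda>k. if k = j then f (2 * t) else if k = i then (if t = 0 then x i else - f (2 * t - 1))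
      else if k \<in> I then x k + weight j k * (\<Sum>s<t. f (2 * s)) + weight i k * (\<Sum>s<t. f (2 * s + 1))
      else x k)"
proof (induction t)
  case 0
  show ?case by (auto simp: play_simps f_def)
next
  case (Suc t)
  have w: "weight j i = weight i j" using m_sym ij by (simp add: weight_def)
  let ?y = "play (concat (replicate t [i, j])) x" and ?G = "if t = 0 then x i else - f (2 * t - 1)"
  have f1: "f (2 * t + 1) = weight i j * f (2 * t) + ?G" by (cases t) (auto simp: f_def)
  have f2: "f (2 * t + 2) = weight i j * f (2 * t + 1) - f (2 * t)" by (simp add: f_def)
  have y: "?y j = f (2 * t)" "?y i = ?G" "\<lbrakk>k \<in> I; k \<noteq> i; k \<noteq> j\<rbrakk> \<Longrightarrow> ?y k = x k +
      weight j k * (\<Sum>s<t. f (2 * s)) + weight i k * (\<Sum>s<t. f (2 * s + 1))"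
    "k \<notin> I \<Longrightarrow> ?y k = x k" for k
    using ij by (auto simp: Suc.IH)
  have z: "fire j ?y j = - f (2 * t)" "fire j ?y i = f (2 * t + 1)"
    "\<lbrakk>k \<in> I; k \<noteq> i; k \<noteq> j\<rbrakk> \<Longrightarrow> fire j ?y k = ?y k + weight j k * f (2 * t)"
    "k \<notin> I \<Longrightarrow> fire j ?y k = ?y k" for k
    using ij y(1,2) f1 w by (auto simp: fire_def)
  have "play (concat (replicate (Suc t) [i, j])) x k = fire i (fire j ?y) k" for k
    by (simp add: play_simps)
  moreover have "fire i (fire j ?y) j = f (2 * t + 2)" "fire i (fire j ?y) i = - f (2 * t + 1)"
    "\<lbrakk>k \<in> I; k \<noteq> i; k \<noteq> j\<rbrakk> \<Longrightarrow> fire i (fire j ?y) k = x k +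
      weight j k * (\<Sum>s<Suc t. f (2 * s)) + weight i k * (\<Sum>s<Suc t. f (2 * s + 1))"
    "k \<notin> I \<Longrightarrow> fire i (fire j ?y) k = x k" for k
    using ij z y(3,4) f2 unfolding fire_def[of i] by (auto simp: algebra_simps)
  ultimately show ?case using ij by (intro ext) simp
qed

lemma play_ceq: "u \<sim> v \<Longrightarrow> play u x = play v x"
proof (induction arbitrary: x rule: coxeter_cong.induct)
  case (relation u v i j)
  let ?n = "the_enat (m i j)"
  have "play (concat (replicate ?n [i, j])) x = x" for x
  proof (cases "i = j")
    case True
    then show ?thesis using m_diag relation
      by (auto simp: one_enat_def play_simps fire_def fun_eq_iff)
  next
    case False
    have n: "2 \<le> ?n" using m_ge_2[of i j] relation False by (cases "m i j") (auto simp: numeral_eq_enat)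
    have w: "weight i j = 2 * cos (pi / real ?n)"
      using relation(5) by (simp only: weight_def if_False)
    show ?thesis
      using fired_full_turn[OF n, of "x j" "x i"] fired_full_turn(1)[OF n, of "x j" "x i" 0] n False relation
      by (auto simp: play_alternating w fun_eq_iff)
  qed
  then show ?case by (simp add: play_simps)
qed auto

text \<open>
  Start with the number \<open>1\<close> at \<open>b\<close> and \<open>0\<close> elsewhere. If \<open>2 k\<close> alternating firings lead back to the
  start, then \<open>k \<theta>\<close> is a zero of the sine, where \<open>\<theta>\<close> is \<open>pi\<close> divided by the label. If the label is
  infinite, then the numbers grow linearly.
\<close>

lemma alt_order_exact:
  assumes ab: "a \<in> I" "b \<in> I" "a \<noteq> b" and k: "0 < k" "enat k < m a b"
  shows "\<not> alt (2 * k) a b \<sim> []"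
proof
  assume h: "alt (2 * k) a b \<sim> []"
  let ?x = "\<lambda>l. if l = b then 1 else 0 :: real"
  let ?f = "fired (weight a b) 1 0"
  have "play (concat (replicate k [a, b])) ?x = ?x"
    using play_ceq[OF h] by (simp add: alt_double play_simps)
  then have f: "?f (2 * k) = 1" "?f (2 * k - 1) = 0"
    using ab k play_alternating[OF ab, of k ?x] by (auto simp: fun_eq_iff dest: spec[of _ a] spec[of _ b])
  show False
  proof (cases "m a b")
    case infinity
    then show False using f(2) k by (simp add: weight_def fired_two of_nat_diff)
  next
    case (enat n)
    let ?t = "pi / real n"
    have kn: "k < n" using k enat by simp
    then have t: "0 < ?t" "?t < pi" using k by (auto simp: field_simps)
    have s0: "sin ?t > 0" using sin_gt_zero t by blast
    have w: "weight a b = 2 * cos ?t" using enat by (simp add: weight_def)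
    have "sin ?t * ?f (2 * k - 1) = sin (real (2 * k) * ?t)"
      unfolding w fired_sin using k by (simp add: of_nat_diff)
    then have 1: "sin (real (2 * k) * ?t) = 0" using f by simp
    have "sin ?t * ?f (2 * k) = sin ((real (2 * k) + 1) * ?t)" unfolding w fired_sin by simp
    then have "sin ?t = sin (real (2 * k) * ?t + ?t)" using f by (simp add: algebra_simps)
    then have "cos (real (2 * k) * ?t) = 1" using 1 s0 by (simp add: sin_add)
    moreover have "real (2 * k) * ?t = 2 * (real k * ?t)" by simp
    ultimately have "cos (2 * (real k * ?t)) = 1" by (simp only:)
    then have "sin (real k * ?t) = 0" using cos_double_sin[of "real k * ?t"] by simp
    moreover have "0 < real k * ?t" "real k * ?t < pi" using k kn by (auto simp: field_simps)
    ultimately show False using sin_gt_zero by fastforce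
  qed
qed

section \<open>Exchange condition and Matsumoto's theorem\<close>

text \<open>
  \<open>inverts u t\<close> holds if the reflection \<open>t\<close> occurs an odd number of times among
  \<open>s\<^sub>1 \<dots> s\<^sub>k \<dots> s\<^sub>1\<close>, where \<open>u = s\<^sub>1 s\<^sub>2 \<dots>\<close>. It only depends on the group element of \<open>u\<close>.
\<close>

fun inverts :: "'i list \<Rightarrow> 'i list \<Rightarrow> bool" where
  "inverts [] t \<longleftrightarrow> False"
| "inverts (i # u) t \<longleftrightarrow> (t \<sim> [i]) \<noteq> inverts u (i # t @ [i])"

lemma ceq_cong_iff: "t \<sim> t' \<Longrightarrow> t \<sim> u \<longleftrightarrow> t' \<sim> u"
  using ceq_sym ceq_trans by blast

lemma inverts_cong: "t \<sim> t' \<Longrightarrow> u \<in> lists I \<Longrightarrow> inverts u t = inverts u t'"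
proof (induction u arbitrary: t t')
  case (Cons i u)
  then have "i # t @ [i] \<sim> i # t' @ [i]" using ceq_ctxt[of t t' "[i]" "[i]"] by simp
  then have "inverts u (i # t @ [i]) = inverts u (i # t' @ [i])" using Cons by auto
  then show ?case using ceq_cong_iff[OF Cons.prems(1)] by simp
qed simp

lemma inverts_append: "inverts (u @ v) t \<longleftrightarrow> inverts u t \<noteq> inverts v (rev u @ t @ u)"
  by (induction u arbitrary: t) auto

lemma ceq_conj_iff: "i \<in> I \<Longrightarrow> t \<in> lists I \<Longrightarrow> i # t @ [i] \<sim> u \<longleftrightarrow> t \<sim> i # u @ [i]"
proof -
  assume i: "i \<in> I" and t: "t \<in> lists I"
  have *: "i # (i # w @ [i]) @ [i] \<sim> w" if "w \<in> lists I" for w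
  proof -
    have "i # i # (w @ [i, i]) \<sim> w @ [i, i]" using i that by (intro ceq_square) auto
    also have "w @ [i, i] \<sim> w" using ceq_square_mid[of i w "[]"] i that by simp
    finally show ?thesis by simp
  qed
  have c: "i # v @ [i] \<sim> i # w @ [i]" if "v \<sim> w" for v w
    using ceq_ctxt[OF that, of "[i]" "[i]"] i by simp
  show ?thesis
  proof
    assume h: "i # t @ [i] \<sim> u"
    show "t \<sim> i # u @ [i]" by (rule ceq_trans[OF ceq_sym[OF *[OF t]] c[OF h]])
  next
    assume h: "t \<sim> i # u @ [i]"
    then have "u \<in> lists I" using ceq_words[of t] by fastforce
    then show "i # t @ [i] \<sim> u" using c[OF h] * ceq_trans by blast
  qed
qed

lemma inverts_alt:
  assumes "a \<in> I" "b \<in> I" "t \<in> lists I"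
  shows "inverts (alt k a b) t \<longleftrightarrow> odd (\<Sum>s<k. of_bool (t \<sim> alt (2 * s + 1) a b) :: nat)"
  using assms
proof (induction k arbitrary: a b t)
  case (Suc k)
  have "(a # t @ [a] \<sim> alt (2 * s + 1) b a) = (t \<sim> alt (2 * Suc s + 1) a b)" for s
    using ceq_conj_iff[of a t "alt (2 * s + 1) b a"] Suc.prems alt_Suc_right[of "2 * s + 2" a b] by simp
  then have "inverts (alt k b a) (a # t @ [a]) \<longleftrightarrow>
      odd (\<Sum>s<k. of_bool (t \<sim> alt (2 * Suc s + 1) a b) :: nat)"
    using Suc.IH[of b a "a # t @ [a]"] Suc.prems by simp
  then show ?case
    unfolding sum.lessThan_Suc_shift by auto
qed simp

text \<open>
  Going once around the relation, every reflection of the dihedral subgroup is met twice.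
\<close>

lemma inverts_relation:
  assumes "a \<in> I" "b \<in> I" "m a b \<noteq> \<infinity>" "t \<in> lists I"
  shows "\<not> inverts (alt (2 * the_enat (m a b)) a b) t"
proof -
  let ?n = "the_enat (m a b)" and ?P = "\<lambda>s. of_bool (t \<sim> alt (2 * s + 1) a b) :: nat"
  have "?P (?n + s) = ?P s" for s
  proof -
    have "alt (2 * (?n + s) + 1) a b = alt (2 * ?n) a b @ alt (2 * s + 1) a b"
      using alt_add[of "2 * ?n" "2 * s + 1" a b] by (simp add: add_mult_distrib2 add.assoc)
    then have "alt (2 * (?n + s) + 1) a b \<sim> alt (2 * s + 1) a b"
      using ceq_right[OF alt_order[OF assms(1-3)], of "alt (2 * s + 1) a b"]
        alternating_word_in[OF assms(1,2)] by (metis append_Nil)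
    then have "(t \<sim> alt (2 * (?n + s) + 1) a b) = (t \<sim> alt (2 * s + 1) a b)"
      using ceq_trans[OF _ ceq_sym] ceq_trans by blast
    then show ?thesis by simp
  qed
  moreover have "(\<Sum>s<2 * ?n. ?P s) = (\<Sum>s<?n. ?P s) + (\<Sum>s<?n. ?P (?n + s))"
    using sum.nat_group[of ?P ?n 2] sum.atLeastLessThan_concat[of 0 ?n "2 * ?n" ?P]
      sum.shift_bounds_nat_ivl[of ?P 0 ?n ?n] by (simp add: lessThan_atLeast0 mult_2 add.commute)
  ultimately have "even (\<Sum>s<2 * ?n. ?P s)" by simp
  then show ?thesis using inverts_alt[OF assms(1,2,4)] by blast
qed

lemma inverts_ceq: "u \<sim> v \<Longrightarrow> t \<in> lists I \<Longrightarrow> inverts u t = inverts v t"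
proof (induction arbitrary: t rule: coxeter_cong.induct)
  case (relation u v i j)
  let ?r = "concat (replicate (the_enat (m i j)) [i, j])"
  have r: "?r = alt (2 * the_enat (m i j)) i j" by (simp add: alt_double)
  have rI: "?r \<in> lists I" unfolding r using relation by (intro alternating_word_in)
  let ?t = "rev u @ t @ u"
  have t: "?t \<in> lists I" using relation by auto
  have e: "?r \<sim> []" unfolding r using relation by (intro alt_order)
  have e': "rev ?r \<sim> []"
    using ceq_trans[OF ceq_sym[OF ceq_right[OF e, of "rev ?r"]] ceq_rev_right[OF rI]] rI by simp
  have "rev ?r @ ?t @ ?r \<sim> [] @ ?t @ []" using e e' t by (intro ceq_append) auto
  then have "inverts v (rev ?r @ ?t @ ?r) = inverts v ?t" using inverts_cong relation by simp
  moreover have "\<not> inverts ?r ?t" unfolding r using relation t by (intro inverts_relation)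
  ultimately show ?case by (simp add: inverts_append)
qed auto

text \<open>
  A reflection that is inverted equals some \<open>s\<^sub>1 \<dots> s\<^sub>k \<dots> s\<^sub>1\<close>, and multiplying \<open>u\<close> by it cancels
  the letter \<open>s\<^sub>k\<close>.
\<close>

lemma inverts_exchange:
  assumes "inverts u t" "u \<in> lists I" "t \<in> lists I"
  shows "\<exists>p j q. u = p @ j # q \<and> t @ u \<sim> p @ q"
  using assms
proof (induction u arbitrary: t)
  case (Cons i u)
  have i: "i \<in> I" "u \<in> lists I" using Cons.prems by auto
  show ?case
  proof (cases "t \<sim> [i]")
    case True
    then have "t @ i # u \<sim> [i] @ i # u" using Cons.prems by (intro ceq_right) auto
    then have "t @ i # u \<sim> u" using ceq_square[OF i] ceq_trans by simp
    then show ?thesis by (intro exI[of _ "[]"]) auto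
  next
    case False
    then have "inverts u (i # t @ [i])" using Cons.prems by simp
    then obtain p j q where *: "u = p @ j # q" "(i # t @ [i]) @ u \<sim> p @ q"
      using Cons.IH[of "i # t @ [i]"] Cons.prems by auto
    have 1: "i # (i # t @ [i]) @ u \<sim> i # p @ q" using * i by (intro ceq_Cons)
    have 2: "i # i # (t @ i # u) \<sim> t @ i # u" using i Cons.prems by (intro ceq_square) auto
    have "t @ i # u \<sim> (i # p) @ q" using ceq_trans[OF ceq_sym[OF 2]] 1 by simp
    then show ?thesis using * by (intro exI[of _ "i # p"]) auto
  qed
qed simp

lemma ceq_parity: "u \<sim> v \<Longrightarrow> even (length u) = even (length v)"
proof (induction rule: coxeter_cong.induct)
  case (relation u v i j)
  have "length (concat (replicate n [i, j])) = 2 * n" for n by (induction n) auto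
  then show ?case by simp
qed auto

definition reduced :: "'i list \<Rightarrow> bool" where
  "reduced u \<longleftrightarrow> u \<in> lists I \<and> (\<forall>v. u \<sim> v \<longrightarrow> length u \<le> length v)"

lemma reduced_words: "reduced u \<Longrightarrow> u \<in> lists I" by (simp add: reduced_def)

lemma reducedD: "reduced u \<Longrightarrow> u \<sim> v \<Longrightarrow> length u \<le> length v" by (simp add: reduced_def)

lemma reduced_ceq: "reduced u \<Longrightarrow> u \<sim> v \<Longrightarrow> length v \<le> length u \<Longrightarrow> reduced v"
  unfolding reduced_def using ceq_trans ceq_words by (meson le_trans)

lemma ex_reduced: "u \<in> lists I \<Longrightarrow> \<exists>v. u \<sim> v \<and> reduced v"
proof -
  assume u: "u \<in> lists I"
  obtain v where v: "u \<sim> v" "\<forall>w. u \<sim> w \<longrightarrow> length v \<le> length w"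
    using ex_has_least_nat[of "\<lambda>v. u \<sim> v" u length] u by auto
  then show ?thesis unfolding reduced_def using ceq_trans ceq_words by blast
qed

lemma reduced_Cons: "reduced (i # u) \<Longrightarrow> reduced u"
  unfolding reduced_def using ceq_Cons[of u _ i] by fastforce

text \<open>
  If \<open>i\<close> is not inverted by \<open>u\<close>, then it is inverted by a reduced word for \<open>i # u\<close>, which is shorter
  than \<open>u\<close> by parity. Deleting a letter from that word would give an even shorter word for \<open>u\<close>.
\<close>

lemma exchange:
  assumes u: "reduced u" and i: "i \<in> I" and n: "\<not> reduced (i # u)"
  shows "\<exists>p j q. u = p @ j # q \<and> i # u \<sim> p @ q"
proof (cases "inverts u [i]")
  case True
  then show ?thesis using inverts_exchange[of u "[i]"] u i by (simp add: reduced_words)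
next
  case False
  have uI: "u \<in> lists I" using u by (rule reduced_words)
  obtain v where v: "i # u \<sim> v" "reduced v" using ex_reduced[of "i # u"] uI i by auto
  have "\<not> length (i # u) \<le> length v" using n v(2) reduced_ceq[OF v(2) ceq_sym[OF v(1)]] by blast
  moreover have "even (length (i # u)) = even (length v)" by (rule ceq_parity[OF v(1)])
  ultimately have len: "length v < length u" by (cases "length u = length v") auto
  have "inverts v [i] = inverts (i # u) [i]"
    by (rule inverts_ceq[OF v(1), symmetric]) (use i in simp)
  also have "\<dots> = (\<not> inverts u ([i] @ [i] @ [i]))" using i by simp
  also have "\<dots> = (\<not> inverts u [i])"
    using inverts_cong[of "[i] @ [i] @ [i]" "[i]" u] ceq_square[of i "[i]"] i uI by simp
  finally have "inverts v [i]" using False by simp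
  then obtain p j q where *: "v = p @ j # q" "i # v \<sim> p @ q"
    using inverts_exchange[of v "[i]"] i reduced_words[OF v(2)] by auto
  have "i # i # u \<sim> p @ q" using ceq_Cons[OF v(1) i] *(2) ceq_trans by blast
  then have "u \<sim> p @ q" using ceq_square[OF i uI] ceq_sym ceq_trans by blast
  then have "length u \<le> length (p @ q)" by (rule reducedD[OF u])
  then show ?thesis using * len by simp
qed

text \<open>
  The exchange condition deletes a letter to make room for \<open>a\<close> in front. Deleting it inside the
  alternating prefix would shorten the word or contradict the order of \<open>s\<^sub>a s\<^sub>b\<close>, so the prefix
  grows. In this way an element with reduced words starting with \<open>a\<close> and with \<open>b\<close> gets reduced words
  starting with both sides of the braid relation.
\<close>

lemma extend_alternating:
  assumes ab: "a \<in> I" "b \<in> I" "a \<noteq> b"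
    and w: "reduced (alt k b a @ z)" and k: "0 < k" "enat k < m a b"
    and desc: "\<not> reduced (a # alt k b a @ z)"
  shows "\<exists>z'. reduced (alt (Suc k) a b @ z') \<and> alt (Suc k) a b @ z' \<sim> alt k b a @ z"
proof -
  let ?w = "alt k b a @ z"
  have wI: "?w \<in> lists I" by (rule reduced_words[OF w])
  obtain p j q where *: "?w = p @ j # q" "a # ?w \<sim> p @ q" using exchange[OF w ab(1) desc] by blast
  have pq: "p \<in> lists I" "q \<in> lists I" "j \<in> I" using wI * by auto
  have "a # a # ?w \<sim> a # p @ q" by (rule ceq_Cons[OF *(2) ab(1)])
  then have apq: "?w \<sim> a # p @ q" using ceq_square[OF ab(1) wI] ceq_sym ceq_trans by blast
  have len: "length (a # p @ q) = length ?w" using *(1) by simp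
  have red: "reduced (a # p @ q)" using reduced_ceq[OF w apq] len by simp
  show ?thesis
  proof (cases "k \<le> length p")
    case True
    then obtain p' where p': "p = alt k b a @ p'"
      using *(1) by (metis append_eq_append_conv_if append_take_drop_id length_alternating_word)
    then have "a # p @ q = alt (Suc k) a b @ (p' @ q)" by simp
    then show ?thesis using red apq ceq_sym by (intro exI[of _ "p' @ q"]) simp
  next
    \<comment> \<open>The deleted letter lies inside the alternating prefix.\<close>
    case False
    define s where "s = length p"
    obtain r where r: "k = s + Suc r" using False by (metis less_iff_Suc_add not_le s_def add_Suc_right)
    define x where "x = (if even s then b else a)"
    define y where "y = (if even s then a else b)"
    have xy: "alt k b a = alt s b a @ x # alt r y x"
      unfolding r alt_add by (auto simp: x_def y_def)
    then have eq: "alt s b a @ x # alt r y x @ z = p @ j # q" using *(1) by simp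
    then have p: "p = alt s b a" "q = alt r y x @ z"
      by (auto simp: append_eq_append_conv s_def)
    have asy: "a # alt s b a = alt s a b @ [y]" using alt_Suc_right[of s a b] by (simp add: y_def)
    show ?thesis
    proof (cases r)
      case 0
      have "(a # alt k b a) @ z \<sim> alt s b a @ z" using *(2) p 0 by simp
      then have "alt (Suc k) a b \<sim> alt s b a" using ceq_cancel_right by fastforce
      then have "alt (Suc k) a b @ rev (alt s b a) \<sim> alt s b a @ rev (alt s b a)"
        using ab by (intro ceq_right) auto
      moreover have "alt s b a @ rev (alt s b a) \<sim> []" using ab by (intro ceq_rev_right) auto
      moreover have "alt (2 * k) a b = alt (Suc k) a b @ rev (alt s b a)"
        using r 0 by (intro alt_split) simp
      ultimately have "alt (2 * k) a b \<sim> []" using ceq_trans by metis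
      then show ?thesis using alt_order_exact[OF ab k] by blast
    next
      case (Suc r')
      have "a # p @ q = alt s a b @ y # y # (alt r' x y @ z)" using p asy Suc by simp
      moreover have "alt s a b @ y # y # (alt r' x y @ z) \<sim> alt s a b @ (alt r' x y @ z)"
        using ab wI by (intro ceq_square_mid) (auto simp: x_def y_def)
      ultimately have "length (a # p @ q) \<le> length (alt s a b @ (alt r' x y @ z))"
        using reducedD[OF red] by metis
      moreover have "length (a # p @ q) = s + 2 + r' + length z" using p Suc by simp
      ultimately show ?thesis by simp
    qed
  qed
qed

text \<open>
  Induction on the length. Words with the same first letter are handled by cancelling it. If the first
  letters \<open>a\<close> and \<open>b\<close> differ, then the element also has reduced words that start with the two sides of
  the braid relation of \<open>a\<close> and \<open>b\<close>. One braid move connects them, and each of them shares its first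
  letter with one of the given words. For an infinite label the alternating prefixes would outgrow the
  words.
\<close>

theorem Matsumoto:
  assumes "reduced u" "reduced v" "u \<sim> v"
  shows "(u, v) \<in> braid_equiv I m (\<lambda>_. True)"
  using assms
proof (induction "length u" arbitrary: u v rule: less_induct)
  case less
  have len: "length v = length u"
    using reducedD[OF less.prems(1,3)] reducedD[OF less.prems(2) ceq_sym[OF less.prems(3)]] by simp
  have same: "(c # x, c # y) \<in> braid_equiv I m (\<lambda>_. True)"
    if "reduced (c # x)" "reduced (c # y)" "c # x \<sim> c # y" "length (c # x) = length u" for c x y
  proof -
    have "(x, y) \<in> braid_equiv I m (\<lambda>_. True)"
      using that by (intro less.hyps) (auto intro: reduced_Cons ceq_Cons_cancel)
    then show ?thesis using braid_equiv_ctxt[of x y I m _ "[c]" "[]"] reduced_words[OF that(1)] by simp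
  qed
  show ?case
  proof (cases u)
    case Nil
    then show ?thesis using len braid_equiv_refl by fastforce
  next
    case (Cons a u')
    then obtain b v' where v: "v = b # v'" using len by (cases v) auto
    have ab: "a \<in> I" "b \<in> I" using less.prems Cons v by (auto dest: reduced_words)
    have descent: "\<not> reduced (c # w)" if "w \<sim> c # x" "c # x \<sim> u" "length (c # x) = length u"
      "length w = length u" "c \<in> I" for c w x
    proof
      assume red: "reduced (c # w)"
      have "c # w \<sim> c # c # x" using that ceq_Cons by blast
      moreover have "x \<in> lists I" using ceq_words[OF that(1)] by simp
      ultimately have "c # w \<sim> x" using ceq_square[of c x] that(5) ceq_trans by blast
      then show False using reducedD[OF red] that by fastforce
    qed
    show ?thesis
    proof (cases "a = b")
      case True
      then show ?thesis using same[of a u' v'] less.prems Cons v by simp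
    next
      case False
      have starts: "\<exists>z. reduced (alt k a b @ z) \<and> alt k a b @ z \<sim> u"
        "\<exists>z. reduced (alt k b a @ z) \<and> alt k b a @ z \<sim> u" if "0 < k" "enat k \<le> m a b" for k
        using that
      proof (induction k)
        case (Suc k)
        {
          case 1
          show ?case
          proof (cases "k = 0")
            case True
            then show ?thesis using less.prems Cons reduced_words[OF less.prems(1)] by (intro exI[of _ u']) simp
          next
            case False
            then have k: "0 < k" "enat k < m a b" using 1 by (auto simp: Suc_ile_eq)
            then obtain z where z: "reduced (alt k b a @ z)" "alt k b a @ z \<sim> u"
              using Suc.IH(2) by fastforce
            have l: "length (alt k b a @ z) = length u"
              using reducedD[OF z] reducedD[OF less.prems(1) ceq_sym[OF z(2)]] by simp
            have "\<not> reduced (a # alt k b a @ z)"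
              using descent[of "alt k b a @ z" a u'] z l Cons ab
                ceq_refl[OF reduced_words[OF less.prems(1)]] by auto
            from extend_alternating[OF ab \<open>a \<noteq> b\<close> z(1) k this] show ?thesis
              using z(2) ceq_trans by blast
          qed
        next
          case 2
          show ?case
          proof (cases "k = 0")
            case True
            then show ?thesis using less.prems v ceq_sym by (intro exI[of _ v']) auto
          next
            case False
            then have k: "0 < k" "enat k < m a b" using 2 by (auto simp: Suc_ile_eq)
            then obtain z where z: "reduced (alt k a b @ z)" "alt k a b @ z \<sim> u"
              using Suc.IH(1) by fastforce
            have l: "length (alt k a b @ z) = length u"
              using reducedD[OF z] reducedD[OF less.prems(1) ceq_sym[OF z(2)]] by simp
            have vu: "v \<sim> u" by (rule ceq_sym[OF less.prems(3)])
            have "\<not> reduced (b # alt k a b @ z)"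
              using descent[of "alt k a b @ z" b v'] ceq_trans[OF z(2) less.prems(3)] vu l len v ab by auto
            from extend_alternating[OF ab(2,1) \<open>a \<noteq> b\<close>[symmetric] z(1) k(1) _ this] k(2) show ?thesis
              using z(2) ceq_trans m_sym[OF ab] by metis
          qed
        }
      qed simp_all
      show ?thesis
      proof (cases "m a b")
        case infinity
        then obtain z where z: "reduced (alt (Suc (length u)) a b @ z)" "alt (Suc (length u)) a b @ z \<sim> u"
          using starts(1)[of "Suc (length u)"] by auto
        then have "length (alt (Suc (length u)) a b @ z) \<le> length u" by (rule reducedD)
        then show ?thesis by simp
      next
        case (enat n)
        have fin: "m a b \<noteq> \<infinity>" using enat by simp
        have n: "0 < n" using m_ge_2[OF ab False] enat by (cases n) (auto simp: zero_enat_def)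
        obtain z where z: "reduced (alt n a b @ z)" "alt n a b @ z \<sim> u" using starts(1)[of n] n enat by auto
        obtain n' where n': "n = Suc n'" using n by (cases n) auto
        have l: "length (alt n a b @ z) = length u"
          using reducedD[OF z] reducedD[OF less.prems(1) ceq_sym[OF z(2)]] by simp
        have zI: "z \<in> lists I" using reduced_words[OF z(1)] by simp
        have bw: "braid_word m a b = alt n a b" "braid_word m b a = alt n b a"
          using enat m_sym[OF ab] by (simp_all add: braid_word_def)
        have mv: "(alt n a b @ z, alt n b a @ z) \<in> braid_moves I m (\<lambda>_. True)"
          using braid_movesI[of "[]" I z a b m "\<lambda>_. True"] zI ab False fin by (simp add: bw)
        have zz: "alt n a b @ z \<sim> alt n b a @ z" by (rule braid_equiv_ceq[OF braid_equiv_move[OF mv]])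
        have "(u, alt n a b @ z) \<in> braid_equiv I m (\<lambda>_. True)"
          using same[of a u' "alt n' b a @ z"] z l Cons n' less.prems ceq_sym[OF z(2)] by simp
        moreover have "(alt n b a @ z, v) \<in> braid_equiv I m (\<lambda>_. True)"
          using same[of b "alt n' a b @ z" v'] reduced_ceq[OF z(1) zz] l n' v less.prems
            ceq_trans[OF ceq_sym[OF zz] ceq_trans[OF z(2) less.prems(3)]] by simp
        ultimately show ?thesis using braid_equiv_move[OF mv] braid_equiv_trans by blast
      qed
    qed
  qed
qed

text \<open>
  If \<open>i # u\<close> is not reduced but \<open>u\<close> is, then \<open>u\<close> has a reduced word that starts with \<open>i\<close>, and
  Matsumoto's theorem reaches it by braid moves.
\<close>

theorem nonreduced_braid_square:
  assumes "u \<in> lists I" "\<not> reduced u"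
  shows "\<exists>p i q. (u, p @ [i, i] @ q) \<in> braid_equiv I m (\<lambda>_. True)"
  using assms
proof (induction u rule: list.induct)
  case Nil
  then show ?case by (auto simp: reduced_def)
next
  case (Cons i u)
  have i: "i \<in> I" "u \<in> lists I" using Cons.prems by auto
  show ?case
  proof (cases "reduced u")
    case False
    then obtain p j q where "(u, p @ [j, j] @ q) \<in> braid_equiv I m (\<lambda>_. True)" using Cons.IH i by blast
    then have "([i] @ u @ [], [i] @ (p @ [j, j] @ q) @ []) \<in> braid_equiv I m (\<lambda>_. True)"
      using i by (intro braid_equiv_ctxt) auto
    then show ?thesis by (intro exI[of _ "i # p"]) auto
  next
    case True
    obtain p j q where *: "u = p @ j # q" "i # u \<sim> p @ q"
      using exchange[OF True i(1) Cons.prems(2)] by blast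
    have "i # i # u \<sim> i # p @ q" by (rule ceq_Cons[OF *(2) i(1)])
    then have uq: "u \<sim> i # p @ q" using ceq_square[OF i] ceq_sym ceq_trans by blast
    have "reduced (i # p @ q)" using reduced_ceq[OF True uq] * by simp
    then have "(u, i # p @ q) \<in> braid_equiv I m (\<lambda>_. True)" using Matsumoto True uq by blast
    then have "([i] @ u @ [], [i] @ (i # p @ q) @ []) \<in> braid_equiv I m (\<lambda>_. True)"
      using i by (intro braid_equiv_ctxt) auto
    then show ?thesis by (intro exI[of _ "[]"]) auto
  qed
qed

end

section \<open>Alive classes and the Coxeter group\<close>

context coxeter_data
begin

lemma class_eq_iff: "\<lbrakk>u \<in> lists I; v \<in> lists I\<rbrakk> \<Longrightarrow>
    coxeter_cong I m `` {u} = coxeter_cong I m `` {v} \<longleftrightarrow> u \<sim> v"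
proof
  assume v: "v \<in> lists I" and eq: "coxeter_cong I m `` {u} = coxeter_cong I m `` {v}"
  have "v \<in> coxeter_cong I m `` {v}" using v by simp
  then show "u \<sim> v" unfolding eq[symmetric] by simp
next
  assume uv: "u \<sim> v"
  show "coxeter_cong I m `` {u} = coxeter_cong I m `` {v}"
    using ceq_trans[OF uv] ceq_trans[OF ceq_sym[OF uv]] by auto
qed

lemma carrier_coxeter_group:
  "carrier (coxeter_group I m) = {coxeter_cong I m `` {u} | u. u \<in> lists I}"
  by (auto simp: coxeter_group_def quotient_def)

lemma not_reduced_square: "\<lbrakk>i \<in> I; p \<in> lists I; q \<in> lists I\<rbrakk> \<Longrightarrow> \<not> reduced (p @ [i, i] @ q)"
proof
  assume *: "i \<in> I" "p \<in> lists I" "q \<in> lists I" "reduced (p @ [i, i] @ q)"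
  have "p @ [i, i] @ q \<sim> p @ q" using ceq_square_mid[OF *(1-3)] by simp
  then have "length (p @ [i, i] @ q) \<le> length (p @ q)" by (rule reducedD[OF *(4)])
  then show False by simp
qed

lemma null_words_square:
  "\<lbrakk>i \<in> I; p \<in> lists I; q \<in> lists I; d i = 2\<rbrakk> \<Longrightarrow> p @ [i, i] @ q \<in> null_words I m d"
proof -
  assume *: "i \<in> I" "p \<in> lists I" "q \<in> lists I" "d i = 2"
  have "replicate (d i) i = [i, i]" using *(4) by (simp add: numeral_2_eq_2)
  then have "[i, i] \<in> monomial_relators I m d" unfolding monomial_relators_def using *(1) by force
  then show ?thesis unfolding null_words_def using *(2,3) by blast
qed

text \<open>
  Without long braid relations and with all squares zero, the alive words are the reduced ones, and
  Matsumoto's theorem identifies their classes with the elements of the group.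
\<close>

theorem alive_classes_coxeter_group:
  assumes d2: "\<forall>i\<in>I. d i = 2"
    and short: "\<forall>a\<in>I. \<forall>b\<in>I. a \<noteq> b \<longrightarrow> m a b \<noteq> \<infinity> \<longrightarrow> the_enat (m a b) < 5"
  shows "card (alive_classes I m d) = order (coxeter_group I m)"
    "finite (alive_classes I m d) \<longleftrightarrow> finite (carrier (coxeter_group I m))"
proof -
  define st where "st u = (if reduced u then Some (coxeter_cong I m `` {u}) else None)" for u
  define c where "c C = (SOME u. u \<in> C \<and> reduced u)" for C
  have moves: "braid_moves I m (\<lambda>_. True) = braid_moves I m (\<lambda>k. k < 5)"
    unfolding braid_moves_def using short by blast
  have equiv: "braid_equiv I m (\<lambda>_. True) = short_equiv I m"
    unfolding braid_equiv_def moves ..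
  have move: "st u = st v" if "(u, v) \<in> braid_moves I m (\<lambda>k. k < 5)" for u v
  proof -
    have uv: "u \<sim> v" using that braid_equiv_move braid_equiv_ceq by blast
    have len: "length u = length v" using that by (rule braid_moves_length)
    have "reduced u \<longleftrightarrow> reduced v"
      using reduced_ceq[of u v] reduced_ceq[of v u] uv ceq_sym[OF uv] len by auto
    moreover have "coxeter_cong I m `` {u} = coxeter_cong I m `` {v}"
      using class_eq_iff[of u v] ceq_words[OF uv] uv by blast
    ultimately show ?thesis by (simp add: st_def)
  qed
  have null: "st u = None" if u: "u \<in> null_words I m d" for u
  proof -
    from u obtain p k q where *: "u = p @ k @ q" "p \<in> lists I" "q \<in> lists I" "k \<in> monomial_relators I m d"
      unfolding null_words_def by blast
    from *(4) obtain i where "i \<in> I" "k = replicate (d i) i"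
      unfolding monomial_relators_def using short by fastforce
    then have "i \<in> I" "k = [i, i]" using d2 by (auto simp: numeral_2_eq_2)
    then show ?thesis using not_reduced_square * by (simp add: st_def)
  qed
  have nf: "(u, c x) \<in> short_equiv I m" if u: "u \<in> lists I" "st u = Some x" for u x
  proof -
    have r: "reduced u" "x = coxeter_cong I m `` {u}" using u by (auto simp: st_def split: if_splits)
    have "u \<in> x \<and> reduced u" using r u by simp
    then have "c x \<in> x \<and> reduced (c x)" unfolding c_def by (rule someI)
    then show ?thesis using Matsumoto[of u "c x"] r unfolding equiv by simp
  qed
  have dead: "u \<in> dead_words I m d" if u: "u \<in> lists I" "st u = None" for u
  proof -
    have "\<not> reduced u" using u by (auto simp: st_def)
    then obtain p i q where *: "(u, p @ [i, i] @ q) \<in> short_equiv I m"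
      using nonreduced_braid_square[OF u(1)] unfolding equiv by blast
    have "i \<in> I" "p \<in> lists I" "q \<in> lists I" using braid_equiv_words[OF *] by auto
    then have "p @ [i, i] @ q \<in> null_words I m d" using null_words_square d2 by blast
    then show ?thesis unfolding dead_words_def using * by blast
  qed
  have X: "{x. \<exists>u\<in>lists I. st u = Some x} = carrier (coxeter_group I m)"
  proof (intro equalityI subsetI)
    fix x assume "x \<in> {x. \<exists>u\<in>lists I. st u = Some x}"
    then show "x \<in> carrier (coxeter_group I m)"
      unfolding carrier_coxeter_group by (auto simp: st_def split: if_splits)
  next
    fix x assume "x \<in> carrier (coxeter_group I m)"
    then obtain u where u: "u \<in> lists I" "x = coxeter_cong I m `` {u}"
      unfolding carrier_coxeter_group by blast
    obtain v where v: "u \<sim> v" "reduced v" using ex_reduced[OF u(1)] by blast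
    then have "st v = Some x" "v \<in> lists I"
      using u class_eq_iff[of u v] reduced_words[OF v(2)] by (auto simp: st_def)
    then show "x \<in> {x. \<exists>u\<in>lists I. st u = Some x}" by blast
  qed
  note inv = alive_classes_invariant[of st d c, OF move null nf dead, unfolded X]
  show "card (alive_classes I m d) = order (coxeter_group I m)" unfolding order_def by (rule inv(1))
  show "finite (alive_classes I m d) \<longleftrightarrow> finite (carrier (coxeter_group I m))" by (rule inv(2))
qed

text \<open>
  With long braid relations the first long braid move met on the way from a word to a word with a
  square exhibits a vanishing factor.
\<close>

theorem finite_group_finite_alive:
  assumes d2: "\<forall>i\<in>I. d i = 2" and fin: "finite (carrier (coxeter_group I m))"
  shows "finite (alive_classes I m d)"
proof -
  have step: "(u, v) \<in> short_equiv I m"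
    if "(u, v) \<in> braid_equiv I m (\<lambda>_. True)" "u \<notin> dead_words I m d" for u v
    using that
  proof (induction rule: braid_equiv_induct)
    case refl
    then show ?case by (simp add: braid_equiv_refl)
  next
    case (step v w)
    have uv: "(u, v) \<in> short_equiv I m" using step by blast
    from step(2) obtain p q a b where *: "v = p @ braid_word m a b @ q" "w = p @ braid_word m b a @ q"
      "p \<in> lists I" "q \<in> lists I" "a \<in> I" "b \<in> I" "a \<noteq> b" "m a b \<noteq> \<infinity>"
      unfolding braid_moves_def by blast
    have "the_enat (m a b) < 5"
    proof (rule ccontr)
      assume "\<not> the_enat (m a b) < 5"
      then have "braid_word m a b \<in> monomial_relators I m d"
        unfolding monomial_relators_def using * by fastforce
      then have "v \<in> null_words I m d" unfolding null_words_def *(1) using *(3,4) by blast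
      then have "u \<in> dead_words I m d" using uv unfolding dead_words_def by blast
      then show False using step.prems by blast
    qed
    then have "(v, w) \<in> braid_moves I m (\<lambda>k. k < 5)" unfolding *(1,2) using * by (intro braid_movesI)
    then show ?case by (intro braid_equiv_trans[OF uv] braid_equiv_move)
  qed
  have alive_reduced: "reduced u" if u: "u \<in> lists I" "u \<notin> dead_words I m d" for u
  proof (rule ccontr)
    assume "\<not> reduced u"
    then obtain p i q where "(u, p @ [i, i] @ q) \<in> braid_equiv I m (\<lambda>_. True)"
      using nonreduced_braid_square[OF u(1)] by blast
    then have *: "(u, p @ [i, i] @ q) \<in> short_equiv I m" using step u by blast
    have "i \<in> I" "p \<in> lists I" "q \<in> lists I" using braid_equiv_words[OF *] by auto
    then have "p @ [i, i] @ q \<in> null_words I m d" using null_words_square d2 by blast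
    then show False using u(2) * unfolding dead_words_def by blast
  qed
  have "finite {u. reduced u \<and> coxeter_cong I m `` {u} = C}" for C
  proof (cases "\<exists>u. reduced u \<and> coxeter_cong I m `` {u} = C")
    case True
    then obtain u where u: "reduced u" "coxeter_cong I m `` {u} = C" by blast
    have "length v = length u \<and> set v \<subseteq> I" if v: "reduced v" "coxeter_cong I m `` {v} = C" for v
    proof -
      have "v \<sim> u" using class_eq_iff[of v u] u v reduced_words by auto
      then show ?thesis
        using reducedD[OF v(1), of u] reducedD[OF u(1), of v] ceq_sym reduced_words[OF v(1)] by force
    qed
    then have "{u. reduced u \<and> coxeter_cong I m `` {u} = C} \<subseteq> {v. set v \<subseteq> I \<and> length v = length u}"
      by auto
    then show ?thesis using finite_lists_length_eq[OF finite_I] finite_subset by blast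
  next
    case False
    then have "{u. reduced u \<and> coxeter_cong I m `` {u} = C} = {}" by blast
    then show ?thesis by (simp only: finite.emptyI)
  qed
  then have "finite (\<Union>C\<in>carrier (coxeter_group I m). {u. reduced u \<and> coxeter_cong I m `` {u} = C})"
    using fin by blast
  moreover have "{u. u \<in> lists I \<and> u \<notin> dead_words I m d} \<subseteq>
      (\<Union>C\<in>carrier (coxeter_group I m). {u. reduced u \<and> coxeter_cong I m `` {u} = C})"
    using alive_reduced unfolding carrier_coxeter_group by auto
  ultimately have "finite {u. u \<in> lists I \<and> u \<notin> dead_words I m d}" by (rule finite_subset[rotated])
  moreover have "alive_classes I m d = (\<lambda>u. short_equiv I m `` {u}) ` {u. u \<in> lists I \<and> u \<notin> dead_words I m d}"
    by (auto simp: alive_classes_def)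
  ultimately show ?thesis by simp
qed

text \<open>
  If every generator can be moved by braid moves to the front of \<open>p\<close>, then \<open>p\<close> represents the
  longest element: the set of elements represented by subwords of \<open>p\<close> does not change under braid
  moves, so it is stable under left multiplication by each generator.
\<close>

lemma subseq_alt_ceq:
  assumes "a \<in> I" "b \<in> I" "subseq y (alt k a b)"
  shows "(\<exists>l\<le>k. y \<sim> alt l a b) \<or> (\<exists>l<k. y \<sim> alt l b a)"
  using assms
proof (induction k arbitrary: a b y)
  case 0
  then have "y = []" by (cases y) auto
  then show ?case by auto
next
  case (Suc k)
  show ?case
  proof (cases "subseq y (alt k b a)")
    case True
    then show ?thesis using Suc.IH[of b a y] Suc.prems by (meson less_Suc_eq_le less_imp_le order.trans)
  next
    case False
    then obtain y' where y: "y = a # y'" "subseq y' (alt k b a)"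
      using Suc.prems(3) by (cases y) (auto split: if_splits)
    from Suc.IH[OF Suc.prems(2,1) y(2)] show ?thesis
    proof (elim disjE exE conjE)
      fix l assume l: "l \<le> k" "y' \<sim> alt l b a"
      then have "y \<sim> alt (Suc l) a b" using ceq_Cons[OF l(2) Suc.prems(1)] y(1) by simp
      then show ?thesis using l by (meson Suc_le_mono)
    next
      fix l assume l: "l < k" "y' \<sim> alt l a b"
      have yl: "y \<sim> a # alt l a b" using ceq_Cons[OF l(2) Suc.prems(1)] y(1) by simp
      show ?thesis
      proof (cases l)
        case 0
        then have "y \<sim> alt (Suc 0) a b" using yl by simp
        then show ?thesis using l(1) by (meson Suc_le_eq le_SucI less_imp_le zero_less_Suc Suc_leI)
      next
        case (Suc l')
        have "a # a # alt l' b a \<sim> alt l' b a" using Suc.prems by (intro ceq_square) auto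
        then have "y \<sim> alt l' b a" using ceq_trans[OF yl] Suc by simp
        then show ?thesis using l Suc by (intro disjI2 exI[of _ l']) auto
      qed
    qed
  qed
qed

lemma subseq_alt_swap:
  assumes "a \<in> I" "b \<in> I" "m a b \<noteq> \<infinity>" "subseq y (braid_word m a b)"
  shows "\<exists>y'. subseq y' (braid_word m b a) \<and> y \<sim> y'"
proof -
  let ?k = "the_enat (m a b)"
  have bw: "braid_word m a b = alt ?k a b" "braid_word m b a = alt ?k b a"
    using m_sym assms by (simp_all add: braid_word_def)
  have pre: "subseq (alt l b a) (alt ?k b a)" if "l \<le> ?k" for l
    using alt_add[of l "?k - l" b a] that by (auto intro!: prefix_imp_subseq prefixI)
  from subseq_alt_ceq[of a b y ?k] assms bw
  consider (same) l where "l \<le> ?k" "y \<sim> alt l a b" | (swap) l where "l < ?k" "y \<sim> alt l b a" by auto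
  then show ?thesis
  proof cases
    case same
    show ?thesis
    proof (cases "l = ?k")
      case True
      then have "y \<sim> braid_word m b a" using ceq_trans[OF same(2)] braid_word_ceq[OF assms(1-3)] bw by simp
      then show ?thesis by blast
    next
      case False
      then obtain k' where k': "?k = Suc k'" "l \<le> k'" using same(1) by (cases ?k) auto
      have "subseq (alt l a b) (alt k' a b)"
        using alt_add[of l "k' - l" a b] k' by (auto intro!: prefix_imp_subseq prefixI)
      then show ?thesis using same(2) bw k' by (intro exI[of _ "alt l a b"]) auto
    qed
  next
    case swap
    then show ?thesis using pre[of l] bw by auto
  qed
qed

lemma subseq_braid_equiv:
  assumes "(p, p') \<in> braid_equiv I m P" "subseq y p" "y \<in> lists I"
  shows "\<exists>y'. subseq y' p' \<and> y \<sim> y'"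
  using assms
proof (induction rule: braid_equiv_induct)
  case refl
  then show ?case using ceq_refl by blast
next
  case (step v w)
  obtain y' where y': "subseq y' v" "y \<sim> y'" using step by blast
  from step(2) obtain r s a b where *: "v = r @ braid_word m a b @ s" "w = r @ braid_word m b a @ s"
    "a \<in> I" "b \<in> I" "m a b \<noteq> \<infinity>"
    unfolding braid_moves_def by blast
  obtain y1 y23 where 1: "y' = y1 @ y23" "subseq y1 r" "subseq y23 (braid_word m a b @ s)"
    using y'(1) * by (auto elim: subseq_appendE)
  obtain y2 y3 where 2: "y23 = y2 @ y3" "subseq y2 (braid_word m a b)" "subseq y3 s"
    using 1(3) by (auto elim: subseq_appendE)
  obtain z where z: "subseq z (braid_word m b a)" "y2 \<sim> z"
    using subseq_alt_swap[OF *(3-5) 2(2)] by blast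
  have "y1 \<in> lists I" "y3 \<in> lists I" using ceq_words[OF y'(2)] 1(1) 2(1) by auto
  then have "y' \<sim> y1 @ z @ y3" using ceq_ctxt[OF z(2)] 1(1) 2(1) by simp
  moreover have "subseq (y1 @ z @ y3) w" unfolding *(2) using 1 2 z by (intro list_emb_append_mono)
  ultimately show ?case using ceq_trans[OF y'(2)] by blast
qed

theorem finite_group_if_longest_word:
  assumes p: "p \<in> lists I" and front: "\<And>i. i \<in> I \<Longrightarrow> \<exists>q. (p, i # q) \<in> braid_equiv I m (\<lambda>_. True)"
  shows "finite (carrier (coxeter_group I m))"
proof -
  have rep: "\<exists>y. subseq y p \<and> u \<sim> y" if "u \<in> lists I" for u
    using that
  proof (induction u rule: list.induct)
    case Nil
    then show ?case by (intro exI[of _ "[]"]) auto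
  next
    case (Cons i u)
    then have i: "i \<in> I" by simp
    obtain y where y: "subseq y p" "u \<sim> y" using Cons by auto
    obtain q where q: "(p, i # q) \<in> braid_equiv I m (\<lambda>_. True)" using front i by blast
    have "y \<in> lists I" using ceq_words[OF y(2)] by blast
    then obtain y' where y': "subseq y' (i # q)" "y \<sim> y'" using subseq_braid_equiv[OF q y(1)] by blast
    have uy: "i # u \<sim> i # y'" using ceq_Cons[OF ceq_trans[OF y(2) y'(2)] i] .
    have "\<exists>z. subseq z (i # q) \<and> i # u \<sim> z"
    proof (cases "\<exists>z. y' = i # z \<and> subseq z q")
      case True
      then obtain z where z: "y' = i # z" "subseq z q" by blast
      have "z \<in> lists I" using ceq_words[OF y'(2)] z by simp
      then have "i # u \<sim> z" using ceq_trans[OF uy] ceq_square[OF i] z by simp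
      then show ?thesis using z(2) by blast
    next
      case False
      then have "subseq y' q" using y'(1) by (cases y') (auto split: if_splits)
      then show ?thesis using uy by (intro exI[of _ "i # y'"]) simp
    qed
    then obtain z where z: "subseq z (i # q)" "i # u \<sim> z" by blast
    have "z \<in> lists I" using ceq_words[OF z(2)] by blast
    then obtain z' where "subseq z' p" "z \<sim> z'"
      using subseq_braid_equiv[OF braid_equiv_sym[OF q] z(1)] by blast
    then show ?case using ceq_trans[OF z(2)] by blast
  qed
  have "finite {y. subseq y p}"
  proof (rule finite_subset)
    show "{y. subseq y p} \<subseteq> {y. set y \<subseteq> set p \<and> length y \<le> length p}"
      by (auto dest: list_emb_set list_emb_length)
  qed (rule finite_lists_length_le, simp)
  moreover have "carrier (coxeter_group I m) \<subseteq> (\<lambda>y. coxeter_cong I m `` {y}) ` {y. subseq y p}"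
  proof
    fix C assume "C \<in> carrier (coxeter_group I m)"
    then obtain u where u: "u \<in> lists I" "C = coxeter_cong I m `` {u}"
      unfolding carrier_coxeter_group by blast
    obtain y where y: "subseq y p" "u \<sim> y" using rep[OF u(1)] by blast
    then have "C = coxeter_cong I m `` {y}" using class_eq_iff[of u y] u ceq_words by blast
    then show "C \<in> (\<lambda>y. coxeter_cong I m `` {y}) ` {y. subseq y p}" using y(1) by blast
  qed
  ultimately show ?thesis using finite_surj by blast
qed

section \<open>Relabelling and parabolic subsystems\<close>

lemma parabolic: "J \<subseteq> I \<Longrightarrow> J \<noteq> {} \<Longrightarrow> coxeter_data J m"
  using coxeter unfolding coxeter_data_def coxeter_matrix_def by (meson finite_subset subsetD)

lemma braid_word_letters:
  assumes "a \<in> I" "b \<in> I" "a \<noteq> b" "m a b \<noteq> \<infinity>"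
  shows "set (braid_word m a b) = {a, b}"
proof -
  obtain n where n: "m a b = enat n" using assms by auto
  have "2 \<le> n" using m_ge_2[OF assms(1-3)] n by (simp add: numeral_eq_enat)
  then obtain k where "n = Suc (Suc k)" by (metis Suc_le_D numeral_2_eq_2 Suc_le_mono)
  then show ?thesis using set_braid_word[of m a b] n by (auto simp: braid_word_def)
qed

text \<open>
  A braid move on a word over \<open>J\<close> only involves letters of \<open>J\<close>, as both letters of an edge occur in its
  braid word.
\<close>

lemma dead_words_parabolic:
  assumes J: "J \<subseteq> I" and d: "\<forall>i\<in>I. 0 < d i" and u: "u \<in> lists J" "u \<in> dead_words I m d"
  shows "u \<in> dead_words J m d"
proof -
  from u obtain v where v: "v \<in> null_words I m d" "(u, v) \<in> short_equiv I m"
    by (auto simp: dead_words_def)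
  have "(u, v) \<in> short_equiv J m"
    using v(2)
  proof (induction rule: braid_equiv_induct)
    case refl
    show ?case using u by (simp add: braid_equiv_refl)
  next
    case (step v w)
    from step(2) obtain p q a b where *: "v = p @ braid_word m a b @ q" "w = p @ braid_word m b a @ q"
      "a \<in> I" "b \<in> I" "a \<noteq> b" "m a b \<noteq> \<infinity>" "the_enat (m a b) < 5"
      unfolding braid_moves_def by blast
    have vJ: "v \<in> lists J" using braid_equiv_words[OF step(3)] by blast
    then have "a \<in> J" "b \<in> J" "p \<in> lists J" "q \<in> lists J"
      using braid_word_letters[OF *(3-6)] *(1) by auto
    then have "(v, w) \<in> braid_moves J m (\<lambda>k. k < 5)"
      unfolding *(1,2) using * by (intro braid_movesI)
    then show ?case by (intro braid_equiv_trans[OF step(3)] braid_equiv_move)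
  qed
  moreover have "v \<in> null_words J m d"
  proof -
    have vJ: "v \<in> lists J" using braid_equiv_words[OF calculation] by blast
    from v(1) obtain p k q where *: "v = p @ k @ q" "k \<in> monomial_relators I m d"
      unfolding null_words_def by blast
    have pq: "p \<in> lists J" "q \<in> lists J" "k \<in> lists J" using vJ * by auto
    from *(2) have "k \<in> monomial_relators J m d"
      unfolding monomial_relators_def
    proof (elim UnE)
      assume "k \<in> {replicate (d i) i | i. i \<in> I}"
      then obtain i where i: "k = replicate (d i) i" "i \<in> I" by blast
      then have "i \<in> J" using pq(3) d by auto
      then show "k \<in> {replicate (d i) i | i. i \<in> J} \<union> {braid_word m a b | a b. a \<in> J \<and> b \<in> J \<and> a \<noteq> b \<and>
          m a b \<noteq> \<infinity> \<and> 5 \<le> the_enat (m a b)}" using i by blast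
    next
      assume "k \<in> {braid_word m a b | a b. a \<in> I \<and> b \<in> I \<and> a \<noteq> b \<and> m a b \<noteq> \<infinity> \<and> 5 \<le> the_enat (m a b)}"
      then obtain a b where ab: "k = braid_word m a b" "a \<in> I" "b \<in> I" "a \<noteq> b" "m a b \<noteq> \<infinity>"
        "5 \<le> the_enat (m a b)" by blast
      then have "a \<in> J" "b \<in> J" using braid_word_letters[OF ab(2-5)] pq(3) by auto
      then show "k \<in> {replicate (d i) i | i. i \<in> J} \<union> {braid_word m a b | a b. a \<in> J \<and> b \<in> J \<and> a \<noteq> b \<and>
          m a b \<noteq> \<infinity> \<and> 5 \<le> the_enat (m a b)}" using ab by blast
    qed
    then show ?thesis
      unfolding null_words_def using *(1) pq(1,2) by blast
  qed
  ultimately show ?thesis unfolding dead_words_def by blast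
qed

lemma finite_alive_parabolic:
  assumes J: "J \<subseteq> I" "J \<noteq> {}" and d: "\<forall>i\<in>I. 0 < d i" and fin: "finite (alive_classes I m d)"
  shows "finite (alive_classes J m d)"
proof -
  interpret J: coxeter_data J m by (rule parabolic[OF J])
  have ex: "\<exists>n. \<forall>u\<in>lists J. n \<le> length u \<longrightarrow> u \<in> dead_words J m d"
  proof (rule ccontr)
    assume "\<not> ?thesis"
    then have *: "\<exists>u\<in>lists J. n \<le> length u \<and> u \<notin> dead_words J m d" for n by blast
    have "\<exists>u\<in>lists I. n \<le> length u \<and> u \<notin> dead_words I m d" for n
    proof -
      obtain u where u: "u \<in> lists J" "n \<le> length u" "u \<notin> dead_words J m d" using * by blast
      then have "u \<notin> dead_words I m d" using dead_words_parabolic[OF J(1) d] by blast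
      moreover have "u \<in> lists I" using u(1) lists_mono[OF J(1)] by blast
      ultimately show ?thesis using u(2) by blast
    qed
    then show False using infinite_alive_classes[of d] fin by blast
  qed
  then obtain n where n: "\<forall>u\<in>lists J. n \<le> length u \<longrightarrow> u \<in> dead_words J m d" by blast
  have "{u. u \<in> lists J \<and> u \<notin> dead_words J m d} \<subseteq> {u. set u \<subseteq> J \<and> length u \<le> n}"
    using n by (force simp: in_lists_conv_set)
  then have "finite {u. u \<in> lists J \<and> u \<notin> dead_words J m d}"
    using finite_lists_length_le[OF J.finite_I] finite_subset by blast
  moreover have "alive_classes J m d = (\<lambda>u. short_equiv J m `` {u}) ` {u. u \<in> lists J \<and> u \<notin> dead_words J m d}"
    by (auto simp: alive_classes_def)
  ultimately show ?thesis by simp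
qed

end

lemma map_in_lists: "\<lbrakk>g ` J \<subseteq> I; u \<in> lists J\<rbrakk> \<Longrightarrow> map g u \<in> lists I"
  by (auto simp: image_subset_iff)

lemma map_alternating_word: "map g (alternating_word n a b) = alternating_word n (g a) (g b)"
  by (induction n arbitrary: a b) auto

lemma braid_equiv_map:
  assumes g: "inj_on g J" "g ` J \<subseteq> I" and m: "\<And>i j. \<lbrakk>i \<in> J; j \<in> J\<rbrakk> \<Longrightarrow> m (g i) (g j) = m' i j"
    and uv: "(u, v) \<in> braid_equiv J m' P"
  shows "(map g u, map g v) \<in> braid_equiv I m P"
  using uv
proof (induction rule: braid_equiv_induct)
  case refl
  then show ?case by (intro braid_equiv_refl map_in_lists[OF g(2)])
next
  case (step v w)
  from step(2) obtain p q a b where *: "v = p @ braid_word m' a b @ q" "w = p @ braid_word m' b a @ q"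
    "p \<in> lists J" "q \<in> lists J" "a \<in> J" "b \<in> J" "a \<noteq> b" "m' a b \<noteq> \<infinity>" "P (the_enat (m' a b))"
    unfolding braid_moves_def by blast
  have "map g (braid_word m' a b) = braid_word m (g a) (g b)" "map g (braid_word m' b a) = braid_word m (g b) (g a)"
    using m * by (simp_all add: braid_word_def map_alternating_word)
  moreover have "g a \<noteq> g b" using g(1) * by (auto dest: inj_onD)
  moreover have "map g p \<in> lists I" "map g q \<in> lists I" "g a \<in> I" "g b \<in> I"
    using g(2) * by (auto simp: image_subset_iff)
  ultimately have "(map g v, map g w) \<in> braid_moves I m P"
    using * m[of a b] braid_movesI[of "map g p" I "map g q" "g a" "g b" m P] by simp
  then show ?case by (intro braid_equiv_trans[OF step(3)] braid_equiv_move)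
qed

lemma null_words_map:
  assumes g: "inj_on g J" "g ` J \<subseteq> I" and m: "\<And>i j. \<lbrakk>i \<in> J; j \<in> J\<rbrakk> \<Longrightarrow> m (g i) (g j) = m' i j"
    and d: "\<And>i. i \<in> J \<Longrightarrow> d (g i) = d' i" and u: "u \<in> null_words J m' d'"
  shows "map g u \<in> null_words I m d"
proof -
  from u obtain p k q where *: "u = p @ k @ q" "p \<in> lists J" "q \<in> lists J" "k \<in> monomial_relators J m' d'"
    unfolding null_words_def by blast
  have "map g k \<in> monomial_relators I m d"
    using *(4) unfolding monomial_relators_def
  proof (elim UnE)
    assume "k \<in> {replicate (d' i) i | i. i \<in> J}"
    then obtain i where "k = replicate (d' i) i" "i \<in> J" by blast
    then have "map g k = replicate (d (g i)) (g i)" "g i \<in> I" using d g(2) by auto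
    then show "map g k \<in> {replicate (d i) i | i. i \<in> I} \<union> {braid_word m a b | a b. a \<in> I \<and> b \<in> I \<and>
        a \<noteq> b \<and> m a b \<noteq> \<infinity> \<and> 5 \<le> the_enat (m a b)}" by blast
  next
    assume "k \<in> {braid_word m' a b | a b. a \<in> J \<and> b \<in> J \<and> a \<noteq> b \<and> m' a b \<noteq> \<infinity> \<and> 5 \<le> the_enat (m' a b)}"
    then obtain a b where ab: "k = braid_word m' a b" "a \<in> J" "b \<in> J" "a \<noteq> b" "m' a b \<noteq> \<infinity>"
      "5 \<le> the_enat (m' a b)" by blast
    have "map g k = braid_word m (g a) (g b)" "g a \<in> I" "g b \<in> I" "g a \<noteq> g b"
      "m (g a) (g b) \<noteq> \<infinity>" "5 \<le> the_enat (m (g a) (g b))"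
      using ab m[of a b] g by (auto simp: braid_word_def map_alternating_word dest: inj_onD)
    then show "map g k \<in> {replicate (d i) i | i. i \<in> I} \<union> {braid_word m a b | a b. a \<in> I \<and> b \<in> I \<and>
        a \<noteq> b \<and> m a b \<noteq> \<infinity> \<and> 5 \<le> the_enat (m a b)}" by blast
  qed
  moreover have "map g u = map g p @ map g k @ map g q" "map g p \<in> lists I" "map g q \<in> lists I"
    using * g(2) by (auto simp: image_subset_iff)
  ultimately show ?thesis unfolding null_words_def by blast
qed

lemma dead_words_map:
  assumes "inj_on g J" "g ` J \<subseteq> I" "\<And>i j. \<lbrakk>i \<in> J; j \<in> J\<rbrakk> \<Longrightarrow> m (g i) (g j) = m' i j"
    "\<And>i. i \<in> J \<Longrightarrow> d (g i) = d' i" "u \<in> dead_words J m' d'"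
  shows "map g u \<in> dead_words I m d"
proof -
  from assms(5) obtain v where v: "v \<in> null_words J m' d'" "(u, v) \<in> short_equiv J m'"
    by (auto simp: dead_words_def)
  have "map g v \<in> null_words I m d" by (rule null_words_map[of g J I m m' d d', OF assms(1-4) v(1)])
  moreover have "(map g u, map g v) \<in> short_equiv I m" by (rule braid_equiv_map[of g J I m m', OF assms(1-3) v(2)])
  ultimately show ?thesis unfolding dead_words_def by blast
qed

lemma coxeter_data_relabel:
  assumes I: "coxeter_data I m" and g: "bij_betw g J I"
    and m: "\<And>i j. \<lbrakk>i \<in> J; j \<in> J\<rbrakk> \<Longrightarrow> m (g i) (g j) = m' i j"
  shows "coxeter_data J m'"
proof -
  interpret I: coxeter_data I m by fact
  have gI: "g i \<in> I" if "i \<in> J" for i using g that by (auto simp: bij_betw_def)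
  have "I \<noteq> {}" using I.coxeter by (simp add: coxeter_matrix_def)
  then have "J \<noteq> {}" "finite J" using g I.finite_I bij_betw_finite[OF g] by (auto simp: bij_betw_def)
  moreover have "m' i i = 1" if "i \<in> J" for i using m[OF that that] I.m_diag gI[OF that] by simp
  moreover have "m' i j = m' j i \<and> 2 \<le> m' i j" if "i \<in> J" "j \<in> J" "i \<noteq> j" for i j
  proof -
    have "g i \<noteq> g j" using that g by (auto simp: bij_betw_def dest: inj_onD)
    then show ?thesis
      using m[OF that(1,2)] m[OF that(2,1)] I.m_sym[of "g i" "g j"] I.m_ge_2[of "g i" "g j"] gI that by simp
  qed
  ultimately show ?thesis unfolding coxeter_data_def coxeter_matrix_def by blast
qed

theorem alive_classes_relabel:
  assumes I: "coxeter_data I m" and g: "bij_betw g J I"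
    and m: "\<And>i j. \<lbrakk>i \<in> J; j \<in> J\<rbrakk> \<Longrightarrow> m (g i) (g j) = m' i j"
    and d: "\<And>i. i \<in> J \<Longrightarrow> d (g i) = d' i"
  shows "card (alive_classes I m d) = card (alive_classes J m' d')"
    "finite (alive_classes I m d) \<longleftrightarrow> finite (alive_classes J m' d')"
proof -
  interpret I: coxeter_data I m by fact
  interpret J: coxeter_data J m' by (rule coxeter_data_relabel[OF I g m])
  define h where "h = the_inv_into J g"
  have inj: "inj_on g J" "g ` J \<subseteq> I" using g by (auto simp: bij_betw_def)
  have gh: "g (h i) = i" "h i \<in> J" if "i \<in> I" for i
    using g that by (auto simp: h_def bij_betw_def f_the_inv_into_f intro: the_inv_into_into)
  have injh: "inj_on h I" "h ` I \<subseteq> J" using gh by (auto intro: inj_on_inverseI)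
  have mh: "m' (h i) (h j) = m i j" if "i \<in> I" "j \<in> I" for i j using m[of "h i" "h j"] gh that by simp
  have dh: "d' (h i) = d i" if "i \<in> I" for i using d[of "h i"] gh that by simp
  have mapgh: "map g (map h u) = u" if "u \<in> lists I" for u
    using that gh by (intro nth_equalityI) auto
  define st where "st u = (if map h u \<in> dead_words J m' d' then None else Some (short_equiv J m' `` {map h u}))" for u
  define c where "c C = map g (SOME w. w \<in> C)" for C
  have hl: "map h u \<in> lists J" if "u \<in> lists I" for u using that gh by auto
  have move: "st u = st v" if uv: "(u, v) \<in> braid_moves I m (\<lambda>k. k < 5)" for u v
  proof -
    have *: "(map h u, map h v) \<in> short_equiv J m'"
      by (rule braid_equiv_map[of h I J m' m, OF injh mh braid_equiv_move[OF uv]])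
    then have "short_equiv J m' `` {map h u} = short_equiv J m' `` {map h v}"
      by (rule equiv_class_eq[OF J.equiv_braid_equiv])
    moreover have "map h u \<in> dead_words J m' d' \<longleftrightarrow> map h v \<in> dead_words J m' d'"
      using J.dead_words_equiv[OF *] J.dead_words_equiv[OF J.braid_equiv_sym[OF *]] by blast
    ultimately show ?thesis by (simp add: st_def)
  qed
  have null: "st u = None" if "u \<in> null_words I m d" for u
    using J.null_words_dead[OF null_words_map[of h I J m' m d' d, OF injh mh dh that]] by (simp add: st_def)
  have nf: "(u, c x) \<in> short_equiv I m" if u: "u \<in> lists I" "st u = Some x" for u x
  proof -
    have x: "x = short_equiv J m' `` {map h u}" using u by (auto simp: st_def split: if_splits)
    have "map h u \<in> x" using braid_equiv_refl[OF hl[OF u(1)]] x by blast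
    then have "(SOME w. w \<in> x) \<in> x" by (rule someI)
    then have "(map h u, SOME w. w \<in> x) \<in> short_equiv J m'" unfolding x by simp
    from braid_equiv_map[OF inj _ this, where m = m] have "(map g (map h u), c x) \<in> short_equiv I m"
      using m unfolding c_def by simp
    then show ?thesis using mapgh[OF u(1)] by simp
  qed
  have dead: "u \<in> dead_words I m d" if u: "u \<in> lists I" "st u = None" for u
  proof -
    have "map h u \<in> dead_words J m' d'" using u by (auto simp: st_def split: if_splits)
    from dead_words_map[OF inj _ _ this, where m = m and d = d] m d have "map g (map h u) \<in> dead_words I m d" by blast
    then show ?thesis using mapgh[OF u(1)] by simp
  qed
  have maphg: "map h (map g w) = w" if "w \<in> lists J" for w
  proof (rule nth_equalityI)
    fix k assume "k < length (map h (map g w))"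
    then have "w ! k \<in> J" using that by (auto simp: in_lists_conv_set)
    then show "map h (map g w) ! k = w ! k"
      using \<open>k < _\<close> inj(1) by (simp add: h_def the_inv_into_f_f)
  qed simp
  have X: "{x. \<exists>u\<in>lists I. st u = Some x} = alive_classes J m' d'"
  proof (intro equalityI subsetI)
    fix x assume "x \<in> {x. \<exists>u\<in>lists I. st u = Some x}"
    then obtain u where u: "u \<in> lists I" "st u = Some x" by blast
    then have "x = short_equiv J m' `` {map h u}" "map h u \<notin> dead_words J m' d'"
      by (auto simp: st_def split: if_splits)
    then show "x \<in> alive_classes J m' d'" unfolding alive_classes_def using hl[OF u(1)] by blast
  next
    fix x assume "x \<in> alive_classes J m' d'"
    then obtain w where w: "w \<in> lists J" "w \<notin> dead_words J m' d'" "x = short_equiv J m' `` {w}"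
      unfolding alive_classes_def by blast
    then have "st (map g w) = Some x" unfolding st_def maphg[OF w(1)] by simp
    moreover have "map g w \<in> lists I" by (rule map_in_lists[OF inj(2) w(1)])
    ultimately show "x \<in> {x. \<exists>u\<in>lists I. st u = Some x}" by blast
  qed
  note inv = I.alive_classes_invariant[of st d c, OF move null nf dead, unfolded X]
  show "card (alive_classes I m d) = card (alive_classes J m' d')" by (rule inv(1))
  show "finite (alive_classes I m d) \<longleftrightarrow> finite (alive_classes J m' d')" by (rule inv(2))
qed

section \<open>Computing with braid moves\<close>

text \<open>
  The functions of this section are written for evaluation inside the logic: they recurse over lists only, with
  lists also serving as bounds for the depth of the recursion, and branch with \<open>case\<close> and \<open>if\<close> instead
  of conjunctions, so that nothing is evaluated without need.
\<close>

primrec pull_all :: "('n \<Rightarrow> 'n list \<Rightarrow> 'n list option) \<Rightarrow> 'n list \<Rightarrow> 'n list \<Rightarrow> 'n list option" where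
  "pull_all f [] w = Some w"
| "pull_all f (c # cs) w = (case f c w of None \<Rightarrow> None | Some x \<Rightarrow> pull_all f cs x)"

text \<open>
  \<open>pull B fuel i w\<close> looks for \<open>z\<close> such that \<open>i # z\<close> arises from \<open>w\<close> by braid moves. If \<open>w\<close> starts with
  \<open>j \<noteq> i\<close>, then \<open>w\<close> must be equivalent to a word starting with the alternating word \<open>j, i, j, \<dots>\<close> of full
  length, whose letters are again found by \<open>pull\<close>. The table \<open>B i j\<close> holds the alternating word
  \<open>i, j, \<dots>\<close> that is one letter shorter than the braid relation.
\<close>

primrec pull :: "('n \<Rightarrow> 'n \<Rightarrow> 'n list option) \<Rightarrow> 'n list \<Rightarrow> 'n \<Rightarrow> 'n list \<Rightarrow> 'n list option" where
  "pull B [] = (\<lambda>i w. None)"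
| "pull B (f # fs) = (\<lambda>i w. case w of [] \<Rightarrow> None | j # w' \<Rightarrow>
     (if i = j then Some w' else
       (case B i j of None \<Rightarrow> None | Some t \<Rightarrow>
         (case pull_all (pull B fs) t w' of None \<Rightarrow> None | Some z \<Rightarrow>
           (case B j i of None \<Rightarrow> None | Some t' \<Rightarrow> Some (t' @ z))))))"

primrec reaches :: "('n \<Rightarrow> 'n \<Rightarrow> 'n list option) \<Rightarrow> 'n list \<Rightarrow> 'n list \<Rightarrow> bool" where
  "reaches B [] w \<longleftrightarrow> (case w of [] \<Rightarrow> True | j # w' \<Rightarrow> False)"
| "reaches B (i # r) w \<longleftrightarrow> (case pull B w i w of None \<Rightarrow> False | Some w' \<Rightarrow> reaches B r w')"

primrec first_success :: "('a \<Rightarrow> bool) \<Rightarrow> 'a list \<Rightarrow> bool" where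
  "first_success p [] \<longleftrightarrow> False"
| "first_success p (x # xs) \<longleftrightarrow> (if p x then True else first_success p xs)"

primrec some_suffix :: "('n \<Rightarrow> 'n list \<Rightarrow> bool) \<Rightarrow> 'n list \<Rightarrow> 'n list \<Rightarrow> bool" where
  "some_suffix p [] z \<longleftrightarrow> False"
| "some_suffix p (c # cs) z \<longleftrightarrow> (if some_suffix p cs z then True else p c (cs @ z))"

text \<open>
  A search for a vanishing factor in a word equivalent to \<open>i # x\<close>: two equal letters in front, a long
  alternating word \<open>i # t\<close> with \<open>t \<in> K i\<close> in front, or a vanishing word after exchanging an alternating
  prefix.
\<close>

primrec dies :: "('n \<Rightarrow> 'n \<Rightarrow> 'n list option) \<Rightarrow> ('n \<Rightarrow> 'n list list) \<Rightarrow> 'n list \<Rightarrow> 'n list \<Rightarrow> 'n \<Rightarrow> 'n list \<Rightarrow> bool"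
where
  "dies B K ls [] = (\<lambda>i x. False)"
| "dies B K ls (f # fs) = (\<lambda>i x.
     case pull B x i x of Some z \<Rightarrow> True | None \<Rightarrow>
      (if first_success (\<lambda>t. case pull_all (pull B x) t x of None \<Rightarrow> False | Some z \<Rightarrow> True) (K i) then True
       else first_success (\<lambda>j. case B j i of None \<Rightarrow> False | Some t' \<Rightarrow>
         (case pull_all (pull B x) t' x of None \<Rightarrow> False | Some z \<Rightarrow>
           (case B i j of None \<Rightarrow> False | Some t \<Rightarrow> some_suffix (dies B K ls fs) t z))) ls))"

lemma first_success_iff: "first_success p xs \<longleftrightarrow> (\<exists>x\<in>set xs. p x)"
  by (induction xs) auto

lemma some_suffixD: "some_suffix p t z \<Longrightarrow> \<exists>r c cs. t = r @ c # cs \<and> p c (cs @ z)"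
proof (induction t)
  case (Cons a t)
  show ?case
  proof (cases "some_suffix p t z")
    case True
    then obtain r c cs where "t = r @ c # cs" "p c (cs @ z)" using Cons.IH by blast
    then show ?thesis by (intro exI[of _ "a # r"]) auto
  next
    case False
    then show ?thesis using Cons.prems by (intro exI[of _ "[]"]) auto
  qed
qed simp

locale braid_table = coxeter_data J m for J :: "'n set" and m +
  fixes P :: "nat \<Rightarrow> bool" and B :: "'n \<Rightarrow> 'n \<Rightarrow> 'n list option"
  assumes table: "\<lbrakk>i \<in> J; j \<in> J; B i j = Some t\<rbrakk> \<Longrightarrow>
    i \<noteq> j \<and> m i j \<noteq> \<infinity> \<and> P (the_enat (m i j)) \<and> braid_word m j i = j # t"
begin

lemma pull_all_sound:
  assumes f: "\<And>c x y. \<lbrakk>c \<in> J; x \<in> lists J; f c x = Some y\<rbrakk> \<Longrightarrow> (x, c # y) \<in> braid_equiv J m P"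
    and "cs \<in> lists J" "w \<in> lists J" "pull_all f cs w = Some z"
  shows "(w, cs @ z) \<in> braid_equiv J m P"
  using assms(2-4)
proof (induction cs arbitrary: w rule: list.induct)
  case Nil
  then show ?case by (simp add: braid_equiv_refl)
next
  case (Cons c cs)
  then obtain x where x: "f c w = Some x" "pull_all f cs x = Some z" by (auto split: option.splits)
  have wx: "(w, c # x) \<in> braid_equiv J m P" using f Cons.prems x by auto
  then have "x \<in> lists J" using braid_equiv_words[OF wx] by simp
  then have "(x, cs @ z) \<in> braid_equiv J m P" using Cons.IH Cons.prems x(2) by auto
  then have "([c] @ x @ [], [c] @ (cs @ z) @ []) \<in> braid_equiv J m P"
    using Cons.prems by (intro braid_equiv_ctxt) auto
  then show ?case using braid_equiv_trans[OF wx] by simp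
qed

lemma pull_sound:
  "\<lbrakk>i \<in> J; w \<in> lists J; pull B fs i w = Some z\<rbrakk> \<Longrightarrow> (w, i # z) \<in> braid_equiv J m P"
proof (induction fs arbitrary: i w z)
  case (Cons f fs)
  obtain j w' where w: "w = j # w'" using Cons.prems(3) by (cases w) auto
  have j: "j \<in> J" "w' \<in> lists J" using Cons.prems w by auto
  show ?case
  proof (cases "i = j")
    case True
    then show ?thesis using Cons.prems w by (simp add: braid_equiv_refl)
  next
    case False
    then obtain t x t' where *: "B i j = Some t" "pull_all (pull B fs) t w' = Some x" "B j i = Some t'"
      "z = t' @ x" using Cons.prems(3) w by (auto split: option.splits)
    have t: "braid_word m j i = j # t" "braid_word m i j = i # t'" "m j i \<noteq> \<infinity>" "P (the_enat (m j i))"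
      using table[OF Cons.prems(1) j(1) *(1)] table[OF j(1) Cons.prems(1) *(3)] by auto
    have tJ: "t \<in> lists J" using t(1) braid_word_in[OF j(1) Cons.prems(1), of m] by simp
    have wx: "(w', t @ x) \<in> braid_equiv J m P"
      by (rule pull_all_sound[OF _ tJ j(2) *(2)]) (rule Cons.IH)
    have xJ: "x \<in> lists J" using braid_equiv_words[OF wx] by simp
    have "([j] @ w' @ [], [j] @ (t @ x) @ []) \<in> braid_equiv J m P"
      using j by (intro braid_equiv_ctxt[OF wx]) auto
    then have 1: "(w, braid_word m j i @ x) \<in> braid_equiv J m P" using w t(1) by simp
    have "([] @ braid_word m j i @ x, [] @ braid_word m i j @ x) \<in> braid_moves J m P"
      using xJ j Cons.prems(1) False t by (intro braid_movesI) auto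
    then have "(braid_word m j i @ x, i # z) \<in> braid_equiv J m P"
      using braid_equiv_move t(2) *(4) by fastforce
    then show ?thesis by (rule braid_equiv_trans[OF 1])
  qed
qed simp

lemma reaches_sound: "\<lbrakk>r \<in> lists J; w \<in> lists J; reaches B r w\<rbrakk> \<Longrightarrow> (w, r) \<in> braid_equiv J m P"
proof (induction r arbitrary: w rule: list.induct)
  case Nil
  then show ?case by (cases w) (auto simp: braid_equiv_refl)
next
  case (Cons i r)
  then obtain w' where w': "pull B w i w = Some w'" "reaches B r w'" by (auto split: option.splits)
  have *: "(w, i # w') \<in> braid_equiv J m P" using Cons.prems w'(1) by (intro pull_sound) auto
  have "(w', r) \<in> braid_equiv J m P" using braid_equiv_words[OF *] Cons w'(2) by auto
  then have "([i] @ w' @ [], [i] @ r @ []) \<in> braid_equiv J m P"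
    using Cons.prems by (intro braid_equiv_ctxt) auto
  then show ?case using braid_equiv_trans[OF *] by simp
qed

end

lemma (in braid_table) dies_sound:
  assumes P: "P = (\<lambda>k. k < 5)" and d: "\<And>i. i \<in> J \<Longrightarrow> d i = 2" and ls: "set ls \<subseteq> J"
    and K: "\<And>i t. \<lbrakk>i \<in> J; t \<in> set (K i)\<rbrakk> \<Longrightarrow>
      \<exists>j\<in>J. i \<noteq> j \<and> m i j \<noteq> \<infinity> \<and> 5 \<le> the_enat (m i j) \<and> braid_word m i j = i # t"
  shows "\<lbrakk>i \<in> J; x \<in> lists J; dies B K ls fs i x\<rbrakk> \<Longrightarrow> i # x \<in> dead_words J m d"
proof (induction fs arbitrary: i x)
  case (Cons f fs)
  note i = Cons.prems(1,2)
  have transfer: "i # x \<in> dead_words J m d" if "(x, y) \<in> short_equiv J m" "i # y \<in> dead_words J m d" for y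
  proof -
    have "([i] @ y @ [], [i] @ x @ []) \<in> short_equiv J m"
      using i by (intro braid_equiv_ctxt braid_equiv_sym[OF that(1)]) auto
    then show ?thesis using dead_words_equiv that(2) by fastforce
  qed
  have pulls: "(x, t @ z) \<in> short_equiv J m" if "t \<in> lists J" "pull_all (pull B x) t x = Some z" for t z
    using pull_all_sound[OF _ that(1) i(2) that(2)] pull_sound unfolding P by blast
  consider (square) z where "pull B x i x = Some z"
    | (long) t z where "t \<in> set (K i)" "pull_all (pull B x) t x = Some z"
    | (swap) j t' z t where "j \<in> J" "B j i = Some t'" "pull_all (pull B x) t' x = Some z"
        "B i j = Some t" "some_suffix (dies B K ls fs) t z"
    using Cons.prems(3) ls by (fastforce simp: first_success_iff split: option.splits if_splits)
  then show ?case
  proof cases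
    case square
    then have xz: "(x, i # z) \<in> short_equiv J m" using pull_sound i unfolding P by blast
    have "[] @ [i, i] @ z \<in> null_words J m d"
      using i braid_equiv_words[OF xz] d by (intro null_words_square) auto
    then show ?thesis using transfer[OF xz] null_words_dead by simp
  next
    case long
    obtain j where j: "j \<in> J" "i \<noteq> j" "m i j \<noteq> \<infinity>" "5 \<le> the_enat (m i j)" "braid_word m i j = i # t"
      using K[OF i(1) long(1)] by blast
    have tJ: "t \<in> lists J" using braid_word_in[OF i(1) j(1), of m] j(5) by simp
    have xz: "(x, t @ z) \<in> short_equiv J m" by (rule pulls[OF tJ long(2)])
    have "braid_word m i j \<in> monomial_relators J m d" unfolding monomial_relators_def using i j by blast
    moreover have "z \<in> lists J" using braid_equiv_words[OF xz] by simp
    ultimately have "[] @ braid_word m i j @ z \<in> null_words J m d" unfolding null_words_def by blast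
    then show ?thesis using transfer[OF xz] null_words_dead j(5) by simp
  next
    case swap
    have t: "braid_word m i j = i # t'" "braid_word m j i = j # t" "i \<noteq> j" "m i j \<noteq> \<infinity>" "the_enat (m i j) < 5"
      using table[OF swap(1) i(1) swap(2)] table[OF i(1) swap(1) swap(4)] P by auto
    have tJ: "t' \<in> lists J" "t \<in> lists J"
      using braid_word_in[OF i(1) swap(1), of m] braid_word_in[OF swap(1) i(1), of m] t by auto
    have xz: "(x, t' @ z) \<in> short_equiv J m" by (rule pulls[OF tJ(1) swap(3)])
    have zJ: "z \<in> lists J" using braid_equiv_words[OF xz] by simp
    obtain r c cs where r: "t = r @ c # cs" "dies B K ls fs c (cs @ z)" using some_suffixD[OF swap(5)] by blast
    have rJ: "r \<in> lists J" "c \<in> J" "cs \<in> lists J" using tJ(2) r(1) by auto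
    have "c # cs @ z \<in> dead_words J m d" using Cons.IH[of c "cs @ z"] rJ zJ r(2) by auto
    then have "(j # r) @ (c # cs @ z) @ [] \<in> dead_words J m d"
      using rJ swap(1) by (intro dead_words_ctxt) auto
    then have dead: "braid_word m j i @ z \<in> dead_words J m d" using t r by simp
    have "([] @ braid_word m i j @ z, [] @ braid_word m j i @ z) \<in> braid_moves J m (\<lambda>k. k < 5)"
      using zJ i swap(1) t by (intro braid_movesI) auto
    then have "(braid_word m i j @ z, braid_word m j i @ z) \<in> short_equiv J m" using braid_equiv_move by fastforce
    then have "braid_word m i j @ z \<in> dead_words J m d" using dead_words_equiv[OF braid_equiv_sym] dead by blast
    then show ?thesis using transfer[OF xz] t by simp
  qed
qed simp

section \<open>Noncommutative Groebner bases for monoids with zero\<close>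

text \<open>
  Words over the letters together with a zero, written \<open>None\<close>, form a monoid. A terminating and
  confluent rewriting system for it has unique normal words, which represent the alive classes. The
  tests for these properties are again programs.
\<close>

primrec strip :: "'n list \<Rightarrow> 'n list \<Rightarrow> 'n list option" where
  "strip [] w = Some w"
| "strip (a # l) w = (case w of [] \<Rightarrow> None | b # w' \<Rightarrow> if a = b then strip l w' else None)"

primrec match :: "('n list \<times> 'n list option) list \<Rightarrow> 'n list \<Rightarrow> ('n list option \<times> 'n list) option" where
  "match [] w = None"
| "match (tr # rs) w = (case tr of (t, r) \<Rightarrow> (case strip t w of Some z \<Rightarrow> Some (r, z) | None \<Rightarrow> match rs w))"

primrec insert_all :: "('n \<Rightarrow> 'n list \<Rightarrow> 'n list option) \<Rightarrow> 'n list \<Rightarrow> 'n list \<Rightarrow> 'n list option" where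
  "insert_all f [] w = Some w"
| "insert_all f (c # cs) w = (case insert_all f cs w of None \<Rightarrow> None | Some w' \<Rightarrow> f c w')"

text \<open>
  A rule \<open>i # t \<rightarrow> r\<close> is stored as the pair \<open>(t, r)\<close> in the list \<open>rules i\<close>, and \<open>r = None\<close> stands for the
  zero of the monoid. Left multiplication by \<open>i\<close> on normal words only needs to look for rules at the
  front.
\<close>

primrec insert_normal ::
  "('n \<Rightarrow> ('n list \<times> 'n list option) list) \<Rightarrow> 'n list \<Rightarrow> 'n \<Rightarrow> 'n list \<Rightarrow> 'n list option" where
  "insert_normal rules [] = (\<lambda>i w. Some (i # w))"
| "insert_normal rules (f # fs) = (\<lambda>i w. case match (rules i) w of None \<Rightarrow> Some (i # w)
     | Some (r, z) \<Rightarrow> (case r of None \<Rightarrow> None | Some r' \<Rightarrow> insert_all (insert_normal rules fs) r' z))"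

definition reduce :: "('n \<Rightarrow> ('n list \<times> 'n list option) list) \<Rightarrow> 'n list \<Rightarrow> 'n list option \<Rightarrow> 'n list option" where
  "reduce rules fuel x =
     (case x of None \<Rightarrow> None | Some w \<Rightarrow> insert_all (insert_normal rules fuel) w [])"

definition put :: "'n list \<Rightarrow> 'n list option \<Rightarrow> 'n list \<Rightarrow> 'n list option" where
  "put p x q = (case x of None \<Rightarrow> None | Some w \<Rightarrow> Some (p @ w @ q))"

inductive rstep :: "('n \<Rightarrow> ('n list \<times> 'n list option) list) \<Rightarrow> 'n list option \<Rightarrow> 'n list option \<Rightarrow> bool"
  for rules where
  step: "(t, r) \<in> set (rules i) \<Longrightarrow> rstep rules (Some (p @ (i # t) @ q)) (put p r q)"

abbreviation rewrites_to where "rewrites_to rules \<equiv> (rstep rules)\<^sup>*\<^sup>*"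

lemma put_simps [simp]: "put p None q = None" "put p (Some w) q = Some (p @ w @ q)"
  by (simp_all add: put_def)

lemma put_put: "put p (put p' x q') q = put (p @ p') x (q' @ q)"
  by (cases x) auto

lemma put_Nil [simp]: "put [] x [] = x"
  by (cases x) auto

lemma rewrites_put: "rstep rules x y \<Longrightarrow> rstep rules (put p x q) (put p y q)"
proof (induction rule: rstep.induct)
  case (step t r i p' q')
  then show ?case using rstep.intros[of t r rules i "p @ p'" "q' @ q"] by (simp add: put_put)
qed

lemma rewrites_to_put: "rewrites_to rules x y \<Longrightarrow> rewrites_to rules (put p x q) (put p y q)"
  by (induction rule: rtranclp_induct) (auto dest: rewrites_put intro: rtranclp.rtrancl_into_rtrancl)

lemma strip_Some: "strip l w = Some z \<longleftrightarrow> w = l @ z"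
  by (induction l arbitrary: w) (auto split: list.splits)

lemma strip_None: "strip l w = None \<longleftrightarrow> (\<nexists>z. w = l @ z)"
  using strip_Some by (metis not_None_eq)

lemma match_Some: "match rs w = Some (r, z) \<Longrightarrow> \<exists>t. (t, r) \<in> set rs \<and> w = t @ z"
  by (induction rs) (auto split: option.splits prod.splits simp: strip_Some)

lemma match_None: "match rs w = None \<longleftrightarrow> (\<forall>(t, r)\<in>set rs. \<nexists>z. w = t @ z)"
  by (induction rs) (auto split: option.splits prod.splits simp: strip_Some strip_None)

lemma insert_all_rewrites:
  assumes "\<And>c x. rewrites_to rules (Some (c # x)) (f c x)"
  shows "rewrites_to rules (Some (cs @ w)) (insert_all f cs w)"
proof (induction cs)
  case (Cons c cs)
  have "rewrites_to rules (put [c] (Some (cs @ w)) []) (put [c] (insert_all f cs w) [])"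
    by (rule rewrites_to_put[OF Cons])
  moreover have "rewrites_to rules (put [c] (insert_all f cs w) []) (insert_all f (c # cs) w)"
    using assms by (cases "insert_all f cs w") auto
  ultimately show ?case by (auto intro: rtranclp_trans)
qed simp

lemma insert_normal_rewrites: "rewrites_to rules (Some (i # w)) (insert_normal rules fs i w)"
proof (induction fs arbitrary: i w)
  case (Cons f fs)
  show ?case
  proof (cases "match (rules i) w")
    case (Some rz)
    obtain r z where rz: "rz = (r, z)" by fastforce
    obtain t where t: "(t, r) \<in> set (rules i)" "w = t @ z" using match_Some Some rz by blast
    have 1: "rewrites_to rules (Some (i # w)) (put [] r z)"
      using rstep.step[of t r rules i "[]" z, OF t(1)] t(2) by auto
    have "rewrites_to rules (put [] r z) (insert_normal rules (f # fs) i w)"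
      using Some rz insert_all_rewrites[OF Cons.IH] by (cases r) auto
    then show ?thesis by (rule rtranclp_trans[OF 1])
  qed simp
qed simp

lemma reduce_rewrites: "rewrites_to rules x (reduce rules fuel x)"
  using insert_all_rewrites[of rules "insert_normal rules fuel" _ "[]", OF insert_normal_rewrites]
  by (cases x) (auto simp: reduce_def)

text \<open>Termination: rules with a nonzero right-hand side replace a word by a lexicographically smaller one.\<close>

primrec same_length :: "'a list \<Rightarrow> 'a list \<Rightarrow> bool" where
  "same_length [] l \<longleftrightarrow> (case l of [] \<Rightarrow> True | b # l' \<Rightarrow> False)"
| "same_length (a # r) l \<longleftrightarrow> (case l of [] \<Rightarrow> False | b # l' \<Rightarrow> same_length r l')"

primrec lex_smaller :: "('a \<Rightarrow> nat) \<Rightarrow> 'a list \<Rightarrow> 'a list \<Rightarrow> bool" where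
  "lex_smaller rank [] l \<longleftrightarrow> False"
| "lex_smaller rank (a # r) l \<longleftrightarrow> (case l of [] \<Rightarrow> False | b # l' \<Rightarrow>
     if a = b then lex_smaller rank r l' else if rank a < rank b then same_length r l' else False)"

primrec word_value :: "('a \<Rightarrow> nat) \<Rightarrow> nat \<Rightarrow> 'a list \<Rightarrow> nat" where
  "word_value rank b [] = 0"
| "word_value rank b (a # w) = rank a * b ^ length w + word_value rank b w"

lemma same_length: "same_length r l \<Longrightarrow> length r = length l"
  by (induction r arbitrary: l) (auto split: list.splits)

lemma word_value_append: "word_value rank b (u @ v) = word_value rank b u * b ^ length v + word_value rank b v"
  by (induction u) (auto simp: algebra_simps power_add)

lemma word_value_bound:
  assumes "\<And>a. rank a < b" shows "word_value rank b w < b ^ length w"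
proof (induction w)
  case (Cons a w)
  have "rank a * b ^ length w + word_value rank b w < (rank a + 1) * b ^ length w" using Cons by simp
  also have "\<dots> \<le> b * b ^ length w" using assms[of a] by (intro mult_le_mono1) simp
  finally show ?case by simp
qed simp

lemma lex_smaller_value:
  assumes rank: "\<And>a. rank a < b"
  shows "lex_smaller rank r l \<Longrightarrow> length r = length l \<and> word_value rank b r < word_value rank b l"
proof (induction r arbitrary: l)
  case (Cons a r)
  then obtain c l' where l: "l = c # l'" by (auto split: list.splits)
  show ?case
  proof (cases "a = c")
    case True
    then show ?thesis using Cons l by auto
  next
    case False
    then have *: "rank a < rank c" "length r = length l'"
      using Cons.prems l same_length by (auto split: if_splits)
    have "word_value rank b (a # r) < (rank a + 1) * b ^ length r"
      using word_value_bound[of rank b r, OF rank] by simp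
    also have "\<dots> \<le> rank c * b ^ length r" using * by (intro mult_le_mono1) simp
    finally show ?thesis using l * by simp
  qed
qed simp

definition option_value :: "('a \<Rightarrow> nat) \<Rightarrow> nat \<Rightarrow> 'a list option \<Rightarrow> nat" where
  "option_value rank b x = (case x of None \<Rightarrow> 0 | Some w \<Rightarrow> Suc (word_value rank b w))"

definition decreasing_rules :: "('n \<Rightarrow> nat) \<Rightarrow> ('n \<Rightarrow> ('n list \<times> 'n list option) list) \<Rightarrow> 'n list \<Rightarrow> bool" where
  "decreasing_rules rank rules ls \<longleftrightarrow> list_all (\<lambda>i. list_all (\<lambda>(t, r).
     case r of None \<Rightarrow> True | Some r' \<Rightarrow> lex_smaller rank r' (i # t)) (rules i)) ls"

text \<open>
  All overlaps of a proper nonempty suffix of one left-hand side with another left-hand side; the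
  second case of the overlap is the nested one.
\<close>

primrec overlaps_join ::
  "('n \<Rightarrow> ('n list \<times> 'n list option) list) \<Rightarrow> 'n list \<Rightarrow> 'n list option \<Rightarrow> 'n list \<Rightarrow> 'n list \<Rightarrow> bool" where
  "overlaps_join rules fuel r p [] \<longleftrightarrow> True"
| "overlaps_join rules fuel r p (j # y) \<longleftrightarrow>
     (if list_all (\<lambda>(t2, r2). case strip y t2 of
          Some z \<Rightarrow> reduce rules fuel (put [] r z) = reduce rules fuel (put p r2 [])
        | None \<Rightarrow> (case strip t2 y of None \<Rightarrow> True | Some z \<Rightarrow> False)) (rules j)
      then overlaps_join rules fuel r (p @ [j]) y else False)"

definition locally_confluent :: "('n \<Rightarrow> ('n list \<times> 'n list option) list) \<Rightarrow> 'n list \<Rightarrow> 'n list \<Rightarrow> bool" where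
  "locally_confluent rules fuel ls \<longleftrightarrow> list_all (\<lambda>i. list_all (\<lambda>(t, r).
     overlaps_join rules fuel r [i] t \<and>
     list_all (\<lambda>(t2, r2). if t = t2 then r = r2 else strip t t2 = None) (rules i)) (rules i)) ls"

lemma overlaps_joinD:
  assumes "overlaps_join rules fuel r p (s @ j # y)" "(t2, r2) \<in> set (rules j)"
  shows "t2 = y @ z \<Longrightarrow> reduce rules fuel (put [] r z) = reduce rules fuel (put (p @ s) r2 [])"
    and "y = t2 @ z \<Longrightarrow> z = []"
proof -
  have *: "case strip y t2 of
      Some z \<Rightarrow> reduce rules fuel (put [] r z) = reduce rules fuel (put (p @ s) r2 [])
    | None \<Rightarrow> (case strip t2 y of None \<Rightarrow> True | Some z \<Rightarrow> False)"
    using assms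
  proof (induction s arbitrary: p)
    case Nil
    then have "list_all (\<lambda>(t2, r2). case strip y t2 of
        Some z \<Rightarrow> reduce rules fuel (put [] r z) = reduce rules fuel (put p r2 [])
      | None \<Rightarrow> (case strip t2 y of None \<Rightarrow> True | Some z \<Rightarrow> False)) (rules j)"
      by (simp split: if_splits)
    from bspec[OF this[unfolded list_all_iff] Nil(2)] show ?case
      unfolding append_Nil2 by (simp only: prod.case)
  next
    case (Cons a s)
    then have "overlaps_join rules fuel r (p @ [a]) (s @ j # y)" by (auto split: if_splits)
    from Cons.IH[OF this Cons.prems(2)] show ?case unfolding append_assoc by (simp only: append_Cons append_Nil)
  qed
  show "reduce rules fuel (put [] r z) = reduce rules fuel (put (p @ s) r2 [])" if "t2 = y @ z"
    using * that strip_Some[of y t2 z] by auto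
  show "z = []" if "y = t2 @ z"
  proof (rule ccontr)
    assume "z \<noteq> []"
    then have "strip y t2 = None" using that by (auto simp: strip_None)
    moreover have "strip t2 y = Some z" using that by (simp add: strip_Some)
    ultimately show False using * by simp
  qed
qed

definition joinable :: "('n \<Rightarrow> ('n list \<times> 'n list option) list) \<Rightarrow> 'n list option \<Rightarrow> 'n list option \<Rightarrow> bool" where
  "joinable rules x y \<longleftrightarrow> (\<exists>z. rewrites_to rules x z \<and> rewrites_to rules y z)"

lemma joinable_reduce: "reduce rules fuel x = reduce rules fuel y \<Longrightarrow> joinable rules x y"
  unfolding joinable_def using reduce_rewrites by metis

lemma joinable_put: "joinable rules x y \<Longrightarrow> joinable rules (put p x q) (put p y q)"
  unfolding joinable_def using rewrites_to_put by blast

lemma joinable_sym: "joinable rules x y \<Longrightarrow> joinable rules y x"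
  unfolding joinable_def by blast

lemma joinable_refl [simp]: "joinable rules x x"
  unfolding joinable_def by blast

text \<open>
  If the two left-hand sides do not overlap in the word, then the two steps commute. Otherwise the
  overlap is one of the finitely many that have been tested.
\<close>

lemma critical_pairs:
  assumes conf: "locally_confluent rules fuel ls" and ls: "set ls = UNIV"
    and 1: "(t, r) \<in> set (rules i)" and 2: "(t', r') \<in> set (rules i')"
    and eq: "p @ (i # t) @ q = p' @ (i' # t') @ q'" and le: "length p \<le> length p'"
  shows "joinable rules (put p r q) (put p' r' q')"
proof -
  obtain s where s: "p' = p @ s" "(i # t) @ q = s @ (i' # t') @ q'"
  proof -
    from eq obtain us where "p = p' @ us \<and> us @ (i # t) @ q = (i' # t') @ q' \<or>
        p @ us = p' \<and> (i # t) @ q = us @ (i' # t') @ q'"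
      unfolding append_eq_append_conv2 by blast
    then show ?thesis using that[of us] that[of "[]"] le by auto
  qed
  have st1: "rstep rules (Some (x @ (i # t) @ y)) (put x r y)" for x y
    by (rule rstep.step[of t r rules i, OF 1])
  have st2: "rstep rules (Some (x @ (i' # t') @ y)) (put x r' y)" for x y
    by (rule rstep.step[of t' r' rules i', OF 2])
  have ov: "overlaps_join rules fuel r [i] t"
    using conf 1 ls unfolding locally_confluent_def list_all_iff by fastforce
  have pf: "if t = t2 then r = r2 else strip t t2 = None" if "(t2, r2) \<in> set (rules i)" for t2 r2
    using conf 1 ls that unfolding locally_confluent_def list_all_iff by fastforce
  have pf': "if t' = t then r' = r else strip t' t = None" if "i' = i"
    using conf 1 2 ls that unfolding locally_confluent_def list_all_iff by fastforce
  show ?thesis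
  proof (cases "length (i # t) \<le> length s")
    case True
    from s(2) obtain us where "i # t = s @ us \<and> us @ q = (i' # t') @ q' \<or>
        (i # t) @ us = s \<and> q = us @ (i' # t') @ q'"
      unfolding append_eq_append_conv2 by blast
    then obtain s' where s': "s = (i # t) @ s'" "q = s' @ (i' # t') @ q'"
    proof
      assume *: "i # t = s @ us \<and> us @ q = (i' # t') @ q'"
      then have "length (i # t) = length s + length us" by (simp only: length_append)
      then have "us = []" using True by simp
      then show ?thesis using * that[of "[]"] by simp
    qed (use that in blast)
    show ?thesis
    proof (cases r)
      case None
      then have "put p r q = None" by simp
      moreover have "rewrites_to rules (put p' r' q') None"
      proof (cases r')
        case (Some w')
        have "rstep rules (Some (p @ (i # t) @ (s' @ w' @ q'))) (put p r (s' @ w' @ q'))"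
          by (rule st1)
        then show ?thesis using None Some s s' by auto
      qed simp
      ultimately show ?thesis unfolding joinable_def by auto
    next
      case (Some w)
      have a: "rstep rules (put p r q) (put (p @ w @ s') r' q')"
        using st2[of "p @ w @ s'" q'] Some s' by simp
      have b: "rewrites_to rules (put p' r' q') (put (p @ w @ s') r' q')"
      proof (cases r')
        case (Some w')
        then show ?thesis
          using st1[of p "s' @ w' @ q'"] \<open>r = Some w\<close> s s' by auto
      qed simp
      show ?thesis unfolding joinable_def using a b by blast
    qed
  next
    case False
    show ?thesis
    proof (cases s)
      case Nil
      then have ii: "i' = i" "t @ q = t' @ q'" using s by auto
      then obtain z where "t = t' @ z \<and> z @ q = q' \<or> t' = t @ z \<and> q = z @ q'"
        by (auto simp: append_eq_append_conv2)
      then have "t = t' \<and> r = r'"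
      proof
        assume z: "t = t' @ z \<and> z @ q = q'"
        then have "strip t' t = Some z" by (simp add: strip_Some)
        then show ?thesis using pf'[OF ii(1)] by (auto split: if_splits)
      next
        assume z: "t' = t @ z \<and> q = z @ q'"
        then have "strip t t' = Some z" by (simp add: strip_Some)
        moreover have "if t = t' then r = r' else strip t t' = None" using 2 ii(1) by (intro pf) simp
        ultimately show ?thesis by (auto split: if_splits)
      qed
      then show ?thesis using ii Nil s by simp
    next
      case (Cons a s')
      then have a: "a = i" "t @ q = s' @ (i' # t') @ q'" using s by auto
      obtain y where y: "t = s' @ i' # y" "y @ q = t' @ q'"
      proof -
        have "length s' < length t" using False Cons by simp
        then obtain y0 where y0: "t = s' @ y0" "y0 @ q = (i' # t') @ q'" "y0 \<noteq> []"
          using a(2) by (auto simp: append_eq_append_conv2)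
        then show ?thesis using that by (cases y0) auto
      qed
      have ov': "overlaps_join rules fuel r [i] (s' @ i' # y)" using ov y(1) by simp
      have join: "joinable rules (put p r q) (put p' r' q')" if z: "t' = y @ z" "q = z @ q'" for z
      proof -
        have "joinable rules (put [] r z) (put ([i] @ s') r' [])"
          by (rule joinable_reduce[OF overlaps_joinD(1)[OF ov' 2 z(1)]])
        then have "joinable rules (put p (put [] r z) q') (put p (put ([i] @ s') r' []) q')"
          by (rule joinable_put)
        then show ?thesis using z s(1) Cons a(1) by (simp add: put_put)
      qed
      from y(2) obtain z where "t' = y @ z \<and> q = z @ q' \<or> y = t' @ z \<and> z @ q = q'"
        by (auto simp: append_eq_append_conv2)
      then show ?thesis
      proof
        assume z: "y = t' @ z \<and> z @ q = q'"
        then have "z = []" using overlaps_joinD(2)[OF ov' 2] by blast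
        then show ?thesis using join[of "[]"] z by simp
      qed (use join in blast)
    qed
  qed
qed

lemma rstep_decreases:
  assumes dec: "decreasing_rules rank rules ls" and ls: "set ls = UNIV" and rank: "\<And>a. rank a < b"
    and "rstep rules u v"
  shows "option_value rank b v < option_value rank b u"
  using assms(4)
proof cases
  case (step t r i p q)
  show ?thesis
  proof (cases r)
    case (Some w)
    have "lex_smaller rank w (i # t)"
      using dec ls step(3) Some unfolding decreasing_rules_def list_all_iff by fastforce
    from lex_smaller_value[OF rank this]
    have *: "length w = length (i # t)" "word_value rank b w < word_value rank b (i # t)" by auto
    have "b ^ length q > 0" using rank[of i] by simp
    then have "word_value rank b w * b ^ length q < word_value rank b (i # t) * b ^ length q"
      using *(2) by (simp only: mult_less_mono1)
    then have "word_value rank b (w @ q) < word_value rank b ((i # t) @ q)"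
      by (simp only: word_value_append add_strict_right_mono)
    moreover have "length (w @ q) = length ((i # t) @ q)" using *(1) by simp
    ultimately have "word_value rank b (p @ w @ q) < word_value rank b (p @ (i # t) @ q)"
      by (simp only: word_value_append[of rank b p] add_strict_left_mono)
    then show ?thesis unfolding step(1,2) Some option_value_def by simp
  qed (use step in \<open>simp add: option_value_def\<close>)
qed

text \<open>
  Newman's lemma: local confluence suffices, by induction along the terminating rewriting relation.
\<close>

lemma rewrites_confluent:
  assumes conf: "locally_confluent rules fuel ls" and ls: "set ls = UNIV"
    and dec: "decreasing_rules rank rules ls" and rank: "\<And>a. rank a < b"
    and "rewrites_to rules x y" "rewrites_to rules x z"
  shows "joinable rules y z"
proof -
  note decr = rstep_decreases[OF dec ls rank]
  have local: "joinable rules y z" if "rstep rules x y" "rstep rules x z" for x y z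
    using that(1)
  proof cases
    case 1: (step t r i p q)
    from that(2) show ?thesis
    proof cases
      case 2: (step t' r' i' p' q')
      have eq: "p @ (i # t) @ q = p' @ (i' # t') @ q'" using 1(1) 2(1) by simp
      show ?thesis
      proof (cases "length p \<le> length p'")
        case True
        then show ?thesis using critical_pairs[OF conf ls 1(3) 2(3) eq] 1(2) 2(2) by simp
      next
        case False
        then show ?thesis
          using critical_pairs[OF conf ls 2(3) 1(3) eq[symmetric]] 1(2) 2(2) joinable_sym by simp
      qed
    qed
  qed
  show ?thesis
    using assms(5,6)
  proof (induction "option_value rank b x" arbitrary: x y z rule: less_induct)
    case less
    show ?case
    proof (cases "x = y \<or> x = z")
      case True
      then show ?thesis using less.prems unfolding joinable_def by blast
    next
      case False
      obtain y1 where y1: "rstep rules x y1" "rewrites_to rules y1 y"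
        using less.prems(1) False by (auto elim: converse_rtranclpE)
      obtain z1 where z1: "rstep rules x z1" "rewrites_to rules z1 z"
        using less.prems(2) False by (auto elim: converse_rtranclpE)
      obtain c where c: "rewrites_to rules y1 c" "rewrites_to rules z1 c"
        using local[OF y1(1) z1(1)] unfolding joinable_def by blast
      obtain e where e: "rewrites_to rules y e" "rewrites_to rules c e"
        using less.hyps[OF decr[OF y1(1)] y1(2) c(1)] unfolding joinable_def by blast
      have "rewrites_to rules z1 e" using c(2) e(2) by (rule rtranclp_trans)
      then obtain k where "rewrites_to rules e k" "rewrites_to rules z k"
        using less.hyps[OF decr[OF z1(1)], of e z] z1(2) unfolding joinable_def by blast
      then show ?thesis unfolding joinable_def using e(1) rtranclp_trans by metis
    qed
  qed
qed

primrec is_normal :: "('n \<Rightarrow> ('n list \<times> 'n list option) list) \<Rightarrow> 'n list \<Rightarrow> bool" where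
  "is_normal rules [] \<longleftrightarrow> True"
| "is_normal rules (i # w) \<longleftrightarrow> is_normal rules w \<and> match (rules i) w = None"

lemma normal_appendD: "is_normal rules (u @ v) \<Longrightarrow> is_normal rules v"
  by (induction u) auto

lemma normal_iff: "is_normal rules w \<longleftrightarrow> (\<forall>y. \<not> rstep rules (Some w) y)"
proof
  assume w: "is_normal rules w"
  show "\<forall>y. \<not> rstep rules (Some w) y"
  proof (intro allI notI)
    fix y assume "rstep rules (Some w) y"
    then show False
    proof cases
      case (step t r i p q)
      then have "is_normal rules ((i # t) @ q)" using w normal_appendD by blast
      then have "match (rules i) (t @ q) = None" by simp
      then show False using step(3) unfolding match_None by blast
    qed
  qed
next
  assume irr: "\<forall>y. \<not> rstep rules (Some w) y"
  have "is_normal rules v" if "\<exists>u. w = u @ v" for v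
    using that
  proof (induction v)
    case (Cons i v)
    then obtain u where u: "w = u @ i # v" by blast
    then have "is_normal rules v" using Cons.IH by (metis append_Cons append_Nil append_assoc)
    moreover have "match (rules i) v = None"
    proof (rule ccontr)
      assume "match (rules i) v \<noteq> None"
      then obtain t r z where t: "(t, r) \<in> set (rules i)" "v = t @ z"
        unfolding match_None by auto
      then show False using irr rstep.step[of t r rules i u z] u by auto
    qed
    ultimately show ?case by simp
  qed simp
  then show "is_normal rules w" by (metis append_Nil)
qed

definition next_level ::
  "('n \<Rightarrow> ('n list \<times> 'n list option) list) \<Rightarrow> 'n list \<Rightarrow> 'n list list \<Rightarrow> 'n list list" where
  "next_level rules ls ws =
     concat (map (\<lambda>i. map (Cons i) (filter (\<lambda>w. match (rules i) w = None) ws)) ls)"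

text \<open>
  Lengths are counted with integers, whose binary numerals are fast to add.
\<close>

primrec int_length :: "'a list \<Rightarrow> int" where
  "int_length [] = 0"
| "int_length (x # xs) = 1 + int_length xs"

text \<open>
  Every suffix of a normal word is normal, so the normal words of the next length are found by putting a
  letter in front of those of the present length. The count ends at a length without normal words.
\<close>

primrec count_levels ::
  "('n \<Rightarrow> ('n list \<times> 'n list option) list) \<Rightarrow> 'n list \<Rightarrow> 'n list \<Rightarrow> 'n list list \<Rightarrow> int option" where
  "count_levels rules ls [] ws = (case ws of [] \<Rightarrow> Some 0 | w # ws' \<Rightarrow> None)"
| "count_levels rules ls (f # fs) ws = (case count_levels rules ls fs (next_level rules ls ws) of
     None \<Rightarrow> None | Some k \<Rightarrow> Some (int_length ws + k))"

lemma int_length: "int_length xs = int (length xs)"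
  by (induction xs) auto

lemma next_level:
  assumes ls: "set ls = UNIV" "distinct ls"
    and ws: "distinct ws" "set ws = {w. is_normal rules w \<and> length w = k}"
  shows "distinct (next_level rules ls ws)"
    "set (next_level rules ls ws) = {w. is_normal rules w \<and> length w = Suc k}"
proof -
  have "distinct (concat (map (\<lambda>i. map (Cons i) (filter (\<lambda>w. match (rules i) w = None) ws)) is))"
    if "distinct is" for "is"
    using that by (induction "is") (auto simp: distinct_map ws(1))
  then show "distinct (next_level rules ls ws)" unfolding next_level_def using ls(2) .
  show "set (next_level rules ls ws) = {w. is_normal rules w \<and> length w = Suc k}"
  proof (intro equalityI subsetI)
    fix w assume "w \<in> {w. is_normal rules w \<and> length w = Suc k}"
    then obtain i v where "w = i # v" "is_normal rules v" "length v = k" "match (rules i) v = None"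
      by (cases w) auto
    then show "w \<in> set (next_level rules ls ws)" unfolding next_level_def using ws(2) ls(1) by auto
  qed (auto simp: next_level_def ws(2))
qed

lemma count_levels:
  assumes ls: "set ls = UNIV" "distinct ls"
    and "distinct ws" "set ws = {w. is_normal rules w \<and> length w = k}" "count_levels rules ls fs ws = Some n"
  shows "finite {w. is_normal rules w \<and> k \<le> length w} \<and> int (card {w. is_normal rules w \<and> k \<le> length w}) = n"
  using assms(3-5)
proof (induction fs arbitrary: ws k n)
  case Nil
  then have *: "{w. is_normal rules w \<and> length w = k} = {}" "n = 0" by (auto split: list.splits)
  have "\<not> (is_normal rules w \<and> k \<le> length w)" for w
  proof
    assume w: "is_normal rules w \<and> k \<le> length w"
    then have "is_normal rules (drop (length w - k) w)"
      using normal_appendD[of rules "take (length w - k) w" "drop (length w - k) w"] by simp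
    then show False using *(1) w by auto
  qed
  then have "{w. is_normal rules w \<and> k \<le> length w} = {}" by blast
  then show ?case using *(2) by (simp only: finite.emptyI card.empty) simp
next
  case (Cons f fs)
  then obtain n' where n': "count_levels rules ls fs (next_level rules ls ws) = Some n'" "n = int_length ws + n'"
    by (auto split: option.splits)
  note IH = Cons.IH[OF next_level(1)[OF ls Cons.prems(1,2)] next_level(2)[OF ls Cons.prems(1,2)] n'(1)]
  let ?X = "{w. is_normal rules w \<and> Suc k \<le> length w}"
  have split: "{w. is_normal rules w \<and> k \<le> length w} = set ws \<union> ?X"
    unfolding Cons.prems(2) by (auto intro: le_neq_implies_less)
  have "set ws \<inter> ?X = {}" unfolding Cons.prems(2) by auto
  then have "card (set ws \<union> ?X) = length ws + card ?X"
    using IH distinct_card[OF Cons.prems(1)] by (subst card_Un_disjoint) auto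
  moreover have "finite (set ws \<union> ?X)" using IH by simp
  ultimately show ?case unfolding split n'(2) int_length using IH by simp
qed

text \<open>
  The normal form is an invariant of the alive classes if the rules hold in the algebra and if both sides
  of each relation have the same normal form.
\<close>

theorem (in coxeter_data) alive_classes_groebner:
  assumes I: "I = UNIV" and ls: "set ls = I" "distinct ls"
    and conf: "locally_confluent rules fuel ls"
    and dec: "decreasing_rules rank rules ls" and rank: "\<And>a. rank a < b"
    and sound: "\<And>i t r. (t, Some r) \<in> set (rules i) \<Longrightarrow> (i # t, r) \<in> short_equiv I m"
    and sound0: "\<And>i t. (t, None) \<in> set (rules i) \<Longrightarrow> i # t \<in> dead_words I m d"
    and braid: "\<And>a b. \<lbrakk>a \<noteq> b; m a b \<noteq> \<infinity>; the_enat (m a b) < 5\<rbrakk> \<Longrightarrow>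
      reduce rules fuel (Some (braid_word m a b)) = reduce rules fuel (Some (braid_word m b a))"
    and long: "\<And>a b. \<lbrakk>a \<noteq> b; m a b \<noteq> \<infinity>; 5 \<le> the_enat (m a b)\<rbrakk> \<Longrightarrow>
      reduce rules fuel (Some (braid_word m a b)) = None"
    and nil: "\<And>i. reduce rules fuel (Some (replicate (d i) i)) = None"
    and count: "count_levels rules ls fs [[]] = Some n"
  shows "finite (alive_classes I m d)" "int (card (alive_classes I m d)) = n"
proof -
  have lsU: "set ls = UNIV" using ls I by simp
  have all: "u \<in> lists I" for u using I by auto
  note confl = rewrites_confluent[OF conf lsU dec rank]
  define irr where "irr x \<longleftrightarrow> (\<forall>y. \<not> rstep rules x y)" for x
  have irrN: "irr None" unfolding irr_def by (auto elim: rstep.cases)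
  have irrD: "y = x" if "irr x" "rewrites_to rules x y" for x y
    using that(2,1) by (induction rule: converse_rtranclp_induct) (auto simp: irr_def)
  have ex: "\<exists>x. rewrites_to rules y x \<and> irr x" for y
  proof (induction "option_value rank b y" arbitrary: y rule: less_induct)
    case less
    show ?case
    proof (cases "irr y")
      case False
      then obtain z where z: "rstep rules y z" unfolding irr_def by blast
      then obtain x where "rewrites_to rules z x" "irr x"
        using less rstep_decreases[OF dec lsU rank z] by blast
      then show ?thesis using z by (meson converse_rtranclp_into_rtranclp)
    qed blast
  qed
  define st where "st u = (SOME x. rewrites_to rules (Some u) x \<and> irr x)" for u
  have st: "rewrites_to rules (Some u) (st u)" "irr (st u)" for u
    using someI_ex[OF ex[of "Some u"]] unfolding st_def by auto
  have to_st: "rewrites_to rules z (st u)" if h: "rewrites_to rules (Some u) z" for u z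
  proof -
    obtain y where "rewrites_to rules z y" "rewrites_to rules (st u) y"
      using confl[OF h st(1)] unfolding joinable_def by blast
    then show ?thesis using irrD[OF st(2)] by auto
  qed
  have st_eq: "st u = st v" if "rewrites_to rules (Some u) z" "rewrites_to rules (Some v) z" for u v z
  proof -
    have "rewrites_to rules (Some v) (st u)" using that(2) to_st[OF that(1)] by (rule rtranclp_trans)
    then have "rewrites_to rules (st u) (st v)" by (rule to_st)
    then show ?thesis using irrD[OF st(2)] by metis
  qed
  have equiv: "case y of None \<Rightarrow> u \<in> dead_words I m d | Some v \<Rightarrow> (u, v) \<in> short_equiv I m"
    if "rewrites_to rules (Some u) y" for u y
    using that
  proof (induction rule: rtranclp_induct)
    case base
    show ?case using all by (simp add: braid_equiv_refl)
  next
    case (step y z)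
    from step(2) show ?case
    proof cases
      case s: (step t r i p q)
      have uy: "(u, p @ (i # t) @ q) \<in> short_equiv I m" using step(3) s(1) by simp
      show ?thesis
      proof (cases r)
        case None
        then have "p @ (i # t) @ q \<in> dead_words I m d"
          using sound0 s(3) all by (intro dead_words_ctxt) auto
        then show ?thesis using None s(2) dead_words_equiv[OF braid_equiv_sym[OF uy]] by simp
      next
        case (Some w)
        then have "(p @ (i # t) @ q, p @ w @ q) \<in> short_equiv I m"
          using sound s(3) all by (intro braid_equiv_ctxt) auto
        then show ?thesis using Some s(2) braid_equiv_trans[OF uy] by simp
      qed
    qed
  qed
  have red: "rewrites_to rules (Some (p @ k @ q)) (put p (reduce rules fuel (Some k)) q)" for p k q
    using rewrites_to_put[OF reduce_rewrites[of rules "Some k" fuel], of p q] by simp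
  have move: "st u = st v" if "(u, v) \<in> braid_moves I m (\<lambda>k. k < 5)" for u v
  proof -
    from that obtain p q a c where *: "u = p @ braid_word m a c @ q" "v = p @ braid_word m c a @ q"
      "a \<noteq> c" "m a c \<noteq> \<infinity>" "the_enat (m a c) < 5"
      unfolding braid_moves_def by blast
    show ?thesis
      using st_eq[OF red[of p "braid_word m a c" q]] red[of p "braid_word m c a" q] braid[OF *(3-5)] *(1,2)
      by simp
  qed
  have null: "st u = None" if "u \<in> null_words I m d" for u
  proof -
    from that obtain p k q where *: "u = p @ k @ q" "k \<in> monomial_relators I m d"
      unfolding null_words_def by blast
    have "reduce rules fuel (Some k) = None"
      using *(2) long nil unfolding monomial_relators_def by auto
    then have "rewrites_to rules (Some u) None" using red[of p k q] *(1) by simp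
    then show ?thesis using to_st[of u None] irrD[OF irrN] by blast
  qed
  have nf: "(u, x) \<in> short_equiv I m" if "u \<in> lists I" "st u = Some x" for u x
    using equiv[OF st(1)[of u]] that(2) by simp
  have dead: "u \<in> dead_words I m d" if "u \<in> lists I" "st u = None" for u
    using equiv[OF st(1)[of u]] that(2) by simp
  have X: "{x. \<exists>u\<in>lists I. st u = Some x} = {w. is_normal rules w \<and> 0 \<le> length w}"
  proof (intro equalityI subsetI)
    fix x assume "x \<in> {x. \<exists>u\<in>lists I. st u = Some x}"
    then obtain u where "st u = Some x" by blast
    then have "irr (Some x)" using st(2)[of u] by simp
    then show "x \<in> {w. is_normal rules w \<and> 0 \<le> length w}"
      unfolding normal_iff irr_def by simp
  next
    fix x assume "x \<in> {w. is_normal rules w \<and> 0 \<le> length w}"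
    then have "irr (Some x)" unfolding irr_def normal_iff by simp
    then have "st x = Some x" using irrD st(1)[of x] by blast
    then show "x \<in> {x. \<exists>u\<in>lists I. st u = Some x}" using all by blast
  qed
  have "set [[]] = {w. is_normal rules w \<and> length w = 0}" by auto
  from count_levels[OF lsU ls(2) _ this count]
  have *: "finite {w. is_normal rules w \<and> 0 \<le> length w}" "int (card {w. is_normal rules w \<and> 0 \<le> length w}) = n"
    by auto
  note inv = alive_classes_invariant[of st d "\<lambda>x. x", OF move null nf dead, unfolded X]
  show "finite (alive_classes I m d)" using inv(2) *(1) by blast
  have "card (alive_classes I m d) = card {w. is_normal rules w \<and> 0 \<le> length w}" by (rule inv(1))
  then show "int (card (alive_classes I m d)) = n" using *(2) by simp
qed

section \<open>Rewriting systems for types \<open>H\<^sub>3\<close> and \<open>H\<^sub>4\<close>\<close>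

text \<open>
  The rules form a noncommutative Groebner basis of the relations with respect to the
  length-lexicographic order. Each rule is justified by a search for braid moves (\<open>reaches\<close>, \<open>dies\<close>),
  and the fuel is long enough for all recursions to end.
\<close>

datatype node3 = A1 | A2 | A3

primrec h3_index :: "node3 \<Rightarrow> nat" where
  "h3_index A1 = 1"
| "h3_index A2 = 2"
| "h3_index A3 = 3"

primrec h3_short_table :: "node3 \<Rightarrow> node3 \<Rightarrow> node3 list option" where
  "h3_short_table A1 = (\<lambda>j. case j of A1 \<Rightarrow> None | A2 \<Rightarrow> None | A3 \<Rightarrow> Some [A1])"
| "h3_short_table A2 = (\<lambda>j. case j of A1 \<Rightarrow> None | A2 \<Rightarrow> None | A3 \<Rightarrow> Some [A2, A3])"
| "h3_short_table A3 = (\<lambda>j. case j of A1 \<Rightarrow> Some [A3] | A2 \<Rightarrow> Some [A3, A2] | A3 \<Rightarrow> None)"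

primrec h3_full_table :: "node3 \<Rightarrow> node3 \<Rightarrow> node3 list option" where
  "h3_full_table A1 = (\<lambda>j. case j of A1 \<Rightarrow> None | A2 \<Rightarrow> Some [A1, A2, A1, A2] | A3 \<Rightarrow> Some [A1])"
| "h3_full_table A2 = (\<lambda>j. case j of A1 \<Rightarrow> Some [A2, A1, A2, A1] | A2 \<Rightarrow> None | A3 \<Rightarrow> Some [A2, A3])"
| "h3_full_table A3 = (\<lambda>j. case j of A1 \<Rightarrow> Some [A3] | A2 \<Rightarrow> Some [A3, A2] | A3 \<Rightarrow> None)"

primrec h3_long :: "node3 \<Rightarrow> node3 list list" where
  "h3_long A1 = [[A2, A1, A2, A1]]"
| "h3_long A2 = [[A1, A2, A1, A2]]"
| "h3_long A3 = []"

primrec h3_rules :: "node3 \<Rightarrow> (node3 list \<times> node3 list option) list" where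
  "h3_rules A1 = [([A1], None),
    ([A2, A1, A2, A1], None),
    ([A3, A2, A1, A2, A1], None)]"
| "h3_rules A2 = [([A2], None),
    ([A1, A2, A1, A2], None),
    ([A3, A2, A1, A2, A1, A3, A2, A1, A2], None)]"
| "h3_rules A3 = [([A1], Some [A1, A3]),
    ([A3], None),
    ([A2, A3], Some [A2, A3, A2]),
    ([A2, A1, A3], Some [A2, A3, A2, A1]),
    ([A2, A1, A2, A3, A2], Some [A2, A3, A2, A1, A2, A3])]"

definition h3_letters :: "node3 list" where "h3_letters = [A1, A2, A3]"

definition h3_fuel :: "node3 list" where
  "h3_fuel = [A1, A1, A1, A1, A1, A1, A1, A1, A1, A1, A1, A1, A1, A1, A1, A1, A1, A1, A1, A1, A1, A1, A1, A1, A1, A1, A1, A1, A1, A1, A1, A1, A1, A1, A1, A1, A1, A1, A1, A1]"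

definition h3_rules_sound :: bool where
  "h3_rules_sound \<longleftrightarrow> list_all (\<lambda>i. list_all (\<lambda>(t, r). case r of
       Some r' \<Rightarrow> reaches h3_short_table r' (i # t)
     | None \<Rightarrow> dies h3_short_table h3_long h3_letters h3_fuel i t) (h3_rules i)) h3_letters"

lemma h3_rules_sound: "h3_rules_sound" by code_simp
lemma h3_count: "count_levels h3_rules h3_letters h3_fuel [[]] = Some 76" by code_simp
lemma h3_decreasing: "decreasing_rules h3_index h3_rules h3_letters" by code_simp
lemma h3_confluent: "locally_confluent h3_rules h3_fuel h3_letters" by code_simp

datatype node4 = B1 | B2 | B3 | B4

primrec h4_index :: "node4 \<Rightarrow> nat" where
  "h4_index B1 = 1"
| "h4_index B2 = 2"
| "h4_index B3 = 3"
| "h4_index B4 = 4"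

primrec h4_short_table :: "node4 \<Rightarrow> node4 \<Rightarrow> node4 list option" where
  "h4_short_table B1 = (\<lambda>j. case j of B1 \<Rightarrow> None | B2 \<Rightarrow> None | B3 \<Rightarrow> Some [B1] | B4 \<Rightarrow> Some [B1])"
| "h4_short_table B2 = (\<lambda>j. case j of B1 \<Rightarrow> None | B2 \<Rightarrow> None | B3 \<Rightarrow> Some [B2, B3] | B4 \<Rightarrow> Some [B2])"
| "h4_short_table B3 = (\<lambda>j. case j of B1 \<Rightarrow> Some [B3] | B2 \<Rightarrow> Some [B3, B2] | B3 \<Rightarrow> None | B4 \<Rightarrow> Some [B3, B4])"
| "h4_short_table B4 = (\<lambda>j. case j of B1 \<Rightarrow> Some [B4] | B2 \<Rightarrow> Some [B4] | B3 \<Rightarrow> Some [B4, B3] | B4 \<Rightarrow> None)"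

primrec h4_full_table :: "node4 \<Rightarrow> node4 \<Rightarrow> node4 list option" where
  "h4_full_table B1 = (\<lambda>j. case j of B1 \<Rightarrow> None | B2 \<Rightarrow> Some [B1, B2, B1, B2] | B3 \<Rightarrow> Some [B1] | B4 \<Rightarrow> Some [B1])"
| "h4_full_table B2 = (\<lambda>j. case j of B1 \<Rightarrow> Some [B2, B1, B2, B1] | B2 \<Rightarrow> None | B3 \<Rightarrow> Some [B2, B3] | B4 \<Rightarrow> Some [B2])"
| "h4_full_table B3 = (\<lambda>j. case j of B1 \<Rightarrow> Some [B3] | B2 \<Rightarrow> Some [B3, B2] | B3 \<Rightarrow> None | B4 \<Rightarrow> Some [B3, B4])"
| "h4_full_table B4 = (\<lambda>j. case j of B1 \<Rightarrow> Some [B4] | B2 \<Rightarrow> Some [B4] | B3 \<Rightarrow> Some [B4, B3] | B4 \<Rightarrow> None)"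

primrec h4_long :: "node4 \<Rightarrow> node4 list list" where
  "h4_long B1 = [[B2, B1, B2, B1]]"
| "h4_long B2 = [[B1, B2, B1, B2]]"
| "h4_long B3 = []"
| "h4_long B4 = []"

primrec h4_rules :: "node4 \<Rightarrow> (node4 list \<times> node4 list option) list" where
  "h4_rules B1 = [([B1], None),
    ([B2, B1, B2, B1], None),
    ([B3, B2, B1, B2, B1], None),
    ([B4, B3, B2, B1, B2, B1], None),
    ([B3, B4, B3, B2, B1, B2, B1], None)]"
| "h4_rules B2 = [([B2], None),
    ([B1, B2, B1, B2], None),
    ([B3, B2, B1, B2, B1, B3, B2, B1, B2], None),
    ([B4, B3, B2, B1, B2, B1, B3, B2, B1, B2], None),
    ([B3, B2, B1, B2, B3, B4, B3, B2, B1, B2, B1, B3, B2, B1, B2], None),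
    ([B3, B2, B4, B3, B2, B1, B2, B1, B3, B2, B1, B4, B3, B2, B1, B2], None)]"
| "h4_rules B3 = [([B1], Some [B1, B3]),
    ([B3], None),
    ([B2, B3], Some [B2, B3, B2]),
    ([B2, B1, B3], Some [B2, B3, B2, B1]),
    ([B2, B1, B2, B3, B2], Some [B2, B3, B2, B1, B2, B3]),
    ([B4, B3, B2, B1, B2, B1, B3, B2, B1, B4, B3, B2, B1, B2], None),
    ([B4, B3, B2, B1, B2, B1, B3, B2, B1, B2, B4, B3, B2, B1, B2, B3], None),
    ([B4, B3, B2, B1, B2, B1, B3, B2, B1, B2, B4, B3, B2, B1, B2, B1, B3], None),
    ([B4, B3, B2, B1, B2, B1, B3, B2, B1, B2, B3, B4, B3, B2, B1, B2, B3, B4], None),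
    ([B4, B3, B2, B1, B2, B1, B3, B2, B1, B2, B3, B4, B3, B2, B1, B2, B1, B3, B4], None),
    ([B4, B3, B2, B1, B2, B1, B3, B2, B1, B2, B3, B4, B3, B2, B1, B2, B1, B3, B2, B4], None),
    ([B4, B3, B2, B1, B2, B1, B3, B2, B1, B2, B3, B4, B3, B2, B1, B2, B1, B3, B2, B1, B4], None),
    ([B4, B3, B2, B1, B2, B1, B3, B2, B1, B2, B3, B4, B3, B2, B1, B2, B1, B3, B2, B1, B2, B4], None),
    ([B4, B3, B2, B1, B2, B1, B3, B2, B1, B2, B3, B4, B3, B2, B1, B2, B1, B3, B2, B1, B2, B3, B4, B3], None)]"
| "h4_rules B4 = [([B1], Some [B1, B4]),
    ([B2], Some [B2, B4]),
    ([B4], None),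
    ([B3, B4], Some [B3, B4, B3]),
    ([B3, B2, B4], Some [B3, B4, B3, B2]),
    ([B3, B2, B1, B4], Some [B3, B4, B3, B2, B1]),
    ([B3, B2, B1, B2, B4], Some [B3, B4, B3, B2, B1, B2]),
    ([B3, B2, B1, B2, B1, B4], Some [B3, B4, B3, B2, B1, B2, B1]),
    ([B3, B2, B1, B2, B3, B4, B3], Some [B3, B4, B3, B2, B1, B2, B3, B4]),
    ([B3, B2, B1, B2, B1, B3, B4, B3], Some [B3, B4, B3, B2, B1, B2, B1, B3, B4]),
    ([B3, B2, B1, B2, B1, B3, B2, B4, B3, B2], Some [B3, B4, B3, B2, B1, B2, B1, B3, B2, B4, B3])]"

definition h4_letters :: "node4 list" where "h4_letters = [B1, B2, B3, B4]"

definition h4_fuel :: "node4 list" where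
  "h4_fuel = [B1, B1, B1, B1, B1, B1, B1, B1, B1, B1, B1, B1, B1, B1, B1, B1, B1, B1, B1, B1, B1, B1, B1, B1, B1, B1, B1, B1, B1, B1, B1, B1, B1, B1, B1, B1, B1, B1, B1, B1]"

definition h4_rules_sound :: bool where
  "h4_rules_sound \<longleftrightarrow> list_all (\<lambda>i. list_all (\<lambda>(t, r). case r of
       Some r' \<Rightarrow> reaches h4_short_table r' (i # t)
     | None \<Rightarrow> dies h4_short_table h4_long h4_letters h4_fuel i t) (h4_rules i)) h4_letters"

lemma h4_rules_sound: "h4_rules_sound" by code_simp
lemma h4_count: "count_levels h4_rules h4_letters h4_fuel [[]] = Some 1460" by code_simp
lemma h4_decreasing: "decreasing_rules h4_index h4_rules h4_letters" by code_simp
lemma h4_confluent: "locally_confluent h4_rules h4_fuel h4_letters" by code_simp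

definition h3_matrix :: "node3 \<Rightarrow> node3 \<Rightarrow> enat" where
  "h3_matrix a b = type_matrix Type_H3 (h3_index a) (h3_index b)"

lemma h3_letters: "set h3_letters = UNIV" "distinct h3_letters"
proof -
  show "set h3_letters = UNIV" unfolding h3_letters_def using node3.exhaust by (auto intro: node3.exhaust)
  show "distinct h3_letters" by (simp add: h3_letters_def)
qed

lemma h3_bij: "bij_betw h3_index UNIV {1..3}"
proof (rule bij_betw_imageI)
  show "inj h3_index"
  proof (rule injI)
    fix a b assume "h3_index a = h3_index b"
    then show "a = b" by (cases a; cases b) simp_all
  qed
  have "range h3_index = h3_index ` set h3_letters" by (simp add: h3_letters)
  then show "range h3_index = {1..3}" by (auto simp: h3_letters_def)
qed

lemma h3_coxeter: "coxeter_data UNIV h3_matrix"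
proof -
  have "finite (UNIV :: node3 set)" unfolding h3_letters(1)[symmetric] by simp
  moreover have "2 \<le> h3_matrix a b" if "a \<noteq> b" for a b
    using that by (cases a; cases b) (simp_all add: h3_matrix_def type_matrix_def)
  ultimately show ?thesis
    unfolding coxeter_data_def coxeter_matrix_def
    by (auto simp: h3_matrix_def type_matrix_def min.commute max.commute)
qed

lemma h3_braid_words:
  assumes "a \<noteq> b"
  shows "h3_matrix a b \<noteq> \<infinity> \<and> (\<exists>t. h3_full_table b a = Some t \<and> braid_word h3_matrix a b = a # t \<and>
    (if the_enat (h3_matrix a b) < 5 then h3_short_table b a = Some t
     else h3_short_table b a = None \<and> t \<in> set (h3_long a)))"
  using assms
  by (cases a; cases b)
    (simp_all add: h3_matrix_def type_matrix_def braid_word_def numeral_eq_enat eval_nat_numeral)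

lemma h3_long_braid: "t \<in> set (h3_long a) \<Longrightarrow>
    \<exists>b. a \<noteq> b \<and> 5 \<le> the_enat (h3_matrix a b) \<and> braid_word h3_matrix a b = a # t"
  by (cases a; simp; (rule exI[of _ A1] exI[of _ A2];
    simp add: h3_matrix_def type_matrix_def braid_word_def numeral_eq_enat eval_nat_numeral))

lemma h3_table_diag: "h3_full_table a a = None" "h3_short_table a a = None"
  by (cases a; simp)+

lemma h3_short_table: "braid_table UNIV h3_matrix (\<lambda>k. k < 5) h3_short_table"
proof (intro braid_table.intro h3_coxeter braid_table_axioms.intro)
  fix i j t assume B: "h3_short_table i j = Some t"
  then have "j \<noteq> i" using h3_table_diag by auto
  from h3_braid_words[OF this] B this show "i \<noteq> j \<and> h3_matrix i j \<noteq> \<infinity> \<and>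
      the_enat (h3_matrix i j) < 5 \<and> braid_word h3_matrix j i = j # t"
    by (auto simp: h3_matrix_def type_matrix_def min.commute max.commute split: if_splits)
qed

lemma h3_full_table: "braid_table UNIV h3_matrix (\<lambda>_. True) h3_full_table"
proof (intro braid_table.intro h3_coxeter braid_table_axioms.intro)
  fix i j t assume B: "h3_full_table i j = Some t"
  then have "j \<noteq> i" using h3_table_diag by auto
  from h3_braid_words[OF this] B this show "i \<noteq> j \<and> h3_matrix i j \<noteq> \<infinity> \<and> True \<and>
      braid_word h3_matrix j i = j # t"
    by (auto simp: h3_matrix_def type_matrix_def min.commute max.commute split: if_splits)
qed

definition h3_relations_hold :: bool where
  "h3_relations_hold \<longleftrightarrow> list_all (\<lambda>a.
     list_all (\<lambda>b. case h3_short_table b a of None \<Rightarrow> True | Some t \<Rightarrow>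
       (case h3_short_table a b of None \<Rightarrow> False | Some t' \<Rightarrow>
         reduce h3_rules h3_fuel (Some (a # t)) = reduce h3_rules h3_fuel (Some (b # t')))) h3_letters \<and>
     list_all (\<lambda>t. reduce h3_rules h3_fuel (Some (a # t)) = None) (h3_long a) \<and>
     reduce h3_rules h3_fuel (Some [a, a]) = None) h3_letters"

lemma h3_relations_hold: "h3_relations_hold" by code_simp

theorem h3_alive_classes:
  "finite (alive_classes UNIV h3_matrix (\<lambda>_. 2))" "card (alive_classes UNIV h3_matrix (\<lambda>_. 2)) = 76"
proof -
  interpret braid_table UNIV h3_matrix "\<lambda>k. k < 5" h3_short_table by (rule h3_short_table)
  have rel: "case h3_short_table b a of None \<Rightarrow> True | Some t \<Rightarrow>
       (case h3_short_table a b of None \<Rightarrow> False | Some t' \<Rightarrow>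
         reduce h3_rules h3_fuel (Some (a # t)) = reduce h3_rules h3_fuel (Some (b # t')))"
    "\<forall>t\<in>set (h3_long a). reduce h3_rules h3_fuel (Some (a # t)) = None"
    "reduce h3_rules h3_fuel (Some [a, a]) = None" for a b
    using h3_relations_hold unfolding h3_relations_hold_def list_all_iff h3_letters by blast+
  have sound: "case r of Some r' \<Rightarrow> reaches h3_short_table r' (i # t)
     | None \<Rightarrow> dies h3_short_table h3_long h3_letters h3_fuel i t" if "(t, r) \<in> set (h3_rules i)" for i t r
    using h3_rules_sound that unfolding h3_rules_sound_def list_all_iff h3_letters by fastforce
  have words: "u \<in> lists UNIV" for u :: "node3 list" by simp
  have rank: "h3_index a < 5" for a by (cases a) simp_all
  have 1: "(i # t, r) \<in> short_equiv UNIV h3_matrix" if "(t, Some r) \<in> set (h3_rules i)" for i t r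
    using sound[OF that] reaches_sound[OF words words] by simp
  have 2: "i # t \<in> dead_words UNIV h3_matrix (\<lambda>_. 2)" if "(t, None) \<in> set (h3_rules i)" for i t
  proof (rule dies_sound[of "\<lambda>_. 2" h3_letters h3_long i t h3_fuel])
    show "\<exists>j\<in>UNIV. i \<noteq> j \<and> h3_matrix i j \<noteq> \<infinity> \<and> 5 \<le> the_enat (h3_matrix i j) \<and> braid_word h3_matrix i j = i # t"
      if "t \<in> set (h3_long i)" for i t
      using h3_long_braid[OF that] h3_braid_words by blast
    show "dies h3_short_table h3_long h3_letters h3_fuel i t" using sound[OF that] by simp
  qed simp_all
  have 3: "reduce h3_rules h3_fuel (Some (braid_word h3_matrix a b)) =
      reduce h3_rules h3_fuel (Some (braid_word h3_matrix b a))"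
    if "a \<noteq> b" "the_enat (h3_matrix a b) < 5" for a b
    using h3_braid_words[of a b] h3_braid_words[of b a] rel(1)[of b a] that m_sym[of a b] by auto
  have 4: "reduce h3_rules h3_fuel (Some (braid_word h3_matrix a b)) = None"
    if "a \<noteq> b" "5 \<le> the_enat (h3_matrix a b)" for a b
    using h3_braid_words[of a b] rel(2)[of a] that by auto
  have 5: "reduce h3_rules h3_fuel (Some (replicate 2 a)) = None" for a
    using rel(3)[of a] by (simp add: numeral_2_eq_2)
  note count = alive_classes_groebner[of h3_letters h3_rules h3_fuel h3_index 5 "\<lambda>_. 2" h3_fuel 76,
      OF _ h3_letters h3_confluent h3_decreasing rank 1 2 3 4 5 h3_count]
  show "finite (alive_classes UNIV h3_matrix (\<lambda>_. 2))" by (rule count(1)) auto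
  have "int (card (alive_classes UNIV h3_matrix (\<lambda>_. 2))) = 76" by (rule count(2)) auto
  then show "card (alive_classes UNIV h3_matrix (\<lambda>_. 2)) = 76" by simp
qed

text \<open>The power of a Coxeter element with exponent half the Coxeter number is the longest element.\<close>

definition h3_longest :: "node3 list" where
  "h3_longest = concat [[A1, A2, A3], [A1, A2, A3], [A1, A2, A3], [A1, A2, A3], [A1, A2, A3]]"

definition h3_longest_absorbs :: bool where
  "h3_longest_absorbs \<longleftrightarrow> list_all (\<lambda>i. case pull h3_full_table h3_longest i h3_longest of
     None \<Rightarrow> False | Some z \<Rightarrow> True) h3_letters"

lemma h3_longest_absorbs: "h3_longest_absorbs" by code_simp

lemma h3_longest: "\<exists>q. (h3_longest, i # q) \<in> braid_equiv UNIV h3_matrix (\<lambda>_. True)"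
proof -
  interpret braid_table UNIV h3_matrix "\<lambda>_. True" h3_full_table by (rule h3_full_table)
  have "case pull h3_full_table h3_longest i h3_longest of None \<Rightarrow> False | Some z \<Rightarrow> True"
    using h3_longest_absorbs unfolding h3_longest_absorbs_def list_all_iff h3_letters by blast
  then obtain q where "pull h3_full_table h3_longest i h3_longest = Some q" by (auto split: option.splits)
  then show ?thesis using pull_sound[of i h3_longest] by auto
qed

definition h4_matrix :: "node4 \<Rightarrow> node4 \<Rightarrow> enat" where
  "h4_matrix a b = type_matrix Type_H4 (h4_index a) (h4_index b)"

lemma h4_letters: "set h4_letters = UNIV" "distinct h4_letters"
proof -
  show "set h4_letters = UNIV" unfolding h4_letters_def using node4.exhaust by (auto intro: node4.exhaust)
  show "distinct h4_letters" by (simp add: h4_letters_def)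
qed

lemma h4_bij: "bij_betw h4_index UNIV {1..4}"
proof (rule bij_betw_imageI)
  show "inj h4_index"
  proof (rule injI)
    fix a b assume "h4_index a = h4_index b"
    then show "a = b" by (cases a; cases b) simp_all
  qed
  have "range h4_index = h4_index ` set h4_letters" by (simp add: h4_letters)
  then show "range h4_index = {1..4}" by (auto simp: h4_letters_def)
qed

lemma h4_coxeter: "coxeter_data UNIV h4_matrix"
proof -
  have "finite (UNIV :: node4 set)" unfolding h4_letters(1)[symmetric] by simp
  moreover have "2 \<le> h4_matrix a b" if "a \<noteq> b" for a b
    using that by (cases a; cases b) (simp_all add: h4_matrix_def type_matrix_def)
  ultimately show ?thesis
    unfolding coxeter_data_def coxeter_matrix_def
    by (auto simp: h4_matrix_def type_matrix_def min.commute max.commute)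
qed

lemma h4_braid_words:
  assumes "a \<noteq> b"
  shows "h4_matrix a b \<noteq> \<infinity> \<and> (\<exists>t. h4_full_table b a = Some t \<and> braid_word h4_matrix a b = a # t \<and>
    (if the_enat (h4_matrix a b) < 5 then h4_short_table b a = Some t
     else h4_short_table b a = None \<and> t \<in> set (h4_long a)))"
  using assms
  by (cases a; cases b)
    (simp_all add: h4_matrix_def type_matrix_def braid_word_def numeral_eq_enat eval_nat_numeral)

lemma h4_long_braid: "t \<in> set (h4_long a) \<Longrightarrow>
    \<exists>b. a \<noteq> b \<and> 5 \<le> the_enat (h4_matrix a b) \<and> braid_word h4_matrix a b = a # t"
  by (cases a; simp; (rule exI[of _ B1] exI[of _ B2];
    simp add: h4_matrix_def type_matrix_def braid_word_def numeral_eq_enat eval_nat_numeral))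

lemma h4_table_diag: "h4_full_table a a = None" "h4_short_table a a = None"
  by (cases a; simp)+

lemma h4_short_table: "braid_table UNIV h4_matrix (\<lambda>k. k < 5) h4_short_table"
proof (intro braid_table.intro h4_coxeter braid_table_axioms.intro)
  fix i j t assume B: "h4_short_table i j = Some t"
  then have "j \<noteq> i" using h4_table_diag by auto
  from h4_braid_words[OF this] B this show "i \<noteq> j \<and> h4_matrix i j \<noteq> \<infinity> \<and>
      the_enat (h4_matrix i j) < 5 \<and> braid_word h4_matrix j i = j # t"
    by (auto simp: h4_matrix_def type_matrix_def min.commute max.commute split: if_splits)
qed

lemma h4_full_table: "braid_table UNIV h4_matrix (\<lambda>_. True) h4_full_table"
proof (intro braid_table.intro h4_coxeter braid_table_axioms.intro)
  fix i j t assume B: "h4_full_table i j = Some t"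
  then have "j \<noteq> i" using h4_table_diag by auto
  from h4_braid_words[OF this] B this show "i \<noteq> j \<and> h4_matrix i j \<noteq> \<infinity> \<and> True \<and>
      braid_word h4_matrix j i = j # t"
    by (auto simp: h4_matrix_def type_matrix_def min.commute max.commute split: if_splits)
qed

definition h4_relations_hold :: bool where
  "h4_relations_hold \<longleftrightarrow> list_all (\<lambda>a.
     list_all (\<lambda>b. case h4_short_table b a of None \<Rightarrow> True | Some t \<Rightarrow>
       (case h4_short_table a b of None \<Rightarrow> False | Some t' \<Rightarrow>
         reduce h4_rules h4_fuel (Some (a # t)) = reduce h4_rules h4_fuel (Some (b # t')))) h4_letters \<and>
     list_all (\<lambda>t. reduce h4_rules h4_fuel (Some (a # t)) = None) (h4_long a) \<and>
     reduce h4_rules h4_fuel (Some [a, a]) = None) h4_letters"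

lemma h4_relations_hold: "h4_relations_hold" by code_simp

theorem h4_alive_classes:
  "finite (alive_classes UNIV h4_matrix (\<lambda>_. 2))" "card (alive_classes UNIV h4_matrix (\<lambda>_. 2)) = 1460"
proof -
  interpret braid_table UNIV h4_matrix "\<lambda>k. k < 5" h4_short_table by (rule h4_short_table)
  have rel: "case h4_short_table b a of None \<Rightarrow> True | Some t \<Rightarrow>
       (case h4_short_table a b of None \<Rightarrow> False | Some t' \<Rightarrow>
         reduce h4_rules h4_fuel (Some (a # t)) = reduce h4_rules h4_fuel (Some (b # t')))"
    "\<forall>t\<in>set (h4_long a). reduce h4_rules h4_fuel (Some (a # t)) = None"
    "reduce h4_rules h4_fuel (Some [a, a]) = None" for a b
    using h4_relations_hold unfolding h4_relations_hold_def list_all_iff h4_letters by blast+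
  have sound: "case r of Some r' \<Rightarrow> reaches h4_short_table r' (i # t)
     | None \<Rightarrow> dies h4_short_table h4_long h4_letters h4_fuel i t" if "(t, r) \<in> set (h4_rules i)" for i t r
    using h4_rules_sound that unfolding h4_rules_sound_def list_all_iff h4_letters by fastforce
  have words: "u \<in> lists UNIV" for u :: "node4 list" by simp
  have rank: "h4_index a < 5" for a by (cases a) simp_all
  have 1: "(i # t, r) \<in> short_equiv UNIV h4_matrix" if "(t, Some r) \<in> set (h4_rules i)" for i t r
    using sound[OF that] reaches_sound[OF words words] by simp
  have 2: "i # t \<in> dead_words UNIV h4_matrix (\<lambda>_. 2)" if "(t, None) \<in> set (h4_rules i)" for i t
  proof (rule dies_sound[of "\<lambda>_. 2" h4_letters h4_long i t h4_fuel])
    show "\<exists>j\<in>UNIV. i \<noteq> j \<and> h4_matrix i j \<noteq> \<infinity> \<and> 5 \<le> the_enat (h4_matrix i j) \<and> braid_word h4_matrix i j = i # t"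
      if "t \<in> set (h4_long i)" for i t
      using h4_long_braid[OF that] h4_braid_words by blast
    show "dies h4_short_table h4_long h4_letters h4_fuel i t" using sound[OF that] by simp
  qed simp_all
  have 3: "reduce h4_rules h4_fuel (Some (braid_word h4_matrix a b)) =
      reduce h4_rules h4_fuel (Some (braid_word h4_matrix b a))"
    if "a \<noteq> b" "the_enat (h4_matrix a b) < 5" for a b
    using h4_braid_words[of a b] h4_braid_words[of b a] rel(1)[of b a] that m_sym[of a b] by auto
  have 4: "reduce h4_rules h4_fuel (Some (braid_word h4_matrix a b)) = None"
    if "a \<noteq> b" "5 \<le> the_enat (h4_matrix a b)" for a b
    using h4_braid_words[of a b] rel(2)[of a] that by auto
  have 5: "reduce h4_rules h4_fuel (Some (replicate 2 a)) = None" for a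
    using rel(3)[of a] by (simp add: numeral_2_eq_2)
  note count = alive_classes_groebner[of h4_letters h4_rules h4_fuel h4_index 5 "\<lambda>_. 2" h4_fuel 1460,
      OF _ h4_letters h4_confluent h4_decreasing rank 1 2 3 4 5 h4_count]
  show "finite (alive_classes UNIV h4_matrix (\<lambda>_. 2))" by (rule count(1)) auto
  have "int (card (alive_classes UNIV h4_matrix (\<lambda>_. 2))) = 1460" by (rule count(2)) auto
  then show "card (alive_classes UNIV h4_matrix (\<lambda>_. 2)) = 1460" by simp
qed

text \<open>The power of a Coxeter element with exponent half the Coxeter number is the longest element.\<close>

definition h4_longest :: "node4 list" where
  "h4_longest = concat [[B1, B2, B3, B4], [B1, B2, B3, B4], [B1, B2, B3, B4], [B1, B2, B3, B4], [B1, B2, B3, B4], [B1, B2, B3, B4], [B1, B2, B3, B4], [B1, B2, B3, B4], [B1, B2, B3, B4], [B1, B2, B3, B4], [B1, B2, B3, B4], [B1, B2, B3, B4], [B1, B2, B3, B4], [B1, B2, B3, B4], [B1, B2, B3, B4]]"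

definition h4_longest_absorbs :: bool where
  "h4_longest_absorbs \<longleftrightarrow> list_all (\<lambda>i. case pull h4_full_table h4_longest i h4_longest of
     None \<Rightarrow> False | Some z \<Rightarrow> True) h4_letters"

lemma h4_longest_absorbs: "h4_longest_absorbs" by code_simp

lemma h4_longest: "\<exists>q. (h4_longest, i # q) \<in> braid_equiv UNIV h4_matrix (\<lambda>_. True)"
proof -
  interpret braid_table UNIV h4_matrix "\<lambda>_. True" h4_full_table by (rule h4_full_table)
  have "case pull h4_full_table h4_longest i h4_longest of None \<Rightarrow> False | Some z \<Rightarrow> True"
    using h4_longest_absorbs unfolding h4_longest_absorbs_def list_all_iff h4_letters by blast
  then obtain q where "pull h4_full_table h4_longest i h4_longest = Some q" by (auto split: option.splits)
  then show ?thesis using pull_sound[of i h4_longest] by auto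
qed

theorem finite_group_relabel:
  assumes I: "coxeter_data I m" and g: "bij_betw g J I"
    and m: "\<And>i j. \<lbrakk>i \<in> J; j \<in> J\<rbrakk> \<Longrightarrow> m (g i) (g j) = m' i j"
    and p: "p \<in> lists J" "\<And>i. i \<in> J \<Longrightarrow> \<exists>q. (p, i # q) \<in> braid_equiv J m' (\<lambda>_. True)"
  shows "finite (carrier (coxeter_group I m))"
proof -
  interpret coxeter_data I m by fact
  have inj: "inj_on g J" "g ` J \<subseteq> I" using g by (auto simp: bij_betw_def)
  show ?thesis
  proof (rule finite_group_if_longest_word)
    show "map g p \<in> lists I" by (rule map_in_lists[OF inj(2) p(1)])
    fix i assume "i \<in> I"
    then obtain j where j: "j \<in> J" "i = g j" using g by (auto simp: bij_betw_def)
    obtain q where "(p, j # q) \<in> braid_equiv J m' (\<lambda>_. True)" using p(2)[OF j(1)] by blast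
    from braid_equiv_map[OF inj _ this, where m = m] m
    have "(map g p, map g (j # q)) \<in> braid_equiv I m (\<lambda>_. True)" by blast
    then show "\<exists>q. (map g p, i # q) \<in> braid_equiv I m (\<lambda>_. True)" using j(2) by auto
  qed
qed

lemma type_numbering_bij:
  assumes f: "type_numbering I m T f" and h: "bij_betw h J {1..type_rank T}"
  shows "bij_betw (f \<circ> h) J I"
    "\<lbrakk>a \<in> J; b \<in> J\<rbrakk> \<Longrightarrow> m ((f \<circ> h) a) ((f \<circ> h) b) = type_matrix T (h a) (h b)"
proof -
  show "bij_betw (f \<circ> h) J I" using f h bij_betw_trans by (auto simp: type_numbering_def)
  assume "a \<in> J" "b \<in> J"
  then have "h a \<in> {1..type_rank T}" "h b \<in> {1..type_rank T}" using h by (auto simp: bij_betw_def)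
  then show "m ((f \<circ> h) a) ((f \<circ> h) b) = type_matrix T (h a) (h b)"
    using f by (auto simp: type_numbering_def)
qed


theorem h3_type:
  assumes I: "coxeter_data I m" and T: "type_numbering I m Type_H3 f"
  shows "finite (carrier (coxeter_group I m))"
    "(\<forall>i\<in>I. d i = 2) \<Longrightarrow> finite (alive_classes I m d) \<and> card (alive_classes I m d) = 76"
proof -
  have h: "bij_betw h3_index UNIV {1..type_rank Type_H3}" using h3_bij by simp
  note g = type_numbering_bij[OF T h]
  have m: "m ((f \<circ> h3_index) a) ((f \<circ> h3_index) b) = h3_matrix a b" for a b
    using g(2) by (simp add: h3_matrix_def)
  show "finite (carrier (coxeter_group I m))"
    by (rule finite_group_relabel[OF I g(1) m, of h3_longest]) (auto intro: h3_longest)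
  assume d: "\<forall>i\<in>I. d i = 2"
  have "(f \<circ> h3_index) a \<in> I" for a using g(1) by (auto simp: bij_betw_def)
  then have "d ((f \<circ> h3_index) a) = 2" for a using d by blast
  from alive_classes_relabel[OF I g(1) m, of d "\<lambda>_. 2", OF this] h3_alive_classes
  show "finite (alive_classes I m d) \<and> card (alive_classes I m d) = 76" by simp
qed

theorem h4_type:
  assumes I: "coxeter_data I m" and T: "type_numbering I m Type_H4 f"
  shows "finite (carrier (coxeter_group I m))"
    "(\<forall>i\<in>I. d i = 2) \<Longrightarrow> finite (alive_classes I m d) \<and> card (alive_classes I m d) = 1460"
proof -
  have h: "bij_betw h4_index UNIV {1..type_rank Type_H4}" using h4_bij by simp
  note g = type_numbering_bij[OF T h]
  have m: "m ((f \<circ> h4_index) a) ((f \<circ> h4_index) b) = h4_matrix a b" for a b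
    using g(2) by (simp add: h4_matrix_def)
  show "finite (carrier (coxeter_group I m))"
    by (rule finite_group_relabel[OF I g(1) m, of h4_longest]) (auto intro: h4_longest)
  assume d: "\<forall>i\<in>I. d i = 2"
  have "(f \<circ> h4_index) a \<in> I" for a using g(1) by (auto simp: bij_betw_def)
  then have "d ((f \<circ> h4_index) a) = 2" for a using d by blast
  from alive_classes_relabel[OF I g(1) m, of d "\<lambda>_. 2", OF this] h4_alive_classes
  show "finite (alive_classes I m d) \<and> card (alive_classes I m d) = 1460" by simp
qed

section \<open>Type A with one large nilpotency degree at an end\<close>

text \<open>
  The basis elements are encoded as pairs \<open>(v, k)\<close> of a permutation \<open>v\<close> of \<open>{0..n}\<close> and a
  counter \<open>k < e\<close>, the exponent of the power of the letter \<open>1\<close> that moved \<open>0\<close> away from the front, with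
  \<open>k = 0\<close> exactly if \<open>v\<close> fixes \<open>0\<close>. A letter \<open>i\<close> swaps
  the positions \<open>i - 1\<close> and \<open>i\<close> if this creates an inversion. The letter \<open>1\<close> can moreover raise \<open>k\<close>
  while \<open>0\<close> sits at position \<open>1\<close>.
\<close>

definition swap_at :: "nat \<Rightarrow> (nat \<Rightarrow> nat) \<Rightarrow> (nat \<Rightarrow> nat)" where
  "swap_at i v = v(i - 1 := v i, i := v (i - 1))"

definition A_states :: "nat \<Rightarrow> nat \<Rightarrow> ((nat \<Rightarrow> nat) \<times> nat) set" where
  "A_states n e = {(v, k). v permutes {0..n} \<and> k < e \<and> (k = 0 \<longleftrightarrow> v 0 = 0)}"

definition A_act :: "nat \<Rightarrow> nat \<Rightarrow> (nat \<Rightarrow> nat) \<times> nat \<Rightarrow> ((nat \<Rightarrow> nat) \<times> nat) option" where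
  "A_act e i x = (case x of (v, k) \<Rightarrow>
     if v (i - 1) < v i then
       (if 1 < i then Some (swap_at i v, k) else if k \<le> 1 then Some (swap_at i v, 1) else None)
     else if i = 1 \<and> v 1 = 0 \<and> Suc k < e then Some (v, Suc k) else None)"

lemma swap_at_apply: "0 < i \<Longrightarrow> swap_at i v j = (if j = i - 1 then v i else if j = i then v (i - 1) else v j)"
  by (auto simp: swap_at_def)

lemma swap_at_swap_at [simp]: "swap_at i (swap_at i v) = v"
  by (auto simp: swap_at_def fun_eq_iff)

lemma swap_at_permutes:
  assumes "v permutes {0..n}" "1 \<le> i" "i \<le> n" shows "swap_at i v permutes {0..n}"
proof -
  have "swap_at i v = v \<circ> transpose (i - 1) i"
    using assms by (auto simp: swap_at_def fun_eq_iff transpose_def)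
  moreover have "transpose (i - 1) i permutes {0..n}" using assms by (intro permutes_swap_id) auto
  ultimately show ?thesis using assms(1) by (simp add: permutes_compose)
qed

lemma permutes_neq: "v permutes S \<Longrightarrow> a \<noteq> b \<Longrightarrow> v a \<noteq> v b"
  using permutes_inj[of v S] by (auto dest: injD)

lemma permutes_neq_previous: "v permutes S \<Longrightarrow> 1 \<le> (i :: nat) \<Longrightarrow> v i \<noteq> v (i - 1)"
proof -
  assume v: "v permutes S" and "1 \<le> i"
  then have "i \<noteq> i - 1" by linarith
  then show ?thesis by (rule permutes_neq[OF v])
qed

lemma swap_at_commute: "\<lbrakk>1 \<le> i; i + 1 < j\<rbrakk> \<Longrightarrow> swap_at i (swap_at j v) = swap_at j (swap_at i v)"
proof -
  assume "1 \<le> i" "i + 1 < j"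
  then have "i - 1 \<noteq> j - 1" "i - 1 \<noteq> j" "i \<noteq> j - 1" "i \<noteq> j" by auto
  then show ?thesis unfolding swap_at_def by (simp add: fun_upd_twist fun_upd_def fun_eq_iff)
qed

lemma swap_at_braid: "1 \<le> i \<Longrightarrow>
  swap_at i (swap_at (Suc i) (swap_at i v)) = swap_at (Suc i) (swap_at i (swap_at (Suc i) v))"
  by (rule ext) (auto simp: swap_at_apply)

locale type_A =
  fixes n e :: nat and m d
  assumes n: "1 \<le> n" and e: "2 \<le> e"
  defines "m \<equiv> type_matrix (Type_A n)"
    and "d \<equiv> (\<lambda>i :: nat. if i = 1 then e else 2)"
begin

abbreviation I where "I \<equiv> {1..n}"
abbreviation S where "S \<equiv> A_states n e"
abbreviation act where "act \<equiv> A_act e"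

lemma m_values: "m i j = (if i = j then 1 else if j = i + 1 \<or> i = j + 1 then 3 else 2)"
  by (auto simp: m_def type_matrix_def min_def max_def)

sublocale coxeter_data I m
  unfolding coxeter_data_def coxeter_matrix_def using n by (auto simp: m_values)

lemma braid_words:
  "\<lbrakk>i \<noteq> j; j \<noteq> i + 1; i \<noteq> j + 1\<rbrakk> \<Longrightarrow> braid_word m i j = [i, j]"
  "braid_word m i (Suc i) = [i, Suc i, i]" "braid_word m (Suc i) i = [Suc i, i, Suc i]"
  by (simp_all add: braid_word_def m_values numeral_eq_enat numeral_2_eq_2 numeral_3_eq_3)

lemma act_closed: "\<lbrakk>i \<in> I; x \<in> S; act i x = Some y\<rbrakk> \<Longrightarrow> y \<in> S"
proof -
  assume i: "i \<in> I" and x: "x \<in> S" and y: "act i x = Some y"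
  obtain v k where xv: "x = (v, k)" by fastforce
  have v: "v permutes {0..n}" "k < e" "k = 0 \<longleftrightarrow> v 0 = 0" using x xv by (auto simp: A_states_def)
  have sp: "swap_at i v permutes {0..n}" using swap_at_permutes v i by simp
  have "v 0 \<noteq> v 1" by (rule permutes_neq[OF v(1)]) simp
  show "y \<in> S"
    using y xv v sp e i \<open>v 0 \<noteq> v 1\<close> unfolding A_act_def A_states_def
    by (auto simp: swap_at_apply split: if_splits)
qed

lemma act_commute:
  assumes "i \<in> I" "j \<in> I" "i + 1 < j" "x \<in> S"
  shows "Option.bind (act j x) (act i) = Option.bind (act i x) (act j)"
proof -
  obtain v k where x: "x = (v, k)" by fastforce
  have j: "swap_at j v (i - 1) = v (i - 1)" "swap_at j v i = v i"
    "swap_at i v (j - 1) = v (j - 1)" "swap_at i v j = v j"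
    using assms by (auto simp: swap_at_apply)
  show ?thesis using assms j swap_at_commute[of i j v] unfolding x A_act_def by auto
qed

lemma act_braid3:
  assumes "i \<in> I" "Suc i \<in> I" "x \<in> S"
  shows "run act [i, Suc i, i] x = run act [Suc i, i, Suc i] x"
proof -
  obtain v k where x: "x = (v, k)" by fastforce
  have v: "v permutes {0..n}" "k = 0 \<longleftrightarrow> v 0 = 0" using assms x by (auto simp: A_states_def)
  have ne: "v (i - 1) \<noteq> v i" "v (i - 1) \<noteq> v (Suc i)" "v i \<noteq> v (Suc i)"
    using permutes_neq[OF v(1)] assms by auto
  note sw = swap_at_apply swap_at_braid[of i v]
  show ?thesis
  proof (cases "1 < i")
    case True
    then show ?thesis using ne unfolding x by (auto simp: A_act_def sw)
  next
    case False
    then have i: "i = 1" using assms by simp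
    show ?thesis using ne v(2) unfolding x i by (auto simp: A_act_def sw swap_at_braid[of 1 v, simplified])
  qed
qed

lemma act_one_power:
  assumes "x \<in> S" shows "run act (replicate e 1) x = None"
proof -
  have at1: "run act (replicate j 1) (v, k) = (if k + j < e then Some (v, k + j) else None)"
    if "v 1 = 0" "0 < v 0" "k < e" for v k j
  proof (induction j)
    case (Suc j)
    then show ?case using that by (auto simp: A_act_def)
  qed (use that in simp)
  obtain v k where x: "x = (v, k)" by fastforce
  have v: "v permutes {0..n}" "k < e" "k = 0 \<longleftrightarrow> v 0 = 0" using assms x by (auto simp: A_states_def)
  have ne: "v 0 \<noteq> v 1" using permutes_neq[OF v(1)] by simp
  obtain e' where e': "e = Suc (Suc e')" using e by (metis Suc_le_D numeral_2_eq_2 Suc_le_mono)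
  have end_append: "run act (replicate e 1) x = Option.bind (act 1 x) (run act (replicate (Suc e') 1))"
  proof -
    have "replicate e 1 = replicate (Suc e') 1 @ [1 :: nat]"
      using e' replicate_append_same[of "Suc e'" "1 :: nat"] by simp
    then show ?thesis by (simp only: run_append) simp
  qed
  show ?thesis
  proof (cases "v 0 < v 1")
    case True
    show ?thesis
    proof (cases "k \<le> 1")
      case k: True
      let ?v = "swap_at 1 v"
      have step: "act 1 x = Some (?v, 1)" using True k x by (simp add: A_act_def)
      have v1: "?v 0 = v 1" "?v 1 = v 0" by (simp_all add: swap_at_apply)
      show ?thesis
      proof (cases "v 0 = 0")
        case True
        then have "run act (replicate (Suc e') 1) (?v, 1) = None"
          using at1[of ?v 1 "Suc e'"] v1 \<open>v 0 < v 1\<close> e' by simp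
        then show ?thesis using end_append step by simp
      next
        case False
        then have "act 1 (?v, 1) = None" using v1 \<open>v 0 < v 1\<close> by (simp add: A_act_def)
        moreover have "run act (replicate (Suc e') 1) (?v, 1) =
            Option.bind (act 1 (?v, 1)) (run act (replicate e' 1))"
          using run_append[of act "replicate e' 1" "[1]"] replicate_append_same[of e' "1 :: nat"] by simp
        ultimately show ?thesis using end_append step by simp
      qed
    next
      case False
      then show ?thesis using end_append x True by (simp add: A_act_def)
    qed
  next
    case False
    show ?thesis
    proof (cases "v 1 = 0")
      case True
      then show ?thesis using at1[of v k e] v x False ne by simp
    next
      case nz: False
      then show ?thesis using end_append x False by (simp add: A_act_def)
    qed
  qed
qed

sublocale nil_action I m d S act
proof unfold_locales
  show "y \<in> S" if "i \<in> I" "x \<in> S" "act i x = Some y" for i x y using act_closed that by blast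
next
  fix a b x assume *: "a \<in> I" "b \<in> I" "a \<noteq> b" "x \<in> S"
  consider "a + 1 < b" | "b + 1 < a" | "b = Suc a" | "a = Suc b" using *(3) by linarith
  then show "run act (braid_word m a b) x = run act (braid_word m b a) x"
  proof cases
    case 1
    then show ?thesis using act_commute[of a b x] * by (simp add: braid_words)
  next
    case 2
    then show ?thesis using act_commute[of b a x] * by (simp add: braid_words)
  next
    case 3
    then show ?thesis using act_braid3[of a x] * by (simp only: braid_words)
  next
    case 4
    then show ?thesis using act_braid3[of b x] * by (simp only: braid_words)
  qed
next
  fix a b x assume "a \<noteq> b" "5 \<le> the_enat (m a b)"
  then show "run act (braid_word m a b) x = None"
    by (auto simp: m_values numeral_eq_enat split: if_splits)
next
  fix i x assume *: "i \<in> I" "x \<in> S"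
  show "run act (replicate (d i) i) x = None"
  proof (cases "i = 1")
    case True
    then show ?thesis using act_one_power *(2) by (simp add: d_def)
  next
    case False
    obtain v k where x: "x = (v, k)" by fastforce
    have "\<not> swap_at i v (i - 1) < swap_at i v i" if "v (i - 1) < v i"
      using that *(1) by (simp add: swap_at_apply)
    then show ?thesis using False *(1) x by (auto simp: d_def numeral_2_eq_2 A_act_def)
  qed
qed

definition start :: "(nat \<Rightarrow> nat) \<times> nat" where "start = (id, 0)"

lemma start_state: "start \<in> S"
  using e by (auto simp: start_def A_states_def permutes_id)

abbreviation reach where "reach u \<equiv> run act u start"

lemma undo_swap:
  assumes "(v, k) \<in> S" "2 \<le> i" "i \<le> n" "v i < v (i - 1)"
  shows "(swap_at i v, k) \<in> S" "act i (swap_at i v, k) = Some (v, k)"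
  using assms swap_at_permutes[of v n i] by (auto simp: A_states_def A_act_def swap_at_apply)

lemma undo_one:
  assumes "(v, 1) \<in> S" "v 1 < v 0"
  shows "(swap_at 1 v, if v 1 = 0 then 0 else 1) \<in> S"
    "act 1 (swap_at 1 v, if v 1 = 0 then 0 else 1) = Some (v, 1)"
  using assms swap_at_permutes[of v n 1] n e by (auto simp: A_states_def A_act_def swap_at_apply)

lemma undo_count:
  assumes "(v, k) \<in> S" "2 \<le> k" "v 1 = 0"
  shows "(v, k - 1) \<in> S" "act 1 (v, k - 1) = Some (v, k)"
proof -
  have "v 0 \<noteq> 0" using assms by (simp add: A_states_def)
  then show "(v, k - 1) \<in> S" "act 1 (v, k - 1) = Some (v, k)"
    using assms by (auto simp: A_states_def A_act_def)
qed

lemma act_cases: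
  assumes "act i (v, k) = Some (w, l)" "(v, k) \<in> S" "i \<in> I"
  shows "(2 \<le> i \<and> w i < w (i - 1) \<and> v = swap_at i w \<and> k = l) \<or>
     (i = 1 \<and> l = 1 \<and> w 1 < w 0 \<and> v = swap_at 1 w \<and> k = (if w 1 = 0 then 0 else 1)) \<or>
     (i = 1 \<and> 2 \<le> l \<and> w 1 = 0 \<and> 0 < w 0 \<and> v = w \<and> k = l - 1)"
proof -
  have "v 0 \<noteq> v 1" using assms(2) permutes_neq[of v "{0..n}" 0 1] by (simp add: A_states_def)
  then show ?thesis
    using assms by (auto simp: A_act_def A_states_def swap_at_apply split: if_splits)
qed

lemma act_inj:
  "\<lbrakk>x \<in> S; x' \<in> S; i \<in> I; act i x = Some y; act i x' = Some y\<rbrakk> \<Longrightarrow> x = x'"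
proof -
  assume *: "x \<in> S" "x' \<in> S" "i \<in> I" "act i x = Some y" "act i x' = Some y"
  obtain v k v' k' w l where "x = (v, k)" "x' = (v', k')" "y = (w, l)" by (metis surj_pair)
  then show "x = x'" using act_cases[of i v k w l] act_cases[of i v' k' w l] * by auto
qed

text \<open>
  Undoing one side of the braid relation from \<open>y\<close> leads to \<open>z\<close>. As letters act injectively, the two
  sides applied to \<open>z\<close> pass through \<open>x\<close> and \<open>x'\<close> before they reach \<open>y\<close>.
\<close>

lemma diamond:
  assumes x: "x \<in> S" "x' \<in> S" and ij: "i \<in> I" "j \<in> I" "i < j"
    and y: "act i x = Some y" "act j x' = Some y"
  shows "\<exists>z\<in>S. if j = Suc i then run act [j, i] z = Some x \<and> run act [i, j] z = Some x'
     else act j z = Some x \<and> act i z = Some x'"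
proof -
  obtain v k v' k' w l where eqs: "x = (v, k)" "x' = (v', k')" "y = (w, l)" by (metis surj_pair)
  have yS: "(w, l) \<in> S" using act_closed[OF ij(1) x(1) y(1)] eqs by simp
  note ci = act_cases[OF y(1)[unfolded eqs] x(1)[unfolded eqs] ij(1)]
  have j2: "2 \<le> j" "j \<le> n" using ij by auto
  have cj: "w j < w (j - 1)" "v' = swap_at j w" "k' = l"
    using act_cases[OF y(2)[unfolded eqs] x(2)[unfolded eqs] ij(2)] j2 by auto
  have injS: "x1 = x2" if "act c x1 = Some r" "act c x2 = Some r" "x1 \<in> S" "x2 \<in> S" "c \<in> I" for c x1 x2 r
    using act_inj that by blast
  show ?thesis
  proof (cases "j = Suc i")
    case False
    then have far: "i + 1 < j" using ij(3) by simp
    obtain z where z: "z \<in> S" "act i z = Some x'"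
    proof -
      have w': "swap_at j w (i - 1) = w (i - 1)" "swap_at j w i = w i" "(swap_at j w, l) \<in> S"
        using far ij x(2) eqs cj by (auto simp: swap_at_apply)
      from ci have "2 \<le> i \<and> w i < w (i - 1) \<or> i = 1 \<and> l = 1 \<and> w 1 < w 0 \<or> i = 1 \<and> 2 \<le> l \<and> w 1 = 0"
        by auto
      then show ?thesis
      proof (elim disjE)
        assume "2 \<le> i \<and> w i < w (i - 1)"
        then show ?thesis using that undo_swap[OF w'(3), of i] w' ij eqs cj by auto
      next
        assume "i = 1 \<and> l = 1 \<and> w 1 < w 0"
        then show ?thesis using that undo_one[of "swap_at j w"] w' ij eqs cj by fastforce
      next
        assume "i = 1 \<and> 2 \<le> l \<and> w 1 = 0"
        then show ?thesis using that undo_count[OF w'(3)] w' ij eqs cj by auto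
      qed
    qed
    have b: "Option.bind (act j z) (act i) = Some y"
      using act_commute[OF ij(1,2) far z(1)] z(2) y(2) by simp
    then obtain x1 where x1: "act j z = Some x1" "act i x1 = Some y" by (auto simp: bind_eq_Some_conv)
    have "x1 = x" using injS[OF x1(2) y(1)] act_closed[OF ij(2) z(1) x1(1)] x(1) ij(1) by blast
    then show ?thesis using z x1 False by auto
  next
    case True
    have l: "l = 1 \<or> 2 \<le> i"
    proof (rule ccontr)
      assume "\<not> ?thesis"
      then have "i = 1" "w 1 = 0" using ci by auto
      then show False using cj(1) True by simp
    qed
    have wi: "w i < w (i - 1)" using ci l by auto
    let ?z = "swap_at i (swap_at j (swap_at i w))"
    obtain h where z: "(?z, h) \<in> S" "run act [i, j, i] (?z, h) = Some y"
    proof (cases "2 \<le> i")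
      case i2: True
      have "?z permutes {0..n}" using yS ij swap_at_permutes by (simp add: A_states_def)
      moreover have "?z 0 = w 0" using i2 True by (simp add: swap_at_apply)
      ultimately have "(?z, l) \<in> S" using yS by (simp add: A_states_def)
      moreover have "run act [i, j, i] (?z, l) = Some y"
        using wi cj(1) i2 True eqs by (auto simp: A_act_def swap_at_apply)
      ultimately show ?thesis using that by blast
    next
      case False
      then have i1: "i = 1" "j = 2" "l = 1" using ij True l by auto
      have "?z permutes {0..n}" using yS ij swap_at_permutes by (simp add: A_states_def)
      moreover have z0: "?z 0 = w 2" "?z 1 = w 1" "?z 2 = w 0" unfolding i1 by (simp_all add: swap_at_apply)
      ultimately have "(?z, if w 2 = 0 then 0 else 1) \<in> S" using e by (simp add: A_states_def)
      moreover have "run act [i, j, i] (?z, if w 2 = 0 then 0 else 1) = Some y"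
        using wi cj(1) eqs z0 unfolding i1 by (auto simp: A_act_def swap_at_apply)
      ultimately show ?thesis using that by blast
    qed
    obtain x1 where x1: "run act [j, i] (?z, h) = Some x1" "act i x1 = Some y"
      using z(2) by (auto simp: bind_eq_Some_conv)
    have x1S: "x1 \<in> S" using run_closed[of "[j, i]" "(?z, h)" x1] ij z(1) x1(1) by simp
    have "run act [j, i, j] (?z, h) = Some y"
      using act_braid3[of i "(?z, h)"] ij z True by simp
    then obtain x2 where x2: "run act [i, j] (?z, h) = Some x2" "act j x2 = Some y"
      by (auto simp: bind_eq_Some_conv)
    have x2S: "x2 \<in> S" using run_closed[of "[i, j]" "(?z, h)" x2] ij z(1) x2(1) by simp
    have "x1 = x" "x2 = x'" using injS[OF x1(2) y(1) x1S x(1) ij(1)] injS[OF x2(2) y(2) x2S x(2) ij(2)] by auto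
    then show ?thesis using z(1) x1(1) x2(1) True by auto
  qed
qed

lemma position_of_zero:
  assumes "v permutes {0..n}" obtains p where "p \<le> n" "v p = 0"
  using permutes_image[OF assms] by (metis atLeastAtMost_iff imageE le0)

text \<open>Moving \<open>0\<close> back to the front and then sorting reaches the start from any state.\<close>

lemma predecessor:
  assumes x: "x \<in> S" "x \<noteq> start"
  shows "\<exists>i\<in>I. \<exists>z\<in>S. act i z = Some x"
proof -
  obtain v k where xv: "x = (v, k)" by fastforce
  have v: "v permutes {0..n}" "k < e" "k = 0 \<longleftrightarrow> v 0 = 0" using x xv by (auto simp: A_states_def)
  have xS: "(v, k) \<in> S" using x xv by simp
  obtain p where p: "p \<le> n" "v p = 0" by (rule position_of_zero[OF v(1)])
  consider "p = 0" | "p = 1" | "2 \<le> p" by linarith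
  then show ?thesis
  proof cases
    case 1
    have "\<exists>i. 2 \<le> i \<and> i \<le> n \<and> v i < v (i - 1)"
    proof (rule ccontr)
      assume nodesc: "\<not> ?thesis"
      have asc: "v (i - 1) < v i" if i: "1 \<le> i" "i \<le> n" for i
      proof (cases "i = 1")
        case True
        then show ?thesis using permutes_neq[OF v(1), of 1 0] 1 p by simp
      next
        case False
        then have "\<not> v i < v (i - 1)" using nodesc i by (metis Suc_1 Suc_leI le_neq_implies_less)
        then show ?thesis using permutes_neq_previous[OF v(1) i(1)] by simp
      qed
      have "i \<le> v i" if "i \<le> n" for i
        using that
      proof (induction i)
        case (Suc i)
        then show ?case using asc[of "Suc i"] by simp
      qed simp
      have "v i = i" if "i \<le> n" for i
        using that
      proof (induction "n - i" arbitrary: i)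
        case 0
        have "v n \<in> {0..n}" using permutes_in_image[OF v(1)] by simp
        then show ?case using \<open>n \<le> n \<Longrightarrow> n \<le> v n\<close> 0 by simp
      next
        case (Suc k)
        then have "v (Suc i) = Suc i" by simp
        then have "v i < Suc i" using asc[of "Suc i"] Suc by simp
        then show ?case using \<open>i \<le> n \<Longrightarrow> i \<le> v i\<close> Suc.prems by simp
      qed
      then have "v = id" using v(1) by (auto simp: fun_eq_iff permutes_def)
      then show False using x(2) xv v(3) by (simp add: start_def)
    qed
    then obtain i where "2 \<le> i" "i \<le> n" "v i < v (i - 1)" by blast
    then show ?thesis using undo_swap[OF xS] xv by fastforce
  next
    case 2
    have v0: "v 0 \<noteq> 0" using permutes_neq[OF v(1), of 0 1] p 2 by simp
    show ?thesis
    proof (cases "2 \<le> k")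
      case True
      then show ?thesis using undo_count[OF xS] p 2 xv n by fastforce
    next
      case False
      then have "k = 1" using v(3) v0 by simp
      then show ?thesis using undo_one[of v] xS p 2 xv n v0 by fastforce
    qed
  next
    case 3
    have "v p < v (p - 1)" using permutes_neq_previous[OF v(1), of p] p 3 by simp
    then show ?thesis using undo_swap[OF xS] p 3 xv by fastforce
  qed
qed

text \<open>
  Like the number of inversions plus \<open>k\<close>, the following sum grows with every letter. It changes by a
  simple amount under a swap.
\<close>

definition weight_of :: "(nat \<Rightarrow> nat) \<times> nat \<Rightarrow> nat" where
  "weight_of x = (\<Sum>i\<le>n. (n - i) * fst x i) + snd x"

lemma act_weight:
  assumes "x \<in> S" "i \<in> I" "act i x = Some y" shows "weight_of x < weight_of y"
proof -
  obtain v k w l where xy: "x = (v, k)" "y = (w, l)" by (metis surj_pair)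
  have sw: "(\<Sum>j\<le>n. (n - j) * v j) < (\<Sum>j\<le>n. (n - j) * swap_at i v j)" if lt: "v (i - 1) < v i"
  proof -
    let ?R = "{..n} - {i - 1, i}"
    have split: "(\<Sum>j\<le>n. (n - j) * f j) = (\<Sum>j\<in>?R. (n - j) * f j) + ((n - (i - 1)) * f (i - 1) + (n - i) * f i)"
      for f :: "nat \<Rightarrow> nat"
    proof -
      have "{..n} = ?R \<union> {i - 1, i}" using assms(2) by auto
      then have "(\<Sum>j\<le>n. (n - j) * f j) = (\<Sum>j\<in>?R \<union> {i - 1, i}. (n - j) * f j)" by simp
      also have "\<dots> = (\<Sum>j\<in>?R. (n - j) * f j) + (\<Sum>j\<in>{i - 1, i}. (n - j) * f j)"
        by (rule sum.union_disjoint) auto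
      also have "(\<Sum>j\<in>{i - 1, i}. (n - j) * f j) = (n - (i - 1)) * f (i - 1) + (n - i) * f i"
      proof -
        have "i - 1 \<noteq> i" using assms(2) by auto
        then show ?thesis by (subst sum.insert) auto
      qed
      finally show ?thesis .
    qed
    have R: "(\<Sum>j\<in>?R. (n - j) * swap_at i v j) = (\<Sum>j\<in>?R. (n - j) * v j)"
      using assms(2) by (intro sum.cong) (auto simp: swap_at_apply)
    define c where "c = n - i"
    have c: "n - (i - 1) = Suc c" "n - i = c" using assms(2) by (auto simp: c_def)
    have "Suc c * v (i - 1) + c * v i < Suc c * v i + c * v (i - 1)" using lt by simp
    moreover have "i \<noteq> i - 1" using assms(2) by auto
    ultimately show ?thesis unfolding split R using assms(2) c by (simp add: swap_at_apply)
  qed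
  show ?thesis
    using assms(3) sw assms(1) unfolding xy weight_of_def A_act_def A_states_def
    by (auto split: if_splits)
qed

lemma reachable: "x \<in> S \<Longrightarrow> \<exists>u\<in>lists I. reach u = Some x"
proof (induction "weight_of x" arbitrary: x rule: less_induct)
  case less
  show ?case
  proof (cases "x = start")
    case True
    then show ?thesis by (intro bexI[of _ "[]"]) auto
  next
    case False
    then obtain i z where z: "i \<in> I" "z \<in> S" "act i z = Some x" using predecessor less.prems by blast
    then obtain u where "u \<in> lists I" "reach u = Some z" using less.hyps[OF act_weight] by blast
    then show ?thesis using z by (intro bexI[of _ "i # u"]) auto
  qed
qed

lemma equiv_Cons: "(u, v) \<in> short_equiv I m \<Longrightarrow> i \<in> I \<Longrightarrow> (i # u, i # v) \<in> short_equiv I m"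
  using braid_equiv_ctxt[of u v I m _ "[i]" "[]"] by simp

lemma equiv_commute:
  "\<lbrakk>i \<in> I; j \<in> I; i + 1 < j; s \<in> lists I\<rbrakk> \<Longrightarrow> (i # j # s, j # i # s) \<in> short_equiv I m"
  using braid_equiv_move[OF braid_movesI[of "[]" I s i j m "\<lambda>k. k < 5"]]
  by (simp add: braid_words m_values numeral_eq_enat)

lemma equiv_braid3:
  "\<lbrakk>i \<in> I; Suc i \<in> I; s \<in> lists I\<rbrakk> \<Longrightarrow> (i # Suc i # i # s, Suc i # i # Suc i # s) \<in> short_equiv I m"
  using braid_equiv_move[OF braid_movesI[of "[]" I s i "Suc i" m "\<lambda>k. k < 5"]]
  by (simp add: braid_words m_values numeral_eq_enat)

text \<open>
  Induction on the state that is reached: if two words with different first letters reach it, the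
  diamond lemma completes both to the two sides of a braid relation after a common word.
\<close>

lemma reach_unique:
  "\<lbrakk>u \<in> lists I; u' \<in> lists I; reach u = Some y; reach u' = Some y\<rbrakk> \<Longrightarrow> (u, u') \<in> short_equiv I m"
proof (induction "weight_of y" arbitrary: u u' y rule: less_induct)
  case less
  \<comment> \<open>The start has the smallest weight, so no letter leads to it.\<close>
  have nonempty: "reach t \<noteq> Some start" if nt: "t \<noteq> []" "t \<in> lists I" for t
  proof
    assume h: "reach t = Some start"
    obtain i s where t: "t = i # s" using nt(1) by (meson neq_Nil_conv)
    then obtain z where z: "reach s = Some z" "act i z = Some start" using h by (auto simp: bind_eq_Some_conv)
    have "z \<in> S" using run_closed[of s start z] z t nt start_state by auto
    then have "weight_of z < weight_of start" using act_weight[OF _ _ z(2)] t nt by simp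
    moreover have "weight_of start \<le> weight_of z'" if "z' \<in> S" for z' using that
    proof (induction "weight_of z'" arbitrary: z' rule: less_induct)
      case less
      show ?case
      proof (cases "z' = start")
        case False
        then obtain c z'' where c: "c \<in> I" "z'' \<in> S" "act c z'' = Some z'"
          using predecessor less.prems by blast
        have lt: "weight_of z'' < weight_of z'" by (rule act_weight[OF c(2,1,3)])
        then have "weight_of start \<le> weight_of z''" using less.hyps c(2) by blast
        then show ?thesis using lt by simp
      qed simp
    qed
    ultimately show False using \<open>z \<in> S\<close> by (meson not_less)
  qed
  show ?case
  proof (cases "u = [] \<or> u' = []")
    case True
    then have "y = start" using less.prems by auto
    then have "u = []" "u' = []" using nonempty less.prems by blast+
    then show ?thesis by (simp add: braid_equiv_refl)
  next
    case False
    then obtain i t j t' where u: "u = i # t" "u' = j # t'" by (metis neq_Nil_conv)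
    have ij: "i \<in> I" "j \<in> I" "t \<in> lists I" "t' \<in> lists I" using less.prems u by auto
    obtain x where x: "reach t = Some x" "act i x = Some y" using less.prems u by (auto simp: bind_eq_Some_conv)
    obtain x' where x': "reach t' = Some x'" "act j x' = Some y" using less.prems u by (auto simp: bind_eq_Some_conv)
    have xS: "x \<in> S" "x' \<in> S" using run_closed start_state ij x(1) x'(1) by blast+
    note wx = act_weight[OF xS(1) ij(1) x(2)] and wx' = act_weight[OF xS(2) ij(2) x'(2)]
    have main: "(a # r, b # r') \<in> short_equiv I m"
      if ab: "a \<in> I" "b \<in> I" "a < b" "r \<in> lists I" "r' \<in> lists I" "reach r = Some q" "reach r' = Some q'"
        "act a q = Some y" "act b q' = Some y" "q \<in> S" "q' \<in> S" for a b r r' q q'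
    proof -
      note wq = act_weight[OF ab(10,1,8)] act_weight[OF ab(11,2,9)]
      obtain z where z: "z \<in> S" "if b = Suc a then run act [b, a] z = Some q \<and> run act [a, b] z = Some q'
          else act b z = Some q \<and> act a z = Some q'" using diamond[OF ab(10,11,1,2,3,8,9)] by blast
      obtain s where s: "s \<in> lists I" "reach s = Some z" using reachable[OF z(1)] by blast
      show ?thesis
      proof (cases "b = Suc a")
        case True
        have "reach (b # a # s) = Some q" "reach (a # b # s) = Some q'"
          using z True s run_append[of act "[b, a]" s start] run_append[of act "[a, b]" s start] by auto
        then have "(r, b # a # s) \<in> short_equiv I m" "(a # b # s, r') \<in> short_equiv I m"
          using less.hyps[OF wq(1)] less.hyps[OF wq(2)] ab s by auto
        then have "(a # r, a # b # a # s) \<in> short_equiv I m" "(b # a # b # s, b # r') \<in> short_equiv I m"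
          using equiv_Cons ab by auto
        then show ?thesis using equiv_braid3[of a s] ab s True braid_equiv_trans by blast
      next
        case False
        have "reach (b # s) = Some q" "reach (a # s) = Some q'" using z False s by auto
        then have "(r, b # s) \<in> short_equiv I m" "(a # s, r') \<in> short_equiv I m"
          using less.hyps[OF wq(1)] less.hyps[OF wq(2)] ab s by auto
        then have "(a # r, a # b # s) \<in> short_equiv I m" "(b # a # s, b # r') \<in> short_equiv I m"
          using equiv_Cons ab by auto
        moreover have "(a # b # s, b # a # s) \<in> short_equiv I m" using equiv_commute ab s False by simp
        ultimately show ?thesis using braid_equiv_trans by blast
      qed
    qed
    consider "i = j" | "i < j" | "j < i" by linarith
    then show ?thesis
    proof cases
      case 1
      then have "x = x'" using act_inj[OF xS ij(1) x(2)] x'(2) by simp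
      then have "(t, t') \<in> short_equiv I m" using less.hyps[OF wx ij(3,4) x(1)] x'(1) by simp
      then show ?thesis using u 1 equiv_Cons ij by simp
    next
      case 2
      then show ?thesis using main[of i j t t' x x'] ij x x' xS u by simp
    next
      case 3
      then show ?thesis using main[of j i t' t x' x] ij x x' xS u braid_equiv_sym by simp
    qed
  qed
qed

lemma dead_Cons: "u \<in> dead_words I m d \<Longrightarrow> i \<in> I \<Longrightarrow> i # u \<in> dead_words I m d"
  using dead_words_ctxt[of u d "[i]" "[]"] by simp

lemma dead_square: "\<lbrakk>2 \<le> i; i \<in> I; s \<in> lists I\<rbrakk> \<Longrightarrow> i # i # s \<in> dead_words I m d"
proof -
  assume i: "2 \<le> i" "i \<in> I" "s \<in> lists I"
  then have "[] @ [i, i] @ s \<in> null_words I m d" by (intro null_words_square) (auto simp: d_def)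
  from null_words_dead[OF this] show ?thesis by simp
qed

lemma equiv_dead: "(u, v) \<in> short_equiv I m \<Longrightarrow> v \<in> dead_words I m d \<Longrightarrow> u \<in> dead_words I m d"
  using dead_words_equiv braid_equiv_sym by blast

text \<open>
  The words \<open>1 2 1 1\<close> vanish, as \<open>(1 2 1) 1 = 2 (1 2 1) = 2 2 1 2\<close>. So the letter \<open>1\<close> kills a
  word in which \<open>0\<close> has moved beyond position \<open>1\<close> after a power of \<open>1\<close>. If positions \<open>0\<close> and \<open>1\<close> are
  inverted, then \<open>1\<close> completes \<open>1 2 1 2\<close>, which vanishes as \<open>(1 2 1) 2 = 2 1 (2 2)\<close>.
\<close>

lemma one_dead:
  assumes "t \<in> lists I" "reach t = Some (v, k)" "v 0 \<noteq> 0" "v 1 \<noteq> 0" "2 \<le> k \<or> v 1 < v 0"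
  shows "1 # t \<in> dead_words I m d"
  using assms
proof (induction "weight_of (v, k)" arbitrary: t v k rule: less_induct)
  case less
  have I1: "1 \<in> I" using n by simp
  have xS: "(v, k) \<in> S" using run_closed[OF less.prems(1) start_state less.prems(2)] .
  have v: "v permutes {0..n}" "1 \<le> k" "k < e" using xS less.prems(3) by (auto simp: A_states_def)
  obtain p where p: "p \<le> n" "v p = 0" by (rule position_of_zero[OF v(1)])
  have p2: "2 \<le> p" using p less.prems by (cases p; cases "p - 1") auto
  then have pI: "p \<in> I" "2 \<in> I" using p by auto
  have desc: "v p < v (p - 1)" using permutes_neq_previous[OF v(1), of p] p p2 by simp
  let ?z = "(swap_at p v, k)"
  have z: "?z \<in> S" "act p ?z = Some (v, k)" using undo_swap[OF xS p2 p(1) desc] by auto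
  obtain s where s: "s \<in> lists I" "reach s = Some ?z" using reachable[OF z(1)] by blast
  have tps: "(t, p # s) \<in> short_equiv I m"
    using less.prems s z pI by (intro reach_unique[of t "p # s" "(v, k)"]) auto
  have 1: "(1 # t, 1 # p # s) \<in> short_equiv I m" by (rule equiv_Cons[OF tps I1])
  \<comment> \<open>The last letter may be taken to be \<open>p\<close>, which commutes with \<open>1\<close> if \<open>p > 2\<close>.\<close>
  show ?case
  proof (cases "p = 2")
    case False
    then have p3: "1 + 1 < p" using p2 by simp
    have "1 # s \<in> dead_words I m d"
    proof (rule less.hyps[OF act_weight[OF z(1) pI(1) z(2)] s])
      have "swap_at p v 0 = v 0" "swap_at p v 1 = v 1" using p3 by (auto simp: swap_at_apply)
      then show "swap_at p v 0 \<noteq> 0" "swap_at p v 1 \<noteq> 0" "2 \<le> k \<or> swap_at p v 1 < swap_at p v 0"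
        using less.prems by auto
    qed
    then have "p # 1 # s \<in> dead_words I m d" using dead_Cons pI by simp
    then have "1 # p # s \<in> dead_words I m d" using equiv_dead[OF equiv_commute[OF I1 pI(1) p3 s(1)]] by simp
    then show ?thesis using equiv_dead[OF 1] by simp
  next
    case True
    let ?w = "swap_at 2 v"
    have w: "?w 0 = v 0" "?w 1 = 0" "?w 2 = v 1" using p True by (simp_all add: swap_at_apply)
    have wS: "(?w, k) \<in> S" using z True by simp
    have b: "(1 # 2 # 1 # r, 2 # 1 # 2 # r) \<in> short_equiv I m" if "r \<in> lists I" for r
      using equiv_braid3[of 1 r] I1 pI that by (simp add: numeral_2_eq_2)
    obtain r where r: "r \<in> lists I" "(s, 1 # r) \<in> short_equiv I m" "2 # 1 # 2 # r \<in> dead_words I m d"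
    proof (cases "2 \<le> k")
      case k2: True
      have y: "(?w, k - 1) \<in> S" "act 1 (?w, k - 1) = Some (?w, k)" using undo_count[OF wS k2 w(2)] by auto
      obtain y' where y': "y' \<in> S" "act 1 y' = Some (?w, k - 1)"
      proof (cases "2 \<le> k - 1")
        case True
        then show ?thesis using that undo_count[OF y(1) True w(2)] by blast
      next
        case False
        then have "k - 1 = 1" using k2 by simp
        then show ?thesis using that undo_one[of ?w] y(1) w less.prems(3) by simp
      qed
      obtain q where q: "q \<in> lists I" "reach q = Some y'" using reachable[OF y'(1)] by blast
      have "reach (1 # 1 # q) = Some (?w, k)" using q y y' by simp
      then have "(s, 1 # 1 # q) \<in> short_equiv I m"
        using s True q I1 by (intro reach_unique[of s "1 # 1 # q" "(?w, k)"]) auto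
      moreover have "2 # 1 # 2 # 1 # q \<in> dead_words I m d"
      proof -
        have "2 # 2 # 1 # 2 # q \<in> dead_words I m d" using dead_square[of 2] pI I1 q by simp
        then show ?thesis using equiv_dead[OF equiv_Cons[OF b[OF q(1)] pI(2)]] by simp
      qed
      ultimately show ?thesis using that[of "1 # q"] q I1 by simp
    next
      case False
      then have k1: "k = 1" using v by simp
      then have lt: "v 1 < v 0" using less.prems(5) by simp
      let ?y = "(swap_at 1 ?w, 0)"
      have y: "?y \<in> S" "act 1 ?y = Some (?w, k)" using undo_one[of ?w] wS w less.prems(3) k1 by auto
      have y2: "swap_at 1 ?w 1 = v 0" "swap_at 1 ?w 2 = v 1" using w by (simp_all add: swap_at_apply)
      have n2: "2 \<le> n" using pI by simp
      have d: "swap_at 1 ?w 2 < swap_at 1 ?w (2 - 1)" using y2 lt by simp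
      note y'' = undo_swap[OF y(1) order.refl n2 d]
      obtain q where q: "q \<in> lists I" "reach q = Some (swap_at 2 (swap_at 1 ?w), 0)" using reachable[OF y''(1)] by blast
      have "reach (1 # 2 # q) = Some (?w, k)" using q y y'' by simp
      then have "(s, 1 # 2 # q) \<in> short_equiv I m"
        using s True q I1 pI by (intro reach_unique[of s "1 # 2 # q" "(?w, k)"]) auto
      moreover have "2 # 1 # 2 # 2 # q \<in> dead_words I m d"
        using dead_Cons[OF dead_Cons[OF dead_square[OF _ pI(2) q(1)] I1] pI(2)] by simp
      ultimately show ?thesis using that[of "2 # q"] q pI by simp
    qed
    have "(1 # 2 # s, 1 # 2 # 1 # r) \<in> short_equiv I m" using equiv_Cons[OF equiv_Cons[OF r(2) pI(2)] I1] .
    then have "1 # 2 # s \<in> dead_words I m d" using equiv_dead b[OF r(1)] r(3) by blast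
    then show ?thesis using equiv_dead[OF 1] True by simp
  qed
qed

text \<open>
  If a letter does not act on the state reached by a word, then the word can be rewritten such that the
  letter completes a square, the full power of \<open>1\<close>, or the situation of \<open>one_dead\<close>.
\<close>

lemma unreachable_dead: "u \<in> lists I \<Longrightarrow> reach u = None \<Longrightarrow> u \<in> dead_words I m d"
proof (induction u rule: list.induct)
  case (Cons i t)
  have i: "i \<in> I" "t \<in> lists I" using Cons.prems by auto
  show ?case
  proof (cases "reach t")
    case None
    then show ?thesis using Cons i dead_Cons by blast
  next
    case (Some x)
    obtain v k where x: "x = (v, k)" by fastforce
    have xS: "(v, k) \<in> S" using run_closed[OF i(2) start_state Some] x by simp
    have v: "v permutes {0..n}" "k < e" "k = 0 \<longleftrightarrow> v 0 = 0" using xS by (auto simp: A_states_def)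
    have none: "act i (v, k) = None" using Cons.prems Some x by simp
    show ?thesis
    proof (cases "i = 1")
      case False
      then have i2: "2 \<le> i" "i \<le> n" using i by auto
      have "v i < v (i - 1)" using none i2 permutes_neq_previous[OF v(1), of i] by (auto simp: A_act_def split: if_splits)
      note z = undo_swap[OF xS i2 this]
      obtain s where s: "s \<in> lists I" "reach s = Some (swap_at i v, k)" using reachable[OF z(1)] by blast
      have "(t, i # s) \<in> short_equiv I m"
        using s z i Some x by (intro reach_unique[of t "i # s" "(v, k)"]) auto
      then show ?thesis using equiv_dead[OF equiv_Cons] dead_square i2 i s by blast
    next
      case i1: True
      have ne: "v 0 \<noteq> v 1" using permutes_neq[OF v(1)] by simp
      show ?thesis
      proof (cases "v 1 = 0")
        case True
        then have v0: "v 0 \<noteq> 0" using ne by simp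
        then have k: "k + 1 = e" "1 \<le> k" using none i1 True v by (auto simp: A_act_def split: if_splits)
        let ?y = "(swap_at 1 v, 0)"
        have y: "?y \<in> S" "act 1 ?y = Some (v, 1)"
          using undo_one[of v] v k True v0 e by (auto simp: A_states_def)
        obtain s where s: "s \<in> lists I" "reach s = Some ?y" using reachable[OF y(1)] by blast
        have "reach (replicate (Suc j) 1 @ s) = Some (v, Suc j)" if "Suc j < e" for j
          using that
        proof (induction j)
          case 0
          then show ?case using s y by simp
        next
          case (Suc j)
          then show ?case using True v0 by (simp add: A_act_def)
        qed
        from this[of "k - 1"] have "reach (replicate k 1 @ s) = Some (v, k)" using k v by simp
        moreover have rep: "replicate k 1 @ s \<in> lists I" using s n by auto
        ultimately have "(t, replicate k 1 @ s) \<in> short_equiv I m"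
          using reach_unique[OF i(2) rep, of "(v, k)"] Some x by simp
        then have "(1 # t, 1 # replicate k 1 @ s) \<in> short_equiv I m" using equiv_Cons i i1 by simp
        moreover have "1 # replicate k 1 @ s \<in> dead_words I m d"
        proof -
          have I1: "1 \<in> I" using n by simp
          have "replicate (d 1) (1 :: nat) = 1 # replicate k 1" using k(1) by (auto simp: d_def)
          moreover have "replicate (d 1) 1 \<in> monomial_relators I m d"
            unfolding monomial_relators_def using I1 by blast
          ultimately have "1 # replicate k 1 \<in> monomial_relators I m d" by (simp only:)
          then have "[] @ (1 # replicate k 1) @ s \<in> null_words I m d"
            unfolding null_words_def using s(1) lists.Nil by blast
          from null_words_dead[OF this] show ?thesis by simp
        qed
        ultimately show ?thesis using equiv_dead i1 by simp
      next
        case False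
        have "v 0 \<noteq> 0" using none i1 v ne by (auto simp: A_act_def split: if_splits)
        moreover have "2 \<le> k \<or> v 1 < v 0" using none i1 v ne by (auto simp: A_act_def split: if_splits)
        ultimately show ?thesis using one_dead[OF i(2)] Some x i1 False by simp
      qed
    qed
  qed
qed simp

text \<open>
  The \<open>n!\<close> permutations that fix \<open>0\<close> occur with one value of \<open>k\<close>, and the other \<open>n n!\<close> permutations with
  \<open>e - 1\<close> values.
\<close>

lemma card_states: "card S = fact n * (1 + n * (e - 1))" "finite S"
proof -
  let ?P = "{v. v permutes {0..n}}" and ?Q = "{v. v permutes {1..n}}"
  have finP: "finite ?P" by (rule finite_permutations) simp
  have sub: "?Q \<subseteq> ?P" by (auto intro: permutes_subset)
  have Q: "?Q = {v \<in> ?P. v 0 = 0}"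
  proof (intro equalityI subsetI)
    fix v assume "v \<in> ?Q"
    then show "v \<in> {v \<in> ?P. v 0 = 0}" using sub permutes_not_in[of v "{1..n}" 0] by auto
  next
    fix v assume "v \<in> {v \<in> ?P. v 0 = 0}"
    then have v: "v permutes {0..n}" "v 0 = 0" by auto
    have "v permutes {1..n}"
    proof (rule permutes_superset[OF v(1)])
      fix x assume "x \<in> {0..n} - {1..n}"
      then have "x = 0" by auto
      then show "v x = x" using v(2) by simp
    qed
    then show "v \<in> ?Q" by simp
  qed
  have cP: "card ?P = fact (Suc n)" by (rule card_permutations) auto
  have cQ: "card ?Q = fact n" by (rule card_permutations) auto
  have S: "S = ?Q \<times> {0} \<union> (?P - ?Q) \<times> {1..<e}"
    using e unfolding Q by (auto simp: A_states_def)
  have fQ: "finite ?Q" using finP sub finite_subset by blast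
  show "finite S" unfolding S using finP fQ by auto
  have "card S = card (?Q \<times> {0 :: nat}) + card ((?P - ?Q) \<times> {1..<e})"
    unfolding S using finP fQ by (intro card_Un_disjoint) auto
  also have "\<dots> = fact n + (fact (Suc n) - fact n) * (e - 1)"
    using card_Diff_subset[OF fQ sub] cP cQ by (simp add: card_cartesian_product)
  also have "\<dots> = fact n * (1 + n * (e - 1))" by (simp add: algebra_simps)
  finally show "card S = fact n * (1 + n * (e - 1))" .
qed

theorem alive_classes_type_A:
  "card (alive_classes I m d) = fact n * (1 + n * (e - 1))" "finite (alive_classes I m d)"
proof -
  define c where "c x = (SOME u. u \<in> lists I \<and> reach u = Some x)" for x
  have nf: "(u, c x) \<in> short_equiv I m" if u: "u \<in> lists I" "reach u = Some x" for u x
  proof -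
    have "u \<in> lists I \<and> reach u = Some x" using u by (rule conjI)
    then have c: "c x \<in> lists I \<and> reach (c x) = Some x" unfolding c_def by (rule someI)
    show ?thesis by (rule reach_unique[OF u(1) c[THEN conjunct1] u(2) c[THEN conjunct2]])
  qed
  have X: "{x. \<exists>u\<in>lists I. reach u = Some x} = S"
  proof (intro equalityI subsetI)
    fix x assume "x \<in> {x. \<exists>u\<in>lists I. reach u = Some x}"
    then obtain u where "u \<in> lists I" "reach u = Some x" by blast
    then show "x \<in> S" by (rule run_closed[OF _ start_state])
  next
    fix x assume "x \<in> S"
    then show "x \<in> {x. \<exists>u\<in>lists I. reach u = Some x}" using reachable[of x] by simp
  qed
  note inv = alive_classes_invariant[of reach d c, OF run_move[OF _ start_state] run_null[OF _ start_state]
      nf unreachable_dead, unfolded X]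
  show "card (alive_classes I m d) = fact n * (1 + n * (e - 1))"
    unfolding card_states(1)[symmetric] by (rule inv(1))
  show "finite (alive_classes I m d)" by (rule iffD2[OF inv(2) card_states(2)])
qed

end

section \<open>Rank two\<close>

locale dihedral_data = coxeter_data I m for I :: "'i set" and m +
  fixes a b :: 'i and k :: nat and d :: "'i \<Rightarrow> nat"
  assumes I_ab: "I = {a, b}" "a \<noteq> b" and m_ab: "m a b = enat k" and d2: "d a = 2" "d b = 2"
begin

lemma k2: "2 \<le> k"
  using m_ge_2[of a b] I_ab m_ab by (simp add: numeral_eq_enat)

lemma braid_ab: "braid_word m a b = alt k a b" "braid_word m b a = alt k b a"
proof -
  have "m b a = enat k" using m_sym[of b a] m_ab I_ab by simp
  then show "braid_word m a b = alt k a b" "braid_word m b a = alt k b a"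
    using m_ab by (simp_all add: braid_word_def)
qed

definition alternates :: "'i list \<Rightarrow> bool" where
  "alternates u \<longleftrightarrow> u = alt (length u) a b \<or> u = alt (length u) b a"

lemma not_alternates_square: "u \<in> lists I \<Longrightarrow> \<not> alternates u \<Longrightarrow> \<exists>p i q. u = p @ [i, i] @ q"
proof (induction u rule: list.induct)
  case (Cons i v)
  show ?case
  proof (cases "alternates v")
    case False
    then obtain p j q where "v = p @ [j, j] @ q" using Cons by auto
    then show ?thesis by (intro exI[of _ "i # p"]) auto
  next
    case True
    then obtain x y where v: "v = alt (length v) x y" "{x, y} = {a, b}" unfolding alternates_def by blast
    have i: "i = x \<or> i = y" using Cons.prems(1) v(2) I_ab by auto
    show ?thesis
    proof (cases v)
      case Nil
      then show ?thesis using Cons.prems I_ab by (auto simp: alternates_def)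
    next
      case v': (Cons c w)
      then have c: "c = x" using v(1) by simp
      show ?thesis
      proof (cases "i = x")
        case True
        then show ?thesis using v' c by (intro exI[of _ "[]"]) auto
      next
        case False
        then have "i # v = alt (length (i # v)) y x" using i v(1) by simp
        moreover have "(y = a \<and> x = b) \<or> (y = b \<and> x = a)" using v(2) I_ab(2) by (auto simp: doubleton_eq_iff)
        ultimately have "alternates (i # v)" unfolding alternates_def by metis
        then show ?thesis using Cons.prems by simp
      qed
    qed
  qed
qed (simp add: alternates_def)

lemma alt_no_square: "x \<noteq> y \<Longrightarrow> alt n x y \<noteq> p @ [i, i] @ q"
proof (induction p arbitrary: n x y)
  case Nil
  show ?case
  proof
    assume h: "alt n x y = [] @ [i, i] @ q"
    then obtain n' where "n = Suc (Suc n')" by (cases n; cases "n - 1") auto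
    then show False using h Nil by auto
  qed
next
  case (Cons c p)
  show ?case
  proof
    assume h: "alt n x y = (c # p) @ [i, i] @ q"
    then obtain n' where "n = Suc n'" by (cases n) auto
    then have "alt n' y x = p @ [i, i] @ q" using h by auto
    then show False using Cons.IH[of y x n'] Cons.prems by simp
  qed
qed

lemma alternates_no_square: "\<not> alternates (p @ [i, i] @ q)"
  unfolding alternates_def using alt_no_square[of a b] alt_no_square[of b a] I_ab(2) by metis

definition state :: "'i list \<Rightarrow> 'i list option" where
  "state u = (if \<not> alternates u then None else if length u < k then Some u
     else if length u = k \<and> k < 5 then Some (alt k a b) else None)"

definition state_set :: "'i list set" where
  "state_set = (\<lambda>n. alt n a b) ` (if k < 5 then {..k} else {..<k}) \<union> (\<lambda>n. alt n b a) ` {1..<k}"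

lemma card_state_set: "card state_set = (if k < 5 then 2 * k else 2 * k - 1)" "finite state_set"
proof -
  have inj: "inj_on (\<lambda>n. alt n x y) A" for x y A
    by (rule inj_onI) (metis length_alternating_word)
  have "(\<lambda>n. alt n a b) ` A \<inter> (\<lambda>n. alt n b a) ` {1..<k} = {}" for A
  proof -
    have "alt n a b \<noteq> alt n' b a" if "1 \<le> n'" for n n'
    proof
      assume h: "alt n a b = alt n' b a"
      then have "n = n'" by (metis length_alternating_word)
      then show False using h that I_ab(2) by (cases n') auto
    qed
    then show ?thesis by auto
  qed
  then have "card state_set = card (if k < 5 then {..k} else {..<k}) + card {1..<k}"
    unfolding state_set_def by (subst card_Un_disjoint) (auto simp: card_image[OF inj])
  then show "card state_set = (if k < 5 then 2 * k else 2 * k - 1)" using k2 by auto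
  show "finite state_set" unfolding state_set_def by auto
qed

lemma letters: "a \<in> I" "b \<in> I" using I_ab by auto

lemma long_dead:
  assumes u: "u \<in> lists I" "alternates u" "k \<le> length u" "5 \<le> k \<or> k < length u"
  shows "u \<in> dead_words I m d"
proof -
  obtain x y where xy: "u = alt (length u) x y" "{x, y} = {a, b}" using u(2) unfolding alternates_def by blast
  have xyI: "x \<in> I" "y \<in> I" "x \<noteq> y" using xy(2) I_ab by auto
  have bw: "braid_word m x y = alt k x y" "braid_word m y x = alt k y x" "m x y = enat k"
    using xy(2) braid_ab m_ab m_sym[OF letters] by (auto simp: doubleton_eq_iff)
  define r where "r = length u - k"
  have split: "u = alt k x y @ (if even k then alt r x y else alt r y x)"
    using xy(1) alt_add[of k r x y] u(3) by (simp add: r_def)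
  let ?z = "if even k then alt r x y else alt r y x"
  have zI: "?z \<in> lists I" using xyI by auto
  show ?thesis
  proof (cases "5 \<le> k")
    case True
    have "braid_word m x y \<in> monomial_relators I m d"
      unfolding monomial_relators_def using xyI bw(3) True by force
    then have "[] @ braid_word m x y @ ?z \<in> null_words I m d" unfolding null_words_def using zI by blast
    from null_words_dead[OF this] show ?thesis using split bw by simp
  next
    case False
    then have k5: "k < 5" "k < length u" using u(4) by auto
    then obtain r' where r': "r = Suc r'" unfolding r_def by (metis Suc_diff_Suc)
    obtain k' where k': "k = Suc k'" using k2 by (cases k) auto
    define c where "c = (if even k then x else y)"
    obtain w where w: "?z = c # w" using r' by (cases "even k") (auto simp: c_def)
    have last: "alt k y x = alt k' y x @ [c]" unfolding k' alt_Suc_right using k' by (simp add: c_def)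
    have "([] @ braid_word m x y @ ?z, [] @ braid_word m y x @ ?z) \<in> braid_moves I m (\<lambda>k. k < 5)"
      using xyI zI bw(3) k5 by (intro braid_movesI) auto
    then have eq: "(u, alt k' y x @ [c, c] @ w) \<in> short_equiv I m"
      using braid_equiv_move split bw last w by fastforce
    have "c \<in> I" "w \<in> lists I" using w zI xyI by (auto simp: c_def)
    moreover have "d c = 2" using d2 I_ab \<open>c \<in> I\<close> by auto
    ultimately have "alt k' y x @ [c, c] @ w \<in> null_words I m d" using xyI by (intro null_words_square) auto
    then show ?thesis unfolding dead_words_def using eq by blast
  qed
qed

text \<open>
  Only alternating words avoid squares, and those longer than \<open>k\<close> are dead. At length \<open>k\<close> itself there are
  two alternating words, which are equivalent if \<open>k < 5\<close> and vanish otherwise.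
\<close>

theorem alive_classes_dihedral:
  "finite (alive_classes I m d)" "card (alive_classes I m d) = (if k < 5 then 2 * k else 2 * k - 1)"
proof -
  have move: "state u = state v" if uv: "(u, v) \<in> braid_moves I m (\<lambda>k. k < 5)" for u v
  proof -
    from uv obtain p q x y where *: "u = p @ braid_word m x y @ q" "v = p @ braid_word m y x @ q"
      "x \<in> I" "y \<in> I" "x \<noteq> y" "m x y \<noteq> \<infinity>" "the_enat (m x y) < 5"
      unfolding braid_moves_def by blast
    have xy: "(x = a \<and> y = b) \<or> (x = b \<and> y = a)" using *(3-5) I_ab by auto
    have bw: "braid_word m x y = alt k x y" "braid_word m y x = alt k y x" "k < 5"
      using xy braid_ab m_ab m_sym[OF letters] *(7) by auto
    show ?thesis
    proof (cases "p = [] \<and> q = []")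
      case True
      then show ?thesis using * bw xy by (auto simp: state_def alternates_def)
    next
      case False
      then have "k < length u" "k < length v" using * bw by auto
      then show ?thesis by (simp add: state_def)
    qed
  qed
  have null: "state u = None" if "u \<in> null_words I m d" for u
  proof -
    from that obtain p r q where *: "u = p @ r @ q" "r \<in> monomial_relators I m d"
      unfolding null_words_def by blast
    from *(2) consider i where "r = replicate (d i) i" "i \<in> I"
      | x y where "r = braid_word m x y" "x \<in> I" "y \<in> I" "x \<noteq> y" "5 \<le> the_enat (m x y)"
      unfolding monomial_relators_def by blast
    then show ?thesis
    proof cases
      case 1
      then have "r = [i, i]" using d2 I_ab by (auto simp: numeral_2_eq_2)
      then show ?thesis using * alternates_no_square by (simp add: state_def)
    next
      case 2
      then have "(x = a \<and> y = b) \<or> (x = b \<and> y = a)" using I_ab by auto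
      then have "length r = k" "5 \<le> k" using 2 m_ab m_sym[OF letters] by auto
      then show ?thesis using *(1) by (simp add: state_def)
    qed
  qed
  have nf: "(u, x) \<in> short_equiv I m" if u: "u \<in> lists I" "state u = Some x" for u x
  proof (cases "length u < k")
    case True
    then show ?thesis using u by (auto simp: state_def braid_equiv_refl split: if_splits)
  next
    case False
    then have *: "length u = k" "k < 5" "x = alt k a b" "alternates u" using u by (auto simp: state_def split: if_splits)
    have "([] @ braid_word m b a @ [], [] @ braid_word m a b @ []) \<in> braid_moves I m (\<lambda>k. k < 5)"
      using letters I_ab m_ab m_sym[OF letters] * by (intro braid_movesI) auto
    then have "(alt k b a, alt k a b) \<in> short_equiv I m" using braid_equiv_move braid_ab by fastforce
    moreover have "(alt k a b, alt k a b) \<in> short_equiv I m" using letters by (intro braid_equiv_refl) simp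
    ultimately show ?thesis using * unfolding alternates_def by auto
  qed
  have dead: "u \<in> dead_words I m d" if u: "u \<in> lists I" "state u = None" for u
  proof (cases "alternates u")
    case True
    then show ?thesis using u long_dead[of u] by (auto simp: state_def split: if_splits)
  next
    case False
    then obtain p i q where *: "u = p @ [i, i] @ q" using not_alternates_square u(1) by blast
    then have "i \<in> I" "p \<in> lists I" "q \<in> lists I" "d i = 2" using u(1) d2 I_ab by auto
    then show ?thesis using null_words_dead null_words_square * by blast
  qed
  have X: "{x. \<exists>u\<in>lists I. state u = Some x} = state_set"
  proof (intro equalityI subsetI)
    fix x assume "x \<in> {x. \<exists>u\<in>lists I. state u = Some x}"
    then obtain u where u: "state u = Some x" by blast
    then have "alternates u" "length u < k \<and> x = u \<or> k < 5 \<and> x = alt k a b"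
      by (auto simp: state_def split: if_splits)
    moreover have "u \<in> state_set" if lt: "length u < k" and al: "alternates u"
    proof (cases "u = alt (length u) a b")
      case True
      then show ?thesis unfolding state_set_def using lt by (intro UnI1 image_eqI[of _ _ "length u"]) auto
    next
      case False
      then have b: "u = alt (length u) b a" using al by (auto simp: alternates_def)
      then have "u \<noteq> []" using False by auto
      then show ?thesis unfolding state_set_def using lt b
        by (intro UnI2 image_eqI[of _ _ "length u"]) (auto simp: Suc_le_eq)
    qed
    moreover have "k < 5 \<Longrightarrow> alt k a b \<in> state_set" unfolding state_set_def by auto
    ultimately show "x \<in> state_set" by auto
  next
    fix x assume "x \<in> state_set"
    then have "\<exists>n. x = alt n a b \<and> (n < k \<or> k < 5 \<and> n = k) \<or> x = alt n b a \<and> n < k"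
      unfolding state_set_def
    proof
      assume "x \<in> (\<lambda>n. alt n a b) ` (if k < 5 then {..k} else {..<k})"
      then obtain n where "x = alt n a b" "n \<in> (if k < 5 then {..k} else {..<k})" by blast
      then show ?thesis by (intro exI[of _ n]) (auto simp: le_less split: if_splits)
    next
      assume "x \<in> (\<lambda>n. alt n b a) ` {1..<k}"
      then obtain n where "x = alt n b a" "n < k" by auto
      then show ?thesis by (intro exI[of _ n]) simp
    qed
    then obtain n where n: "x = alt n a b \<and> (n < k \<or> k < 5 \<and> n = k) \<or> x = alt n b a \<and> n < k" ..
    have x: "x \<in> lists I" using n letters alternating_word_in by metis
    have "alternates x" "length x < k \<or> k < 5 \<and> x = alt k a b" using n by (auto simp: alternates_def)
    then have "state x = Some x" by (auto simp: state_def)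
    then show "x \<in> {x. \<exists>u\<in>lists I. state u = Some x}" using x(1) by blast
  qed
  note inv = alive_classes_invariant[of state d "\<lambda>x. x", OF move null nf dead, unfolded X]
  show "finite (alive_classes I m d)" by (rule iffD2[OF inv(2) card_state_set(2)])
  show "card (alive_classes I m d) = (if k < 5 then 2 * k else 2 * k - 1)"
    unfolding card_state_set(1)[symmetric] by (rule inv(1))
qed

theorem finite_dihedral_group: "finite (carrier (coxeter_group I m))"
proof (rule finite_group_if_longest_word)
  show "alt k a b \<in> lists I" using letters by simp
  fix i assume "i \<in> I"
  then consider "i = a" | "i = b" using I_ab by auto
  moreover obtain k' where k': "k = Suc k'" using k2 by (cases k) auto
  moreover have "([] @ braid_word m a b @ [], [] @ braid_word m b a @ []) \<in> braid_moves I m (\<lambda>_. True)"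
    using letters I_ab m_ab by (intro braid_movesI) auto
  then have "(alt k a b, alt k b a) \<in> braid_equiv I m (\<lambda>_. True)" using braid_equiv_move braid_ab by fastforce
  moreover have "(alt k a b, alt k a b) \<in> braid_equiv I m (\<lambda>_. True)" using letters by (intro braid_equiv_refl) simp
  ultimately show "\<exists>q. (alt k a b, i # q) \<in> braid_equiv I m (\<lambda>_. True)" by cases auto
qed

end

section \<open>Infinite families of alive words\<close>

text \<open>
  An endless sequence of blocks of pairwise commuting letters, given by a successor function on
  an index set. A word that runs through the blocks only admits braid moves inside the blocks, provided
  that letters of consecutive blocks do not commute and that alternating stretches are too short for a
  braid relation.
\<close>

locale block_sequence = coxeter_data I m for I :: "'i set" and m +
  fixes d :: "'i \<Rightarrow> nat" and K :: "'k set" and succ :: "'k \<Rightarrow> 'k" and B :: "'k \<Rightarrow> 'i set"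
  assumes K: "K \<noteq> {}" "\<And>\<kappa>. \<kappa> \<in> K \<Longrightarrow> succ \<kappa> \<in> K"
    and d: "\<And>i. i \<in> I \<Longrightarrow> 2 \<le> d i"
    and B: "\<And>\<kappa>. \<kappa> \<in> K \<Longrightarrow> B \<kappa> \<noteq> {} \<and> B \<kappa> \<subseteq> I"
    and linked: "\<And>\<kappa> a b. \<lbrakk>\<kappa> \<in> K; a \<in> B \<kappa>; b \<in> B (succ \<kappa>); a \<noteq> b\<rbrakk> \<Longrightarrow> 3 \<le> m a b"
    and commuting: "\<And>\<kappa> a b. \<lbrakk>\<kappa> \<in> K; a \<in> B \<kappa>; b \<in> B \<kappa>; a \<noteq> b\<rbrakk> \<Longrightarrow> m a b = 2"
    and repeated: "\<And>\<kappa> a. \<lbrakk>\<kappa> \<in> K; a \<in> B \<kappa>; a \<in> B (succ \<kappa>)\<rbrakk> \<Longrightarrow> 2 < d a \<and> a \<notin> B (succ (succ \<kappa>))"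
    and bounce3: "\<And>\<kappa> a b. \<lbrakk>\<kappa> \<in> K; a \<in> B \<kappa>; B (succ \<kappa>) = {b}; a \<in> B (succ (succ \<kappa>)); a \<noteq> b\<rbrakk> \<Longrightarrow> 4 \<le> m a b"
    and bounce4: "\<And>\<kappa> a b. \<lbrakk>\<kappa> \<in> K; a \<in> B \<kappa>; B (succ \<kappa>) = {b}; B (succ (succ \<kappa>)) = {a};
        b \<in> B (succ (succ (succ \<kappa>))); a \<noteq> b\<rbrakk> \<Longrightarrow> 6 \<le> m a b"
    and bounce6: "\<And>\<kappa> a b. \<lbrakk>\<kappa> \<in> K; a \<in> B \<kappa>; B (succ \<kappa>) = {b}; B (succ (succ \<kappa>)) = {a};
        B (succ (succ (succ \<kappa>))) = {b}; B (succ (succ (succ (succ \<kappa>)))) = {a};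
        b \<in> B (succ (succ (succ (succ (succ \<kappa>))))); a \<noteq> b\<rbrakk> \<Longrightarrow> False"
begin

text \<open>
  In the state \<open>(\<kappa>, R)\<close> the letters \<open>R\<close> of the block at \<open>\<kappa>\<close> are still to be read, in any order; after the
  last of them the next block begins.
\<close>

definition block_act :: "'i \<Rightarrow> 'k \<times> 'i set \<Rightarrow> ('k \<times> 'i set) option" where
  "block_act i x = (case x of (\<kappa>, R) \<Rightarrow> if i \<notin> R then None
     else if R = {i} then Some (succ \<kappa>, B (succ \<kappa>)) else Some (\<kappa>, R - {i}))"

definition block_states :: "('k \<times> 'i set) set" where
  "block_states = {(\<kappa>, R). \<kappa> \<in> K \<and> R \<noteq> {} \<and> R \<subseteq> B \<kappa>}"

lemma block_act_closed: "x \<in> block_states \<Longrightarrow> block_act i x = Some y \<Longrightarrow> y \<in> block_states"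
  using K(2) B by (auto simp: block_states_def block_act_def split: prod.splits if_splits)

lemma two_steps:
  assumes "(\<kappa>, R) \<in> block_states" "block_act a (\<kappa>, R) = Some y" "block_act b y = Some z" "a \<noteq> b" "m a b \<noteq> 2"
  shows "a \<in> B \<kappa>" "y = (succ \<kappa>, B (succ \<kappa>))" "b \<in> B (succ \<kappa>)" "succ \<kappa> \<in> K" "R = {a}"
proof -
  have R: "\<kappa> \<in> K" "R \<subseteq> B \<kappa>" "a \<in> R" using assms(1,2) by (auto simp: block_states_def block_act_def split: if_splits)
  show "R = {a}"
  proof (rule ccontr)
    assume "R \<noteq> {a}"
    then have "y = (\<kappa>, R - {a})" using assms(2) R by (auto simp: block_act_def)
    then have "b \<in> R" using assms(3) by (auto simp: block_act_def split: if_splits)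
    then show False using commuting[OF R(1), of a b] R assms(4,5) by auto
  qed
  then show y: "y = (succ \<kappa>, B (succ \<kappa>))" using assms(2) by (auto simp: block_act_def)
  show "a \<in> B \<kappa>" "succ \<kappa> \<in> K" using R K(2) by auto
  show "b \<in> B (succ \<kappa>)" using assms(3) y by (auto simp: block_act_def split: if_splits)
qed

text \<open>
  The reversal lists the letters in the order in which they act. A letter that does not commute with the
  next one must be the last letter of its block, as the letters of a block commute.
\<close>

lemma alternating_stretch:
  assumes "a \<noteq> b" "m a b \<noteq> 2" "m b a \<noteq> 2" "x \<in> block_states"
    "run block_act (rev (alt (Suc (Suc n)) a b)) x = Some y"
  shows "\<exists>\<kappa>\<in>K. a \<in> B \<kappa> \<and> fst x = \<kappa> \<and> snd x = {a} \<and>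
     run block_act (rev (alt (Suc n) b a)) (succ \<kappa>, B (succ \<kappa>)) = Some y \<and> b \<in> B (succ \<kappa>)"
proof -
  obtain \<kappa> R where x: "x = (\<kappa>, R)" by fastforce
  have "rev (alt (Suc (Suc n)) a b) = (rev (alt n a b) @ [b]) @ [a]" by simp
  then obtain z where z: "block_act a x = Some z" "run block_act (rev (alt n a b) @ [b]) z = Some y"
    using assms(5) by (auto simp: run_append bind_eq_Some_conv)
  then obtain w where w: "block_act b z = Some w" by (auto simp: run_append bind_eq_Some_conv)
  note ts = two_steps[OF assms(4)[unfolded x] z(1)[unfolded x] w assms(1,2)]
  have "\<kappa> \<in> K" using assms(4) x by (simp add: block_states_def)
  then show ?thesis using ts z(2) x by (intro bexI[of _ \<kappa>]) auto
qed

text \<open>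
  Reading \<open>a b a\<close> requires a bounce, which the label \<open>3\<close> forbids; longer alternating stretches
  require several bounces in a row.
\<close>

lemma no_braid:
  assumes ab: "a \<in> I" "b \<in> I" "a \<noteq> b" and m3: "3 \<le> m a b" and x: "x \<in> block_states"
  shows "m a b = 3 \<Longrightarrow> run block_act (rev (alt 3 a b)) x = None"
    "m a b < 6 \<Longrightarrow> run block_act (rev (alt 4 a b)) x = None"
    "run block_act (rev (alt 6 a b)) x = None"
proof -
  have m2: "m a b \<noteq> 2" "m b a \<noteq> 2" using m3 m_sym[OF ab(1,2)] by auto
  have states: "(\<kappa>, B \<kappa>) \<in> block_states" if "\<kappa> \<in> K" for \<kappa> using that B by (auto simp: block_states_def)
  note st = alternating_stretch[OF ab(3) m2] alternating_stretch[OF ab(3)[symmetric] m2(2,1)]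
  have three: "\<exists>\<kappa>\<in>K. a \<in> B \<kappa> \<and> B (succ \<kappa>) = {b} \<and> a \<in> B (succ (succ \<kappa>)) \<and>
      run block_act (rev (alt (Suc n) a b)) (succ (succ \<kappa>), B (succ (succ \<kappa>))) = Some y"
    if h: "run block_act (rev (alt (Suc (Suc (Suc n))) a b)) x = Some y" for n y
  proof -
    obtain \<kappa> where 1: "\<kappa> \<in> K" "a \<in> B \<kappa>" "run block_act (rev (alt (Suc (Suc n)) b a)) (succ \<kappa>, B (succ \<kappa>)) = Some y"
      using st(1)[OF x h] by blast
    have k1: "succ \<kappa> \<in> K" using K(2) 1 by blast
    from st(2)[OF states[OF k1] 1(3)] show ?thesis using 1 by auto
  qed
  have five: "\<exists>\<kappa>\<in>K. a \<in> B \<kappa> \<and> B (succ \<kappa>) = {b} \<and> B (succ (succ \<kappa>)) = {a} \<and> b \<in> B (succ (succ (succ \<kappa>))) \<and>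
      run block_act (rev (alt (Suc n) b a)) (succ (succ (succ \<kappa>)), B (succ (succ (succ \<kappa>)))) = Some y"
    if h: "run block_act (rev (alt (Suc (Suc (Suc (Suc n)))) a b)) x = Some y" for n y
  proof -
    obtain \<kappa> where 1: "\<kappa> \<in> K" "a \<in> B \<kappa>" "B (succ \<kappa>) = {b}" "a \<in> B (succ (succ \<kappa>))"
      "run block_act (rev (alt (Suc (Suc n)) a b)) (succ (succ \<kappa>), B (succ (succ \<kappa>))) = Some y"
      using three[OF h] by blast
    have k2: "succ (succ \<kappa>) \<in> K" using K(2) 1 by blast
    from st(1)[OF states[OF k2] 1(5)] show ?thesis using 1 by auto
  qed
  show "run block_act (rev (alt 3 a b)) x = None" if m: "m a b = 3"
  proof (rule ccontr)
    assume "run block_act (rev (alt 3 a b)) x \<noteq> None"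
    then obtain y where "run block_act (rev (alt (Suc (Suc (Suc 0))) a b)) x = Some y"
      by (auto simp: numeral_3_eq_3)
    from three[OF this] obtain \<kappa> where "\<kappa> \<in> K" "a \<in> B \<kappa>" "B (succ \<kappa>) = {b}" "a \<in> B (succ (succ \<kappa>))" by blast
    then have "4 \<le> m a b" using bounce3 ab(3) by blast
    then show False using m by simp
  qed
  show "run block_act (rev (alt 4 a b)) x = None" if m: "m a b < 6"
  proof (rule ccontr)
    assume "run block_act (rev (alt 4 a b)) x \<noteq> None"
    then obtain y where "run block_act (rev (alt (Suc (Suc (Suc (Suc 0)))) a b)) x = Some y"
      by (auto simp: eval_nat_numeral)
    from five[OF this] obtain \<kappa> where "\<kappa> \<in> K" "a \<in> B \<kappa>" "B (succ \<kappa>) = {b}" "B (succ (succ \<kappa>)) = {a}"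
      "b \<in> B (succ (succ (succ \<kappa>)))" by blast
    then have "6 \<le> m a b" using bounce4 ab(3) by blast
    then show False using m by simp
  qed
  show "run block_act (rev (alt 6 a b)) x = None"
  proof (rule ccontr)
    assume "run block_act (rev (alt 6 a b)) x \<noteq> None"
    then obtain y where h: "run block_act (rev (alt (Suc (Suc (Suc (Suc (Suc (Suc 0)))))) a b)) x = Some y"
      by (auto simp: eval_nat_numeral)
    from five[OF h] obtain \<kappa> where 1: "\<kappa> \<in> K" "a \<in> B \<kappa>" "B (succ \<kappa>) = {b}" "B (succ (succ \<kappa>)) = {a}"
      "run block_act (rev (alt (Suc (Suc (Suc 0))) b a)) (succ (succ (succ \<kappa>)), B (succ (succ (succ \<kappa>)))) = Some y" by blast
    have k: "succ (succ (succ \<kappa>)) \<in> K" "succ (succ (succ (succ \<kappa>))) \<in> K" using K(2) 1 by blast+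
    from st(2)[OF states[OF k(1)] 1(5)] have 2: "B (succ (succ (succ \<kappa>))) = {b}"
      "run block_act (rev (alt (Suc (Suc 0)) a b)) (succ (succ (succ (succ \<kappa>))), B (succ (succ (succ (succ \<kappa>))))) = Some y"
      by auto
    from st(1)[OF states[OF k(2)] 2(2)] have 3: "B (succ (succ (succ (succ \<kappa>)))) = {a}"
      "b \<in> B (succ (succ (succ (succ (succ \<kappa>)))))" by auto
    show False using bounce6[OF 1(1-4) 2(1) 3 ab(3)] .
  qed
qed

lemma run_suffix_None: "run act v x = None \<Longrightarrow> run act (u @ v) x = None"
  by (simp add: run_append)

lemma braid_None:
  assumes ab: "a \<in> I" "b \<in> I" "a \<noteq> b" and m: "3 \<le> m a b" "m a b \<noteq> \<infinity>" and x: "x \<in> block_states"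
  shows "run block_act (braid_word m a b) x = None"
proof -
  obtain n where n: "m a b = enat n" using m(2) by auto
  have n3: "3 \<le> n" using m(1) n by (simp add: numeral_eq_enat)
  have ba: "3 \<le> m b a" "m b a = enat n" using m(1) m_sym[OF ab(1,2)] n by auto
  have m3: "3 \<le> m c e" if "m c e = enat n" for c e using that n3 by (simp add: numeral_eq_enat)
  have short: "\<exists>j\<in>{3, 4, 6}. j \<le> n \<and> (\<forall>c\<in>I. \<forall>e\<in>I. c \<noteq> e \<longrightarrow> m c e = enat n \<longrightarrow>
      run block_act (rev (alt j c e)) x = None)"
  proof -
    consider "n = 3" | "4 \<le> n" "n < 6" | "6 \<le> n" using n3 by linarith
    then show ?thesis
    proof cases
      case 1
      have "run block_act (rev (alt 3 c e)) x = None" if "c \<in> I" "e \<in> I" "c \<noteq> e" "m c e = enat n" for c e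
        using no_braid(1)[OF that(1-3) m3[OF that(4)] x] that(4) 1 by (simp add: numeral_eq_enat)
      then show ?thesis using 1 by auto
    next
      case 2
      have "run block_act (rev (alt 4 c e)) x = None" if "c \<in> I" "e \<in> I" "c \<noteq> e" "m c e = enat n" for c e
        using no_braid(2)[OF that(1-3) m3[OF that(4)] x] that(4) 2 by (simp add: numeral_eq_enat)
      then show ?thesis using 2 by auto
    next
      case 3
      have "run block_act (rev (alt 6 c e)) x = None" if "c \<in> I" "e \<in> I" "c \<noteq> e" "m c e = enat n" for c e
        using no_braid(3)[OF that(1-3) m3[OF that(4)] x] .
      then show ?thesis using 3 by auto
    qed
  qed
  then obtain j where j: "j \<le> n" "\<And>c e. \<lbrakk>c \<in> I; e \<in> I; c \<noteq> e; m c e = enat n\<rbrakk> \<Longrightarrow>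
      run block_act (rev (alt j c e)) x = None" by blast
  have all: "run block_act (alt j c e) x = None" if ce: "c \<in> I" "e \<in> I" "c \<noteq> e" "m c e = enat n" "m e c = enat n" for c e
  proof (cases "even j")
    case True
    then have "alt j c e = rev (alt j e c)" by (simp add: rev_alt)
    then show ?thesis using j(2)[of e c] ce by simp
  next
    case False
    then have "alt j c e = rev (alt j c e)" by (simp add: rev_alt)
    then show ?thesis using j(2)[of c e] ce by simp
  qed
  have "alt n a b = alt (n - j) a b @ (if even (n - j) then alt j a b else alt j b a)"
    using alt_add[of "n - j" j a b] j(1) by simp
  moreover have "run block_act (if even (n - j) then alt j a b else alt j b a) x = None"
    using all[of a b] all[of b a] ab n ba(2) by simp
  ultimately have "run block_act (alt n a b) x = None" by (simp only: run_suffix_None)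
  then show ?thesis using n by (simp add: braid_word_def)
qed

lemma block_commute:
  assumes ab: "a \<in> I" "b \<in> I" "a \<noteq> b" "m a b = 2" and x: "x \<in> block_states"
  shows "Option.bind (block_act b x) (block_act a) = Option.bind (block_act a x) (block_act b)"
proof -
  obtain \<kappa> R where xR: "x = (\<kappa>, R)" by fastforce
  have K: "\<kappa> \<in> K" "R \<subseteq> B \<kappa>" using x xR by (auto simp: block_states_def)
  have no: "b \<notin> B (succ \<kappa>)" if "a \<in> R" "m a b = 2" "a \<noteq> b" for a b
  proof
    assume "b \<in> B (succ \<kappa>)"
    then have "3 \<le> m a b" using linked[OF K(1)] that K(2) by blast
    then show False using that(2) by simp
  qed
  have "m b a = 2" using ab m_sym[OF ab(1,2)] by simp
  then show ?thesis
    using no[of a b] no[of b a] ab unfolding xR block_act_def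
    by (auto simp: Diff_insert2[symmetric] insert_commute split: if_splits)
qed

lemma nil_action_blocks: "nil_action I m d block_states block_act"
proof unfold_locales
  show "y \<in> block_states" if "i \<in> I" "x \<in> block_states" "block_act i x = Some y" for i x y
    using block_act_closed that by blast
next
  fix a b x assume *: "a \<in> I" "b \<in> I" "a \<noteq> b" "m a b \<noteq> \<infinity>" "x \<in> block_states"
  show "run block_act (braid_word m a b) x = run block_act (braid_word m b a) x"
  proof (cases "m a b = 2")
    case True
    then have "braid_word m a b = [a, b]" "braid_word m b a = [b, a]"
      using m_sym[OF *(1,2)] by (simp_all add: braid_word_def numeral_eq_enat numeral_2_eq_2)
    then show ?thesis using block_commute[OF *(1-3) True *(5)] by simp
  next
    case False
    then have "3 \<le> m a b" using m_ge_2[OF *(1-3)] *(4) by (auto simp: numeral_eq_enat)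
    then show ?thesis using braid_None[of a b x] braid_None[of b a x] * m_sym[OF *(1,2)] by simp
  qed
next
  fix a b x assume *: "a \<in> I" "b \<in> I" "a \<noteq> b" "m a b \<noteq> \<infinity>" "5 \<le> the_enat (m a b)" "x \<in> block_states"
  then have "3 \<le> m a b" by (auto simp: numeral_eq_enat)
  then show "run block_act (braid_word m a b) x = None" using braid_None * by blast
next
  fix i x assume i: "i \<in> I" and x: "x \<in> block_states"
  obtain \<kappa> R where xR: "x = (\<kappa>, R)" by fastforce
  have K: "\<kappa> \<in> K" "R \<subseteq> B \<kappa>" using x xR by (auto simp: block_states_def)
  have two: "2 < d i \<and> block_act i z = None" if "block_act i x = Some y" "block_act i y = Some z" for y z
    using that repeated[OF K(1), of i] K xR by (auto simp: block_act_def split: if_splits)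
  have three: "run block_act [i, i, i] x = None"
  proof (cases "block_act i x")
    case (Some y)
    then show ?thesis using two[OF Some] by (cases "block_act i y") auto
  qed simp
  have "run block_act [i, i] x = None \<or> 2 < d i"
  proof (cases "block_act i x")
    case (Some y)
    then show ?thesis using two[OF Some] by (cases "block_act i y") auto
  qed simp
  then show "run block_act (replicate (d i) i) x = None"
  proof
    assume h: "run block_act [i, i] x = None"
    have "d i = (d i - 2) + 2" using d[OF i] by simp
    then have "replicate (d i) i = replicate (d i - 2) i @ replicate 2 i" by (metis replicate_add)
    then have "replicate (d i) i = replicate (d i - 2) i @ [i, i]" by (simp add: numeral_2_eq_2)
    then show ?thesis using h by (simp only: run_suffix_None)
  next
    assume "2 < d i"
    then have "d i = (d i - 3) + 3" by simp
    then have "replicate (d i) i = replicate (d i - 3) i @ replicate 3 i" by (metis replicate_add)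
    then have "replicate (d i) i = replicate (d i - 3) i @ [i, i, i]" by (simp add: numeral_3_eq_3)
    then show ?thesis using three by (simp only: run_suffix_None)
  qed
qed

theorem infinite_blocks: "infinite (alive_classes I m d)"
proof (rule infinite_alive_classes)
  interpret A: nil_action I m d block_states block_act by (rule nil_action_blocks)
  obtain \<kappa> where "\<kappa> \<in> K" using K(1) by blast
  then have start: "(\<kappa>, B \<kappa>) \<in> block_states" using B by (auto simp: block_states_def)
  fix n
  have "\<exists>u\<in>lists I. length u = n \<and> (\<exists>y\<in>block_states. run block_act u (\<kappa>, B \<kappa>) = Some y)"
  proof (induction n)
    case 0
    then show ?case using start by (intro bexI[of _ "[]"]) auto
  next
    case (Suc n)
    then obtain u \<kappa>' R where u: "u \<in> lists I" "length u = n" "(\<kappa>', R) \<in> block_states"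
      "run block_act u (\<kappa>, B \<kappa>) = Some (\<kappa>', R)" by auto
    obtain i where i: "i \<in> R" "i \<in> I" using u(3) B by (auto simp: block_states_def)
    then have "block_act i (\<kappa>', R) \<noteq> None" by (simp add: block_act_def)
    then obtain y where y: "block_act i (\<kappa>', R) = Some y" by blast
    then show ?case using u i block_act_closed[OF u(3) y] by (intro bexI[of _ "i # u"]) auto
  qed
  then obtain u where u: "u \<in> lists I" "length u = n" "run block_act u (\<kappa>, B \<kappa>) \<noteq> None" by auto
  then have "u \<notin> dead_words I m d" using A.run_dead[OF _ start, of u] by auto
  then show "\<exists>u\<in>lists I. n \<le> length u \<and> u \<notin> dead_words I m d" using u by blast
qed

end

section \<open>Infinite examples given by finite tables\<close>

locale nil_Hecke_data = coxeter_data I m for I :: "'i set" and m +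
  fixes d :: "'i \<Rightarrow> nat"
  assumes d_ge_2: "i \<in> I \<Longrightarrow> 2 \<le> d i"

definition table_act :: "(int \<times> int) list list \<Rightarrow> nat \<Rightarrow> int \<Rightarrow> int option" where
  "table_act T i = map_of (T ! i)"

text \<open>An entry \<open>5\<close> of \<open>c\<close> stands for all labels from \<open>5\<close> on, including infinity.\<close>

definition table_ok :: "(int \<times> int) list list \<Rightarrow> (nat \<Rightarrow> nat \<Rightarrow> nat) \<Rightarrow> int list \<Rightarrow> bool" where
  "table_ok T c xs \<longleftrightarrow>
     list_all (\<lambda>x. list_all (\<lambda>a. run (table_act T) [a, a] x = None \<and>
       list_all (\<lambda>b. if a = b then True
         else if c a b = 5 then run (table_act T) (alt 5 a b) x = None
         else run (table_act T) (alt (c a b) a b) x = run (table_act T) (alt (c a b) b a) x)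
       [0..<length T]) [0..<length T]) xs \<and>
     list_all (list_all (\<lambda>e. snd e \<in> set xs)) T"

context nil_Hecke_data
begin

text \<open>
  The table is an action of the nil-Hecke algebra of the vertices in \<open>L\<close>, and \<open>p\<close> can be repeated without
  end from the state \<open>x\<close>.
\<close>

lemma infinite_if_table:
  assumes T: "table_ok T c xs" "T \<noteq> []"
    and L: "distinct L" "set L \<subseteq> I" "length L = length T"
    and m: "\<And>a b. \<lbrakk>a < length T; b < length T; a \<noteq> b\<rbrakk> \<Longrightarrow>
      c a b < 5 \<and> m (L ! a) (L ! b) = enat (c a b) \<or> c a b = 5 \<and> 5 \<le> m (L ! a) (L ! b)"
    and x: "x \<in> set xs"
    and p: "p \<in> lists {..<length T}" "p \<noteq> []" "run (table_act T) p x = Some x"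
  shows "infinite (alive_classes I m d)"
proof
  assume fin: "finite (alive_classes I m d)"
  have "set L \<noteq> {}" using L(3) T(2) by auto
  note sub = L(2) this
  have pos: "\<forall>i\<in>I. 0 < d i" using d_ge_2 by force
  let ?J = "{..<length T}" and ?m = "\<lambda>a b. m (L ! a) (L ! b)" and ?d = "\<lambda>a. d (L ! a)"
  have bij: "bij_betw ((!) L) ?J (set L)" by (rule bij_betw_nth[OF L(1)]) (simp_all add: L(3))
  have fin': "finite (alive_classes ?J ?m ?d)"
    using alive_classes_relabel(2)[OF parabolic[OF sub] bij, of ?m d ?d]
      finite_alive_parabolic[OF sub pos fin] by simp
  interpret J: coxeter_data ?J ?m by (rule coxeter_data_relabel[OF parabolic[OF sub] bij]) simp
  have ok: "run (table_act T) [a, a] y = None"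
    "a \<noteq> b \<Longrightarrow> c a b = 5 \<Longrightarrow> run (table_act T) (alt 5 a b) y = None"
    "a \<noteq> b \<Longrightarrow> c a b \<noteq> 5 \<Longrightarrow> run (table_act T) (alt (c a b) a b) y = run (table_act T) (alt (c a b) b a) y"
    if "a \<in> ?J" "b \<in> ?J" "y \<in> set xs" for a b y
  proof -
    have ab: "a \<in> set [0..<length T]" "b \<in> set [0..<length T]" using that by auto
    show "run (table_act T) [a, a] y = None"
      using T(1) that(3) ab unfolding table_ok_def list_all_iff by blast
    have "if a = b then True else if c a b = 5 then run (table_act T) (alt 5 a b) y = None
        else run (table_act T) (alt (c a b) a b) y = run (table_act T) (alt (c a b) b a) y"
      using T(1) that(3) ab unfolding table_ok_def list_all_iff by blast
    then show "a \<noteq> b \<Longrightarrow> c a b = 5 \<Longrightarrow> run (table_act T) (alt 5 a b) y = None"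
      "a \<noteq> b \<Longrightarrow> c a b \<noteq> 5 \<Longrightarrow> run (table_act T) (alt (c a b) a b) y = run (table_act T) (alt (c a b) b a) y"
      by simp_all
  qed
  have sym: "m (L ! a) (L ! b) = m (L ! b) (L ! a)" if "a \<in> ?J" "b \<in> ?J" for a b
    using J.m_sym[of a b] that by blast
  interpret nil_action ?J ?m ?d "set xs" "table_act T"
  proof unfold_locales
    fix i y z assume "i \<in> ?J" "y \<in> set xs" "table_act T i y = Some z"
    then have "(y, z) \<in> set (T ! i)" "T ! i \<in> set T" by (auto simp: table_act_def dest: map_of_SomeD)
    then show "z \<in> set xs" using T(1) unfolding table_ok_def list_all_iff by force
  next
    fix a b y assume *: "a \<in> ?J" "b \<in> ?J" "a \<noteq> b" "?m a b \<noteq> \<infinity>" "the_enat (?m a b) < 5" "y \<in> set xs"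
    then have "c a b < 5" "?m a b = enat (c a b)" "?m b a = enat (c a b)"
      using m[of a b] sym[OF *(1,2)] by (auto simp: numeral_eq_enat)
    then show "run (table_act T) (braid_word ?m a b) y = run (table_act T) (braid_word ?m b a) y"
      using ok(3)[OF *(1,2,6,3)] by (simp add: braid_word_def)
  next
    fix a b y assume *: "a \<in> ?J" "b \<in> ?J" "a \<noteq> b" "?m a b \<noteq> \<infinity>" "5 \<le> the_enat (?m a b)" "y \<in> set xs"
    then have c: "c a b = 5" "c b a = 5"
      using m[of a b] m[of b a] sym[OF *(1,2)] by (auto simp: numeral_eq_enat)
    define k where "k = the_enat (?m a b)"
    have "alt k a b = alt (k - 5) a b @ (if even (k - 5) then alt 5 a b else alt 5 b a)"
      using alt_add[of "k - 5" 5 a b] *(5) by (simp add: k_def)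
    moreover have "run (table_act T) (if even (k - 5) then alt 5 a b else alt 5 b a) y = None"
      using ok(2)[OF *(1,2,6,3) c(1)] ok(2)[OF *(2,1,6) *(3)[symmetric] c(2)] by simp
    ultimately have "run (table_act T) (alt k a b) y = None" by (simp only: run_append Option.bind.simps)
    then show "run (table_act T) (braid_word ?m a b) y = None" by (simp add: braid_word_def k_def)
  next
    fix a y assume *: "a \<in> ?J" "y \<in> set xs"
    then have "L ! a \<in> I" using L by auto
    then have "?d a = (?d a - 2) + 2" using d_ge_2 by force
    then have "replicate (?d a) a = replicate (?d a - 2) a @ replicate 2 a" by (metis replicate_add)
    then have "replicate (?d a) a = replicate (?d a - 2) a @ [a, a]" by (simp add: numeral_2_eq_2)
    then show "run (table_act T) (replicate (?d a) a) y = None"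
      using ok(1)[OF *(1,1,2)] by (simp only: run_append Option.bind.simps)
  qed
  show False using cycle_infinite[OF x p] fin' by blast
qed

end

text \<open>Labels of a path in which the edge from \<open>e\<close> to \<open>e + 1\<close> is heavy.\<close>

definition path_labels :: "nat \<Rightarrow> nat \<Rightarrow> nat \<Rightarrow> nat" where
  "path_labels e a b = (if a = Suc b \<or> b = Suc a then (if min a b = e then 5 else 3) else 2)"

text \<open>
  The states are the positions in the word \<open>x a b y a b\<close>, repeated periodically, up to the exchange of commuting
  letters. On the path \<open>x, a, b, y\<close> with letters \<open>0\<close> to \<open>3\<close> they never admit more than four
  alternating letters \<open>a\<close> and \<open>b\<close>.
\<close>

definition middle_table :: "(int \<times> int) list list" where
  "middle_table =
     [[(0, 1), (4, 6), (7, 8)],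
      [(1, 2), (3, 4), (5, 7)],
      [(2, 3), (7, 0), (8, 1)],
      [(3, 5), (4, 7), (6, 8)]]"

definition middle_states :: "int list" where "middle_states = [0, 1, 2, 3, 4, 5, 6, 7, 8]"

lemma middle_table_ok: "table_ok middle_table (path_labels 1) middle_states"
  "run (table_act middle_table) [2, 1, 3, 2, 1, 0] 0 = Some 0"
  by code_simp+

text \<open>
  The states are the elements of the group with diagram \<open>5, 3, 3, 3\<close> represented by the final segments
  of reduced words of the powers of \<open>4 2 3 1 2 1 0 1 0\<close>, far from the start and up to multiplication by one
  period.
\<close>

definition h5_table :: "(int \<times> int) list list" where
  "h5_table =
     [[(5, 8), (6, 7), (12, 13), (17, 19), (18, 20), (24, 25), (29, 32), (30, 31), (36, 38), (37, 39),
       (42, 45), (43, 46), (44, 47), (50, 53), (51, 54), (52, 55), (58, 0), (59, 1)],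
      [(0, 9), (1, 12), (7, 14), (8, 17), (11, 18), (13, 21), (16, 24), (19, 26), (20, 29), (23, 30),
       (25, 36), (28, 37), (31, 42), (34, 43), (35, 44), (39, 49), (40, 50), (41, 51), (46, 56), (47, 57),
       (48, 58), (53, 2), (54, 3), (55, 6)],
      [(0, 8), (2, 10), (3, 11), (9, 16), (12, 18), (13, 20), (14, 22), (15, 23), (17, 24), (19, 25),
       (21, 28), (26, 34), (27, 35), (29, 37), (32, 39), (33, 40), (36, 43), (38, 46), (42, 52), (45, 55),
       (51, 59), (54, 1), (57, 4), (58, 5)],
      [(2, 9), (6, 12), (7, 13), (10, 15), (14, 21), (16, 23), (22, 27), (24, 30), (25, 31), (28, 35),
       (34, 41), (36, 42), (37, 44), (38, 45), (39, 47), (40, 48), (43, 51), (46, 54), (49, 57), (50, 58),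
       (52, 59), (53, 0), (55, 1), (56, 3)],
      [(1, 8), (3, 9), (4, 10), (11, 16), (12, 17), (13, 19), (18, 24), (20, 25), (21, 26), (27, 33),
       (28, 34), (29, 36), (32, 38), (35, 40), (37, 43), (39, 46), (41, 48), (44, 50), (47, 53), (49, 56),
       (51, 58), (54, 0), (57, 2), (59, 5)]]"

definition h5_states :: "int list" where "h5_states = [0, 1, 2, 3, 4, 5, 6, 7, 8, 9, 10, 11, 12, 13, 14, 15, 16, 17, 18, 19, 20, 21, 22, 23, 24, 25, 26, 27, 28, 29, 30, 31, 32, 33, 34, 35, 36, 37, 38, 39, 40, 41, 42, 43, 44, 45, 46, 47, 48, 49, 50, 51, 52, 53, 54, 55, 56, 57, 58, 59]"

lemma h5_table_ok: "table_ok h5_table (path_labels 0) h5_states"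
  "run (table_act h5_table) [4, 2, 3, 1, 2, 1, 0, 1, 0] 5 = Some 5"
  by code_simp+

context nil_Hecke_data
begin

definition heavy_path :: "nat \<Rightarrow> 'i list \<Rightarrow> bool" where
  "heavy_path e L \<longleftrightarrow> distinct L \<and> set L \<subseteq> I \<and>
     (\<forall>a<length L. \<forall>b<length L. a < b \<longrightarrow>
        (if b = Suc a then (if a = e then 5 \<le> m (L ! a) (L ! b) else m (L ! a) (L ! b) = 3)
         else m (L ! a) (L ! b) = 2))"

lemma heavy_path_labels:
  assumes L: "heavy_path e L" and ab: "a < length L" "b < length L" "a \<noteq> b"
  shows "path_labels e a b < 5 \<and> m (L ! a) (L ! b) = enat (path_labels e a b) \<or>
    path_labels e a b = 5 \<and> 5 \<le> m (L ! a) (L ! b)"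
proof -
  have "L ! a \<in> I" "L ! b \<in> I" using nth_mem[OF ab(1)] nth_mem[OF ab(2)] L unfolding heavy_path_def by blast+
  then have *: "m (L ! a) (L ! b) = m (L ! b) (L ! a)" by (rule m_sym)
  have key: "if j = Suc i then (if i = e then 5 \<le> m (L ! i) (L ! j) else m (L ! i) (L ! j) = 3)
      else m (L ! i) (L ! j) = 2" if "i < length L" "j < length L" "i < j" for i j
    using L that unfolding heavy_path_def by blast
  show ?thesis
  proof (cases "a < b")
    case True
    show ?thesis using key[OF ab(1,2) True] True by (auto simp: path_labels_def numeral_eq_enat split: if_splits)
  next
    case False
    then have "b < a" using ab(3) by simp
    then show ?thesis unfolding * using key[OF ab(2,1)] by (auto simp: path_labels_def numeral_eq_enat split: if_splits)
  qed
qed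

theorem infinite_heavy_middle:
  assumes "heavy_path 1 [x, a, b, y]" shows "infinite (alive_classes I m d)"
proof (rule infinite_if_table[OF middle_table_ok(1), of "[x, a, b, y]" 0 "[2, 1, 3, 2, 1, 0]"])
  show "run (table_act middle_table) [2, 1, 3, 2, 1, 0] 0 = Some 0" by (rule middle_table_ok(2))
  have len: "length middle_table = length [x, a, b, y]" by (simp add: middle_table_def)
  show "path_labels 1 i j < 5 \<and> m ([x, a, b, y] ! i) ([x, a, b, y] ! j) = enat (path_labels 1 i j) \<or>
      path_labels 1 i j = 5 \<and> 5 \<le> m ([x, a, b, y] ! i) ([x, a, b, y] ! j)"
    if "i < length middle_table" "j < length middle_table" "i \<noteq> j" for i j
    using heavy_path_labels[OF assms] that unfolding len by blast
qed (use assms in \<open>auto simp: heavy_path_def middle_table_def middle_states_def\<close>)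

theorem infinite_heavy_end:
  assumes "heavy_path 0 L" "length L = 5" shows "infinite (alive_classes I m d)"
proof (rule infinite_if_table[OF h5_table_ok(1), of L 5 "[4, 2, 3, 1, 2, 1, 0, 1, 0]"])
  show "run (table_act h5_table) [4, 2, 3, 1, 2, 1, 0, 1, 0] 5 = Some 5" by (rule h5_table_ok(2))
  have len: "length h5_table = length L" using assms(2) by (simp add: h5_table_def)
  then show "length L = length h5_table" by simp
  show "path_labels 0 i j < 5 \<and> m (L ! i) (L ! j) = enat (path_labels 0 i j) \<or>
      path_labels 0 i j = 5 \<and> 5 \<le> m (L ! i) (L ! j)"
    if "i < length h5_table" "j < length h5_table" "i \<noteq> j" for i j
    using heavy_path_labels[OF assms(1)] that unfolding len by blast
qed (use assms in \<open>auto simp: heavy_path_def h5_table_def h5_states_def\<close>)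

section \<open>Infinite examples given by block sequences\<close>

text \<open>
  The walk around the cycle never returns to a vertex after two steps, so no alternating stretch has length
  three.
\<close>

theorem infinite_cycle:
  assumes L: "3 \<le> L" and v: "\<And>j. j < L \<Longrightarrow> v j \<in> I" "inj_on v {..<L}"
    and adj: "\<And>j. Suc j < L \<Longrightarrow> 3 \<le> m (v j) (v (Suc j))" "3 \<le> m (v (L - 1)) (v 0)"
  shows "infinite (alive_classes I m d)"
proof -
  define succ where "succ j = (if Suc j = L then 0 else Suc j)" for j
  have inj: "v i = v j \<longleftrightarrow> i = j" if "i < L" "j < L" for i j using v(2) that by (auto dest: inj_onD)
  have s: "succ j < L" "succ j \<noteq> j" "succ (succ j) \<noteq> j" if "j < L" for j
    using that L by (auto simp: succ_def split: if_splits)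
  have link: "3 \<le> m (v j) (v (succ j))" if "j < L" for j
    using that adj by (auto simp: succ_def)
  interpret block_sequence I m d "{..<L}" succ "\<lambda>j. {v j}"
  proof unfold_locales
    show "\<And>\<kappa> a b. \<lbrakk>\<kappa> \<in> {..<L}; a \<in> {v \<kappa>}; {v (succ \<kappa>)} = {b}; a \<in> {v (succ (succ \<kappa>))}; a \<noteq> b\<rbrakk> \<Longrightarrow> 4 \<le> m a b"
      "\<And>\<kappa> a b. \<lbrakk>\<kappa> \<in> {..<L}; a \<in> {v \<kappa>}; {v (succ \<kappa>)} = {b}; {v (succ (succ \<kappa>))} = {a};
        b \<in> {v (succ (succ (succ \<kappa>)))}; a \<noteq> b\<rbrakk> \<Longrightarrow> 6 \<le> m a b"
      "\<And>\<kappa> a b. \<lbrakk>\<kappa> \<in> {..<L}; a \<in> {v \<kappa>}; {v (succ \<kappa>)} = {b}; {v (succ (succ \<kappa>))} = {a};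
        {v (succ (succ (succ \<kappa>)))} = {b}; {v (succ (succ (succ (succ \<kappa>))))} = {a};
        b \<in> {v (succ (succ (succ (succ (succ \<kappa>)))))}; a \<noteq> b\<rbrakk> \<Longrightarrow> False"
      using inj s s(3)[THEN not_sym] by auto
    show "{..<L} \<noteq> {}" using L by (simp add: lessThan_empty_iff)
    show "\<And>\<kappa> a. \<lbrakk>\<kappa> \<in> {..<L}; a \<in> {v \<kappa>}; a \<in> {v (succ \<kappa>)}\<rbrakk> \<Longrightarrow> 2 < d a \<and> a \<notin> {v (succ (succ \<kappa>))}"
      using inj s s(2)[THEN not_sym] by auto
  qed (use L v(1) s link d_ge_2 in auto)
  show ?thesis by (rule infinite_blocks)
qed

text \<open>For \<open>6 \<le> m a b\<close> the word \<open>b (a c) b a\<close> can be repeated: \<open>a\<close> and \<open>b\<close> alternate at most five times.\<close>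

theorem infinite_heavy_six:
  assumes I: "a \<in> I" "b \<in> I" "c \<in> I" and m: "6 \<le> m a b" "3 \<le> m b c" "m a c = 2" and ne: "a \<noteq> b" "b \<noteq> c" "a \<noteq> c"
  shows "infinite (alive_classes I m d)"
proof -
  define succ where "succ j = (if j = 3 then 0 else Suc j)" for j
  define B where "B j = (if j = 0 \<or> j = 2 then {b} else if j = 1 then {a, c} else {a})" for j :: nat
  have K: "j \<in> {..<4} \<longleftrightarrow> j = 0 \<or> j = 1 \<or> j = 2 \<or> j = 3" for j :: nat by auto
  have sym: "m b a = m a b" "m c b = m b c" "m c a = m a c" using m_sym I by blast+
  have le: "3 \<le> m a b" "4 \<le> m a b"
    by (rule order_trans[OF _ m(1)], simp)+
  have ss: "succ 0 = 1" "succ (Suc 0) = 2" "succ 1 = 2" "succ 2 = 3" "succ 3 = 0" by (auto simp: succ_def)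
  have BB: "B 0 = {b}" "B 1 = {a, c}" "B (Suc 0) = {a, c}" "B 2 = {b}" "B 3 = {a}" by (auto simp: B_def)
  interpret block_sequence I m d "{..<4}" succ B
  proof unfold_locales
    show "\<And>\<kappa> x y. \<lbrakk>\<kappa> \<in> {..<4}; x \<in> B \<kappa>; B (succ \<kappa>) = {y}; x \<in> B (succ (succ \<kappa>)); x \<noteq> y\<rbrakk> \<Longrightarrow> 4 \<le> m x y"
      unfolding K using ne sym le by (elim disjE) (auto simp: ss BB doubleton_eq_iff)
    show "\<And>\<kappa> x y. \<lbrakk>\<kappa> \<in> {..<4}; x \<in> B \<kappa>; B (succ \<kappa>) = {y}; B (succ (succ \<kappa>)) = {x};
        y \<in> B (succ (succ (succ \<kappa>))); x \<noteq> y\<rbrakk> \<Longrightarrow> 6 \<le> m x y"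
      unfolding K using ne sym m by (elim disjE) (auto simp: ss BB doubleton_eq_iff)
    show "\<And>\<kappa> x y. \<lbrakk>\<kappa> \<in> {..<4}; x \<in> B \<kappa>; B (succ \<kappa>) = {y}; B (succ (succ \<kappa>)) = {x};
        B (succ (succ (succ \<kappa>))) = {y}; B (succ (succ (succ (succ \<kappa>)))) = {x};
        y \<in> B (succ (succ (succ (succ (succ \<kappa>))))); x \<noteq> y\<rbrakk> \<Longrightarrow> False"
      unfolding K using ne by (elim disjE) (auto simp: ss BB doubleton_eq_iff)
    show "\<And>\<kappa> x. \<lbrakk>\<kappa> \<in> {..<4}; x \<in> B \<kappa>; x \<in> B (succ \<kappa>)\<rbrakk> \<Longrightarrow> 2 < d x \<and> x \<notin> B (succ (succ \<kappa>))"
      unfolding K using ne by (elim disjE) (auto simp: ss BB)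
    show "\<And>\<kappa> x y. \<lbrakk>\<kappa> \<in> {..<4}; x \<in> B \<kappa>; y \<in> B (succ \<kappa>); x \<noteq> y\<rbrakk> \<Longrightarrow> 3 \<le> m x y"
      unfolding K using sym le m by (elim disjE) (auto simp: ss BB)
    show "\<And>\<kappa> x y. \<lbrakk>\<kappa> \<in> {..<4}; x \<in> B \<kappa>; y \<in> B \<kappa>; x \<noteq> y\<rbrakk> \<Longrightarrow> m x y = 2"
      unfolding K using sym m by (elim disjE) (auto simp: ss BB)
    show "\<And>\<kappa>. \<kappa> \<in> {..<4} \<Longrightarrow> B \<kappa> \<noteq> {} \<and> B \<kappa> \<subseteq> I"
      unfolding K using I by (elim disjE) (auto simp: BB)
    show "{..<4} \<noteq> ({} :: nat set)" by (simp add: lessThan_empty_iff)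
  qed (use d_ge_2 in \<open>auto simp: succ_def\<close>)
  show ?thesis by (rule infinite_blocks)
qed

text \<open>
  A vertex at which a walk through the graph can reverse: it repeats the vertex if its exponent exceeds
  \<open>2\<close>, encoded by the empty set, and otherwise it makes an excursion to a block of neighbours.
\<close>

definition turning :: "'i \<Rightarrow> 'i set \<Rightarrow> bool" where
  "turning x G \<longleftrightarrow> G \<subseteq> I \<and> x \<notin> G \<and> (\<forall>c\<in>G. 3 \<le> m x c) \<and> (\<forall>c\<in>G. \<forall>c'\<in>G. c \<noteq> c' \<longrightarrow> m c c' = 2) \<and>
     (G = {} \<longrightarrow> 2 < d x) \<and> (\<forall>c. G = {c} \<longrightarrow> 4 \<le> m x c)"

end

datatype walk_position = Up nat | Down nat | Top | Bottom

context nil_Hecke_data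
begin

text \<open>
  The walk goes up along the path, turns at its last vertex, goes down and turns at the first one. It returns
  to a vertex after two steps only when it turns by an excursion, and then not twice in a row.
\<close>

theorem infinite_two_turnings:
  assumes v: "\<And>j. j \<le> k \<Longrightarrow> v j \<in> I" "inj_on v {..k}" "\<And>j. j < k \<Longrightarrow> 3 \<le> m (v j) (v (Suc j))"
    and turn: "turning (v 0) G" "turning (v k) H"
    and away: "0 < k \<Longrightarrow> v 1 \<notin> G" "0 < k \<Longrightarrow> v (k - 1) \<notin> H"
    and apart: "k = 0 \<Longrightarrow> G \<inter> H = {} \<and> (G \<noteq> {} \<or> H \<noteq> {})"
  shows "infinite (alive_classes I m d)"
proof -
  define succ where "succ \<kappa> = (case \<kappa> of
      Up j \<Rightarrow> if j < k then Up (Suc j) else if H = {} then Down k else Top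
    | Top \<Rightarrow> Down k
    | Down j \<Rightarrow> if 0 < j then Down (j - 1) else if G = {} then Up 0 else Bottom
    | Bottom \<Rightarrow> Up 0)" for \<kappa>
  define B where "B \<kappa> = (case \<kappa> of Up j \<Rightarrow> {v j} | Down j \<Rightarrow> {v j} | Top \<Rightarrow> H | Bottom \<Rightarrow> G)" for \<kappa>
  define K where "K = Up ` {..k} \<union> Down ` {..k} \<union> (if H = {} then {} else {Top}) \<union> (if G = {} then {} else {Bottom})"
  have inj: "v i = v j \<longleftrightarrow> i = j" if "i \<le> k" "j \<le> k" for i j using v(2) that by (auto dest: inj_onD)
  have G: "G \<subseteq> I" "v 0 \<notin> G" "\<And>c. c \<in> G \<Longrightarrow> 3 \<le> m (v 0) c" "\<And>c c'. \<lbrakk>c \<in> G; c' \<in> G; c \<noteq> c'\<rbrakk> \<Longrightarrow> m c c' = 2"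
    "G = {} \<Longrightarrow> 2 < d (v 0)" "\<And>c. G = {c} \<Longrightarrow> 4 \<le> m (v 0) c"
    using turn(1) by (auto simp: turning_def)
  have H: "H \<subseteq> I" "v k \<notin> H" "\<And>c. c \<in> H \<Longrightarrow> 3 \<le> m (v k) c" "\<And>c c'. \<lbrakk>c \<in> H; c' \<in> H; c \<noteq> c'\<rbrakk> \<Longrightarrow> m c c' = 2"
    "H = {} \<Longrightarrow> 2 < d (v k)" "\<And>c. H = {c} \<Longrightarrow> 4 \<le> m (v k) c"
    using turn(2) by (auto simp: turning_def)
  have down: "3 \<le> m (v j) (v (j - 1))" if "0 < j" "j \<le> k" for j
    using v(3)[of "j - 1"] m_sym[of "v j" "v (j - 1)"] v(1) that by simp
  have Gs: "3 \<le> m c (v 0)" if "c \<in> G" for c using G(1) G(3)[OF that] m_sym[of c "v 0"] v(1)[of 0] that by auto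
  have Hs: "3 \<le> m c (v k)" if "c \<in> H" for c using H(1) H(3)[OF that] m_sym[of c "v k"] v(1)[of k] that by auto
  have KE: "\<kappa> \<in> K \<Longrightarrow> (\<exists>j\<le>k. \<kappa> = Up j) \<or> (\<exists>j\<le>k. \<kappa> = Down j) \<or> \<kappa> = Top \<and> H \<noteq> {} \<or> \<kappa> = Bottom \<and> G \<noteq> {}" for \<kappa>
    by (auto simp: K_def split: if_splits)
  \<comment> \<open>Two steps apart, the walk only returns to a vertex at the two ends.\<close>
  have bounce: "(\<kappa> = Up k \<and> H \<noteq> {} \<and> a = v k \<and> B (succ \<kappa>) = H) \<or> (\<kappa> = Down 0 \<and> G \<noteq> {} \<and> a = v 0 \<and> B (succ \<kappa>) = G)"
    if "\<kappa> \<in> K" "a \<in> B \<kappa>" "a \<in> B (succ (succ \<kappa>))" for \<kappa> a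
    using KE[OF that(1)]
  proof (elim disjE exE conjE)
    fix j assume j: "j \<le> k" "\<kappa> = Up j"
    consider "j = k" | "Suc j = k" | "Suc (Suc j) \<le> k" using j(1) by linarith
    then show ?thesis
    proof cases
      case 1
      show ?thesis
      proof (cases "H = {}")
        case True
        have \<kappa>: "\<kappa> = Up k" using j(2) 1 by simp
        have a: "a = v k" "a \<in> B (succ (Down k))"
          using that(2,3) True unfolding \<kappa> by (simp_all add: B_def succ_def)
        have False
        proof (cases "k = 0")
          case k: True
          then have "G \<noteq> {}" using apart True by blast
          then show ?thesis using a k G(2) by (simp add: B_def succ_def)
        next
          case False
          then have "v k = v (k - 1)" using a by (simp add: B_def succ_def)
          then show ?thesis using inj[of k "k - 1"] False by simp
        qed
        then show ?thesis ..
      next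
        case False
        then show ?thesis using that j 1 by (auto simp: B_def succ_def)
      qed
    next
      case 2
      then show ?thesis using that j away(2) inj[of j k] by (auto simp: B_def succ_def split: if_splits)
    next
      case 3
      then show ?thesis using that j inj[of j "Suc (Suc j)"] by (auto simp: B_def succ_def split: if_splits)
    qed
  next
    fix j assume j: "j \<le> k" "\<kappa> = Down j"
    consider "j = 0" | "j = 1" | "2 \<le> j" by linarith
    then show ?thesis
    proof cases
      case 1
      show ?thesis
      proof (cases "G = {}")
        case True
        have \<kappa>: "\<kappa> = Down 0" using j(2) 1 by simp
        have a: "a = v 0" "a \<in> B (succ (Up 0))"
          using that(2,3) True unfolding \<kappa> by (simp_all add: B_def succ_def)
        have False
        proof (cases "k = 0")
          case k: True
          then have "H \<noteq> {}" using apart True by blast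
          then show ?thesis using a k H(2) by (simp add: B_def succ_def)
        next
          case False
          then have "v 0 = v 1" using a by (simp add: B_def succ_def)
          then show ?thesis using inj[of 0 1] False by simp
        qed
        then show ?thesis ..
      next
        case False
        then show ?thesis using that j 1 by (auto simp: B_def succ_def)
      qed
    next
      case 2
      then show ?thesis using that j away(1) inj[of 0 1] by (auto simp: B_def succ_def split: if_splits)
    next
      case 3
      then have "v j = v (j - 2)" using that(2,3) unfolding j(2) by (simp add: B_def succ_def numeral_2_eq_2)
      then have False using inj[of j "j - 2"] j(1) 3 by simp
      then show ?thesis ..
    qed
  next
    assume t: "\<kappa> = Top" "H \<noteq> {}"
    then show ?thesis using that away(2) apart H(2)
      by (cases "k = 0") (auto simp: B_def succ_def split: if_splits)
  next
    assume t: "\<kappa> = Bottom" "G \<noteq> {}"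
    then show ?thesis using that away(1) apart G(2)
      by (cases "k = 0") (auto simp: B_def succ_def split: if_splits)
  qed
  have closed: "succ \<kappa> \<in> K" if "\<kappa> \<in> K" for \<kappa>
    using KE[OF that] by (auto simp: K_def succ_def split: if_splits)
  have no_second: False if \<kappa>: "\<kappa> \<in> K" "a \<in> B \<kappa>" "B (succ \<kappa>) = {b}" "a \<in> B (succ (succ \<kappa>))"
    "b \<in> B (succ (succ (succ \<kappa>)))" for \<kappa> a b
  proof -
    have s: "succ \<kappa> \<in> K" "b \<in> B (succ \<kappa>)" using closed \<kappa> by auto
    from bounce[OF \<kappa>(1,2,4)] bounce[OF s \<kappa>(5)] show False
      by (auto simp: succ_def split: if_splits)
  qed
  interpret block_sequence I m d K succ B
  proof unfold_locales
    show "K \<noteq> {}" by (auto simp: K_def)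
    show "succ \<kappa> \<in> K" if "\<kappa> \<in> K" for \<kappa> by (rule closed[OF that])
    show "2 \<le> d i" if "i \<in> I" for i by (rule d_ge_2[OF that])
    show "B \<kappa> \<noteq> {} \<and> B \<kappa> \<subseteq> I" if "\<kappa> \<in> K" for \<kappa>
      using KE[OF that] v(1) G(1) H(1) by (elim disjE exE conjE) (auto simp: B_def)
    show "3 \<le> m a b" if "\<kappa> \<in> K" "a \<in> B \<kappa>" "b \<in> B (succ \<kappa>)" "a \<noteq> b" for \<kappa> a b
      using KE[OF that(1)]
    proof (elim disjE exE conjE)
      fix j assume j: "j \<le> k" "\<kappa> = Up j"
      then show ?thesis using that v(3)[of j] H(3) by (auto simp: B_def succ_def split: if_splits)
    next
      fix j assume j: "j \<le> k" "\<kappa> = Down j"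
      then show ?thesis using that down[of j] G(3) by (auto simp: B_def succ_def split: if_splits)
    qed (use that Gs Hs in \<open>auto simp: B_def succ_def\<close>)
    show "m a b = 2" if "\<kappa> \<in> K" "a \<in> B \<kappa>" "b \<in> B \<kappa>" "a \<noteq> b" for \<kappa> a b
      using KE[OF that(1)] that G(4) H(4) by (elim disjE exE conjE) (auto simp: B_def)
    show "2 < d a \<and> a \<notin> B (succ (succ \<kappa>))" if \<kappa>: "\<kappa> \<in> K" "a \<in> B \<kappa>" "a \<in> B (succ \<kappa>)" for \<kappa> a
    proof -
      have flat: "(\<kappa> = Up k \<and> H = {} \<or> \<kappa> = Down 0 \<and> G = {}) \<and> 2 < d a"
        using KE[OF \<kappa>(1)]
      proof (elim disjE exE conjE)
        fix j assume j: "j \<le> k" "\<kappa> = Up j"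
        then show ?thesis using \<kappa> inj[of j "Suc j"] H(2,5) by (auto simp: B_def succ_def split: if_splits)
      next
        fix j assume j: "j \<le> k" "\<kappa> = Down j"
        then show ?thesis using \<kappa> inj[of j "j - 1"] G(2,5) by (auto simp: B_def succ_def split: if_splits)
      qed (use \<kappa> G(2) H(2) in \<open>auto simp: B_def succ_def\<close>)
      then show ?thesis using bounce[OF \<kappa>(1,2)] by auto
    qed
    show "4 \<le> m a b" if "\<kappa> \<in> K" "a \<in> B \<kappa>" "B (succ \<kappa>) = {b}" "a \<in> B (succ (succ \<kappa>))" "a \<noteq> b" for \<kappa> a b
      using bounce[OF that(1,2,4)] that(3) G(6) H(6) by auto
    show "6 \<le> m a b" if "\<kappa> \<in> K" "a \<in> B \<kappa>" "B (succ \<kappa>) = {b}" "B (succ (succ \<kappa>)) = {a}"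
      "b \<in> B (succ (succ (succ \<kappa>)))" "a \<noteq> b" for \<kappa> a b
      using no_second[OF that(1-3) _ that(5)] that(4) by simp
    show False if "\<kappa> \<in> K" "a \<in> B \<kappa>" "B (succ \<kappa>) = {b}" "B (succ (succ \<kappa>)) = {a}"
      "B (succ (succ (succ \<kappa>))) = {b}" "B (succ (succ (succ (succ \<kappa>)))) = {a}"
      "b \<in> B (succ (succ (succ (succ (succ \<kappa>)))))" "a \<noteq> b" for \<kappa> a b
      using no_second[OF that(1-3)] that(4,5) by simp
  qed
  show ?thesis by (rule infinite_blocks)
qed

end

section \<open>The graph of a finite example\<close>

locale finite_nil_Hecke = nil_Hecke_data I m d for I :: "'i set" and m d +
  assumes irreducible: "coxeter_irreducible I m" and finite_alive: "finite (alive_classes I m d)"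
begin

lemma commute_or_adjacent: "\<lbrakk>a \<in> I; b \<in> I; a \<noteq> b; m a b \<noteq> 2\<rbrakk> \<Longrightarrow> 3 \<le> m a b"
  using m_ge_2[of a b] by (cases "m a b") (auto simp: numeral_eq_enat)

lemma adjacent_neq: "\<lbrakk>a \<in> I; 3 \<le> m a b\<rbrakk> \<Longrightarrow> a \<noteq> b"
  using m_diag by (auto simp: one_enat_def numeral_eq_enat)

definition simple_path :: "nat \<Rightarrow> (nat \<Rightarrow> 'i) \<Rightarrow> bool" where
  "simple_path k v \<longleftrightarrow> (\<forall>j\<le>k. v j \<in> I) \<and> inj_on v {..k} \<and> (\<forall>j<k. 3 \<le> m (v j) (v (Suc j)))"

lemma simple_path_inj: "\<lbrakk>simple_path k v; i \<le> k; j \<le> k; v i = v j\<rbrakk> \<Longrightarrow> i = j"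
  unfolding simple_path_def inj_on_def by blast

lemma simple_path_prefix: "\<lbrakk>simple_path k v; j \<le> k\<rbrakk> \<Longrightarrow> simple_path j v"
  unfolding simple_path_def by (auto intro: inj_on_subset)

lemma simple_path_shift: "simple_path (Suc k) v \<Longrightarrow> simple_path k (\<lambda>j. v (Suc j))"
  unfolding simple_path_def inj_on_def by auto

lemma simple_path_extend:
  assumes "simple_path k v" "z \<in> I" "3 \<le> m (v k) z" "z \<notin> v ` {..k}"
  shows "simple_path (Suc k) (v(Suc k := z))"
  using assms unfolding simple_path_def inj_on_def by (auto simp: le_Suc_eq less_Suc_eq)

lemma simple_path_exists:
  assumes "x \<in> I" "y \<in> I" shows "\<exists>k v. simple_path k v \<and> v 0 = x \<and> v k = y"
proof -
  have "(x, y) \<in> {(a, b). a \<in> I \<and> b \<in> I \<and> a \<noteq> b \<and> 3 \<le> m a b}\<^sup>*"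
    using irreducible assms unfolding coxeter_irreducible_def by blast
  then show ?thesis
  proof (induction rule: rtrancl_induct)
    case base
    show ?case using assms(1) by (intro exI[of _ 0] exI[of _ "\<lambda>_. x"]) (simp add: simple_path_def)
  next
    case (step y z)
    then obtain k v where v: "simple_path k v" "v 0 = x" "v k = y" by blast
    show ?case
    proof (cases "z \<in> v ` {..k}")
      case True
      then obtain j where "j \<le> k" "v j = z" by auto
      then show ?thesis using simple_path_prefix[OF v(1)] v(2) by blast
    next
      case False
      then have "simple_path (Suc k) (v(Suc k := z))" using simple_path_extend[OF v(1)] v(3) step(2) by auto
      moreover have "(v(Suc k := z)) 0 = x" "(v(Suc k := z)) (Suc k) = z" using v(2) by simp_all
      ultimately show ?thesis by blast
    qed
  qed
qed

text \<open>
  A further edge between two vertices of a path would close a cycle.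
\<close>

lemma path_chord:
  assumes v: "simple_path k v" and ij: "Suc i < j" "j \<le> k"
  shows "m (v i) (v j) = 2"
proof (rule ccontr)
  have I: "v i \<in> I" "v j \<in> I" using v ij by (auto simp: simple_path_def)
  assume "m (v i) (v j) \<noteq> 2"
  moreover have "v i \<noteq> v j" using simple_path_inj[OF v, of i j] ij by auto
  ultimately have "3 \<le> m (v j) (v i)" using commute_or_adjacent I m_sym[OF I] by simp
  moreover have "inj_on (\<lambda>t. v (i + t)) {..<Suc (j - i)}"
  proof (rule inj_onI)
    fix s t assume "s \<in> {..<Suc (j - i)}" "t \<in> {..<Suc (j - i)}" "v (i + s) = v (i + t)"
    then show "s = t" using simple_path_inj[OF v, of "i + s" "i + t"] ij by auto
  qed
  ultimately have "infinite (alive_classes I m d)"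
    using v ij by (intro infinite_cycle[of "Suc (j - i)" "\<lambda>t. v (i + t)"]) (auto simp: simple_path_def)
  then show False using finite_alive by blast
qed

lemma neighbours_commute:
  assumes "x \<in> I" "y \<in> I" "z \<in> I" "3 \<le> m y x" "3 \<le> m y z" "x \<noteq> z"
  shows "m x z = 2"
proof -
  define v where "v j = (if j = 0 then x else if j = 1 then y else z)" for j :: nat
  have "y \<noteq> x" "y \<noteq> z" using adjacent_neq assms by blast+
  moreover have "3 \<le> m x y" using m_sym[of x y] assms by simp
  ultimately have "simple_path 2 v" using assms unfolding simple_path_def inj_on_def v_def
    by (auto simp: le_Suc_eq less_Suc_eq numeral_2_eq_2)
  from path_chord[OF this, of 0 2] show ?thesis by (simp add: v_def)
qed

text \<open>
  A path to \<open>y\<close> whose start is a turning point. Its entry to \<open>y\<close> is the last vertex before \<open>y\<close>, or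
  the excursion at the start if the path is trivial; \<open>y\<close> cannot be a turning point away from the entry.
\<close>

definition reached :: "'i \<Rightarrow> nat \<Rightarrow> (nat \<Rightarrow> 'i) \<Rightarrow> 'i set \<Rightarrow> bool" where
  "reached y k v G \<longleftrightarrow> simple_path k v \<and> turning (v 0) G \<and> (0 < k \<longrightarrow> v 1 \<notin> G) \<and> v k = y"

definition "entry" :: "nat \<Rightarrow> (nat \<Rightarrow> 'i) \<Rightarrow> 'i set \<Rightarrow> 'i set" where
  "entry k v G = (if k = 0 then G else {v (k - 1)})"

lemma reached_turning:
  assumes y: "reached y k v G" and H: "turning y H" "H \<inter> entry k v G = {}"
  shows "k = 0 \<and> G = {} \<and> H = {}"
proof (rule ccontr)
  assume *: "\<not> ?thesis"
  have "infinite (alive_classes I m d)"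
    by (rule infinite_two_turnings[of k v G H])
      (use y H * in \<open>auto simp: reached_def simple_path_def entry_def split: if_splits\<close>)
  then show False using finite_alive by blast
qed

lemma turning_edge: "\<lbrakk>a \<in> I; b \<in> I; 4 \<le> m a b\<rbrakk> \<Longrightarrow> turning a {b}"
proof -
  assume *: "a \<in> I" "b \<in> I" "4 \<le> m a b"
  then have "3 \<le> m a b" using order_trans[of 3 4 "m a b"] by simp
  then show ?thesis using * adjacent_neq[of a b] by (auto simp: turning_def)
qed

lemma turning_branch:
  "\<lbrakk>y \<in> I; z \<in> I; w \<in> I; 3 \<le> m y z; 3 \<le> m y w; z \<noteq> w\<rbrakk> \<Longrightarrow> turning y {z, w}"
  using neighbours_commute[of z y w] neighbours_commute[of w y z] adjacent_neq[of y z] adjacent_neq[of y w]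
  by (auto simp: turning_def doubleton_eq_iff)

lemma reached_fat: "\<lbrakk>reached y k v G; 2 < d y\<rbrakk> \<Longrightarrow> k = 0"
  using reached_turning[of y k v G "{}"] by (auto simp: turning_def)

text \<open>
  If the heavy edge leads back along the path, then the path can be stopped one step earlier and the edge used for
  an excursion.
\<close>

lemma reached_heavy:
  assumes y: "reached y k v G" and z: "z \<in> I" "4 \<le> m y z"
  shows "k = 0 \<and> z \<in> G"
proof -
  have yI: "y \<in> I" using y by (auto simp: reached_def simple_path_def)
  have z_in: "z \<in> entry k v G" using reached_turning[OF y turning_edge[OF yI z]] by blast
  show ?thesis
  proof (cases k)
    case 0
    then show ?thesis using z_in by (simp add: entry_def)
  next
    case (Suc k')
    then have zk: "z = v k'" using z_in by (simp add: entry_def)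
    have sp: "simple_path (Suc k') v" using y Suc by (simp add: reached_def)
    have "reached z k' v G" using y Suc zk simple_path_prefix[OF sp, of k'] by (simp add: reached_def)
    moreover have "turning z {y}" using turning_edge[of z y] z yI m_sym[of y z] by simp
    moreover have "y \<notin> entry k' v G"
    proof (cases "k' = 0")
      case True
      then show ?thesis using y Suc by (auto simp: entry_def reached_def)
    next
      case False
      then have "k' - 1 \<le> Suc k'" "k' - 1 \<noteq> Suc k'" by simp_all
      then have "v (k' - 1) \<noteq> v (Suc k')" using simple_path_inj[OF sp, of "k' - 1" "Suc k'"] by auto
      then show ?thesis using y Suc False by (simp add: entry_def reached_def)
    qed
    ultimately show ?thesis using reached_turning[of z k' v G "{y}"] by blast
  qed
qed

lemma reached_degree:
  assumes y: "reached y k v G" and G: "G \<subseteq> {c}"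
    and z: "z1 \<in> I" "z2 \<in> I" "z3 \<in> I" "3 \<le> m y z1" "3 \<le> m y z2" "3 \<le> m y z3"
    and ne: "z1 \<noteq> z2" "z1 \<noteq> z3" "z2 \<noteq> z3"
  shows False
proof -
  have yI: "y \<in> I" using y by (auto simp: reached_def simple_path_def)
  \<comment> \<open>The three neighbours contain two that differ from the single possible entry \<open>e\<close>.\<close>
  obtain e where e: "entry k v G \<subseteq> {e}" using G unfolding entry_def by (cases "k = 0") auto
  have "\<exists>z w. {z, w} \<subseteq> {z1, z2, z3} \<and> z \<noteq> w \<and> z \<noteq> e \<and> w \<noteq> e"
  proof (cases "e = z1")
    case True
    then show ?thesis using ne by (intro exI[of _ z2] exI[of _ z3]) auto
  next
    case False
    then show ?thesis using ne by (cases "e = z2") (intro exI[of _ z1] exI[of _ z3], simp, intro exI[of _ z1] exI[of _ z2], auto)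
  qed
  then obtain z w where zw: "{z, w} \<subseteq> {z1, z2, z3}" "z \<noteq> w" "{z, w} \<inter> entry k v G = {}" using e by blast
  then have "turning y {z, w}" using turning_branch[OF yI, of z w] z by auto
  then show False using reached_turning[OF y _ zw(3)] by blast
qed

text \<open>
  A longest simple path from a leaf contains all neighbours of its vertices, hence all vertices.
\<close>

lemma spanning_path:
  assumes x: "x \<in> I" and leaf: "\<And>z w. \<lbrakk>z \<in> I; w \<in> I; 3 \<le> m x z; 3 \<le> m x w\<rbrakk> \<Longrightarrow> z = w"
    and degree: "\<And>y z1 z2 z3. \<lbrakk>y \<in> I; z1 \<in> I; z2 \<in> I; z3 \<in> I; 3 \<le> m y z1; 3 \<le> m y z2; 3 \<le> m y z3;
      z1 \<noteq> z2; z1 \<noteq> z3; z2 \<noteq> z3\<rbrakk> \<Longrightarrow> False"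
  shows "\<exists>k v. simple_path k v \<and> v 0 = x \<and> v ` {..k} = I"
proof -
  let ?P = "\<lambda>(k, v). simple_path k v \<and> v 0 = x"
  have "?P (0, \<lambda>_. x)" using x by (simp add: simple_path_def)
  moreover have "\<forall>kv. ?P kv \<longrightarrow> fst kv < card I"
  proof (intro allI impI)
    fix kv assume P: "?P kv"
    obtain k v where kv: "kv = (k, v)" by fastforce
    then have "v ` {..k} \<subseteq> I" "card (v ` {..k}) = Suc k"
      using P by (auto simp: simple_path_def card_image)
    then show "fst kv < card I" using card_mono[OF finite_I, of "v ` {..k}"] kv by simp
  qed
  ultimately have "\<exists>kv. ?P kv \<and> (\<forall>kv'. ?P kv' \<longrightarrow> fst kv' \<le> fst kv)"
    by (rule ex_has_greatest_nat)
  then obtain k v where v: "simple_path k v" "v 0 = x" "\<And>k' v'. simple_path k' v' \<Longrightarrow> v' 0 = x \<Longrightarrow> k' \<le> k"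
    by auto
  have vI: "v j \<in> I" if "j \<le> k" for j using v(1) that by (simp add: simple_path_def)
  have step: "3 \<le> m (v j) (v (Suc j))" "3 \<le> m (v (Suc j)) (v j)" if j: "j < k" for j
  proof -
    show up: "3 \<le> m (v j) (v (Suc j))" using v(1) j by (simp add: simple_path_def)
    have "m (v (Suc j)) (v j) = m (v j) (v (Suc j))" by (rule m_sym) (use vI j in auto)
    then show "3 \<le> m (v (Suc j)) (v j)" using up by simp
  qed
  \<comment> \<open>A neighbour outside the path would extend it or give some vertex too many neighbours.\<close>
  have closed: "z \<in> v ` {..k}" if j: "j \<le> k" and z: "z \<in> I" "3 \<le> m (v j) z" for j z
  proof (rule ccontr)
    assume out: "z \<notin> v ` {..k}"
    consider "j = k" | "j = 0" "0 < k" | j' where "j = Suc j'" "j < k" using j by (cases j) (auto simp: le_less)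
    then show False
    proof cases
      case 1
      then have "simple_path (Suc k) (v(Suc k := z))" using simple_path_extend[OF v(1)] z out by blast
      then show False using v(3)[of "Suc k" "v(Suc k := z)"] v(2) by simp
    next
      case 2
      then have "z = v 1" using leaf[of z "v 1"] z step(1)[of 0] v(2) vI[of 1] by simp
      then show False using out 2 by auto
    next
      case 3
      have "v j' \<noteq> v (Suc j)" using simple_path_inj[OF v(1), of j' "Suc j"] 3 by auto
      moreover have "z \<noteq> v j'" "z \<noteq> v (Suc j)" using out 3 by auto
      ultimately show False
        using degree[of "v j" "v j'" "v (Suc j)" z] vI[of j] vI[of j'] vI[of "Suc j"] z step(1)[of j] step(2)[of j'] 3 by auto
    qed
  qed
  have "y \<in> v ` {..k}" if "y \<in> I" for y
  proof -
    have "(x, y) \<in> {(a, b). a \<in> I \<and> b \<in> I \<and> a \<noteq> b \<and> 3 \<le> m a b}\<^sup>*"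
      using irreducible x that unfolding coxeter_irreducible_def by blast
    then show ?thesis
    proof (induction rule: rtrancl_induct)
      case base
      show ?case using v(2) by auto
    next
      case (step y z)
      then show ?case using closed by auto
    qed
  qed
  then have "v ` {..k} = I" using vI by auto
  then show ?thesis using v(1,2) by blast
qed

lemma path_numbering:
  assumes v: "simple_path k v" "v ` {..k} = I" and T: "type_admissible T" "type_rank T = Suc k"
    and edge: "\<And>i. i < k \<Longrightarrow> type_entry T (Suc i) (Suc (Suc i)) = m (v i) (v (Suc i))"
    and far: "\<And>i j. \<lbrakk>Suc i < j; j \<le> k\<rbrakk> \<Longrightarrow> type_entry T (Suc i) (Suc j) = 2"
  shows "type_numbering I m T (\<lambda>i. v (i - 1))"
proof -
  have vI: "v j \<in> I" if "j \<le> k" for j using v(1) that by (simp add: simple_path_def)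
  have entries: "m (v i) (v j) = type_entry T (Suc i) (Suc j)" if "i < j" "j \<le> k" for i j
  proof (cases "j = Suc i")
    case True
    then show ?thesis using edge[of i] that by simp
  next
    case False
    then show ?thesis using path_chord[OF v(1), of i j] far[of i j] that by simp
  qed
  have matrix: "m (v i) (v j) = type_matrix T (Suc i) (Suc j)" if "i \<le> k" "j \<le> k" for i j
  proof -
    consider "i = j" | "i < j" | "j < i" by linarith
    then show ?thesis
    proof cases
      case 3
      then show ?thesis
        using entries[of j i] m_sym[of "v i" "v j"] vI that by (simp add: type_matrix_def min_def max_def)
    qed (use m_diag vI entries that in \<open>auto simp: type_matrix_def min_def max_def\<close>)
  qed
  have "bij_betw (\<lambda>i. v (i - 1)) {1..Suc k} I"
  proof (rule bij_betw_imageI)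
    show "inj_on (\<lambda>i. v (i - 1)) {1..Suc k}"
    proof (rule inj_onI)
      fix i j assume "i \<in> {1..Suc k}" "j \<in> {1..Suc k}" "v (i - 1) = v (j - 1)"
      then show "i = j" using simple_path_inj[OF v(1), of "i - 1" "j - 1"] by (cases i; cases j) auto
    qed
    have "{..k} = (\<lambda>i. i - 1) ` {1..Suc k}"
    proof (intro equalityI subsetI)
      fix i assume "i \<in> {..k}"
      then show "i \<in> (\<lambda>i. i - 1) ` {1..Suc k}" by (intro image_eqI[of _ _ "Suc i"]) auto
    qed auto
    then show "(\<lambda>i. v (i - 1)) ` {1..Suc k} = I" using v(2) by (metis image_image)
  qed
  moreover have "m (v (i - 1)) (v (j - 1)) = type_matrix T i j" if "i \<in> {1..Suc k}" "j \<in> {1..Suc k}" for i j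
    using matrix[of "i - 1" "j - 1"] that by (cases i; cases j) auto
  ultimately show ?thesis unfolding type_numbering_def using T by simp
qed

text \<open>
  Every vertex is reached from the turning point \<open>x\<close>, so there is no second place to turn: no other large
  exponent, no label above \<open>3\<close>, no branch vertex, and not more than one neighbour of \<open>x\<close>.
\<close>

theorem fat_vertex:
  assumes x: "x \<in> I" "2 < d x"
  shows "\<exists>n\<ge>1. \<exists>f. type_numbering I m (Type_A n) f \<and> f 1 = x \<and> (\<forall>i\<in>{2..n}. d (f i) = 2)"
proof -
  have from_x: "\<exists>k v. reached y k v {} \<and> v 0 = x" if y: "y \<in> I" for y
  proof -
    obtain k v where v: "simple_path k v" "v 0 = x" "v k = y" using simple_path_exists[OF x(1) y] by blast
    then have "reached y k v {}" using x(2) by (simp add: reached_def turning_def)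
    then show ?thesis using v(2) by blast
  qed
  have thin: "d y = 2" if y: "y \<in> I" "y \<noteq> x" for y
  proof (rule ccontr)
    assume "d y \<noteq> 2"
    then have "2 < d y" using d_ge_2[OF y(1)] by simp
    moreover obtain k v where "reached y k v {}" "v 0 = x" using from_x[OF y(1)] by blast
    ultimately show False using reached_fat[of y k v "{}"] y(2) by (auto simp: reached_def)
  qed
  have simply_laced: "m y z = 3" if yz: "y \<in> I" "z \<in> I" "3 \<le> m y z" for y z
  proof (rule ccontr)
    assume "m y z \<noteq> 3"
    then have "4 \<le> m y z" using yz(3) by (cases "m y z") (auto simp: numeral_eq_enat)
    moreover obtain k v where "reached y k v {}" using from_x[OF yz(1)] by blast
    ultimately show False using reached_heavy[of y k v "{}" z] yz by blast
  qed
  have leaf: "z = w" if zw: "z \<in> I" "w \<in> I" "3 \<le> m x z" "3 \<le> m x w" for z w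
  proof (rule ccontr)
    assume "z \<noteq> w"
    then have "turning x {z, w}" using turning_branch[OF x(1)] zw by blast
    moreover have "reached x 0 (\<lambda>_. x) {}" using x by (simp add: reached_def simple_path_def turning_def)
    ultimately show False using reached_turning[of x 0 "\<lambda>_. x" "{}" "{z, w}"] by (simp add: entry_def)
  qed
  have degree: False if z: "y \<in> I" "z1 \<in> I" "z2 \<in> I" "z3 \<in> I" "3 \<le> m y z1" "3 \<le> m y z2" "3 \<le> m y z3"
    "z1 \<noteq> z2" "z1 \<noteq> z3" "z2 \<noteq> z3" for y z1 z2 z3
  proof -
    obtain k v where "reached y k v {}" using from_x[OF z(1)] by blast
    from reached_degree[OF this _ z(2-)] show False by simp
  qed
  have "\<exists>k v. simple_path k v \<and> v 0 = x \<and> v ` {..k} = I"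
    by (rule spanning_path[OF x(1)]) (rule leaf degree; assumption)+
  then obtain k v where v: "simple_path k v" "v 0 = x" "v ` {..k} = I" by blast
  have vI: "v j \<in> I" if "j \<le> k" for j using v(1) that by (simp add: simple_path_def)
  have "m (v i) (v (Suc i)) = 3" if "i < k" for i
    using simply_laced[of "v i" "v (Suc i)"] vI that v(1) by (simp add: simple_path_def)
  then have "type_numbering I m (Type_A (Suc k)) (\<lambda>i. v (i - 1))"
    by (intro path_numbering[OF v(1,3)]) auto
  moreover have "d (v (i - 1)) = 2" if "i \<in> {2..Suc k}" for i
  proof -
    have i: "i - 1 \<le> k" "i - 1 \<noteq> 0" using that by auto
    then have "v (i - 1) \<noteq> x" using simple_path_inj[OF v(1) i(1), of 0] v(2) by auto
    then show ?thesis using thin vI[OF i(1)] by blast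
  qed
  ultimately show ?thesis using v(2) by (intro exI[of _ "Suc k"] conjI exI[of _ "\<lambda>i. v (i - 1)"]) auto
qed

text \<open>A path from \<open>a\<close> that starts with the heavy edge is replaced by its part from \<open>b\<close> on.\<close>

lemma reached_from_edge:
  assumes ab: "a \<in> I" "b \<in> I" "4 \<le> m a b" and y: "y \<in> I"
  shows "\<exists>k v c. reached y k v {c} \<and> {v 0, c} = {a, b}"
proof -
  have ba: "4 \<le> m b a" using ab m_sym[OF ab(1,2)] by simp
  obtain k v where v: "simple_path k v" "v 0 = a" "v k = y" using simple_path_exists[OF ab(1) y] by blast
  show ?thesis
  proof (cases "0 < k \<and> v 1 = b")
    case True
    then obtain k' where k': "k = Suc k'" by (cases k) auto
    let ?v = "\<lambda>j. v (Suc j)"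
    have "v 0 \<noteq> v (Suc 1)" if "0 < k'" using simple_path_inj[OF v(1), of 0 "Suc 1"] k' that by auto
    then have "reached y k' ?v {a}"
      using simple_path_shift[OF v(1)[unfolded k']] turning_edge[OF ab(2,1) ba] v True k'
      by (auto simp: reached_def)
    then show ?thesis using True by (intro exI[of _ k'] exI[of _ ?v] exI[of _ a]) auto
  next
    case False
    then have "reached y k v {b}" using v turning_edge[OF ab] by (auto simp: reached_def)
    then show ?thesis using v(2) by (intro exI[of _ k] exI[of _ v] exI[of _ b]) auto
  qed
qed

context
  fixes a b assumes ab: "a \<in> I" "b \<in> I" "5 \<le> m a b"
begin

lemma heavy_4: "4 \<le> m a b"
  using ab(3) order_trans[of 4 5 "m a b"] by simp

lemma other_edges:
  assumes yz: "y \<in> I" "z \<in> I" "3 \<le> m y z" "{y, z} \<noteq> {a, b}" shows "m y z = 3"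
proof (rule ccontr)
  assume "m y z \<noteq> 3"
  then have "4 \<le> m y z" using yz(3) by (cases "m y z") (auto simp: numeral_eq_enat)
  moreover obtain k v c where "reached y k v {c}" "{v 0, c} = {a, b}"
    using reached_from_edge[OF ab(1,2) heavy_4 yz(1)] by blast
  ultimately show False using reached_heavy[of y k v "{c}" z] yz by (auto simp: reached_def)
qed

lemma heavy_degree:
  assumes "y \<in> I" "z1 \<in> I" "z2 \<in> I" "z3 \<in> I" "3 \<le> m y z1" "3 \<le> m y z2" "3 \<le> m y z3"
    "z1 \<noteq> z2" "z1 \<noteq> z3" "z2 \<noteq> z3"
  shows False
proof -
  obtain k v c where "reached y k v {c}" using reached_from_edge[OF ab(1,2) heavy_4 assms(1)] by blast
  from reached_degree[OF this _ assms(2-)] show False by blast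
qed

text \<open>
  Otherwise \<open>x, a, b, y\<close> is a path with a heavy edge in the middle.
\<close>

lemma heavy_edge_at_end:
  assumes x: "x \<in> I" "x \<noteq> b" "3 \<le> m a x" and y: "y \<in> I" "y \<noteq> a" "3 \<le> m b y"
  shows False
proof -
  have adj: "3 \<le> m a b" "3 \<le> m b a" using heavy_4 order_trans[of 3 4 "m a b"] m_sym[OF ab(1,2)] by auto
  have neq: "a \<noteq> b" "x \<noteq> a" "y \<noteq> b" using adjacent_neq[OF ab(1) adj(1)] adjacent_neq[OF ab(1) x(3)]
      adjacent_neq[OF ab(2) y(3)] by auto
  have xb: "m x b = 2" by (rule neighbours_commute[of x a b]) (use ab x adj in auto)
  have ay: "m a y = 2" by (rule neighbours_commute[of a b y]) (use ab y adj in auto)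
  have "x \<noteq> y" using xb y(3) m_sym[OF x(1) ab(2)] by auto
  have xa: "m x a = 3" "m b y = 3"
    using other_edges[of a x] other_edges[of b y] m_sym[OF x(1) ab(1)] ab x y neq by (auto simp: doubleton_eq_iff)
  define v where "v j = [x, a, b, y] ! j" for j
  have "simple_path 3 v"
    unfolding simple_path_def inj_on_def v_def using ab x y xa adj neq \<open>x \<noteq> y\<close>
    by (auto simp: le_Suc_eq less_Suc_eq numeral_3_eq_3)
  from path_chord[OF this, of 0 3] have "m x y = 2" by (simp add: v_def)
  then have "heavy_path 1 [x, a, b, y]"
    unfolding heavy_path_def using ab x y xa xb ay neq \<open>x \<noteq> y\<close>
    by (auto simp: less_Suc_eq)
  then show False using infinite_heavy_middle finite_alive by blast
qed

lemma finite_group_heavy_end: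
  assumes fin: "m a b \<noteq> \<infinity>" and leaf: "\<And>x. \<lbrakk>x \<in> I; 3 \<le> m a x\<rbrakk> \<Longrightarrow> x = b"
  shows "finite (carrier (coxeter_group I m))"
proof -
  have adj: "3 \<le> m a b" using heavy_4 order_trans[of 3 4 "m a b"] by auto
  have "\<exists>k v. simple_path k v \<and> v 0 = a \<and> v ` {..k} = I"
  proof (rule spanning_path[OF ab(1)])
    show "z = w" if "z \<in> I" "w \<in> I" "3 \<le> m a z" "3 \<le> m a w" for z w using leaf that by blast
  qed (rule heavy_degree)
  then obtain k v where v: "simple_path k v" "v 0 = a" "v ` {..k} = I" by blast
  have vI: "v j \<in> I" if "j \<le> k" for j using v(1) that by (simp add: simple_path_def)
  have neq: "a \<noteq> b" by (rule adjacent_neq[OF ab(1) adj])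
  have k: "0 < k"
  proof (rule ccontr)
    assume "\<not> 0 < k"
    then have "I = {a}" using v by auto
    then show False using ab neq by auto
  qed
  have v1: "v 1 = b" using leaf[of "v 1"] v(1,2) vI[of 1] k by (auto simp: simple_path_def)
  have edge: "m (v i) (v (Suc i)) = 3" if "0 < i" "i < k" for i
  proof (rule other_edges)
    show "v i \<in> I" "v (Suc i) \<in> I" "3 \<le> m (v i) (v (Suc i))" using v(1) that by (auto simp: simple_path_def)
    have "v i \<noteq> v 0" "v (Suc i) \<noteq> v 0"
      using simple_path_inj[OF v(1), of i 0] simple_path_inj[OF v(1), of "Suc i" 0] that by auto
    then show "{v i, v (Suc i)} \<noteq> {a, b}" using v(2) by (auto simp: doubleton_eq_iff)
  qed
  have data: "coxeter_data I m" by unfold_locales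
  show ?thesis
  proof (cases "k = 1")
    case True
    then have "I = {a, b}" using v(2,3) v1 by (auto simp: atMost_Suc)
    moreover obtain n where "m a b = enat n" using fin by auto
    ultimately interpret dihedral_data I m a b n "\<lambda>_. 2"
      by unfold_locales (use neq in auto)
    show ?thesis by (rule finite_dihedral_group)
  next
    case False
    then have k2: "2 \<le> k" using k by simp
    have far: "m (v i) (v j) = 2" if "Suc i < j" "j \<le> k" for i j by (rule path_chord[OF v(1) that])
    have "\<not> 6 \<le> m a b"
    proof
      assume "6 \<le> m a b"
      moreover have "m a (v 2) = 2" using far[of 0 2] v(2) k2 by simp
      moreover have "3 \<le> m b (v 2)" using edge[of 1] v1 k2 by (simp add: numeral_2_eq_2)
      moreover have "v 0 \<noteq> v 2" "v 1 \<noteq> v 2"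
        using simple_path_inj[OF v(1), of 0 2] simple_path_inj[OF v(1), of 1 2] k2 by auto
      ultimately have "infinite (alive_classes I m d)"
        using infinite_heavy_six[OF ab(1,2) vI[OF k2]] v(2) v1 neq by auto
      then show False using finite_alive by blast
    qed
    then have five: "m a b = 5" using ab(3) by (cases "m a b") (auto simp: numeral_eq_enat)
    have "k < 4"
    proof (rule ccontr)
      assume "\<not> k < 4"
      then have k4: "4 \<le> k" by simp
      let ?L = "map v [0..<5]"
      have "inj_on v (set [0..<5])" using v(1) k4 by (auto simp: simple_path_def intro: inj_on_subset)
      then have "distinct ?L" by (simp add: distinct_map)
      moreover have "set ?L \<subseteq> I" using vI k4 by auto
      moreover have "if j = Suc i then (if i = 0 then 5 \<le> m (v i) (v j) else m (v i) (v j) = 3) else m (v i) (v j) = 2"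
        if "i < j" "j < 5" for i j
      proof (cases "j = Suc i")
        case True
        then show ?thesis using edge[of i] five v(2) v1 that k4 by auto
      next
        case False
        then show ?thesis using far[of i j] that k4 by simp
      qed
      ultimately have "heavy_path 0 ?L" unfolding heavy_path_def by (simp add: nth_map[of _ "[0..<5]"] del: upt_rec_numeral)
      then show False using infinite_heavy_end[of ?L] finite_alive by simp
    qed
    then consider "k = 2" | "k = 3" using k2 by linarith
    then show ?thesis
    proof cases
      case 1
      have "type_numbering I m Type_H3 (\<lambda>i. v (i - 1))"
      proof (rule path_numbering[OF v(1,3)])
        fix i assume "i < k"
        then show "type_entry Type_H3 (Suc i) (Suc (Suc i)) = m (v i) (v (Suc i))"
          using edge[of i] five v(2) v1 by (cases "i = 0") auto
      qed (use 1 in auto)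
      then show ?thesis by (rule h3_type(1)[OF data])
    next
      case 2
      have "type_numbering I m Type_H4 (\<lambda>i. v (i - 1))"
      proof (rule path_numbering[OF v(1,3)])
        fix i assume "i < k"
        then show "type_entry Type_H4 (Suc i) (Suc (Suc i)) = m (v i) (v (Suc i))"
          using edge[of i] five v(2) v1 by (cases "i = 0") auto
      qed (use 2 in auto)
      then show ?thesis by (rule h4_type(1)[OF data])
    qed
  qed
qed

end

theorem finite_group_if_heavy:
  assumes ab: "a \<in> I" "b \<in> I" "5 \<le> m a b" "m a b \<noteq> \<infinity>"
  shows "finite (carrier (coxeter_group I m))"
proof (cases "\<forall>x\<in>I. 3 \<le> m a x \<longrightarrow> x = b")
  case True
  then show ?thesis using finite_group_heavy_end[OF ab(1-3) ab(4)] by blast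
next
  case False
  then obtain x where x: "x \<in> I" "x \<noteq> b" "3 \<le> m a x" by blast
  have ba: "5 \<le> m b a" "m b a \<noteq> \<infinity>" using ab m_sym[OF ab(1,2)] by auto
  have "y = a" if "y \<in> I" "3 \<le> m b y" for y
    using heavy_edge_at_end[OF ab(1-3) x] that by blast
  then show ?thesis using finite_group_heavy_end[OF ab(2,1) ba] by blast
qed

end

section \<open>The classification\<close>

lemma type_A_reverse:
  assumes "type_numbering I m (Type_A n) f"
  shows "type_numbering I m (Type_A n) (\<lambda>i. f (Suc n - i))"
proof -
  have "bij_betw (\<lambda>i. Suc n - i) {1..n} {1..n}"
    by (rule bij_betw_byWitness[where f' = "\<lambda>i. Suc n - i"]) auto
  then have "bij_betw (f \<circ> (\<lambda>i. Suc n - i)) {1..n} I"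
    using assms by (auto simp: type_numbering_def intro: bij_betw_trans)
  moreover have "m (f (Suc n - i)) (f (Suc n - j)) = type_matrix (Type_A n) i j"
    if "i \<in> {1..n}" "j \<in> {1..n}" for i j
  proof -
    have "type_matrix (Type_A n) (Suc n - i) (Suc n - j) = type_matrix (Type_A n) i j"
      using that by (auto simp: type_matrix_def min_def max_def)
    moreover have "Suc n - i \<in> {1..n}" "Suc n - j \<in> {1..n}" using that by auto
    ultimately show ?thesis using assms by (auto simp: type_numbering_def)
  qed
  ultimately show ?thesis using assms by (auto simp: type_numbering_def comp_def)
qed

lemma alive_classes_type_A_end:
  assumes I: "coxeter_data I m" and f: "type_numbering I m (Type_A n) f" and e: "2 \<le> e"
    and d: "d (f 1) = e \<and> (\<forall>i\<in>{2..n}. d (f i) = 2) \<or> d (f n) = e \<and> (\<forall>i\<in>{1..<n}. d (f i) = 2)"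
  shows "finite (alive_classes I m d)" "card (alive_classes I m d) = fact n * (1 + n * (e - 1))"
proof -
  have n: "1 \<le> n" using f by (simp add: type_numbering_def)
  obtain g where g: "type_numbering I m (Type_A n) g" "d (g 1) = e" "\<forall>i\<in>{2..n}. d (g i) = 2"
    using d
  proof
    assume "d (f 1) = e \<and> (\<forall>i\<in>{2..n}. d (f i) = 2)"
    then show ?thesis using that[OF f] by blast
  next
    assume *: "d (f n) = e \<and> (\<forall>i\<in>{1..<n}. d (f i) = 2)"
    show ?thesis
    proof (rule that[OF type_A_reverse[OF f]])
      show "d (f (Suc n - 1)) = e" using * by simp
      have "Suc n - i \<in> {1..<n}" if "i \<in> {2..n}" for i using that by auto
      then show "\<forall>i\<in>{2..n}. d (f (Suc n - i)) = 2" using * by blast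
    qed
  qed
  have g': "bij_betw g {1..n} I" "\<And>i j. \<lbrakk>i \<in> {1..n}; j \<in> {1..n}\<rbrakk> \<Longrightarrow> m (g i) (g j) = type_matrix (Type_A n) i j"
    using g(1) by (auto simp: type_numbering_def)
  have dg: "d (g i) = (if i = 1 then e else 2)" if "i \<in> {1..n}" for i using g(2,3) that by auto
  interpret A: type_A n e "type_matrix (Type_A n)" "\<lambda>i. if i = 1 then e else 2"
    by unfold_locales (use n e in auto)
  note rel = alive_classes_relabel[where d = d and d' = "\<lambda>i. if i = 1 then e else 2", OF I g' dg]
  show "finite (alive_classes I m d)" using rel(2) A.alive_classes_type_A(2) by blast
  show "card (alive_classes I m d) = fact n * (1 + n * (e - 1))" using rel(1) A.alive_classes_type_A(1) by simp
qed

context nil_Hecke_data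
begin

text \<open>
  A large exponent forces type \<open>A\<^sub>n\<close>, and a large finite label forces a finite group. Otherwise the alive
  classes are the elements of the group.
\<close>

lemma finite_alive_cases:
  assumes irr: "coxeter_irreducible I m" and fin: "finite (alive_classes I m d)"
  shows "finite (carrier (coxeter_group I m)) \<and> (\<forall>i\<in>I. d i = 2) \<or>
    (\<exists>n\<ge>1. \<exists>f. type_numbering I m (Type_A n) f \<and> 2 < d (f 1) \<and> (\<forall>i\<in>{2..n}. d (f i) = 2))"
proof -
  interpret finite_nil_Hecke I m d by unfold_locales (rule irr fin)+
  show ?thesis
  proof (cases "\<forall>i\<in>I. d i = 2")
    case False
    then obtain x where x: "x \<in> I" "2 < d x" using d_ge_2 by force
    then show ?thesis using fat_vertex[OF x] by blast
  next
    case d2: True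
    have "finite (carrier (coxeter_group I m))"
    proof (cases "\<exists>a\<in>I. \<exists>b\<in>I. 5 \<le> m a b \<and> m a b \<noteq> \<infinity>")
      case True
      then show ?thesis using finite_group_if_heavy by blast
    next
      case False
      have "\<forall>a\<in>I. \<forall>b\<in>I. a \<noteq> b \<longrightarrow> m a b \<noteq> \<infinity> \<longrightarrow> the_enat (m a b) < 5"
      proof (intro ballI impI)
        fix a b assume ab: "a \<in> I" "b \<in> I" "m a b \<noteq> \<infinity>"
        then have "\<not> 5 \<le> m a b" using False by blast
        then show "the_enat (m a b) < 5" using ab(3) by (auto simp: numeral_eq_enat)
      qed
      then show ?thesis using alive_classes_coxeter_group(2)[OF d2] fin by blast
    qed
    then show ?thesis using d2 by blast
  qed
qed

lemma alive_classes_type: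
  assumes d2: "\<forall>i\<in>I. d i = 2" and fin: "finite (carrier (coxeter_group I m))" and T: "has_type I m T"
  shows "card (alive_classes I m d) = (case T of
      Type_H3 \<Rightarrow> 76
    | Type_H4 \<Rightarrow> 1460
    | Type_I2 k \<Rightarrow> if k < 5 then 2 * k else 2 * k - 1
    | _ \<Rightarrow> order (coxeter_group I m))"
proof -
  obtain f where f: "type_numbering I m T f" using T by (auto simp: has_type_def)
  have data: "coxeter_data I m" by unfold_locales
  have order: "card (alive_classes I m d) = order (coxeter_group I m)"
    if le: "\<And>i j. type_entry T i j \<le> 4"
  proof (rule alive_classes_coxeter_group(1)[OF d2], intro ballI impI)
    fix a b assume ab: "a \<in> I" "b \<in> I" "a \<noteq> b"
    obtain i j where "a = f i" "b = f j" "i \<in> {1..type_rank T}" "j \<in> {1..type_rank T}"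
      using f ab by (auto simp: type_numbering_def bij_betw_def)
    then have "m a b = type_matrix T i j" using f by (auto simp: type_numbering_def)
    then have "m a b \<le> 4" using le by (simp add: type_matrix_def one_enat_def numeral_eq_enat)
    then show "the_enat (m a b) < 5" by (cases "m a b") (auto simp: numeral_eq_enat)
  qed
  have small: "(1 :: enat) \<le> 4" "(2 :: enat) \<le> 4" "(3 :: enat) \<le> 4" by (simp_all add: one_enat_def numeral_eq_enat)
  show ?thesis
  proof (cases T)
    case Type_H3
    then show ?thesis using h3_type(2)[OF data _ d2] f by simp
  next
    case Type_H4
    then show ?thesis using h4_type(2)[OF data _ d2] f by simp
  next
    case (Type_I2 k)
    have bij: "bij_betw f {1..2} I" using f Type_I2 by (simp add: type_numbering_def)
    have pair: "{1..2 :: nat} = {1, 2}" by auto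
    have I: "I = {f 1, f 2}" using bij pair by (simp add: bij_betw_def)
    moreover have "f 1 \<noteq> f 2" using bij pair by (auto simp: bij_betw_def inj_on_def)
    moreover have "m (f 1) (f 2) = enat k" using f Type_I2 by (simp add: type_numbering_def type_matrix_def)
    ultimately interpret dihedral_data I m "f 1" "f 2" k d by unfold_locales (use d2 in auto)
    show ?thesis using alive_classes_dihedral(2) Type_I2 by simp
  qed (use order small in \<open>simp_all add: type_E_entry_def\<close>)
qed

end

theorem corollary1p8:
  fixes R :: "('k, 'm) ring_scheme"
    and I :: "'i set"
    and m :: "'i \<Rightarrow> 'i \<Rightarrow> enat"
    and d :: "'i \<Rightarrow> nat"
  assumes "cring R" and "\<one>\<^bsub>R\<^esub> \<noteq> \<zero>\<^bsub>R\<^esub>"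
    and "coxeter_matrix I m" and "coxeter_irreducible I m"
    and "\<forall>i\<in>I. 2 \<le> d i"
  defines "NH \<equiv> nil_Hecke R I m d (braid_pairs_less I m 5)"
    and "case1 \<equiv> finite (carrier (coxeter_group I m)) \<and> (\<forall>i\<in>I. d i = 2)"
    and "case2 \<equiv> (\<lambda>n e. 2 < e \<and> (\<exists>f. type_numbering I m (Type_A n) f \<and>
           (d (f 1) = e \<and> (\<forall>i\<in>{2..n}. d (f i) = 2) \<or>
            d (f n) = e \<and> (\<forall>i\<in>{1..<n}. d (f i) = 2))))"
  shows
    "(module_fin_gen R NH \<longleftrightarrow>
        (case1 \<and> \<not> (\<exists>n\<ge>1. \<exists>e. case2 n e)) \<or> (\<not> case1 \<and> (\<exists>n\<ge>1. \<exists>e. case2 n e))) \<and>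
     (case1 \<longrightarrow>
        (\<forall>T. has_type I m T \<longrightarrow>
           free_of_rank R NH
             (case T of
                Type_H3 \<Rightarrow> 76
              | Type_H4 \<Rightarrow> 1460
              | Type_I2 k \<Rightarrow> if k < 5 then 2 * k else 2 * k - 1
              | _ \<Rightarrow> order (coxeter_group I m)))) \<and>
     (\<forall>n\<ge>1. \<forall>e. case2 n e \<longrightarrow> free_of_rank R NH (fact n * (1 + n * (e - 1))))"
proof -
  interpret nil_Hecke_data I m d
    using assms(3,5) by unfold_locales blast+
  have data: "coxeter_data I m" by unfold_locales
  have rank: "finite (alive_classes I m d) \<Longrightarrow> free_of_rank R NH (card (alive_classes I m d))"
    and fin_gen: "module_fin_gen R NH \<longleftrightarrow> finite (alive_classes I m d)"
    unfolding NH_def by (rule nil_Hecke_rank(1)[OF assms(1,2)], assumption, rule nil_Hecke_rank(2)[OF assms(1,2)])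
  have case1_finite: "finite (alive_classes I m d)" if case1
    using that finite_group_finite_alive unfolding case1_def by blast
  have case2_count: "finite (alive_classes I m d)" "card (alive_classes I m d) = fact n * (1 + n * (e - 1))"
    if c: "case2 n e" for n e
  proof -
    obtain f where f: "type_numbering I m (Type_A n) f" "2 < e"
      "d (f 1) = e \<and> (\<forall>i\<in>{2..n}. d (f i) = 2) \<or> d (f n) = e \<and> (\<forall>i\<in>{1..<n}. d (f i) = 2)"
      using c unfolding case2_def by blast
    have "2 \<le> e" using f(2) by simp
    note count = alive_classes_type_A_end[OF data f(1) this f(3)]
    show "finite (alive_classes I m d)" "card (alive_classes I m d) = fact n * (1 + n * (e - 1))"
      by (rule count)+
  qed
  have exclusive: "\<not> case1" if n: "1 \<le> n" "case2 n e" for n e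
  proof
    assume case1
    then have d2: "\<forall>i\<in>I. d i = 2" unfolding case1_def by blast
    obtain f where f: "bij_betw f {1..n} I" "d (f 1) = e \<or> d (f n) = e" "2 < e"
      using n(2) unfolding case2_def type_numbering_def by auto
    have "f 1 \<in> I" "f n \<in> I" using f(1) n(1) by (auto simp: bij_betw_def)
    then show False using d2 f(2,3) by auto
  qed
  have "case1 \<or> (\<exists>n\<ge>1. \<exists>e. case2 n e)" if fin: "finite (alive_classes I m d)"
    using finite_alive_cases[OF assms(4) fin] unfolding case1_def case2_def by blast
  then have "module_fin_gen R NH \<longleftrightarrow>
      (case1 \<and> \<not> (\<exists>n\<ge>1. \<exists>e. case2 n e)) \<or> (\<not> case1 \<and> (\<exists>n\<ge>1. \<exists>e. case2 n e))"
    using fin_gen case1_finite case2_count(1) exclusive by blast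
  moreover have "case1 \<longrightarrow> (\<forall>T. has_type I m T \<longrightarrow> free_of_rank R NH
      (case T of Type_H3 \<Rightarrow> 76 | Type_H4 \<Rightarrow> 1460 | Type_I2 k \<Rightarrow> if k < 5 then 2 * k else 2 * k - 1
        | _ \<Rightarrow> order (coxeter_group I m)))"
  proof (intro impI allI)
    fix T assume c: case1 and T: "has_type I m T"
    then have "\<forall>i\<in>I. d i = 2" "finite (carrier (coxeter_group I m))" unfolding case1_def by blast+
    from alive_classes_type[OF this T] rank[OF case1_finite[OF c]]
    show "free_of_rank R NH (case T of Type_H3 \<Rightarrow> 76 | Type_H4 \<Rightarrow> 1460
        | Type_I2 k \<Rightarrow> if k < 5 then 2 * k else 2 * k - 1 | _ \<Rightarrow> order (coxeter_group I m))" by (simp only:)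
  qed
  moreover have "\<forall>n\<ge>1. \<forall>e. case2 n e \<longrightarrow> free_of_rank R NH (fact n * (1 + n * (e - 1)))"
  proof (intro allI impI)
    fix n e assume "case2 n e"
    from case2_count[OF this] rank show "free_of_rank R NH (fact n * (1 + n * (e - 1)))" by simp
  qed
  ultimately show ?thesis by blast
qed

end
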